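(* Let $f(z)=\sum_{k=0}^\infty a_k z^k$ with $\{a_k\}_{k\ge 0}$ i.i.d. real standard Gaussian random variables, let $\mathbb{D}_+=\{z\in\mathbb{C}: |z|<1,\ \Im z>0\}$, and let $\rho^{\mathrm{c}}_n$ be the $n$-point correlation function for the complex zeros of $f$ in $\mathbb{D}_+$. Then for every $n\ge1$ and all $z_1,\dots,z_n\in\mathbb{D}_+$, $$\rho^{\mathrm{c}}_n(z_1,\dots,z_n)=\frac{1}{(\pi\sqrt{-1})^n}\prod_{j=1}^n\frac{1}{|1-z_j^2|}\cdot\mathrm{Pf}\,(\mathbb{K}^{\mathrm{c}}(z_i,z_j))_{i,j=1}^n,$$ where $\mathbb{K}^{\mathrm{c}}(z,w)$ is the $2\times2$ matrix kernel $$\mathbb{K}^{\mathrm{c}}(z,w)=\begin{pmatrix}\frac{z-w}{(1-zw)^2}&\frac{z-\bar w}{(1-z\bar w)^2}\\[2pt] \frac{\bar z-w}{(1-\bar z w)^2}&\frac{\bar z-\bar w}{(1-\bar z\bar w)^2}\end{pmatrix}.$$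
   Context: The series $f$ converges almost surely on the open unit disc. The $n$-point correlation function of a point process on $\mathbb{D}_+$ is the density, with respect to Lebesgue (area) measure on $\mathbb{D}_+^n$, of its $n$-th factorial moment measure; i.e. for pairwise disjoint Borel sets $B_1,\dots,B_n\subset\mathbb{D}_+$, $E[\prod_i N(B_i)]=\int_{B_1\times\cdots\times B_n}\rho^{\mathrm{c}}_n$, where $N(B)$ is the number of zeros in $B$ (the continuous version is taken). $(\mathbb{K}^{\mathrm{c}}(z_i,z_j))_{i,j=1}^n$ is the $2n\times2n$ skew-symmetric matrix whose $(i,j)$ block of size $2\times2$ is $\mathbb{K}^{\mathrm{c}}(z_i,z_j)$. The Pfaffian of a $2n\times2n$ skew-symmetric matrix $B=(b_{ij})$ is $\mathrm{Pf}(B)=\sum_\eta\epsilon(\eta)\,b_{\eta(1)\eta(2)}\cdots b_{\eta(2n-1)\eta(2n)}$, summed over permutations $\eta$ of $\{1,\dots,2n\}$ with $\eta(2i-1)<\eta(2i)$ for all $i$ and $\eta(1)<\eta(3)<\cdots<\eta(2n-1)$, where $\epsilon(\eta)$ is the signature. *)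

theory Defs
  imports "HOL-Probability.Probability" "HOL-Complex_Analysis.Complex_Analysis"
begin

definition upper_half_disc :: "complex set" where
  "upper_half_disc = {z. cmod z < 1 \<and> Im z > 0}"

text \<open>The series converges almost surely on the open unit disc; the values taken where it
  diverges are irrelevant.\<close>

definition gaussian_series :: "(nat \<Rightarrow> 'w \<Rightarrow> real) \<Rightarrow> 'w \<Rightarrow> complex \<Rightarrow> complex" where
  "gaussian_series a \<omega> z = (\<Sum>k. complex_of_real (a k \<omega>) * z ^ k)"

text \<open>Zeros are counted with multiplicity, and the count may be infinite.\<close>

definition num_zeros :: "(complex \<Rightarrow> complex) \<Rightarrow> complex set \<Rightarrow> ennreal" where
  "num_zeros f B = (\<integral>\<^sup>+ z. of_nat (nat (zorder f z)) \<partial>count_space {z \<in> B. f z = 0})"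

text \<open>The continuous version on \<open>D\<^sup>n\<close> of the \<open>n\<close>-point correlation function of the zeros in
  \<open>D\<close> of a random function \<open>F\<close>. Points of \<open>D\<^sup>n\<close> are the extensional functions on
  \<open>{1..n}\<close>, the reference measure \<open>lborel\<close> on the complex plane is area measure,
  and both sides of the identity may be infinite. Without nonnegativity of \<open>\<rho>\<close> the coercion
  \<open>ennreal\<close> would silently drop negative values.\<close>

definition continuous_correlation_function ::
    "'w measure \<Rightarrow> ('w \<Rightarrow> complex \<Rightarrow> complex) \<Rightarrow> complex set \<Rightarrow> nat
      \<Rightarrow> ((nat \<Rightarrow> complex) \<Rightarrow> real) \<Rightarrow> bool" where
  "continuous_correlation_function M F D n \<rho> \<longleftrightarrow>
     continuous_on (PiE {1..n} (\<lambda>_. D)) \<rho> \<and>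
     (\<forall>z \<in> PiE {1..n} (\<lambda>_. D). \<rho> z \<ge> 0) \<and>
     (\<forall>B. (\<forall>i\<in>{1..n}. B i \<in> sets borel \<and> B i \<subseteq> D) \<and> disjoint_family_on B {1..n} \<longrightarrow>
        (\<integral>\<^sup>+ \<omega>. (\<Prod>i\<in>{1..n}. num_zeros (F \<omega>) (B i)) \<partial>M) =
        (\<integral>\<^sup>+ z. ennreal (\<rho> z) * indicator (PiE {1..n} B) z \<partial>(Pi\<^sub>M {1..n} (\<lambda>_. lborel))))"

text \<open>The matrix is given by its entries \<open>b p q\<close> for \<open>p, q\<close> in \<open>{1..2 * n}\<close>.\<close>

definition pfaffian :: "nat \<Rightarrow> (nat \<Rightarrow> nat \<Rightarrow> 'a::comm_ring_1) \<Rightarrow> 'a" where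
  "pfaffian n b =
     (\<Sum>\<eta> | \<eta> permutes {1..2*n} \<and>
           (\<forall>i\<in>{1..n}. \<eta> (2*i - 1) < \<eta> (2*i)) \<and>
           (\<forall>i\<in>{1..<n}. \<eta> (2*i - 1) < \<eta> (2*i + 1)).
        of_int (sign \<eta>) * (\<Prod>i\<in>{1..n}. b (\<eta> (2*i - 1)) (\<eta> (2*i))))"

text \<open>The matrix assembled from the \<open>2 \<times> 2\<close> blocks \<open>K (z i) (z j)\<close>: row \<open>2 * i - 1\<close> is the
  first and row \<open>2 * i\<close> the second row of block row \<open>i\<close>, and likewise for columns.\<close>

definition block_matrix ::
    "('b \<Rightarrow> 'b \<Rightarrow> 'a ^ 2 ^ 2) \<Rightarrow> (nat \<Rightarrow> 'b) \<Rightarrow> nat \<Rightarrow> nat \<Rightarrow> 'a" where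
  "block_matrix K z p q =
     K (z ((p + 1) div 2)) (z ((q + 1) div 2))
       $ (if odd p then 1 else 2) $ (if odd q then 1 else 2)"

definition kernel_c :: "complex \<Rightarrow> complex \<Rightarrow> complex ^ 2 ^ 2" where
  "kernel_c z w = vector
     [vector [(z - w) / (1 - z * w)^2,         (z - cnj w) / (1 - z * cnj w)^2],
      vector [(cnj z - w) / (1 - cnj z * w)^2, (cnj z - cnj w) / (1 - cnj z * cnj w)^2]]"

end

theory Submission imports Defs
begin

text \<open>
  Fix a zero \<open>z\<close>. For a given tail of the coefficient sequence, \<open>f z = 0\<close> determines the first two
  coefficients, so the area formula turns the expected number of zeros in \<open>B\<close>, weighted by a functional of \<open>f\<close>,
  into an area integral over \<open>z\<close>. Conditionally on \<open>f z = 0\<close>, the series is distributed as the Blaschke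
  product with zeros \<open>z\<close> and \<open>cnj z\<close> times an independent copy of itself: multiplication by this product
  is realised by a lattice filter whose steps are rotations, and those preserve the Gaussian measure. Iterating
  this Palm formula over disjoint sets writes the correlation function as an explicit product times the Gaussian
  moment of \<open>\<Prod>\<^sub>i \<bar>f (z\<^sub>i)\<bar>\<^sup>2 = \<Prod>\<^sub>i f (z\<^sub>i) f (cnj z\<^sub>i)\<close>.

  By Wick's formula this moment is the Hafnian of \<open>1 / (1 - xy)\<close>. It satisfies a recursion, obtained by
  expanding \<open>\<Prod>\<^sub>l (u - l) / (1 - u l)\<close> times the moment in partial fractions in \<open>u\<close>, that matches
  the expansion along the first row of the Pfaffian of \<open>(x - y) / (1 - xy)\<^sup>2\<close>. The two sides thus agree up to
  a Schur-type product of Moebius factors, which cancels the product from the Palm formula. Points with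
  coincidences are reached by continuity.
\<close>

section \<open>An area formula counting preimages\<close>

text \<open>The event \<open>f z = 0\<close> has probability zero, so conditioning on it needs a
  meaning. Here it is a limit: the law of \<open>f\<close> is written in two coordinate systems,
  through the first two coefficients with a fixed tail, and through the lattice filter with its
  two-dimensional initial state. In both, \<open>f z\<close> is an affine image of two real
  coordinates; restricting \<open>f z\<close> to a shrinking window and comparing limits identifies
  the conditioned series together with its normalising constant. Two real coordinates suffice
  because \<open>Im z > 0\<close> makes \<open>1\<close> and \<open>z\<close> a real basis of the
  plane, and the second Blaschke zero \<open>cnj z\<close> is forced by the real coefficients.

  Multiplicities are harmless: a double zero makes the coefficient pair a critical value, which
  Sard's theorem excludes almost surely. Disjointness of the sets keeps later zeros away from those
  already factored out, so the counts do not change. The constant \<open>1 / (pi * i)\<close> per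
  point arises because \<open>z - cnj z\<close> is \<open>2 * i * Im z\<close>, which turns the
  Moebius factor of a conjugate pair into the Palm weight.\<close>

lemma has_derivative_locally_injective_nbhd:
  fixes f :: "real^'n::{finite,wellorder} \<Rightarrow> real^'n::_" and f' :: "real^'n::_ \<Rightarrow> (real^'n::_) \<Rightarrow>\<^sub>L (real^'n::_)"
  assumes "open V" and der: "\<And>x. x \<in> V \<Longrightarrow> (f has_derivative blinfun_apply (f' x)) (at x)"
    and cont: "continuous_on V f'" and "x \<in> V" and det: "det (matrix (blinfun_apply (f' x))) \<noteq> 0"
  obtains W where "open W" "x \<in> W" "W \<subseteq> V" "inj_on f W" "bounded (f ` W)"
proof -
  have lin: "linear (blinfun_apply (f' x))"
    by (rule bounded_linear.linear[OF blinfun.bounded_linear_right])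
  have "inj (blinfun_apply (f' x))"
    using det det_nz_iff_inj[OF lin] by simp
  then obtain g where g: "linear g" "g \<circ> blinfun_apply (f' x) = id"
    using linear_injective_left_inverse[OF lin] by blast
  define invf where "invf = Blinfun g"
  have blg: "bounded_linear g" using g(1) linear_conv_bounded_linear by blast
  have "invf o\<^sub>L f' x = id_blinfun"
    by (rule blinfun_eqI) (use g(2) in \<open>simp add: invf_def bounded_linear_Blinfun_apply[OF blg] o_def fun_eq_iff\<close>)
  note inv = this
  obtain U' V' g2 where U': "open U'" "U' \<subseteq> V" "x \<in> U'" "homeomorphism U' V' f g2"
    by (rule inverse_function_theorem[OF \<open>open V\<close> der cont \<open>x \<in> V\<close> inv]) blast+
  have contf: "continuous_on U' f"
    using U'(4) by (simp add: homeomorphism_def)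
  \<comment> \<open>Intersecting with the preimage of a unit ball bounds the image; the change of
    variables below needs images of finite measure.\<close>
  define W where "W = U' \<inter> f -` ball (f x) 1"
  have "open W" unfolding W_def
    by (simp add: contf continuous_open_preimage U'(1))
  moreover have "inj_on f W"
    using U'(4) unfolding W_def homeomorphism_def inj_on_def by (metis IntE)
  moreover have "bounded (f ` W)"
    by (rule bounded_subset[of "ball (f x) 1"]) (auto simp: W_def)
  ultimately show ?thesis using U' that[of W] by (auto simp: W_def)
qed

text \<open>A bounded image has finite measure, so the change of variables in integral form applies
  and both sides can be read as extended nonnegative integrals.\<close>

lemma emeasure_injective_image:
  fixes f :: "real^'n::{finite,wellorder} \<Rightarrow> real^'n::_"
  assumes S: "S \<in> sets lebesgue"
    and der: "\<And>x. x \<in> S \<Longrightarrow> (f has_derivative f' x) (at x within S)"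
    and inj: "inj_on f S" and bdd: "bounded (f ` S)"
  shows "f ` S \<in> sets lebesgue"
    and "emeasure lebesgue (f ` S) = (\<integral>\<^sup>+x. ennreal \<bar>det (matrix (f' x))\<bar> * indicator S x \<partial>lborel)"
proof -
  show im: "f ` S \<in> sets lebesgue"
    by (rule differentiable_image_in_sets_lebesgue[OF S])
      (use der in \<open>auto simp: differentiable_on_def differentiable_def\<close>)
  have fm: "f ` S \<in> lmeasurable"
    using bdd im by (rule bounded_set_imp_lmeasurable)
  then have hi: "((\<lambda>x. \<bar>det (matrix (f' x))\<bar>) has_integral measure lebesgue (f ` S)) S"
    using has_measure_differentiable_image[OF S der inj] by blast
  have "(\<integral>\<^sup>+x. ennreal (indicator S x * \<bar>det (matrix (f' x))\<bar>) \<partial>lborel) = ennreal (measure lebesgue (f ` S))"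
    by (rule nn_integral_has_integral_lebesgue[OF _ hi]) simp
  moreover have "emeasure lebesgue (f ` S) = ennreal (measure lebesgue (f ` S))"
    using fm by (rule emeasure_eq_measure2)
  moreover have "ennreal (indicator S x * \<bar>det (matrix (f' x))\<bar>) = ennreal \<bar>det (matrix (f' x))\<bar> * indicator S x" for x
    by (auto simp: indicator_def)
  ultimately show "emeasure lebesgue (f ` S) = (\<integral>\<^sup>+x. ennreal \<bar>det (matrix (f' x))\<bar> * indicator S x \<partial>lborel)"
    by simp
qed

lemma negligible_critical_values:
  fixes f :: "real^'n::{finite,wellorder} \<Rightarrow> real^'n::_"
  assumes der: "\<And>x. x \<in> S \<Longrightarrow> (f has_derivative f' x) (at x)"
    and det0: "\<And>x. x \<in> S \<Longrightarrow> det (matrix (f' x)) = 0"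
  shows "negligible (f ` S)"
proof (rule baby_Sard[of _ _ f'])
  show "(f has_derivative f' x) (at x within S)" if "x \<in> S" for x
    using der[OF that] by (rule has_derivative_at_withinI)
  show "rank (matrix (f' x)) < CARD('n)" if "x \<in> S" for x
    using det0[OF that] by (simp add: det_eq_0_rank)
qed simp

text \<open>Critical points contribute to neither side: their Jacobian vanishes and their values
  form a null set. The regular points form an open set covered by countably many pieces on which
  \<open>f\<close> is injective; after making the pieces disjoint, each one satisfies the change of
  variables formula and the contributions add up.\<close>

lemma area_formula:
  fixes f :: "real^'n::{finite,wellorder} \<Rightarrow> real^'n::_" and f' :: "real^'n::_ \<Rightarrow> (real^'n::_) \<Rightarrow>\<^sub>L (real^'n::_)"
  assumes "open U" and der: "\<And>x. x \<in> U \<Longrightarrow> (f has_derivative blinfun_apply (f' x)) (at x)"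
    and cont: "continuous_on U f'" and B: "B \<in> sets borel" "B \<subseteq> U"
  shows "(\<integral>\<^sup>+y. emeasure (count_space UNIV) {x\<in>B. f x = y} \<partial>lborel) =
    (\<integral>\<^sup>+x. ennreal \<bar>det (matrix (blinfun_apply (f' x)))\<bar> * indicator B x \<partial>lborel)"
proof -
  define J where "J x = \<bar>det (matrix (blinfun_apply (f' x)))\<bar>" for x
  define V where "V = {x\<in>U. J x \<noteq> 0}"
  have cJ: "continuous_on U J"
    unfolding J_def det_def matrix_def
    by (simp, intro continuous_intros cont)
  have oV: "open V"
  proof -
    have "open (U \<inter> J -` (-{0}))"
      by (rule continuous_open_preimage[OF cJ \<open>open U\<close>]) (simp add: open_Compl)
    moreover have "V = U \<inter> J -` (-{0})" by (auto simp: V_def)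
    ultimately show ?thesis by simp
  qed
  have "\<exists>W. open W \<and> x \<in> W \<and> W \<subseteq> V \<and> inj_on f W \<and> bounded (f ` W)" if xV: "x \<in> V" for x
  proof -
    have "x \<in> U" "det (matrix (blinfun_apply (f' x))) \<noteq> 0" using xV by (auto simp: V_def J_def)
    have cV: "continuous_on V f'" using cont by (rule continuous_on_subset) (auto simp: V_def)
    have dV: "\<And>x. x \<in> V \<Longrightarrow> (f has_derivative blinfun_apply (f' x)) (at x)"
      by (rule der) (auto simp: V_def)
    obtain W where "open W" "x \<in> W" "W \<subseteq> V" "inj_on f W" "bounded (f ` W)"
      by (rule has_derivative_locally_injective_nbhd[OF oV dV cV xV \<open>det (matrix (blinfun_apply (f' x))) \<noteq> 0\<close>]) blast+
    then show ?thesis by blast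
  qed
  then have "\<forall>x\<in>V. \<exists>W. open W \<and> x \<in> W \<and> W \<subseteq> V \<and> inj_on f W \<and> bounded (f ` W)" by blast
  from bchoice[OF this] obtain W where W: "\<And>x. x \<in> V \<Longrightarrow> open (W x) \<and> x \<in> W x \<and> W x \<subseteq> V \<and> inj_on f (W x) \<and> bounded (f ` W x)"
    by blast
  obtain \<F> where \<F>: "\<F> \<subseteq> W ` V" "countable \<F>" "\<Union>\<F> = \<Union>(W ` V)"
  proof (rule Lindelof[of "W ` V"])
    show "open S" if "S \<in> W ` V" for S using that W by blast
  qed blast
  have UF: "\<Union>\<F> = V"
  proof
    show "\<Union>\<F> \<subseteq> V" unfolding \<F>(3) using W by (meson UN_least)
    show "V \<subseteq> \<Union>\<F>" unfolding \<F>(3) using W by (meson UN_I subsetI)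
  qed
  \<comment> \<open>The countable cover is enumerated by all naturals. Repetitions disappear in
    \<open>disjointed\<close>, and the empty cover needs its own value because there is nothing to
    enumerate.\<close>
  define C where "C n = (if \<F> = {} then {} else from_nat_into \<F> n)" for n
  have CF: "C n = {} \<or> C n \<in> W ` V" for n
    using \<F>(1) from_nat_into[of \<F> n] unfolding C_def by (metis subsetD)
  have UC: "(\<Union>n. C n) = V"
  proof (cases "\<F> = {}")
    case False
    then have "range C = \<F>" using \<F>(2) by (simp add: C_def range_from_nat_into)
    with UF show ?thesis by simp
  qed (use UF in \<open>simp add: C_def\<close>)
  define S where "S n = B \<inter> disjointed C n" for n
  have Csub: "disjointed C n \<subseteq> C n" for n by (rule disjointed_subset)
  have CW: "open (C n) \<and> inj_on f (C n) \<and> bounded (f ` C n)" for n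
  proof (cases "C n = {}")
    case False
    then obtain x where "x \<in> V" "C n = W x" using CF[of n] by blast
    then show ?thesis using W[of x] by simp
  qed simp
  have Cb: "C n \<in> sets borel" for n using CW[of n] by simp
  have Sb: "S n \<in> sets borel" for n
    unfolding S_def using B(1) Cb by (auto simp: disjointed_def intro!: sets.finite_UN)
  have Sdisj: "disjoint_family S"
    using disjoint_family_disjointed[of C] by (auto simp: disjoint_family_on_def S_def)
  have SU: "(\<Union>n. S n) = B \<inter> V"
    unfolding S_def using UN_disjointed_eq[of C] UC by auto
  have Sinj: "inj_on f (S n)" and Sbd: "bounded (f ` S n)" for n
  proof -
    have "S n \<subseteq> C n" using Csub by (auto simp: S_def)
    with CW[of n] show "inj_on f (S n)" "bounded (f ` S n)"
      by (simp_all add: inj_on_subset[of f "C n"] bounded_subset[of "f ` C n"] image_mono)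
  qed
  have Sder: "(f has_derivative blinfun_apply (f' x)) (at x within S n)" if "x \<in> S n" for x n
  proof -
    have "x \<in> U" using that B(2) by (auto simp: S_def)
    then show ?thesis by (rule has_derivative_at_withinI[OF der])
  qed
  have Sleb: "S n \<in> sets lebesgue" for n using Sb[of n] by (simp add: sets_completionI_sets)
  \<comment> \<open>The images are only known to be Lebesgue measurable, so the counting side is
    integrated below against the completion of \<open>lborel\<close>.\<close>
  note im = emeasure_injective_image[OF Sleb Sder Sinj Sbd]
  have neg: "negligible (f ` {x\<in>U. J x = 0})"
    by (rule negligible_critical_values[of _ f "\<lambda>x. blinfun_apply (f' x)"]) (auto simp: J_def intro: der)
  \<comment> \<open>Off the critical values every preimage point is regular and hence lies in
    exactly one \<open>S n\<close>; injectivity there turns its count into an indicator.\<close>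
  have eqN: "emeasure (count_space UNIV) {x\<in>B. f x = y} = (\<Sum>n. indicator (f ` S n) y)"
    if y: "y \<notin> f ` {x\<in>U. J x = 0}" for y
  proof -
    have "{x\<in>B. f x = y} = (\<Union>n. {x\<in>S n. f x = y})"
    proof -
      have "{x\<in>B. f x = y} = {x\<in>B \<inter> V. f x = y}" using y B(2) by (auto simp: V_def)
      then show ?thesis unfolding SU[symmetric] by auto
    qed
    also have "emeasure (count_space UNIV) \<dots> = (\<Sum>n. emeasure (count_space UNIV) {x\<in>S n. f x = y})"
      by (rule suminf_emeasure[symmetric]) (use Sdisj in \<open>auto simp: disjoint_family_on_def\<close>)
    also have "\<dots> = (\<Sum>n. indicator (f ` S n) y)"
    proof (rule arg_cong[where f=suminf], rule ext)
      fix n show "emeasure (count_space UNIV) {x\<in>S n. f x = y} = indicator (f ` S n) y"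
      proof (cases "y \<in> f ` S n")
        case True
        then obtain x where "x \<in> S n" "f x = y" by auto
        then have "{x\<in>S n. f x = y} = {x}" using Sinj[of n] by (auto simp: inj_on_def)
        then show ?thesis using True by simp
      next
        case False
        then have "{x\<in>S n. f x = y} = {}" by auto
        with False show ?thesis by (simp only:) simp
      qed
    qed
    finally show ?thesis .
  qed
  have "(\<integral>\<^sup>+y. emeasure (count_space UNIV) {x\<in>B. f x = y} \<partial>lborel) =
     (\<integral>\<^sup>+y. emeasure (count_space UNIV) {x\<in>B. f x = y} \<partial>lebesgue)"
    by (simp add: nn_integral_completion)
  also have "\<dots> = (\<integral>\<^sup>+y. (\<Sum>n. indicator (f ` S n) y) \<partial>lebesgue)"
    by (rule nn_integral_cong_AE, rule AE_I'[of "f ` {x\<in>U. J x = 0}"])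
      (use neg eqN in \<open>auto simp: negligible_iff_null_sets\<close>)
  also have "\<dots> = (\<Sum>n. \<integral>\<^sup>+y. indicator (f ` S n) y \<partial>lebesgue)"
    by (rule nn_integral_suminf) (use im(1) in auto)
  also have "\<dots> = (\<Sum>n. \<integral>\<^sup>+x. ennreal (J x) * indicator (S n) x \<partial>lborel)"
    using im by (simp add: J_def)
  also have "\<dots> = (\<Sum>n. \<integral>\<^sup>+x. (ennreal (J x) * indicator U x) * indicator (S n) x \<partial>lborel)"
    by (intro arg_cong[where f=suminf] ext nn_integral_cong)
      (use B(2) in \<open>auto simp: indicator_def S_def\<close>)
  also have "\<dots> = (\<integral>\<^sup>+x. (\<Sum>n. (ennreal (J x) * indicator U x) * indicator (S n) x) \<partial>lborel)"
  proof (rule nn_integral_suminf[symmetric])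
    \<comment> \<open>\<open>J\<close> is controlled only on \<open>U\<close>. Cutting it off
      outside the open set \<open>U\<close>, on which it is continuous, makes it Borel
      measurable.\<close>
    fix n
    have "(\<lambda>x. ennreal (indicator U x *\<^sub>R J x)) \<in> borel_measurable borel"
      using borel_measurable_continuous_on_indicator[OF _ cJ] \<open>open U\<close> by simp
    also have "(\<lambda>x. ennreal (indicator U x *\<^sub>R J x)) = (\<lambda>x. ennreal (J x) * indicator U x)"
      by (auto simp: indicator_def)
    finally have [measurable]: "(\<lambda>x. ennreal (J x) * indicator U x) \<in> borel_measurable borel" .
    show "(\<lambda>x. ennreal (J x) * indicator U x * indicator (S n) x) \<in> borel_measurable lborel"
      using Sb[of n] by simp
  qed
  also have "\<dots> = (\<integral>\<^sup>+x. ennreal (J x) * indicator B x \<partial>lborel)"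
  proof (rule nn_integral_cong)
    fix x
    have "(\<Sum>n. (ennreal (J x) * indicator U x) * indicator (S n) x) = (ennreal (J x) * indicator U x) * indicator (\<Union>n. S n) x"
      using Sdisj by (simp add: suminf_indicator)
    also have "\<dots> = ennreal (J x) * indicator B x"
      using B(2) by (auto simp: SU V_def indicator_def)
    finally show "(\<Sum>n. (ennreal (J x) * indicator U x) * indicator (S n) x) = ennreal (J x) * indicator B x" .
  qed
  finally show ?thesis by (simp add: J_def)
qed

section \<open>Random power series\<close>

definition pser :: "(nat \<Rightarrow> real) \<Rightarrow> complex \<Rightarrow> complex" where
  "pser a z = (\<Sum>k. complex_of_real (a k) * z ^ k)"

definition pderiv_ser :: "(nat \<Rightarrow> real) \<Rightarrow> complex \<Rightarrow> complex" where
  "pderiv_ser a z = pser (\<lambda>k. real (Suc k) * a (Suc k)) z"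

text \<open>Radius of convergence at least one, tested along the countable sequence of radii
  \<open>1 - 1 / (m + 1)\<close>, which keeps the set measurable.\<close>

definition conv_seqs :: "(nat \<Rightarrow> real) set" where
  "conv_seqs = {a. \<forall>m. summable (\<lambda>k. \<bar>a k\<bar> * (1 - 1 / real (Suc m)) ^ k)}"

section \<open>The Gaussian product measure on coefficient sequences\<close>

abbreviation gauss1 :: "real measure" where "gauss1 \<equiv> density lborel std_normal_density"

definition gauss :: "(nat \<Rightarrow> real) measure" where
  "gauss = PiM UNIV (\<lambda>_. gauss1)"

lemma prob_space_gauss1: "prob_space gauss1"
  by (rule prob_space_normal_density) simp

lemma gauss_seq: "sequence_space gauss1"
proof -
  interpret prob_space gauss1 by (rule prob_space_gauss1)
  show ?thesis by unfold_locales
qed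

lemma prob_space_gauss: "prob_space gauss"
  unfolding gauss_def by (rule prob_space_PiM) (rule prob_space_gauss1)

lemma sigma_finite_gauss1 [simp]: "sigma_finite_measure gauss1"
  using prob_space_gauss1 by (simp add: prob_space_imp_sigma_finite)

lemma sets_gauss [measurable_cong]: "sets gauss = sets (PiM UNIV (\<lambda>_. borel))"
  unfolding gauss_def by (rule sets_PiM_cong) simp_all

lemma sets_gauss_borel: "sets gauss = sets borel"
  unfolding sets_gauss by (rule sets_PiM_equal_borel)

lemma space_gauss [simp]: "space gauss = UNIV"
  using sets_eq_imp_space_eq[OF sets_gauss] by (simp add: space_PiM)

lemma in_space_PiM_borel [simp]: "t \<in> space (PiM UNIV (\<lambda>_. borel))"
  by (simp add: space_PiM)

lemma nn_integral_gauss_case_nat: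
  assumes [measurable]: "F \<in> borel_measurable (PiM UNIV (\<lambda>_. borel))"
  shows "(\<integral>\<^sup>+a. F a \<partial>gauss) = (\<integral>\<^sup>+x. \<integral>\<^sup>+t. F (case_nat x t) \<partial>gauss \<partial>gauss1)"
proof -
  interpret S: sequence_space gauss1 by (rule gauss_seq)
  interpret P: prob_space gauss by (rule prob_space_gauss)
  have eq: "distr (gauss1 \<Otimes>\<^sub>M gauss) gauss (\<lambda>(s, \<omega>). case_nat s \<omega>) = gauss"
    unfolding gauss_def by (rule S.PiM_iter)
  have "(\<integral>\<^sup>+a. F a \<partial>gauss) = (\<integral>\<^sup>+a. F a \<partial>distr (gauss1 \<Otimes>\<^sub>M gauss) gauss (\<lambda>(s, \<omega>). case_nat s \<omega>))"
    by (simp add: eq)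
  also have "\<dots> = (\<integral>\<^sup>+y. F (case_nat (fst y) (snd y)) \<partial>(gauss1 \<Otimes>\<^sub>M gauss))"
    by (subst nn_integral_distr) (auto simp: case_prod_beta)
  also have "\<dots> = (\<integral>\<^sup>+x. \<integral>\<^sup>+t. F (case_nat x t) \<partial>gauss \<partial>gauss1)"
    by (subst P.nn_integral_fst[symmetric]) auto
  finally show ?thesis .
qed

section \<open>Analytic functions given by coefficient sequences\<close>

lemma summable_conv_seqs:
  assumes "a \<in> conv_seqs" "0 \<le> r" "r < 1"
  shows "summable (\<lambda>k. \<bar>a k\<bar> * r ^ k)"
proof -
  obtain m where m: "r < 1 - 1 / real (Suc m)"
    using reals_Archimedean[of "1 - r"] assms(3) by (auto simp: inverse_eq_divide algebra_simps)
  show ?thesis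
  proof (rule summable_comparison_test')
    show "summable (\<lambda>k. \<bar>a k\<bar> * (1 - 1 / real (Suc m)) ^ k)"
      using assms(1) by (auto simp: conv_seqs_def)
    show "norm (\<bar>a k\<bar> * r ^ k) \<le> \<bar>a k\<bar> * (1 - 1 / real (Suc m)) ^ k" for k
      using m assms(2) by (auto simp: abs_mult intro!: mult_left_mono power_mono)
  qed
qed

lemma conv_seqsI:
  assumes "\<And>r. 0 < r \<Longrightarrow> r < 1 \<Longrightarrow> summable (\<lambda>k. \<bar>a k\<bar> * r ^ k)"
  shows "a \<in> conv_seqs"
  unfolding conv_seqs_def
proof safe
  fix m
  have "(1 - 1 / real (Suc m)) \<ge> 0" by simp
  show "summable (\<lambda>k. \<bar>a k\<bar> * (1 - 1 / real (Suc m)) ^ k)"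
  proof (cases "m = 0")
    case True
    then show ?thesis by (intro summable_finite[of "{0}"]) auto
  next
    case False
    then show ?thesis by (intro assms) auto
  qed
qed

lemma summable_pser:
  assumes "a \<in> conv_seqs" "cmod z < 1"
  shows "summable (\<lambda>k. norm (complex_of_real (a k) * z ^ k))"
  using summable_conv_seqs[OF assms(1), of "cmod z"] assms(2) by (simp add: norm_mult norm_power)

lemmas summable_pser' = summable_norm_cancel[OF summable_pser]

lemma has_field_derivative_pser:
  assumes "a \<in> conv_seqs" "cmod z < 1"
  shows "(pser a has_field_derivative pderiv_ser a z) (at z)"
proof -
  have "((\<lambda>z. \<Sum>n. complex_of_real (a n) * z ^ n) has_field_derivative (\<Sum>n. diffs (\<lambda>n. complex_of_real (a n)) n * z ^ n)) (at z)"
  proof (rule termdiffs_strong')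
    show "summable (\<lambda>n. complex_of_real (a n) * z ^ n)" if "norm z < 1" for z
      using summable_pser'[OF assms(1) that] .
  qed (use assms in auto)
  then show ?thesis
    by (simp add: pser_def[abs_def] pderiv_ser_def diffs_def)
qed

lemma pser_holomorphic: "a \<in> conv_seqs \<Longrightarrow> pser a holomorphic_on ball 0 1"
  unfolding holomorphic_on_def field_differentiable_def
  by (metis has_field_derivative_at_within has_field_derivative_pser mem_ball_0)

lemma conv_seqs_deriv:
  assumes "a \<in> conv_seqs" shows "(\<lambda>k. real (Suc k) * a (Suc k)) \<in> conv_seqs"
proof (rule conv_seqsI)
  fix r :: real assume r: "0 < r" "r < 1"
  have "summable (\<lambda>n. diffs (\<lambda>k. \<bar>a k\<bar>) n * r ^ n)"
  proof (rule termdiff_converges[of _ 1])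
    fix x :: real assume "norm x < 1"
    then show "summable (\<lambda>n. \<bar>a n\<bar> * x ^ n)"
      using summable_conv_seqs[OF assms, of "\<bar>x\<bar>"] by (intro summable_norm_cancel[of "\<lambda>n. \<bar>a n\<bar> * x ^ n"]) (simp add: abs_mult power_abs)
  qed (use r in auto)
  then show "summable (\<lambda>k. \<bar>real (Suc k) * a (Suc k)\<bar> * r ^ k)"
    by (simp add: diffs_def abs_mult)
qed

lemma pderiv_ser_holomorphic: "a \<in> conv_seqs \<Longrightarrow> pderiv_ser a holomorphic_on ball 0 1"
  unfolding pderiv_ser_def[abs_def] by (intro pser_holomorphic conv_seqs_deriv)

lemma conv_seqs_tail: "(\<lambda>k. a (Suc k)) \<in> conv_seqs \<longleftrightarrow> a \<in> conv_seqs"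
proof
  assume *: "(\<lambda>k. a (Suc k)) \<in> conv_seqs"
  show "a \<in> conv_seqs"
  proof (rule conv_seqsI)
    fix r :: real assume "0 < r" "r < 1"
    then have "summable (\<lambda>k. \<bar>a (Suc k)\<bar> * r ^ k * r)"
      by (intro summable_mult2 summable_conv_seqs[OF *]) auto
    then have "summable (\<lambda>k. \<bar>a (Suc k)\<bar> * r ^ Suc k)" by (simp add: ac_simps)
    then show "summable (\<lambda>k. \<bar>a k\<bar> * r ^ k)" by (rule summable_Suc_iff[where f="\<lambda>k. \<bar>a k\<bar> * r ^ k", THEN iffD1])
  qed
next
  assume *: "a \<in> conv_seqs"
  show "(\<lambda>k. a (Suc k)) \<in> conv_seqs"
  proof (rule conv_seqsI)
    fix r :: real assume r: "0 < r" "r < 1"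
    then have "summable (\<lambda>k. \<bar>a k\<bar> * r ^ k)"
      by (intro summable_conv_seqs[OF *]) auto
    then have "summable (\<lambda>k. \<bar>a (Suc k)\<bar> * r ^ Suc k * (1/r))"
      by (intro summable_mult2) (rule summable_Suc_iff[where f="\<lambda>k. \<bar>a k\<bar> * r ^ k", THEN iffD2])
    then show "summable (\<lambda>k. \<bar>a (Suc k)\<bar> * r ^ k)" using r by (simp add: field_simps)
  qed
qed

lemma conv_seqs_case_nat [simp]: "case_nat x t \<in> conv_seqs \<longleftrightarrow> t \<in> conv_seqs"
  using conv_seqs_tail[of "case_nat x t"] by simp

lemma pser_split_head:
  assumes "a \<in> conv_seqs" "cmod z < 1"
  shows "pser a z = of_real (a 0) + z * pser (\<lambda>k. a (Suc k)) z"
proof -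
  have s: "summable (\<lambda>k. complex_of_real (a (Suc k)) * z ^ k)"
    using summable_pser'[of "\<lambda>k. a (Suc k)" z] assms by (simp add: conv_seqs_tail)
  have "pser a z = (\<Sum>k. complex_of_real (a (Suc k)) * z ^ Suc k) + of_real (a 0)"
    unfolding pser_def by (subst suminf_split_head[OF summable_pser'[OF assms]]) simp
  also have "(\<Sum>k. complex_of_real (a (Suc k)) * z ^ Suc k) = z * pser (\<lambda>k. a (Suc k)) z"
    unfolding pser_def by (subst suminf_mult[OF s, symmetric]) (simp add: ac_simps)
  finally show ?thesis by simp
qed

lemma pser_case_nat:
  assumes "t \<in> conv_seqs" "cmod z < 1"
  shows "pser (case_nat x t) z = of_real x + z * pser t z"
  using pser_split_head[of "case_nat x t" z] assms by simp

lemma pser_add: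
  assumes "a \<in> conv_seqs" "b \<in> conv_seqs" "cmod z < 1"
  shows "pser (\<lambda>k. a k + b k) z = pser a z + pser b z"
  unfolding pser_def using suminf_add[OF summable_pser'[OF assms(1,3)] summable_pser'[OF assms(2,3)]]
  by (simp add: algebra_simps)

lemma pser_cmult:
  assumes "a \<in> conv_seqs" "cmod z < 1"
  shows "pser (\<lambda>k. c * a k) z = of_real c * pser a z"
  unfolding pser_def using suminf_mult[OF summable_pser'[OF assms], of "of_real c"]
  by (simp add: algebra_simps)

lemma conv_seqs_cmult: "a \<in> conv_seqs \<Longrightarrow> (\<lambda>k. c * a k) \<in> conv_seqs"
  using summable_mult[of "\<lambda>k. \<bar>a k\<bar> * _ ^ k" "\<bar>c\<bar>"] summable_conv_seqs[of a]
  by (intro conv_seqsI) (auto simp: abs_mult mult.assoc)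

lemma conv_seqs_le:
  assumes "b \<in> conv_seqs" "\<And>k. \<bar>a k\<bar> \<le> \<bar>b k\<bar>" shows "a \<in> conv_seqs"
proof (rule conv_seqsI)
  fix r :: real assume "0 < r" "r < 1"
  with assms show "summable (\<lambda>k. \<bar>a k\<bar> * r ^ k)"
    by (intro summable_comparison_test'[OF summable_conv_seqs[OF assms(1), of r]])
       (auto simp: abs_mult intro!: mult_right_mono)
qed

lemma conv_seqs_add:
  assumes "a \<in> conv_seqs" "b \<in> conv_seqs" shows "(\<lambda>k. a k + b k) \<in> conv_seqs"
proof (rule conv_seqsI)
  fix r :: real assume r: "0 < r" "r < 1"
  have "summable (\<lambda>k. \<bar>a k\<bar> * r ^ k + \<bar>b k\<bar> * r ^ k)"
    using r assms by (intro summable_add summable_conv_seqs) auto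
  then show "summable (\<lambda>k. \<bar>a k + b k\<bar> * r ^ k)"
    by (rule summable_comparison_test') (use r in \<open>auto simp: abs_mult ring_distribs(2)[symmetric] intro!: mult_right_mono\<close>)
qed

lemma pser_cnj:
  assumes "a \<in> conv_seqs" "cmod z < 1" shows "pser a (cnj z) = cnj (pser a z)"
  using sums_cnj[of "\<lambda>k. complex_of_real (a k) * z ^ k" "pser a z"] summable_pser'[OF assms]
  by (simp add: pser_def summable_sums sums_unique[symmetric])

text \<open>The value at 0 kills the first coefficient; dividing by \<open>z\<close> shows that the
  tail series vanishes off 0, and by continuity also at 0. Induction then removes the coefficients
  one at a time.\<close>

lemma pser_zero_imp_zero:
  assumes "a \<in> conv_seqs" "\<And>z. z \<in> ball 0 1 \<Longrightarrow> pser a z = 0"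
  shows "a k = 0"
  using assms
proof (induction k arbitrary: a)
  case 0
  have "pser a 0 = of_real (a 0)" using pser_split_head[of a 0] 0 by simp
  with 0(2)[of 0] show ?case by simp
next
  case (Suc k)
  let ?t = "\<lambda>k. a (Suc k)"
  have t: "?t \<in> conv_seqs" using Suc.prems(1) by (simp add: conv_seqs_tail)
  have a0: "a 0 = 0" using pser_split_head[of a 0] Suc.prems(1) Suc.prems(2)[of 0] by simp
  have nz: "pser ?t z = 0" if "z \<in> ball 0 1" "z \<noteq> 0" for z
    using pser_split_head[of a z] Suc.prems(1) Suc.prems(2)[of z] that a0 by simp
  have "pser ?t 0 = 0"
  proof -
    have "(pser ?t \<longlongrightarrow> pser ?t 0) (at 0)"
      using DERIV_isCont[OF has_field_derivative_pser[OF t, of 0]] by (simp add: isCont_def)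
    moreover have "(pser ?t \<longlongrightarrow> 0) (at 0)"
    proof (rule Lim_transform_eventually[OF tendsto_const])
      have "eventually (\<lambda>z. z \<in> ball (0::complex) 1 - {0}) (at 0)"
        by (rule eventually_at_in_open) auto
      then show "eventually (\<lambda>z. 0 = pser ?t z) (at 0)"
        by eventually_elim (use nz in auto)
    qed
    ultimately show ?thesis using tendsto_unique[OF at_neq_bot] by blast
  qed
  with nz have "\<And>z. z \<in> ball 0 1 \<Longrightarrow> pser ?t z = 0" by metis
  from Suc.IH[OF t this] show ?case .
qed

lemma pser_zero_imp_zero_open:
  assumes "a \<in> conv_seqs" and "open U" "U \<subseteq> ball 0 1" "U \<noteq> {}" "\<And>z. z \<in> U \<Longrightarrow> pser a z = 0"
  shows "a k = 0"
proof (rule pser_zero_imp_zero[OF assms(1)])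
  fix z :: complex assume "z \<in> ball 0 1"
  then show "pser a z = 0"
    using analytic_continuation_open[OF \<open>open U\<close> open_ball \<open>U \<noteq> {}\<close> connected_ball \<open>U \<subseteq> ball 0 1\<close>
       pser_holomorphic[OF assms(1)] holomorphic_on_const[of 0]] assms(5) by auto
qed

lemma measurable_pser_compose [measurable (raw)]:
  assumes [measurable]: "f \<in> measurable M (PiM UNIV (\<lambda>_. borel))" "g \<in> borel_measurable M"
  shows "(\<lambda>x. pser (f x) (g x)) \<in> borel_measurable M"
  unfolding pser_def by measurable

lemma measurable_pderiv_ser_compose [measurable (raw)]:
  assumes [measurable]: "f \<in> measurable M (PiM UNIV (\<lambda>_. borel))" "g \<in> borel_measurable M"
  shows "(\<lambda>x. pderiv_ser (f x) (g x)) \<in> borel_measurable M"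
  unfolding pderiv_ser_def pser_def by measurable

lemma summable_iff_suminf_ennreal:
  assumes "\<And>k. 0 \<le> f k" shows "summable f \<longleftrightarrow> (\<Sum>k. ennreal (f k)) \<noteq> top"
proof
  assume "summable f"
  then show "(\<Sum>k. ennreal (f k)) \<noteq> top" using suminf_ennreal2[OF assms] by simp
qed (rule summable_suminf_not_top[OF assms])

lemma conv_seqs_measurable [measurable]: "conv_seqs \<in> sets (PiM UNIV (\<lambda>_. borel))"
proof -
  have m: "{a \<in> space (PiM UNIV (\<lambda>_. borel)). summable (\<lambda>k. \<bar>a k\<bar> * (1 - 1 / real (Suc m)) ^ k)} \<in> sets (PiM UNIV (\<lambda>_. borel))" for m
  proof -
    define r where "r = 1 - 1 / real (Suc m)"
    have r: "0 \<le> r" by (simp add: r_def)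
    have "summable (\<lambda>k. \<bar>a k\<bar> * r ^ k) \<longleftrightarrow> (\<Sum>k. ennreal (\<bar>a k\<bar> * r ^ k)) \<noteq> top" for a :: "nat \<Rightarrow> real"
      by (rule summable_iff_suminf_ennreal) (simp add: r)
    moreover have "{a \<in> space (PiM UNIV (\<lambda>_. borel)). (\<Sum>k. ennreal (\<bar>a k\<bar> * r ^ k)) \<noteq> top} \<in> sets (PiM UNIV (\<lambda>_. borel))"
      by measurable
    ultimately show ?thesis unfolding r_def[symmetric] by presburger
  qed
  have "conv_seqs = (\<Inter>m. {a \<in> space (PiM UNIV (\<lambda>_. borel)). summable (\<lambda>k. \<bar>a k\<bar> * (1 - 1 / real (Suc m)) ^ k)})"
    by (auto simp: conv_seqs_def space_PiM)
  also have "\<dots> \<in> sets (PiM UNIV (\<lambda>_. borel))"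
    by (rule sets.countable_INT) (use m in auto)
  finally show ?thesis .
qed

section \<open>Almost sure convergence on the disc\<close>

lemma nn_integral_gauss_component:
  assumes "f \<in> borel_measurable borel"
  shows "(\<integral>\<^sup>+a. f (a k) \<partial>gauss) = (\<integral>\<^sup>+x. f x \<partial>gauss1)"
proof -
  have "distr gauss gauss1 (\<lambda>a. a k) = gauss1"
    unfolding gauss_def using distr_PiM_component[of UNIV "\<lambda>_. gauss1" k] prob_space_gauss1 by simp
  then have "(\<integral>\<^sup>+x. f x \<partial>gauss1) = (\<integral>\<^sup>+x. f x \<partial>distr gauss gauss1 (\<lambda>a. a k))" by simp
  also have "\<dots> = (\<integral>\<^sup>+a. f (a k) \<partial>gauss)"
    using assms by (subst nn_integral_distr) auto
  finally show ?thesis ..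
qed

lemma gauss1_abs_moment_finite: "(\<integral>\<^sup>+x. ennreal (\<bar>x\<bar> ^ m) \<partial>gauss1) < \<infinity>"
proof -
  have "integrable gauss1 (\<lambda>x. \<bar>x\<bar> ^ m)"
    using integrable_std_normal_moment_abs[of m] by (simp add: integrable_density normal_density_nonneg)
  then show ?thesis by (simp add: integrable_iff_bounded)
qed

text \<open>All coefficients share the same finite first absolute moment, so the expectation of the
  absolute series at radius \<open>r\<close> is dominated by a geometric series. The countable
  family of radii is then handled simultaneously.\<close>

lemma AE_gauss_conv: "AE a in gauss. a \<in> conv_seqs"
proof -
  have "AE a in gauss. summable (\<lambda>k. \<bar>a k\<bar> * (1 - 1 / real (Suc m)) ^ k)" for m
  proof -
    define r where "r = 1 - 1 / real (Suc m)"
    have r: "0 \<le> r" "r < 1" by (auto simp: r_def)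
    define c where "c = (\<integral>\<^sup>+x. ennreal \<bar>x\<bar> \<partial>gauss1)"
    have c: "c < \<infinity>" using gauss1_abs_moment_finite[of 1] by (simp add: c_def)
    have "(\<integral>\<^sup>+a. (\<Sum>k. ennreal (\<bar>a k\<bar> * r ^ k)) \<partial>gauss) = (\<Sum>k. \<integral>\<^sup>+a. ennreal (\<bar>a k\<bar> * r ^ k) \<partial>gauss)"
      by (rule nn_integral_suminf) measurable
    also have "\<dots> = (\<Sum>k. c * ennreal (r ^ k))"
    proof (rule arg_cong[where f=suminf], rule ext)
      fix k
      have "(\<integral>\<^sup>+a. ennreal (\<bar>a k\<bar> * r ^ k) \<partial>gauss) = (\<integral>\<^sup>+a. ennreal \<bar>a k\<bar> * ennreal (r ^ k) \<partial>gauss)"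
        using r by (simp add: ennreal_mult')
      also have "\<dots> = c * ennreal (r ^ k)"
        unfolding c_def by (subst nn_integral_multc) (auto simp: nn_integral_gauss_component[of "\<lambda>x. ennreal \<bar>x\<bar>"])
      finally show "(\<integral>\<^sup>+a. ennreal (\<bar>a k\<bar> * r ^ k) \<partial>gauss) = c * ennreal (r ^ k)" .
    qed
    also have "\<dots> = c * (\<Sum>k. ennreal (r ^ k))" by (rule ennreal_suminf_cmult)
    also have "(\<Sum>k. ennreal (r ^ k)) = ennreal (\<Sum>k. r ^ k)"
      using r by (intro suminf_ennreal2) (auto intro: summable_geometric)
    also have "c * \<dots> < \<infinity>" using c by (simp add: ennreal_mult_less_top)
    finally have fin: "(\<integral>\<^sup>+a. (\<Sum>k. ennreal (\<bar>a k\<bar> * r ^ k)) \<partial>gauss) \<noteq> \<infinity>" by simp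
    have "AE a in gauss. (\<Sum>k. ennreal (\<bar>a k\<bar> * r ^ k)) \<noteq> \<infinity>"
      by (rule nn_integral_PInf_AE[OF _ fin]) measurable
    then show ?thesis
    proof eventually_elim
      case (elim a)
      then show ?case unfolding r_def[symmetric]
        by (intro summable_suminf_not_top) (use r in simp_all)
    qed
  qed
  then show ?thesis by (simp add: conv_seqs_def AE_all_countable)
qed

section \<open>Measurability of the number of zeros\<close>

text \<open>Used for half-open dyadic cells, which are intersections of an open and a closed set:
  hitting such a cell reduces to hitting countably many compact sets.\<close>

lemma open_Int_closed_eq_Union_compact:
  fixes V C :: "'a::euclidean_space set"
  assumes "open V" "closed C"
  obtains K :: "nat \<Rightarrow> 'a set" where "\<And>n. compact (K n)" "V \<inter> C = (\<Union>n. K n)"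
proof -
  obtain F :: "nat \<Rightarrow> 'a set" where F: "\<And>n. compact (F n)" "(\<Union>n. F n) = V"
    using open_Union_compact_subsets[OF assms(1)] by metis
  show ?thesis
  proof (rule that)
    show "compact (F n \<inter> C)" for n using F(1) assms(2) by (rule compact_Int_closed)
    show "V \<inter> C = (\<Union>n. F n \<inter> C)" unfolding F(2)[symmetric] by blast
  qed
qed

text \<open>On a compact set a continuous function attains the infimum of its modulus, so a zero
  exists exactly when the modulus becomes arbitrarily small on a countable dense subset. That
  condition involves only countably many measurable evaluations.\<close>

lemma measurable_ex_zero_compact:
  fixes G :: "'a \<Rightarrow> 'b::euclidean_space \<Rightarrow> real"
  assumes "compact K" and cont: "\<And>x. x \<in> space M \<Longrightarrow> continuous_on K (G x)"
    and meas: "\<And>q. q \<in> K \<Longrightarrow> (\<lambda>x. G x q) \<in> borel_measurable M"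
  shows "{x\<in>space M. \<exists>q\<in>K. G x q = 0} \<in> sets M"
proof -
  obtain D where D: "countable D" "D \<subseteq> K" "K \<subseteq> closure D"
    using separable[of K] by blast
  have "(\<exists>q\<in>K. G x q = 0) \<longleftrightarrow> (\<forall>n::nat. \<exists>q\<in>D. \<bar>G x q\<bar> < 1 / real (Suc n))" if x: "x \<in> space M" for x
  proof
    assume "\<exists>q\<in>K. G x q = 0"
    then obtain q where q: "q \<in> K" "G x q = 0" by blast
    show "\<forall>n::nat. \<exists>q\<in>D. \<bar>G x q\<bar> < 1 / real (Suc n)"
    proof
      fix n :: nat
      have "\<exists>d>0. \<forall>y\<in>K. dist y q < d \<longrightarrow> dist (G x y) (G x q) < 1 / real (Suc n)"
        by (rule cont[OF x, unfolded continuous_on_iff, rule_format, OF q(1)]) simp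
      then obtain d where d: "d > 0" "\<And>y. y \<in> K \<Longrightarrow> dist y q < d \<Longrightarrow> dist (G x y) (G x q) < 1 / real (Suc n)"
        by blast
      have "q \<in> closure D" using D(3) q(1) by blast
      then obtain y where "y \<in> D" "dist y q < d" using d(1) by (auto simp: closure_approachable)
      then show "\<exists>q\<in>D. \<bar>G x q\<bar> < 1 / real (Suc n)" using d(2)[of y] D(2) q(2) by (auto simp: dist_real_def)
    qed
  next
    assume *: "\<forall>n::nat. \<exists>q\<in>D. \<bar>G x q\<bar> < 1 / real (Suc n)"
    then have "K \<noteq> {}" using D(2) by blast
    have "continuous_on K (\<lambda>q. \<bar>G x q\<bar>)" using cont[OF x] by (intro continuous_intros)
    from continuous_attains_inf[OF \<open>compact K\<close> \<open>K \<noteq> {}\<close> this]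
    obtain q where q: "q \<in> K" "\<And>y. y \<in> K \<Longrightarrow> \<bar>G x q\<bar> \<le> \<bar>G x y\<bar>" by blast
    have "\<bar>G x q\<bar> \<le> 1 / real (Suc n)" for n
    proof -
      obtain y where "y \<in> D" "\<bar>G x y\<bar> < 1 / real (Suc n)" using * by blast
      with q(2)[of y] D(2) show ?thesis by auto
    qed
    then have "\<bar>G x q\<bar> \<le> 0"
      by (intro LIMSEQ_le_const[OF LIMSEQ_inverse_real_of_nat] exI[of _ 0]) (simp add: inverse_eq_divide)
    with q(1) show "\<exists>q\<in>K. G x q = 0" by auto
  qed
  then have "{x\<in>space M. \<exists>q\<in>K. G x q = 0} = {x\<in>space M. \<forall>n::nat. \<exists>q\<in>D. \<bar>G x q\<bar> < 1 / real (Suc n)}"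
    by blast
  also have "\<dots> = (\<Inter>n. \<Union>q\<in>D. {x\<in>space M. \<bar>G x q\<bar> < 1 / real (Suc n)}) \<inter> space M" by auto
  also have "\<dots> \<in> sets M"
  proof -
    have "{x\<in>space M. \<bar>G x q\<bar> < 1 / real (Suc n)} \<in> sets M" if "q \<in> D" for q and n :: nat
    proof -
      have [measurable]: "(\<lambda>x. G x q) \<in> borel_measurable M" using meas D(2) that by blast
      show ?thesis by measurable
    qed
    then have "(\<Inter>n::nat. \<Union>q\<in>D. {x\<in>space M. \<bar>G x q\<bar> < 1 / real (Suc n)}) \<in> sets M"
      using D(1) by (intro sets.countable_INT sets.countable_UN') auto
    then show ?thesis by auto
  qed
  finally show ?thesis .
qed

text \<open>Any finite subset is eventually mapped injectively, so the image counts reach its size.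
  Arbitrarily large finite subsets give the infinite case.\<close>

lemma emeasure_count_space_eq_SUP_image:
  fixes \<phi> :: "nat \<Rightarrow> 'a \<Rightarrow> 'b"
  assumes sep: "\<And>x y. x \<noteq> y \<Longrightarrow> \<exists>m0. \<forall>m\<ge>m0. \<phi> m x \<noteq> \<phi> m y"
  shows "emeasure (count_space UNIV) S = (SUP m. emeasure (count_space UNIV) (\<phi> m ` S))"
proof (rule antisym)
  have fin_le: "ennreal (real (card T)) \<le> (SUP m. emeasure (count_space UNIV) (\<phi> m ` S))" if T: "finite T" "T \<subseteq> S" for T
  proof -
    have "\<exists>m. inj_on (\<phi> m) T"
    proof -
      have "\<forall>p\<in>{p\<in>T\<times>T. fst p \<noteq> snd p}. \<exists>m0. \<forall>m\<ge>m0. \<phi> m (fst p) \<noteq> \<phi> m (snd p)" using sep by blast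
      from bchoice[OF this] obtain f where
        f: "\<forall>p\<in>{p\<in>T\<times>T. fst p \<noteq> snd p}. \<forall>m\<ge>f p. \<phi> m (fst p) \<noteq> \<phi> m (snd p)" by blast
      \<comment> \<open>A sum of naturals bounds each of its terms, so this level separates all
        pairs of \<open>T\<close> at once.\<close>
      define m where "m = (\<Sum>p\<in>{p\<in>T\<times>T. fst p \<noteq> snd p}. f p)"
      have "inj_on (\<phi> m) T"
      proof (rule inj_onI, rule ccontr)
        fix x y assume xy: "x \<in> T" "y \<in> T" "\<phi> m x = \<phi> m y" "x \<noteq> y"
        have "f (x, y) \<le> m" unfolding m_def
          by (rule member_le_sum) (use xy T in auto)
        then show False using f xy by auto
      qed
      then show ?thesis ..
    qed
    then obtain m where m: "inj_on (\<phi> m) T" ..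
    have "ennreal (real (card T)) = emeasure (count_space UNIV) (\<phi> m ` T)"
      using T m by (simp add: card_image ennreal_of_nat_eq_real_of_nat)
    also have "\<dots> \<le> emeasure (count_space UNIV) (\<phi> m ` S)"
      by (rule emeasure_mono) (use T in auto)
    also have "\<dots> \<le> (SUP m. emeasure (count_space UNIV) (\<phi> m ` S))" by (rule SUP_upper) simp
    finally show ?thesis .
  qed
  show "emeasure (count_space UNIV) S \<le> (SUP m. emeasure (count_space UNIV) (\<phi> m ` S))"
  proof (cases "finite S")
    case True
    then show ?thesis using fin_le[of S] by (simp add: ennreal_of_nat_eq_real_of_nat)
  next
    case False
    have "ennreal (real n) \<le> (SUP m. emeasure (count_space UNIV) (\<phi> m ` S))" for n
      using infinite_arbitrarily_large[OF False, of n] fin_le by metis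
    then have "(SUP m. emeasure (count_space UNIV) (\<phi> m ` S)) = top"
      using ennreal_Ex_less_of_nat[of "SUP m. emeasure (count_space UNIV) (\<phi> m ` S)"]
      by (metis ennreal_of_nat_eq_real_of_nat leD top.not_eq_extremum)
    then show ?thesis by (metis top_greatest)
  qed
  show "(SUP m. emeasure (count_space UNIV) (\<phi> m ` S)) \<le> emeasure (count_space UNIV) S"
  proof (rule SUP_least)
    fix m
    show "emeasure (count_space UNIV) (\<phi> m ` S) \<le> emeasure (count_space UNIV) S"
      by (cases "finite S") (auto simp: card_image_le)
  qed
qed

text \<open>The index of the half-open dyadic square of side \<open>2 ^ (-m)\<close> that contains
  \<open>z\<close>.\<close>

definition grid :: "nat \<Rightarrow> complex \<Rightarrow> int \<times> int" where
  "grid m z = (\<lfloor>2 ^ m * Re z\<rfloor>, \<lfloor>2 ^ m * Im z\<rfloor>)"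

lemma floor_separates:
  assumes "(x::real) < y" shows "\<exists>m0. \<forall>m\<ge>m0. \<lfloor>2 ^ m * x\<rfloor> \<noteq> \<lfloor>2 ^ m * y\<rfloor>"
proof -
  obtain m0 where m0: "1 / (y - x) < 2 ^ m0" using real_arch_pow[of 2 "1/(y-x)"] by auto
  show ?thesis
  proof (intro exI[of _ m0] allI impI)
    fix m assume "m \<ge> m0"
    then have "(2::real) ^ m0 \<le> 2 ^ m" by simp
    with m0 have "1 / (y - x) < 2 ^ m" by linarith
    then have "2 ^ m * x + 1 < 2 ^ m * y" using assms by (simp add: field_simps)
    then show "\<lfloor>2 ^ m * x\<rfloor> \<noteq> \<lfloor>2 ^ m * y\<rfloor>" by linarith
  qed
qed

lemma grid_separates: "z \<noteq> w \<Longrightarrow> \<exists>m0. \<forall>m\<ge>m0. grid m z \<noteq> grid m w"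
proof -
  assume "z \<noteq> w"
  then have "Re z < Re w \<or> Re w < Re z \<or> Im z < Im w \<or> Im w < Im z"
    by (metis complex_eqI linorder_neqE_linordered_idom)
  then show ?thesis
    unfolding grid_def using floor_separates by (smt (verit, best) Pair_inject)
qed

text \<open>The points of \<open>Z x\<close> in \<open>V\<close> are counted as the limit of the
  number of dyadic squares they occupy. Whether a square is occupied is measurable, since its
  intersection with \<open>V\<close> is a countable union of compact sets.\<close>

lemma measurable_count_open:
  fixes Z :: "'a \<Rightarrow> complex set"
  assumes hit: "\<And>K. compact K \<Longrightarrow> K \<subseteq> U \<Longrightarrow> {x\<in>space M. Z x \<inter> K \<noteq> {}} \<in> sets M"
    and V: "open V" "V \<subseteq> U"
  shows "(\<lambda>x. emeasure (count_space UNIV) (Z x \<inter> V)) \<in> borel_measurable M"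
proof -
  have hit2: "{x\<in>space M. p \<in> grid m ` (Z x \<inter> V)} \<in> sets M" for m p
  proof -
    obtain i j where p: "p = (i, j)" by (cases p)
    define W where "W = {z. 2 ^ m * Re z < of_int i + 1} \<inter> {z. 2 ^ m * Im z < of_int j + 1}"
    define C where "C = {z. of_int i \<le> 2 ^ m * Re z} \<inter> {z. of_int j \<le> 2 ^ m * Im z}"
    have "open W" unfolding W_def by (intro open_Int open_Collect_less continuous_intros)
    have "closed C" unfolding C_def by (intro closed_Int closed_Collect_le continuous_intros)
    obtain K where K: "\<And>n. compact (K n)" "(V \<inter> W) \<inter> C = (\<Union>n::nat. K n)"
      using open_Int_closed_eq_Union_compact[of "V \<inter> W" C] V(1) \<open>open W\<close> \<open>closed C\<close> by blast
    have gr: "grid m z = p \<longleftrightarrow> z \<in> W \<inter> C" for z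
      by (auto simp: p grid_def W_def C_def floor_eq_iff)
    have "p \<in> grid m ` (Z x \<inter> V) \<longleftrightarrow> Z x \<inter> ((V \<inter> W) \<inter> C) \<noteq> {}" for x
    proof -
      have "p \<in> grid m ` (Z x \<inter> V) \<longleftrightarrow> (\<exists>z. z \<in> Z x \<and> z \<in> V \<and> grid m z = p)" by blast
      then show ?thesis unfolding gr by blast
    qed
    then have "{x\<in>space M. p \<in> grid m ` (Z x \<inter> V)} = (\<Union>n. {x\<in>space M. Z x \<inter> K n \<noteq> {}})"
      unfolding K(2) by auto
    also have "\<dots> \<in> sets M"
      using K V(2) by (intro sets.countable_UN) (auto intro!: hit)
    finally show ?thesis .
  qed
  have inf: "infinite (UNIV :: (int \<times> int) set)" by (simp add: finite_prod infinite_UNIV_int)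
  define e :: "nat \<Rightarrow> int \<times> int" where "e = from_nat_into UNIV"
  have e: "bij_betw e UNIV UNIV"
    unfolding e_def using bij_betw_from_nat_into[OF _ inf] by simp
  have cnt: "emeasure (count_space UNIV) T = (\<Sum>n. indicator T (e n))" for T
  proof -
    have "emeasure (count_space UNIV) T = (\<integral>\<^sup>+p. indicator T p \<partial>count_space UNIV)" by simp
    also have "\<dots> = (\<integral>\<^sup>+n. indicator T (e n) \<partial>count_space UNIV)"
      by (rule nn_integral_bij_count_space[OF e, symmetric])
    also have "\<dots> = (\<Sum>n. indicator T (e n))" by (rule nn_integral_count_space_nat)
    finally show ?thesis .
  qed
  have "(\<lambda>x. emeasure (count_space UNIV) (Z x \<inter> V)) =
     (\<lambda>x. SUP m. (\<Sum>n. indicator (grid m ` (Z x \<inter> V)) (e n)))"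
    unfolding cnt[symmetric]
    by (rule ext, rule emeasure_count_space_eq_SUP_image) (rule grid_separates)
  also have "\<dots> \<in> borel_measurable M"
  proof (intro borel_measurable_SUP borel_measurable_suminf_order)
    fix m n
    have "(\<lambda>x. indicator {x\<in>space M. e n \<in> grid m ` (Z x \<inter> V)} x :: ennreal) \<in> borel_measurable M"
      by (rule borel_measurable_indicator[OF hit2])
    then show "(\<lambda>x. indicator (grid m ` (Z x \<inter> V)) (e n) :: ennreal) \<in> borel_measurable M"
      by (rule measurable_cong[THEN iffD2, rotated]) (simp add: indicator_def)
  qed auto
  finally show ?thesis .
qed

text \<open>Dynkin's argument from open sets to Borel sets. Complements need a subtraction of
  counts, which is legitimate only for finite counts; the induction is therefore run inside
  \<open>V n\<close>, whose trace on \<open>Z x\<close> is finite, and \<open>n\<close> tends to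
  infinity afterwards.\<close>

lemma measurable_count_borel:
  fixes Z :: "'a \<Rightarrow> complex set"
  assumes hit: "\<And>K. compact K \<Longrightarrow> K \<subseteq> U \<Longrightarrow> {x\<in>space M. Z x \<inter> K \<noteq> {}} \<in> sets M"
    and fin: "\<And>x K. x \<in> space M \<Longrightarrow> compact K \<Longrightarrow> K \<subseteq> U \<Longrightarrow> finite (Z x \<inter> K)"
    and U: "open U" and B: "B \<in> sets borel" "B \<subseteq> U"
  shows "(\<lambda>x. emeasure (count_space UNIV) (Z x \<inter> B)) \<in> borel_measurable M"
proof -
  obtain K where K: "\<And>n. compact (K n)" "\<And>n. K n \<subseteq> U" "\<And>n. K n \<subseteq> interior (K (Suc n))" "(\<Union>n. K n) = U"
    using open_Union_compact_subsets[OF U] by metis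
  define V where "V n = interior (K n)" for n
  have V: "open (V n)" "V n \<subseteq> U" "V n \<subseteq> K n" for n
    using K(2)[of n] interior_subset[of "K n"] by (auto simp: V_def)
  have incV: "incseq V" unfolding V_def incseq_Suc_iff
    using K(3) interior_subset by (meson order_trans)
  have UV: "(\<Union>n. V n) = U"
    using K(2,3,4) V(2) unfolding V_def by blast
  have finV: "finite (Z x \<inter> V n)" if "x \<in> space M" for x n
    by (rule finite_subset[OF _ fin[OF that K(1,2)[of n]]]) (use V(3) in auto)
  have 1: "(\<lambda>x. emeasure (count_space UNIV) (Z x \<inter> (V n \<inter> A))) \<in> borel_measurable M" if "A \<in> sets borel" for n A
  proof -
    have ss: "A \<in> sigma_sets UNIV {S. open S}" using that by (simp add: borel_def)
    show ?thesis
    proof (rule sigma_sets_induct_disjoint[OF _ _ ss, where P="\<lambda>A. (\<lambda>x. emeasure (count_space UNIV) (Z x \<inter> (V n \<inter> A))) \<in> borel_measurable M"])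
      show "Int_stable {S::complex set. open S}" by (auto simp: Int_stable_def)
      show "{S::complex set. open S} \<subseteq> Pow UNIV" by simp
    next
      fix A :: "complex set" assume "A \<in> {S. open S}"
      then show "(\<lambda>x. emeasure (count_space UNIV) (Z x \<inter> (V n \<inter> A))) \<in> borel_measurable M"
        using V by (intro measurable_count_open[OF hit]) auto
    next
      show "(\<lambda>x. emeasure (count_space UNIV) (Z x \<inter> (V n \<inter> {}))) \<in> borel_measurable M" by simp
    next
      fix A assume A: "(\<lambda>x. emeasure (count_space UNIV) (Z x \<inter> (V n \<inter> A))) \<in> borel_measurable M"
      have [measurable]: "(\<lambda>x. emeasure (count_space UNIV) (Z x \<inter> V n)) \<in> borel_measurable M"
        using V by (intro measurable_count_open[OF hit]) auto
      have "emeasure (count_space UNIV) (Z x \<inter> (V n \<inter> (UNIV - A))) =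
        emeasure (count_space UNIV) (Z x \<inter> V n) - emeasure (count_space UNIV) (Z x \<inter> (V n \<inter> A))" if "x \<in> space M" for x
      proof -
        have "Z x \<inter> (V n \<inter> (UNIV - A)) = (Z x \<inter> V n) - (Z x \<inter> (V n \<inter> A))" by auto
        moreover have "finite (Z x \<inter> (V n \<inter> A))" by (rule finite_subset[OF _ finV[OF that, of n]]) auto
        ultimately show ?thesis
          by (simp only:) (rule emeasure_Diff, auto)
      qed
      then show "(\<lambda>x. emeasure (count_space UNIV) (Z x \<inter> (V n \<inter> (UNIV - A)))) \<in> borel_measurable M"
        by (rule measurable_cong[THEN iffD2]) (use A in measurable)
    next
      fix A :: "nat \<Rightarrow> complex set" assume dis: "disjoint_family A"
        and A: "\<And>i. (\<lambda>x. emeasure (count_space UNIV) (Z x \<inter> (V n \<inter> A i))) \<in> borel_measurable M"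
      have "emeasure (count_space UNIV) (Z x \<inter> (V n \<inter> (\<Union>i. A i))) = (\<Sum>i. emeasure (count_space UNIV) (Z x \<inter> (V n \<inter> A i)))" for x
      proof -
        have "Z x \<inter> (V n \<inter> (\<Union>i. A i)) = (\<Union>i. Z x \<inter> (V n \<inter> A i))" by auto
        then show ?thesis
          by (simp only:) (rule suminf_emeasure[symmetric], use dis in \<open>auto simp: disjoint_family_on_def\<close>)
      qed
      then show "(\<lambda>x. emeasure (count_space UNIV) (Z x \<inter> (V n \<inter> (\<Union>i. A i)))) \<in> borel_measurable M"
        using A by simp
    qed
  qed
  have "emeasure (count_space UNIV) (Z x \<inter> B) = (SUP n. emeasure (count_space UNIV) (Z x \<inter> (V n \<inter> B)))" for x
  proof -
    have "Z x \<inter> B = (\<Union>n. Z x \<inter> (V n \<inter> B))" using UV B(2) by auto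
    also have "emeasure (count_space UNIV) \<dots> = (SUP n. emeasure (count_space UNIV) (Z x \<inter> (V n \<inter> B)))"
      by (rule SUP_emeasure_incseq[symmetric]) (use incV in \<open>auto simp: incseq_def\<close>)
    finally show ?thesis .
  qed
  then show ?thesis using 1[OF B(1)] by simp
qed

section \<open>The leading coefficients as a function of a zero\<close>

definition nondeg :: "(nat \<Rightarrow> real) \<Rightarrow> bool" where
  "nondeg a \<longleftrightarrow> a \<in> conv_seqs \<and> (\<exists>k. a k \<noteq> 0)"

text \<open>The condition \<open>nondeg a\<close> is built in so that the zero set is locally finite
  for every sequence and not only for almost every one: the zero series and divergent series get no
  zeros at all.\<close>

definition zeros :: "(nat \<Rightarrow> real) \<Rightarrow> complex set" where
  "zeros a = {z. cmod z < 1 \<and> nondeg a \<and> pser a z = 0}"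

text \<open>Every zero counts once here. The agreement with \<open>num_zeros\<close> is an almost
  sure statement that rests on the absence of double zeros.\<close>

definition zcount :: "(nat \<Rightarrow> real) \<Rightarrow> complex set \<Rightarrow> ennreal" where
  "zcount a B = emeasure (count_space UNIV) (zeros a \<inter> B)"

lemma nondeg_pred [measurable]: "Measurable.pred (PiM UNIV (\<lambda>_. borel)) nondeg"
  unfolding nondeg_def by measurable

lemma finite_zeros_compact:
  assumes "compact K" "K \<subseteq> ball 0 1" shows "finite (zeros a \<inter> K)"
proof (cases "nondeg a")
  case True
  then have a: "a \<in> conv_seqs" "\<exists>k. a k \<noteq> 0" by (auto simp: nondeg_def)
  show ?thesis
  proof (rule ccontr)
    assume "infinite (zeros a \<inter> K)"
    then obtain \<xi> where \<xi>: "\<xi> \<in> K" "\<xi> islimpt (zeros a \<inter> K)"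
      using \<open>compact K\<close> unfolding compact_eq_Bolzano_Weierstrass by blast
    have "pser a w = 0" if "w \<in> ball 0 1" for w
      by (rule analytic_continuation[OF pser_holomorphic[OF a(1)], of "zeros a \<inter> K" \<xi>])
        (use \<xi> assms that in \<open>auto simp: zeros_def\<close>)
    from pser_zero_imp_zero[OF a(1) this] a(2) show False by blast
  qed
qed (simp add: zeros_def)

lemma zeros_hit_measurable:
  assumes "compact K" "K \<subseteq> ball 0 1"
  shows "{a \<in> space (PiM UNIV (\<lambda>_. borel)). zeros a \<inter> K \<noteq> {}} \<in> sets (PiM UNIV (\<lambda>_. borel))"
proof -
  have "{a\<in>space (PiM UNIV (\<lambda>_. borel)). \<exists>q\<in>K. (if nondeg a then cmod (pser a q) else 1) = 0} \<in> sets (PiM UNIV (\<lambda>_. borel))"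
  proof (rule measurable_ex_zero_compact[OF \<open>compact K\<close>])
    fix a :: "nat \<Rightarrow> real"
    show "continuous_on K (\<lambda>q. if nondeg a then cmod (pser a q) else 1)"
    proof (cases "nondeg a")
      case True
      then have "pser a holomorphic_on ball 0 1" by (auto simp: nondeg_def intro: pser_holomorphic)
      then have "continuous_on K (pser a)"
        using assms(2) by (meson continuous_on_subset holomorphic_on_imp_continuous_on)
      then show ?thesis using True by (auto intro!: continuous_intros)
    qed simp
  next
    fix q show "(\<lambda>x. if nondeg x then cmod (pser x q) else 1) \<in> borel_measurable (PiM UNIV (\<lambda>_. borel))"
      by measurable
  qed
  also have "{a\<in>space (PiM UNIV (\<lambda>_. borel)). \<exists>q\<in>K. (if nondeg a then cmod (pser a q) else 1) = 0} =
     {a \<in> space (PiM UNIV (\<lambda>_. borel)). zeros a \<inter> K \<noteq> {}}"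
  proof -
    have "\<forall>q\<in>K. cmod q < 1" using assms(2) by auto
    then show ?thesis by (auto simp: zeros_def disjoint_iff split: if_splits)
  qed
  finally show ?thesis .
qed

lemma zcount_measurable:
  assumes "B \<in> sets borel" "B \<subseteq> ball 0 1"
  shows "(\<lambda>a. zcount a B) \<in> borel_measurable (PiM UNIV (\<lambda>_. borel))"
  unfolding zcount_def
  by (rule measurable_count_borel[where U="ball 0 1"])
    (use assms zeros_hit_measurable finite_zeros_compact in auto)

section \<open>Lebesgue measure on \<open>real^2\<close>, on pairs of reals and on the complex
  plane\<close>

lemma nn_integral_lborel_vec2:
  fixes G :: "real \<times> real \<Rightarrow> ennreal"
  assumes [measurable]: "G \<in> borel_measurable (borel \<Otimes>\<^sub>M borel)"
  shows "(\<integral>\<^sup>+v. G ((v::real^2) $ 1, v $ 2) \<partial>lborel) = (\<integral>\<^sup>+x. \<integral>\<^sup>+y. G (x, y) \<partial>lborel \<partial>lborel)"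
proof -
  define j :: "real \<times> real \<Rightarrow> real^2" where "j p = (fst p) *\<^sub>R axis 1 1 + (snd p) *\<^sub>R axis 2 1" for p
  have j12: "j p $ 1 = fst p" "j p $ 2 = snd p" for p
    by (simp_all add: j_def axis_def)
  have jm [measurable]: "j \<in> borel_measurable (borel \<Otimes>\<^sub>M borel)"
    unfolding j_def by measurable
  have m1 [measurable]: "(\<lambda>v::real^2. v $ i) \<in> borel_measurable borel" for i
    by (intro borel_measurable_continuous_onI continuous_intros)
  have "lborel = distr (lborel \<Otimes>\<^sub>M lborel) borel j"
  proof (rule lborel_eqI)
    fix l u :: "real^2" assume lu: "\<And>b. b \<in> Basis \<Longrightarrow> l \<bullet> b \<le> u \<bullet> b"
    have lu': "l $ i \<le> u $ i" for i using lu[of "axis i 1"] by (auto simp: inner_axis Basis_vec_def)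
    have "emeasure (distr (lborel \<Otimes>\<^sub>M lborel) borel j) (box l u) = emeasure (lborel \<Otimes>\<^sub>M lborel) ({l$1<..<u$1} \<times> {l$2<..<u$2})"
    proof (subst emeasure_distr)
      have "j -` box l u \<inter> space (lborel \<Otimes>\<^sub>M lborel) = {l$1<..<u$1} \<times> {l$2<..<u$2}"
        by (auto simp: mem_box_cart j12 space_pair_measure forall_2)
      then show "emeasure (lborel \<Otimes>\<^sub>M lborel) (j -` box l u \<inter> space (lborel \<Otimes>\<^sub>M lborel)) = emeasure (lborel \<Otimes>\<^sub>M lborel) ({l$1<..<u$1} \<times> {l$2<..<u$2})"
        by simp
    qed auto
    also have "\<dots> = ennreal (u$1 - l$1) * ennreal (u$2 - l$2)"
      using lu' by (subst lborel.emeasure_pair_measure_Times) auto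
    also have "\<dots> = ennreal ((u$1 - l$1) * (u$2 - l$2))"
      using lu' by (simp add: ennreal_mult)
    also have "(u$1 - l$1) * (u$2 - l$2) = prod ((\<bullet>) (u - l)) Basis"
    proof -
      have B: "(Basis :: (real^2) set) = {axis 1 1, axis 2 1}"
        by (auto simp: Basis_vec_def UNIV_2)
      have "axis 1 1 \<noteq> (axis 2 1 :: real^2)" by (simp add: axis_eq_axis)
      then show ?thesis unfolding B by (simp add: inner_axis)
    qed
    finally show "emeasure (distr (lborel \<Otimes>\<^sub>M lborel) borel j) (box l u) = ennreal (prod ((\<bullet>) (u - l)) Basis)" .
  qed simp
  then have "(\<integral>\<^sup>+v. G ((v::real^2) $ 1, v $ 2) \<partial>lborel) = (\<integral>\<^sup>+v. G ((v::real^2) $ 1, v $ 2) \<partial>distr (lborel \<Otimes>\<^sub>M lborel) borel j)" by simp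
  also have "\<dots> = (\<integral>\<^sup>+p. G (fst p, snd p) \<partial>(lborel \<Otimes>\<^sub>M lborel))"
    by (subst nn_integral_distr) (auto simp: j12)
  also have "\<dots> = (\<integral>\<^sup>+x. \<integral>\<^sup>+y. G (x, y) \<partial>lborel \<partial>lborel)"
    by (subst lborel.nn_integral_fst[symmetric]) auto
  finally show ?thesis .
qed

definition cplx :: "real^2 \<Rightarrow> complex" where "cplx v = Complex (v $ 1) (v $ 2)"

lemma cplx_measurable [measurable]: "cplx \<in> borel_measurable borel"
proof -
  have "continuous_on UNIV cplx" unfolding cplx_def[abs_def] Complex_eq
    by (intro continuous_intros)
  then show ?thesis by (rule borel_measurable_continuous_onI)
qed

lemma nn_integral_lborel_cplx:
  fixes G :: "complex \<Rightarrow> ennreal"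
  assumes [measurable]: "G \<in> borel_measurable borel"
  shows "(\<integral>\<^sup>+z. G z \<partial>lborel) = (\<integral>\<^sup>+v. G (cplx v) \<partial>lborel)"
proof -
  have "lborel = distr lborel borel cplx"
  proof (rule lborel_eqI)
    fix l u :: complex assume lu: "\<And>b. b \<in> Basis \<Longrightarrow> l \<bullet> b \<le> u \<bullet> b"
    have lu': "Re l \<le> Re u" "Im l \<le> Im u" using lu[of 1] lu[of \<i>] by (auto simp: Basis_complex_def)
    define l' u' :: "real^2" where "l' = Re l *\<^sub>R axis 1 1 + Im l *\<^sub>R axis 2 1" and "u' = Re u *\<^sub>R axis 1 1 + Im u *\<^sub>R axis 2 1"
    have l': "l' $ 1 = Re l" "l' $ 2 = Im l" "u' $ 1 = Re u" "u' $ 2 = Im u"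
      by (simp_all add: l'_def u'_def axis_def)
    have "cplx -` box l u = box l' u'"
      by (auto simp: mem_box_cart mem_box Basis_complex_def cplx_def forall_2 l')
    then have "emeasure (distr lborel borel cplx) (box l u) = emeasure lborel (box l' u')"
      by (subst emeasure_distr) auto
    also have "\<dots> = ennreal (prod ((\<bullet>) (u' - l')) Basis)"
      by (rule emeasure_lborel_box) (use lu' in \<open>auto simp: Basis_vec_def UNIV_2 inner_axis l'\<close>)
    also have "prod ((\<bullet>) (u' - l')) Basis = (Re u - Re l) * (Im u - Im l)"
    proof -
      have B: "(Basis :: (real^2) set) = {axis 1 1, axis 2 1}"
        by (auto simp: Basis_vec_def UNIV_2)
      have "axis 1 1 \<noteq> (axis 2 1 :: real^2)" by (simp add: axis_eq_axis)
      then show ?thesis unfolding B by (simp add: inner_axis l')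
    qed
    also have "\<dots> = prod ((\<bullet>) (u - l)) Basis" by (simp add: Basis_complex_def)
    finally show "emeasure (distr lborel borel cplx) (box l u) = ennreal (prod ((\<bullet>) (u - l)) Basis)" .
  qed simp
  then have "(\<integral>\<^sup>+z. G z \<partial>lborel) = (\<integral>\<^sup>+z. G z \<partial>distr lborel borel cplx)" by simp
  also have "\<dots> = (\<integral>\<^sup>+v. G (cplx v) \<partial>lborel)" by (subst nn_integral_distr) auto
  finally show ?thesis .
qed

text \<open>The unique pair \<open>(a0, a1)\<close> of leading coefficients for which the series with tail \<open>t\<close> vanishes at \<open>z\<close>.\<close>

definition coef1 :: "(nat \<Rightarrow> real) \<Rightarrow> complex \<Rightarrow> real" where
  "coef1 t z = - Im (z\<^sup>2 * pser t z) / Im z"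

definition coef0 :: "(nat \<Rightarrow> real) \<Rightarrow> complex \<Rightarrow> real" where
  "coef0 t z = - Re (z\<^sup>2 * pser t z) - coef1 t z * Re z"

abbreviation cons2 :: "real \<Rightarrow> real \<Rightarrow> (nat \<Rightarrow> real) \<Rightarrow> nat \<Rightarrow> real" where
  "cons2 x y t \<equiv> case_nat x (case_nat y t)"

lemma pser_cons2:
  assumes "t \<in> conv_seqs" "cmod z < 1"
  shows "pser (cons2 x y t) z = of_real x + of_real y * z + z\<^sup>2 * pser t z"
  using assms by (simp add: pser_case_nat power2_eq_square algebra_simps)

text \<open>The imaginary part of the equation contains only \<open>y\<close>, with coefficient
  \<open>Im z > 0\<close>; once \<open>y\<close> is known the real part gives
  \<open>x\<close>.\<close>

lemma pser_cons2_eq_0_iff: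
  assumes "t \<in> conv_seqs" "z \<in> upper_half_disc"
  shows "pser (cons2 x y t) z = 0 \<longleftrightarrow> x = coef0 t z \<and> y = coef1 t z"
proof -
  have z: "cmod z < 1" "Im z > 0" using assms(2) by (auto simp: upper_half_disc_def)
  define g where "g = z\<^sup>2 * pser t z"
  have "pser (cons2 x y t) z = 0 \<longleftrightarrow> x + y * Re z + Re g = 0 \<and> y * Im z + Im g = 0"
    unfolding pser_cons2[OF assms(1) z(1)] g_def[symmetric] complex_eq_iff by simp
  also have "\<dots> \<longleftrightarrow> x = coef0 t z \<and> y = coef1 t z"
  proof -
    have "y * Im z + Im g = 0 \<longleftrightarrow> y = coef1 t z"
      using z(2) unfolding coef1_def g_def[symmetric] by (auto simp: field_simps)
    then show ?thesis unfolding coef0_def g_def[symmetric] by auto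
  qed
  finally show ?thesis .
qed

lemma coef_measurable [measurable (raw)]:
  assumes [measurable]: "f \<in> measurable M (PiM UNIV (\<lambda>_. borel))" "g \<in> borel_measurable M"
  shows "(\<lambda>x. coef0 (f x) (g x)) \<in> borel_measurable M" "(\<lambda>x. coef1 (f x) (g x)) \<in> borel_measurable M"
  unfolding coef0_def coef1_def by measurable

lemma emeasure_count_space_image_inj:
  "inj f \<Longrightarrow> emeasure (count_space UNIV) (f ` A) = emeasure (count_space UNIV) A"
  by (cases "finite A") (simp_all add: card_image finite_image_iff inj_on_subset[of f UNIV])

lemma area_formula_matrix:
  fixes f :: "real^'n::{finite,wellorder} \<Rightarrow> real^'n::_" and M :: "real^'n::_ \<Rightarrow> real^'n::_^'n::_"
  assumes "open U" and der: "\<And>x. x \<in> U \<Longrightarrow> (f has_derivative (\<lambda>h. M x *v h)) (at x)"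
    and cont: "continuous_on U M" and B: "B \<in> sets borel" "B \<subseteq> U"
  shows "(\<integral>\<^sup>+y. emeasure (count_space UNIV) {x\<in>B. f x = y} \<partial>lborel) =
    (\<integral>\<^sup>+x. ennreal \<bar>det (M x)\<bar> * indicator B x \<partial>lborel)"
proof -
  define f' where "f' x = Blinfun ((*v) (M x))" for x
  have ap: "blinfun_apply (f' x) = (*v) (M x)" for x
    unfolding f'_def by (rule bounded_linear_Blinfun_apply) (simp add: matrix_vector_mul_bounded_linear)
  have cf: "continuous_on U f'"
  proof (rule continuous_on_blinfun_componentwise)
    fix i
    show "continuous_on U (\<lambda>x. blinfun_apply (f' x) i)"
      unfolding ap matrix_vector_mult_def by (intro continuous_intros cont)
  qed
  have mt: "matrix (blinfun_apply (f' x)) = M x" for x unfolding ap by simp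
  show ?thesis
    using area_formula[OF \<open>open U\<close> _ cf B, of f] der unfolding mt unfolding ap by simp
qed

section \<open>The Jacobian of the map from a zero to the leading coefficients\<close>

lemma pderiv_ser_unique:
  assumes "a \<in> conv_seqs" "cmod z < 1" "(pser a has_field_derivative D) (at z)"
  shows "pderiv_ser a z = D"
  using DERIV_unique[OF has_field_derivative_pser[OF assms(1,2)] assms(3)] .

lemma pderiv_ser_cons2:
  assumes t: "t \<in> conv_seqs" and z: "cmod z < 1"
  shows "pderiv_ser (cons2 x y t) z = of_real y + (2 * z * pser t z + z\<^sup>2 * pderiv_ser t z)"
proof (rule pderiv_ser_unique)
  have "((\<lambda>w. of_real x + of_real y * w + w\<^sup>2 * pser t w) has_field_derivative
       of_real y + (2 * z * pser t z + z\<^sup>2 * pderiv_ser t z)) (at z)"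
    by (auto intro!: derivative_eq_intros has_field_derivative_pser[OF t z] simp: algebra_simps)
  then show "(pser (cons2 x y t) has_field_derivative of_real y + (2 * z * pser t z + z\<^sup>2 * pderiv_ser t z)) (at z)"
  proof (rule has_field_derivative_transform_within_open[of _ _ _ "ball 0 1"])
    show "of_real x + of_real y * w + w\<^sup>2 * pser t w = pser (cons2 x y t) w" if "w \<in> ball 0 1" for w
      using that by (simp add: pser_cons2[OF t])
  qed (use z in auto)
qed (use t z in auto)

text \<open>For a fixed tail, the zeros of the series with leading coefficients \<open>v $ 1\<close>
  and \<open>v $ 2\<close> are exactly the preimages of \<open>v\<close>. Counting zeros thus
  becomes counting preimages of a smooth map of the plane.\<close>

definition root_map :: "(nat \<Rightarrow> real) \<Rightarrow> real^2 \<Rightarrow> real^2" where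
  "root_map t v = coef0 t (cplx v) *\<^sub>R axis 1 1 + coef1 t (cplx v) *\<^sub>R axis 2 1"

text \<open>Heuristically from the implicit function theorem: moving \<open>z\<close> changes
  \<open>f z\<close> with real Jacobian \<open>\<bar>f' z\<bar>\<close> squared, and the
  coefficients compensate through the map from \<open>(x, y)\<close> to \<open>x + y * z\<close>,
  whose determinant is \<open>Im z\<close>.\<close>

definition root_jac :: "(nat \<Rightarrow> real) \<Rightarrow> complex \<Rightarrow> real" where
  "root_jac t z = (cmod (pderiv_ser (cons2 (coef0 t z) (coef1 t z) t) z))\<^sup>2 / Im z"

text \<open>The columns are the derivatives in the directions \<open>1\<close> and \<open>i\<close>;
  multiplication of \<open>G'\<close> by \<open>i\<close> exchanges its real and imaginary parts up
  to sign, which explains the second column. The \<open>Im G\<close> terms come from the quotient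
  rule and from \<open>coef1\<close>.\<close>

definition root_mat :: "(nat \<Rightarrow> real) \<Rightarrow> real^2 \<Rightarrow> real^2^2" where
  "root_mat t v = (let z = cplx v; G = z\<^sup>2 * pser t z; G' = 2 * z * pser t z + z\<^sup>2 * pderiv_ser t z;
      a21 = - Im G' / Im z; a22 = - Re G' / Im z + Im G / (Im z)\<^sup>2;
      a11 = - Re G' + Im G / Im z - a21 * Re z; a12 = Im G' - a22 * Re z
    in vector [vector [a11, a12], vector [a21, a22]])"

lemma cplx_simps [simp]: "Re (cplx v) = v $ 1" "Im (cplx v) = v $ 2"
  by (simp_all add: cplx_def)

lemma bounded_linear_cplx: "bounded_linear cplx"
proof -
  have eq: "cplx = (\<lambda>v. of_real (v $ 1) + \<i> * of_real (v $ 2))"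
    by (rule ext) (simp add: complex_eq_iff)
  show ?thesis unfolding eq
    by (intro bounded_linear_add bounded_linear_const_mult bounded_linear_of_real[THEN bounded_linear_compose] bounded_linear_vec_nth)
qed

lemma root_map_has_derivative:
  assumes t: "t \<in> conv_seqs" and v: "cplx v \<in> upper_half_disc"
  shows "(root_map t has_derivative (\<lambda>h. root_mat t v *v h)) (at v)"
proof -
  define z where "z = cplx v"
  have z: "cmod z < 1" "Im z > 0" using v by (auto simp: upper_half_disc_def z_def)
  define G where "G w = w\<^sup>2 * pser t w" for w
  define G' where "G' = 2 * z * pser t z + z\<^sup>2 * pderiv_ser t z"
  have "(G has_field_derivative G') (at z)"
    unfolding G_def G'_def by (auto intro!: derivative_eq_intros has_field_derivative_pser[OF t] z simp: algebra_simps)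
  then have dG: "(G has_derivative (\<lambda>h. G' * h)) (at z)" by (simp add: has_field_derivative_def)
  have dc: "(cplx has_derivative cplx) (at v)"
    by (rule bounded_linear_imp_has_derivative[OF bounded_linear_cplx])
  have dGc: "((\<lambda>v. G (cplx v)) has_derivative (\<lambda>h. G' * cplx h)) (at v)"
    using has_derivative_compose[OF dc, of G "\<lambda>h. G' * h"] dG by (simp add: z_def)
  have dGr: "((\<lambda>v. Re (G (cplx v))) has_derivative (\<lambda>h. Re (G' * cplx h))) (at v)"
    by (rule has_derivative_Re[OF dGc])
  have dGi: "((\<lambda>v. Im (G (cplx v))) has_derivative (\<lambda>h. Im (G' * cplx h))) (at v)"
    by (rule has_derivative_Im[OF dGc])
  have dn: "((\<lambda>v. v $ i) has_derivative (\<lambda>h. h $ i)) (at v)" for i :: 2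
    by (rule bounded_linear_imp_has_derivative[OF bounded_linear_vec_nth])
  have v2: "v $ 2 \<noteq> 0" using z by (simp add: z_def)
  define d1 where "d1 h = - Im (G' * cplx h) / v $ 2 + Im (G z) * h $ 2 / (v $ 2)\<^sup>2" for h
  have D1: "((\<lambda>v. coef1 t (cplx v)) has_derivative d1) (at v)"
  proof -
    have "((\<lambda>v. - Im (G (cplx v)) / v $ 2) has_derivative d1) (at v)"
      by (rule has_derivative_eq_rhs[OF has_derivative_divide[OF has_derivative_minus[OF dGi] dn v2]])
         (use v2 in \<open>auto simp: d1_def z_def fun_eq_iff field_simps power2_eq_square\<close>)
    then show ?thesis by (simp add: coef1_def G_def)
  qed
  define d0 where "d0 h = - Re (G' * cplx h) - (coef1 t z * h $ 1 + d1 h * v $ 1)" for h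
  have D0: "((\<lambda>v. coef0 t (cplx v)) has_derivative d0) (at v)"
  proof -
    have "((\<lambda>v. - Re (G (cplx v)) - coef1 t (cplx v) * v $ 1) has_derivative d0) (at v)"
      by (rule has_derivative_eq_rhs[OF has_derivative_diff[OF has_derivative_minus[OF dGr] has_derivative_mult[OF D1 dn]]])
         (auto simp: d0_def z_def fun_eq_iff)
    then show ?thesis by (simp add: coef0_def G_def)
  qed
  have "(root_map t has_derivative (\<lambda>h. d0 h *\<^sub>R axis 1 1 + d1 h *\<^sub>R axis 2 1)) (at v)"
    unfolding root_map_def
    by (intro has_derivative_add has_derivative_scaleR_left D0 D1)
  also have "(\<lambda>h. d0 h *\<^sub>R axis 1 1 + d1 h *\<^sub>R axis 2 1) = (\<lambda>h. root_mat t v *v h)"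
  proof
    fix h
    have e1: "coef1 t z = - Im (G z) / v $ 2" by (simp add: coef1_def G_def z_def)
    show "d0 h *\<^sub>R axis 1 1 + d1 h *\<^sub>R axis 2 1 = root_mat t v *v h"
      unfolding vec_eq_iff forall_2 root_mat_def Let_def z_def[symmetric] G'_def[symmetric] G_def[symmetric]
      by (simp add: matrix_vector_mult_def sum_2 axis_def d0_def d1_def e1 z_def[symmetric] algebra_simps)
         (simp add: z_def algebra_simps diff_divide_distrib add_divide_distrib)
  qed
  finally show ?thesis .
qed

text \<open>The terms with \<open>Re z\<close> amount to a row operation and cancel. What remains is
  the squared modulus of \<open>coef1 t z + G'\<close> over \<open>Im z\<close>, and
  \<open>coef1 t z + G'\<close> is the derivative at \<open>z\<close> of the completed
  series.\<close>

lemma det_root_mat: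
  assumes t: "t \<in> conv_seqs" and v: "cplx v \<in> upper_half_disc"
  shows "det (root_mat t v) = root_jac t (cplx v)"
proof -
  define z where "z = cplx v"
  have z: "cmod z < 1" "Im z > 0" using v by (auto simp: upper_half_disc_def z_def)
  define G where "G = z\<^sup>2 * pser t z"
  define G' where "G' = 2 * z * pser t z + z\<^sup>2 * pderiv_ser t z"
  define y where "y = Im z"
  define x where "x = Re z"
  have y: "y > 0" using z by (simp add: y_def)
  have e1: "coef1 t z = - Im G / y" by (simp add: coef1_def G_def y_def)
  have "det (root_mat t v) = (- Re G' + Im G / y - (- Im G' / y) * x) * (- Re G' / y + Im G / y\<^sup>2)
      - (Im G' - (- Re G' / y + Im G / y\<^sup>2) * x) * (- Im G' / y)"
    unfolding root_mat_def Let_def z_def[symmetric] G'_def[symmetric] G_def[symmetric]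
    by (simp add: det_2 y_def x_def)
  also have "\<dots> = ((- Im G / y + Re G')\<^sup>2 + (Im G')\<^sup>2) / y"
    using y by (simp add: field_simps power2_eq_square)
  also have "\<dots> = root_jac t z"
    unfolding root_jac_def pderiv_ser_cons2[OF t z(1)] G'_def[symmetric] e1 y_def[symmetric]
    by (simp add: cmod_power2)
  finally show ?thesis by (simp add: z_def)
qed

lemma open_upper_half_disc: "open upper_half_disc"
  unfolding upper_half_disc_def
  by (intro open_Collect_conj open_Collect_less continuous_intros)

lemma continuous_on_matrix2:
  assumes "continuous_on S a" "continuous_on S b" "continuous_on S c" "continuous_on S d"
  shows "continuous_on S (\<lambda>v. vector [vector [a v, b v], vector [c v, d v]] :: real^2^2)"
proof -
  have eq: "(\<lambda>v. vector [vector [a v, b v], vector [c v, d v]] :: real^2^2) =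
    (\<lambda>v. \<chi> i j. if i = 1 then (if j = 1 then a v else b v) else (if j = 1 then c v else d v))"
    by (rule ext) (simp add: vec_eq_iff forall_2)
  show ?thesis unfolding eq
  proof (intro continuous_on_vec_lambda)
    fix i j :: 2
    show "continuous_on S (\<lambda>v. if i = 1 then (if j = 1 then a v else b v) else (if j = 1 then c v else d v))"
      using assms by (cases "i = 1"; cases "j = 1") simp_all
  qed
qed

lemma continuous_on_root_mat:
  assumes t: "t \<in> conv_seqs"
  shows "continuous_on (cplx -` upper_half_disc) (root_mat t)"
proof -
  let ?U = "cplx -` upper_half_disc"
  have c: "continuous_on ?U cplx"
    by (rule linear_continuous_on[OF bounded_linear_cplx])
  have sub: "cplx ` ?U \<subseteq> ball 0 1" by (auto simp: upper_half_disc_def)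
  have c1: "continuous_on ?U (\<lambda>v. pser t (cplx v))"
    by (rule continuous_on_compose2[OF holomorphic_on_imp_continuous_on[OF pser_holomorphic[OF t]] c sub])
  have c2: "continuous_on ?U (\<lambda>v. pderiv_ser t (cplx v))"
    by (rule continuous_on_compose2[OF holomorphic_on_imp_continuous_on[OF pderiv_ser_holomorphic[OF t]] c sub])
  have nz: "\<forall>v\<in>?U. v $ 2 \<noteq> 0" "\<forall>v\<in>?U. (v $ 2)\<^sup>2 \<noteq> 0" by (auto simp: upper_half_disc_def)
  show ?thesis
    unfolding root_mat_def Let_def cplx_simps
    by (rule continuous_on_matrix2; intro continuous_intros c c1 c2 nz)
qed

lemma root_jac_measurable [measurable (raw)]:
  assumes [measurable]: "f \<in> measurable M (PiM UNIV (\<lambda>_. borel))" "g \<in> borel_measurable M"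
  shows "(\<lambda>x. root_jac (f x) (g x)) \<in> borel_measurable M"
  unfolding root_jac_def by measurable

lemma root_area_formula_set:
  assumes t: "t \<in> conv_seqs" and C: "C \<in> sets borel" "C \<subseteq> upper_half_disc"
  shows "(\<integral>\<^sup>+y. emeasure (count_space UNIV) {z\<in>C. coef0 t z = (y::real^2) $ 1 \<and> coef1 t z = y $ 2} \<partial>lborel) =
    (\<integral>\<^sup>+z. ennreal (root_jac t z) * indicator C z \<partial>lborel)"
proof -
  have oU: "open (cplx -` upper_half_disc)"
    by (rule open_vimage[OF open_upper_half_disc linear_continuous_on[OF bounded_linear_cplx]])
  have Cb: "cplx -` C \<in> sets borel" using measurable_sets[OF cplx_measurable C(1)] by simp
  have bij: "emeasure (count_space UNIV) {z\<in>C. coef0 t z = y $ 1 \<and> coef1 t z = y $ 2} =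
      emeasure (count_space UNIV) {v\<in>cplx -` C. root_map t v = y}" for y
  proof -
    have "{z\<in>C. coef0 t z = y $ 1 \<and> coef1 t z = y $ 2} = cplx ` {v\<in>cplx -` C. root_map t v = y}"
    proof -
      have "root_map t v = y \<longleftrightarrow> coef0 t (cplx v) = y $ 1 \<and> coef1 t (cplx v) = y $ 2" for v
        by (simp add: root_map_def vec_eq_iff forall_2 axis_def)
      moreover have "\<exists>v. cplx v = z" for z
        by (rule exI[of _ "vector [Re z, Im z]"]) (simp add: complex_eq_iff)
      ultimately show ?thesis by (auto simp: image_iff) (metis)
    qed
    moreover have "inj cplx" by (rule injI) (simp add: cplx_def vec_eq_iff forall_2)
    ultimately show ?thesis
      by (simp only: emeasure_count_space_image_inj)
  qed
  have "(\<integral>\<^sup>+y. emeasure (count_space UNIV) {z\<in>C. coef0 t z = (y::real^2) $ 1 \<and> coef1 t z = y $ 2} \<partial>lborel) =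
     (\<integral>\<^sup>+v. ennreal \<bar>det (root_mat t v)\<bar> * indicator (cplx -` C) v \<partial>lborel)"
    unfolding bij
    by (rule area_formula_matrix[OF oU root_map_has_derivative[OF t] continuous_on_root_mat[OF t] Cb]) (use C in auto)
  also have "\<dots> = (\<integral>\<^sup>+v. ennreal (root_jac t (cplx v)) * indicator C (cplx v) \<partial>lborel)"
  proof (rule nn_integral_cong)
    fix v
    show "ennreal \<bar>det (root_mat t v)\<bar> * indicator (cplx -` C) v = ennreal (root_jac t (cplx v)) * indicator C (cplx v)"
    proof (cases "cplx v \<in> C")
      case True
      then have "cplx v \<in> upper_half_disc" using C by auto
      then have "det (root_mat t v) = root_jac t (cplx v)" "root_jac t (cplx v) \<ge> 0"
        using det_root_mat[OF t] by (auto simp: root_jac_def upper_half_disc_def)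
      then show ?thesis by (simp add: indicator_def)
    qed (simp add: indicator_def)
  qed
  also have "\<dots> = (\<integral>\<^sup>+z. ennreal (root_jac t z) * indicator C z \<partial>lborel)"
    by (rule nn_integral_lborel_cplx[symmetric]) (use C in measurable)
  finally show ?thesis .
qed

text \<open>Both sides are integrals of \<open>K\<close> over the coefficient plane, one against
  zero counts and one against the image of the weighted area measure on \<open>B\<close>. The
  counting version for a set \<open>C\<close>, applied to the part of \<open>B\<close> mapped into
  \<open>E\<close>, shows that the two measures agree on every \<open>E\<close>.\<close>

lemma root_area_formula:
  fixes K :: "real \<times> real \<Rightarrow> ennreal"
  assumes t: "t \<in> conv_seqs" and B: "B \<in> sets borel" "B \<subseteq> upper_half_disc"
    and K [measurable]: "K \<in> borel_measurable (borel \<Otimes>\<^sub>M borel)"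
  shows "(\<integral>\<^sup>+x. \<integral>\<^sup>+y. K (x, y) * zcount (cons2 x y t) B \<partial>lborel \<partial>lborel) =
    (\<integral>\<^sup>+z. K (coef0 t z, coef1 t z) * ennreal (root_jac t z) * indicator B z \<partial>lborel)"
proof -
  have Bball: "B \<subseteq> ball 0 1" using B(2) by (auto simp: upper_half_disc_def)
  note [measurable] = B(1)
  have zc [measurable]: "(\<lambda>p. zcount (cons2 (fst p) (snd p) t) B) \<in> borel_measurable (borel \<Otimes>\<^sub>M borel)"
    by (rule measurable_compose[OF _ zcount_measurable[OF B(1) Bball]]) measurable
  define \<mu>1 where "\<mu>1 = density (lborel \<Otimes>\<^sub>M lborel) (\<lambda>p. zcount (cons2 (fst p) (snd p) t) B)"
  define \<mu>2 where "\<mu>2 = distr (density lborel (\<lambda>z. ennreal (root_jac t z) * indicator B z)) (borel \<Otimes>\<^sub>M borel) (\<lambda>z. (coef0 t z, coef1 t z))"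
  have "\<mu>1 = \<mu>2"
  proof (rule measure_eqI)
    show "sets \<mu>1 = sets \<mu>2" by (simp add: \<mu>1_def \<mu>2_def)
    fix E assume "E \<in> sets \<mu>1"
    then have E [measurable]: "E \<in> sets (borel \<Otimes>\<^sub>M borel)" by (simp add: \<mu>1_def)
    define C where "C = {z\<in>B. (coef0 t z, coef1 t z) \<in> E}"
    have C: "C \<in> sets borel" "C \<subseteq> upper_half_disc"
    proof -
      have "C = B \<inter> {z\<in>space borel. (coef0 t z, coef1 t z) \<in> E}" by (auto simp: C_def)
      also have "\<dots> \<in> sets borel" by measurable
      finally show "C \<in> sets borel" .
    qed (use B(2) in \<open>auto simp: C_def\<close>)
    have "emeasure \<mu>1 E = (\<integral>\<^sup>+p. zcount (cons2 (fst p) (snd p) t) B * indicator E p \<partial>(lborel \<Otimes>\<^sub>M lborel))"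
      unfolding \<mu>1_def by (subst emeasure_density) auto
    also have "\<dots> = (\<integral>\<^sup>+x. \<integral>\<^sup>+y. zcount (cons2 x y t) B * indicator E (x, y) \<partial>lborel \<partial>lborel)"
      by (subst lborel.nn_integral_fst[symmetric]) auto
    also have "\<dots> = (\<integral>\<^sup>+v. zcount (cons2 ((v::real^2) $ 1) (v $ 2) t) B * indicator E (v $ 1, v $ 2) \<partial>lborel)"
      by (rule nn_integral_lborel_vec2[where G="\<lambda>p. zcount (cons2 (fst p) (snd p) t) B * indicator E p", simplified, symmetric]) measurable
    also have "\<dots> = (\<integral>\<^sup>+y. emeasure (count_space UNIV) {z\<in>C. coef0 t z = (y::real^2) $ 1 \<and> coef1 t z = y $ 2} \<partial>lborel)"
    proof (rule nn_integral_cong_AE)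
      \<comment> \<open>A nonzero pair of leading coefficients already guarantees
        \<open>nondeg\<close>, so that \<open>zeros\<close> is the genuine zero set; the exceptional
        pair is a null set.\<close>
      have "AE v in lborel. (v::real^2) \<noteq> 0"
        by (rule AE_lborel_singleton)
      then show "AE v in lborel. zcount (cons2 ((v::real^2) $ 1) (v $ 2) t) B * indicator E (v $ 1, v $ 2) =
         emeasure (count_space UNIV) {z\<in>C. coef0 t z = v $ 1 \<and> coef1 t z = v $ 2}"
      proof eventually_elim
        case (elim v)
        have "\<exists>k. cons2 (v $ 1) (v $ 2) t k \<noteq> 0"
        proof (rule ccontr)
          assume "\<not> ?thesis"
          then have "cons2 (v $ 1) (v $ 2) t 0 = 0" "cons2 (v $ 1) (v $ 2) t 1 = 0" by blast+
          then have "v = 0" by (simp add: vec_eq_iff forall_2)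
          with elim show False by simp
        qed
        then have nd: "nondeg (cons2 (v $ 1) (v $ 2) t)" using t by (simp add: nondeg_def)
        have "zeros (cons2 (v $ 1) (v $ 2) t) \<inter> B = {z\<in>B. coef0 t z = v $ 1 \<and> coef1 t z = v $ 2}"
          using nd B(2) pser_cons2_eq_0_iff[OF t] by (auto simp: zeros_def upper_half_disc_def)
        moreover have "{z\<in>C. coef0 t z = v $ 1 \<and> coef1 t z = v $ 2} =
           (if (v $ 1, v $ 2) \<in> E then {z\<in>B. coef0 t z = v $ 1 \<and> coef1 t z = v $ 2} else {})"
          by (auto simp: C_def)
        ultimately show ?case unfolding zcount_def by (simp add: indicator_def)
      qed
    qed
    also have "\<dots> = (\<integral>\<^sup>+z. ennreal (root_jac t z) * indicator C z \<partial>lborel)"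
      by (rule root_area_formula_set[OF t C])
    also have "\<dots> = (\<integral>\<^sup>+z. ennreal (root_jac t z) * indicator B z * indicator ((\<lambda>z. (coef0 t z, coef1 t z)) -` E) z \<partial>lborel)"
      by (rule nn_integral_cong) (auto simp: C_def indicator_def)
    also have "\<dots> = emeasure \<mu>2 E"
    proof -
      have m: "(\<lambda>z. (coef0 t z, coef1 t z)) \<in> measurable (density lborel (\<lambda>z. ennreal (root_jac t z) * indicator B z)) (borel \<Otimes>\<^sub>M borel)"
        by measurable
      have "(\<lambda>z. (coef0 t z, coef1 t z)) -` E \<in> sets lborel"
        using measurable_sets[OF m E] by simp
      then show ?thesis unfolding \<mu>2_def
        by (subst emeasure_distr[OF m E], subst emeasure_density) auto
    qed
    finally show "emeasure \<mu>1 E = emeasure \<mu>2 E" .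
  qed
  then have "(\<integral>\<^sup>+p. K p \<partial>\<mu>1) = (\<integral>\<^sup>+p. K p \<partial>\<mu>2)" by simp
  also have "(\<integral>\<^sup>+p. K p \<partial>\<mu>2) = (\<integral>\<^sup>+z. K (coef0 t z, coef1 t z) * ennreal (root_jac t z) * indicator B z \<partial>lborel)"
  proof -
    have m: "(\<lambda>z. (coef0 t z, coef1 t z)) \<in> measurable (density lborel (\<lambda>z. ennreal (root_jac t z) * indicator B z)) (borel \<Otimes>\<^sub>M borel)"
      by measurable
    show ?thesis unfolding \<mu>2_def
      by (subst nn_integral_distr[OF m]) (auto simp: nn_integral_density ac_simps)
  qed
  also have "(\<integral>\<^sup>+p. K p \<partial>\<mu>1) = (\<integral>\<^sup>+x. \<integral>\<^sup>+y. K (x, y) * zcount (cons2 x y t) B \<partial>lborel \<partial>lborel)"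
    unfolding \<mu>1_def
    by (subst nn_integral_density, measurable) (subst lborel.nn_integral_fst[symmetric], auto simp: ac_simps)
  finally show ?thesis .
qed

section \<open>Lattice filters and Blaschke products\<close>

lemma nn_integral_gauss1:
  assumes [measurable]: "f \<in> borel_measurable borel"
  shows "(\<integral>\<^sup>+x. f x \<partial>gauss1) = (\<integral>\<^sup>+x. ennreal (std_normal_density x) * f x \<partial>lborel)"
  by (subst nn_integral_density) auto

lemma std_normal_density_rotate:
  assumes "c\<^sup>2 + s\<^sup>2 = 1"
  shows "std_normal_density (c * x + s * y) * std_normal_density (s * x - c * y) =
    std_normal_density x * std_normal_density y"
proof -
  have "(c * x + s * y)\<^sup>2 + (s * x - c * y)\<^sup>2 = (c\<^sup>2 + s\<^sup>2) * (x\<^sup>2 + y\<^sup>2)"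
    by (simp add: power2_eq_square algebra_simps)
  then have "(c * x + s * y)\<^sup>2 + (s * x - c * y)\<^sup>2 = x\<^sup>2 + y\<^sup>2" using assms by simp
  then show ?thesis
    unfolding std_normal_density_def by (simp add: exp_add[symmetric] field_simps)
qed

lemma nn_integral_lborel_linear2_aux:
  fixes H :: "real \<Rightarrow> real \<Rightarrow> ennreal"
  assumes H: "(\<lambda>p. H (fst p) (snd p)) \<in> borel_measurable (borel \<Otimes>\<^sub>M borel)" and det: "a * d - b * c \<noteq> 0" "b \<noteq> 0"
  shows "(\<integral>\<^sup>+x. \<integral>\<^sup>+y. H (a * x + b * y) (c * x + d * y) \<partial>lborel \<partial>lborel) =
    ennreal (1 / \<bar>a * d - b * c\<bar>) * (\<integral>\<^sup>+x. \<integral>\<^sup>+y. H x y \<partial>lborel \<partial>lborel)"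
proof -
  have Hm [measurable]: "case_prod H \<in> borel_measurable (borel \<Otimes>\<^sub>M borel)" using H by (simp add: case_prod_beta')
  \<comment> \<open>After substituting \<open>u = a * x + b * y\<close> for \<open>y\<close>, the
    second argument becomes \<open>d / b * u + e * x\<close>, so \<open>e\<close> is the scale of
    the remaining substitution in \<open>x\<close>.\<close>
  define e where "e = (b * c - a * d) / b"
  have e: "e \<noteq> 0" using det by (simp add: e_def)
  have "(\<integral>\<^sup>+x. \<integral>\<^sup>+y. H (a * x + b * y) (c * x + d * y) \<partial>lborel \<partial>lborel) =
     (\<integral>\<^sup>+x. \<integral>\<^sup>+u. ennreal \<bar>1/b\<bar> * H u (d / b * u + e * x) \<partial>lborel \<partial>lborel)"
  proof (rule nn_integral_cong)
    fix x
    have "(\<integral>\<^sup>+y. H (a * x + b * y) (c * x + d * y) \<partial>lborel) =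
      ennreal \<bar>1/b\<bar> * (\<integral>\<^sup>+u. H (a * x + b * (- a * x / b + 1/b * u)) (c * x + d * (- a * x / b + 1/b * u)) \<partial>lborel)"
      by (rule nn_integral_real_affine) (use det in auto)
    also have "\<dots> = ennreal \<bar>1/b\<bar> * (\<integral>\<^sup>+u. H u (d / b * u + e * x) \<partial>lborel)"
    proof (intro arg_cong2[where f="(*)"] refl nn_integral_cong arg_cong2[where f=H])
      fix u
      show "a * x + b * (- a * x / b + 1/b * u) = u" using det(2) by (simp add: field_simps)
      show "c * x + d * (- a * x / b + 1/b * u) = d / b * u + e * x"
        using det(2) by (simp add: e_def field_simps)
    qed
    also have "\<dots> = (\<integral>\<^sup>+u. ennreal \<bar>1/b\<bar> * H u (d / b * u + e * x) \<partial>lborel)"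
      by (rule nn_integral_cmult[symmetric]) measurable
    finally show "(\<integral>\<^sup>+y. H (a * x + b * y) (c * x + d * y) \<partial>lborel) = (\<integral>\<^sup>+u. ennreal \<bar>1/b\<bar> * H u (d / b * u + e * x) \<partial>lborel)" .
  qed
  also have "\<dots> = (\<integral>\<^sup>+u. \<integral>\<^sup>+x. ennreal \<bar>1/b\<bar> * H u (d / b * u + e * x) \<partial>lborel \<partial>lborel)"
    by (rule lborel_pair.Fubini') measurable
  also have "\<dots> = (\<integral>\<^sup>+u. ennreal (1 / \<bar>a * d - b * c\<bar>) * (\<integral>\<^sup>+v. H u v \<partial>lborel) \<partial>lborel)"
  proof (rule nn_integral_cong)
    fix u
    have "(\<integral>\<^sup>+v. H u v \<partial>lborel) = ennreal \<bar>e\<bar> * (\<integral>\<^sup>+x. H u (d / b * u + e * x) \<partial>lborel)"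
      by (rule nn_integral_real_affine) (use e in auto)
    then have "ennreal (1 / \<bar>a * d - b * c\<bar>) * (\<integral>\<^sup>+v. H u v \<partial>lborel) =
      ennreal (1 / \<bar>a * d - b * c\<bar> * \<bar>e\<bar>) * (\<integral>\<^sup>+x. H u (d / b * u + e * x) \<partial>lborel)"
    proof -
      have "ennreal (1 / \<bar>a * d - b * c\<bar> * \<bar>e\<bar>) = ennreal (1 / \<bar>a * d - b * c\<bar>) * ennreal \<bar>e\<bar>"
        by (rule ennreal_mult) auto
      then show ?thesis using \<open>(\<integral>\<^sup>+v. H u v \<partial>lborel) = _\<close> by (simp only: mult.assoc)
    qed
    also have "1 / \<bar>a * d - b * c\<bar> * \<bar>e\<bar> = \<bar>1 / b\<bar>"
      using det by (simp add: e_def abs_divide abs_minus_commute)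
    finally show "(\<integral>\<^sup>+x. ennreal \<bar>1/b\<bar> * H u (d / b * u + e * x) \<partial>lborel) = ennreal (1 / \<bar>a * d - b * c\<bar>) * (\<integral>\<^sup>+v. H u v \<partial>lborel)"
      by (subst nn_integral_cmult) auto
  qed
  also have "\<dots> = ennreal (1 / \<bar>a * d - b * c\<bar>) * (\<integral>\<^sup>+u. \<integral>\<^sup>+v. H u v \<partial>lborel \<partial>lborel)"
    by (rule nn_integral_cmult) measurable
  finally show ?thesis .
qed

lemma nn_integral_lborel_linear2:
  fixes H :: "real \<Rightarrow> real \<Rightarrow> ennreal"
  assumes H: "(\<lambda>p. H (fst p) (snd p)) \<in> borel_measurable (borel \<Otimes>\<^sub>M borel)" and det: "a * d - b * c \<noteq> 0"
  shows "(\<integral>\<^sup>+x. \<integral>\<^sup>+y. H (a * x + b * y) (c * x + d * y) \<partial>lborel \<partial>lborel) =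
    ennreal (1 / \<bar>a * d - b * c\<bar>) * (\<integral>\<^sup>+x. \<integral>\<^sup>+y. H x y \<partial>lborel \<partial>lborel)"
proof (cases "b = 0")
  case False
  then show ?thesis using nn_integral_lborel_linear2_aux[OF H det] by simp
next
  case True
  with det have d: "d \<noteq> 0" by auto
  have Hm [measurable]: "case_prod H \<in> borel_measurable (borel \<Otimes>\<^sub>M borel)" using H by (simp add: case_prod_beta')
  have H': "(\<lambda>p. H (snd p) (fst p)) \<in> borel_measurable (borel \<Otimes>\<^sub>M borel)" by measurable
  have "c * b - d * a \<noteq> 0" using det by (simp add: algebra_simps)
  from nn_integral_lborel_linear2_aux[where H="\<lambda>u v. H v u", OF H' this d]
  have "(\<integral>\<^sup>+x. \<integral>\<^sup>+y. H (a * x + b * y) (c * x + d * y) \<partial>lborel \<partial>lborel) =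
    ennreal (1 / \<bar>c * b - d * a\<bar>) * (\<integral>\<^sup>+x. \<integral>\<^sup>+y. H y x \<partial>lborel \<partial>lborel)" .
  also have "(\<integral>\<^sup>+x. \<integral>\<^sup>+y. H y x \<partial>lborel \<partial>lborel) = (\<integral>\<^sup>+x. \<integral>\<^sup>+y. H x y \<partial>lborel \<partial>lborel)"
    by (rule lborel_pair.Fubini') measurable
  also have "\<bar>c * b - d * a\<bar> = \<bar>a * d - b * c\<bar>" by (simp add: mult.commute abs_minus_commute)
  finally show ?thesis .
qed

lemma nn_integral_lborel_rotate:
  fixes H :: "real \<Rightarrow> real \<Rightarrow> ennreal"
  assumes H: "(\<lambda>p. H (fst p) (snd p)) \<in> borel_measurable (borel \<Otimes>\<^sub>M borel)" and cs: "c\<^sup>2 + s\<^sup>2 = 1"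
  shows "(\<integral>\<^sup>+x. \<integral>\<^sup>+y. H (c * x + s * y) (s * x - c * y) \<partial>lborel \<partial>lborel) = (\<integral>\<^sup>+x. \<integral>\<^sup>+y. H x y \<partial>lborel \<partial>lborel)"
proof -
  have d: "c * (- c) - s * s = - 1" using cs by (simp add: power2_eq_square)
  then have "c * (- c) - s * s \<noteq> 0" by simp
  from nn_integral_lborel_linear2[OF H this] show ?thesis unfolding d by simp
qed

lemma nn_integral_gauss1_gauss1:
  fixes F :: "real \<Rightarrow> real \<Rightarrow> ennreal"
  assumes F: "(\<lambda>p. F (fst p) (snd p)) \<in> borel_measurable (borel \<Otimes>\<^sub>M borel)"
  shows "(\<integral>\<^sup>+x. \<integral>\<^sup>+y. F x y \<partial>gauss1 \<partial>gauss1) =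
    (\<integral>\<^sup>+x. \<integral>\<^sup>+y. ennreal (std_normal_density x * std_normal_density y) * F x y \<partial>lborel \<partial>lborel)"
proof -
    have F1 [measurable]: "case_prod F \<in> borel_measurable (borel \<Otimes>\<^sub>M borel)" using F by (simp add: case_prod_beta')
    have F2 [measurable]: "(\<lambda>y. F x y) \<in> borel_measurable borel" for x
      by measurable
    have [measurable]: "(\<lambda>x. \<integral>\<^sup>+y. ennreal (std_normal_density y) * F x y \<partial>lborel) \<in> borel_measurable borel"
      by measurable
    have "(\<integral>\<^sup>+x. \<integral>\<^sup>+y. F x y \<partial>gauss1 \<partial>gauss1) = (\<integral>\<^sup>+x. \<integral>\<^sup>+y. ennreal (std_normal_density y) * F x y \<partial>lborel \<partial>gauss1)"
      by (simp add: nn_integral_gauss1)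
    also have "\<dots> = (\<integral>\<^sup>+x. ennreal (std_normal_density x) * (\<integral>\<^sup>+y. ennreal (std_normal_density y) * F x y \<partial>lborel) \<partial>lborel)"
      by (rule nn_integral_gauss1) measurable
    also have "\<dots> = (\<integral>\<^sup>+x. \<integral>\<^sup>+y. ennreal (std_normal_density x * std_normal_density y) * F x y \<partial>lborel \<partial>lborel)"
      by (simp add: nn_integral_cmult[symmetric] ennreal_mult' mult.assoc)
    finally show ?thesis .
qed

lemma nn_integral_gauss1_rotate:
  fixes H :: "real \<Rightarrow> real \<Rightarrow> ennreal"
  assumes H: "(\<lambda>p. H (fst p) (snd p)) \<in> borel_measurable (borel \<Otimes>\<^sub>M borel)" and cs: "c\<^sup>2 + s\<^sup>2 = 1"
  shows "(\<integral>\<^sup>+x. \<integral>\<^sup>+y. H (c * x + s * y) (s * x - c * y) \<partial>gauss1 \<partial>gauss1) = (\<integral>\<^sup>+x. \<integral>\<^sup>+y. H x y \<partial>gauss1 \<partial>gauss1)"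
proof -
  define G where "G x y = ennreal (std_normal_density x * std_normal_density y) * H x y" for x y
  have G: "(\<lambda>p. G (fst p) (snd p)) \<in> borel_measurable (borel \<Otimes>\<^sub>M borel)"
    unfolding G_def using H by measurable
  have H': "(\<lambda>p. H (c * fst p + s * snd p) (s * fst p - c * snd p)) \<in> borel_measurable (borel \<Otimes>\<^sub>M borel)"
    using measurable_compose[OF _ H, of "\<lambda>p. (c * fst p + s * snd p, s * fst p - c * snd p)" "borel \<Otimes>\<^sub>M borel"] by simp
  show ?thesis
    unfolding nn_integral_gauss1_gauss1[OF H] nn_integral_gauss1_gauss1[OF H']
    using nn_integral_lborel_rotate[OF G cs] unfolding G_def std_normal_density_rotate[OF cs] .
qed

text \<open>The normalised lattice realisation of a Blaschke product of degree two: state \<open>(p, q)\<close>,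
  input \<open>b\<close>; every step is a product of two planar reflections, which keeps Gaussian vectors Gaussian.\<close>

primrec lattice_state :: "real \<Rightarrow> real \<Rightarrow> real \<Rightarrow> real \<Rightarrow> real \<times> real \<Rightarrow> (nat \<Rightarrow> real) \<Rightarrow> nat \<Rightarrow> real \<times> real" where
  "lattice_state k1 s1 k2 s2 x b 0 = x"
| "lattice_state k1 s1 k2 s2 x b (Suc n) = (let (p, q) = lattice_state k1 s1 k2 s2 x b n; w = s2 * b n - k2 * p
     in (k1 * w + s1 * q, s1 * w - k1 * q))"

definition lattice_out :: "real \<Rightarrow> real \<Rightarrow> real \<Rightarrow> real \<Rightarrow> real \<Rightarrow> real \<Rightarrow> (nat \<Rightarrow> real) \<Rightarrow> nat \<Rightarrow> real" where
  "lattice_out k1 s1 k2 s2 p q b n = k2 * b n + s2 * fst (lattice_state k1 s1 k2 s2 (p, q) b n)"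

text \<open>The recursion consumes inputs at the end, whereas the induction over cylinder sets
  consumes them at the front: reading \<open>b0\<close> merely changes the initial state.\<close>

lemma lattice_state_Suc_shift:
  "lattice_state k1 s1 k2 s2 x (case_nat b0 b) (Suc n) =
   lattice_state k1 s1 k2 s2 (let w = s2 * b0 - k2 * fst x in (k1 * w + s1 * snd x, s1 * w - k1 * snd x)) b n"
proof (induction n)
  case 0
  show ?case by (simp add: Let_def case_prod_beta)
next
  case (Suc n)
  show ?case
    unfolding lattice_state.simps(2)[of k1 s1 k2 s2 x "case_nat b0 b" "Suc n"] Suc.IH by simp
qed

lemma lattice_out_0: "lattice_out k1 s1 k2 s2 p q b 0 = k2 * b 0 + s2 * p"
  by (simp add: lattice_out_def)

lemma lattice_out_Suc: "lattice_out k1 s1 k2 s2 p q (case_nat b0 b) (Suc n) =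
  lattice_out k1 s1 k2 s2 (k1 * (s2 * b0 - k2 * p) + s1 * q) (s1 * (s2 * b0 - k2 * p) - k1 * q) b n"
  unfolding lattice_out_def lattice_state_Suc_shift by (simp add: Let_def)

lemma measurable_lattice_state:
  assumes [measurable]: "f \<in> borel_measurable M" "g \<in> borel_measurable M" "h \<in> measurable M (PiM UNIV (\<lambda>_. borel))"
  shows "(\<lambda>x. lattice_state k1 s1 k2 s2 (f x, g x) (h x) n) \<in> measurable M (borel \<Otimes>\<^sub>M borel)"
proof (induction n)
  case (Suc n)
  note [measurable] = Suc.IH
  have [measurable]: "(\<lambda>x. h x n) \<in> borel_measurable M"
    by (rule measurable_compose[OF assms(3) measurable_component_singleton]) simp
  show ?case by (simp add: Let_def case_prod_beta)
qed simp

lemma measurable_lattice_out [measurable (raw)]: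
  assumes [measurable]: "f \<in> borel_measurable M" "g \<in> borel_measurable M" "h \<in> measurable M (PiM UNIV (\<lambda>_. borel))"
  shows "(\<lambda>x. lattice_out k1 s1 k2 s2 (f x) (g x) (h x)) \<in> measurable M (PiM UNIV (\<lambda>_. borel))"
proof (rule measurable_PiM_single')
  fix i :: nat
  note [measurable] = measurable_lattice_state[OF assms]
  have [measurable]: "(\<lambda>x. h x i) \<in> borel_measurable M"
    by (rule measurable_compose[OF assms(3) measurable_component_singleton]) simp
  show "(\<lambda>x. lattice_out k1 s1 k2 s2 (f x) (g x) (h x) i) \<in> borel_measurable M"
    unfolding lattice_out_def by measurable
qed (auto simp: space_PiM)

text \<open>One step reflects \<open>(b0, p)\<close> into the first output and an intermediate
  \<open>w\<close>, then reflects \<open>(w, q)\<close> into the new state. Hence the first output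
  is standard normal, independent of the new state and of the remaining inputs, and the new state is
  again a standard Gaussian pair. The induction hypothesis applies to the rest.\<close>

lemma lattice_out_cylinder:
  assumes ks: "k1\<^sup>2 + s1\<^sup>2 = 1" "k2\<^sup>2 + s2\<^sup>2 = 1"
    and F: "\<And>i. F i \<in> sets borel"
  shows "(\<integral>\<^sup>+p. \<integral>\<^sup>+q. \<integral>\<^sup>+b. (\<Prod>i<N. indicator (F i) (lattice_out k1 s1 k2 s2 p q b i)) \<partial>gauss \<partial>gauss1 \<partial>gauss1) =
    (\<Prod>i<N. emeasure gauss1 (F i))"
  using F
proof (induction N arbitrary: F)
  case 0
  interpret prob_space gauss by (rule prob_space_gauss)
  interpret g: prob_space gauss1 by (rule prob_space_gauss1)
  show ?case by (simp add: emeasure_space_1[simplified] g.emeasure_space_1[simplified])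
next
  case (Suc N)
  let ?out = "lattice_out k1 s1 k2 s2"
  interpret prob_space gauss by (rule prob_space_gauss)
  interpret g: prob_space gauss1 by (rule prob_space_gauss1)
  interpret gg: pair_sigma_finite gauss1 gauss1 ..
  have [measurable]: "F i \<in> sets borel" for i by (rule Suc.prems)
  define R where "R p q = (\<integral>\<^sup>+b. (\<Prod>i<N. indicator (F (Suc i)) (?out p q b i)) \<partial>gauss)" for p q
  have outm [measurable]: "(\<lambda>x. ?out (f x) (g x) (h x) i) \<in> borel_measurable M"
    if [measurable]: "f \<in> borel_measurable M" "g \<in> borel_measurable M" "h \<in> measurable M (PiM UNIV (\<lambda>_. borel))"
    for f g h i and M :: "'z measure"
    by (rule measurable_compose[OF measurable_lattice_out measurable_component_singleton]) auto
  have Rm: "(\<lambda>x. R (fst x) (snd x)) \<in> borel_measurable (borel \<Otimes>\<^sub>M borel)"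
    unfolding R_def
    by (rule borel_measurable_nn_integral) (auto intro!: borel_measurable_prod measurable_compose[OF measurable_compose[OF measurable_lattice_out measurable_component_singleton]] simp: case_prod_beta)
  have Rm' [measurable]: "(\<lambda>x. R (f x) (g x)) \<in> borel_measurable M"
    if [measurable]: "f \<in> borel_measurable M" "g \<in> borel_measurable M" for f g and M :: "(real \<times> real) measure"
    using measurable_compose[OF _ Rm, of "\<lambda>x. (f x, g x)" M] by simp
  have Rm'' [measurable]: "(\<lambda>x. R (f x) (g x)) \<in> borel_measurable M"
    if [measurable]: "f \<in> borel_measurable M" "g \<in> borel_measurable M" for f g and M :: "real measure"
    using measurable_compose[OF _ Rm, of "\<lambda>x. (f x, g x)" M] by simp
  have Rm3 [measurable]: "(\<lambda>x. R (f x) (g x)) \<in> borel_measurable M"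
    if [measurable]: "f \<in> borel_measurable M" "g \<in> borel_measurable M" for f g and M :: "((real \<times> real) \<times> real) measure"
    using measurable_compose[OF _ Rm, of "\<lambda>x. (f x, g x)" M] by simp
  have IH: "(\<integral>\<^sup>+p. \<integral>\<^sup>+q. R p q \<partial>gauss1 \<partial>gauss1) = (\<Prod>i<N. emeasure gauss1 (F (Suc i)))"
    unfolding R_def by (rule Suc.IH) measurable
  define S where "S p q b0 = indicator (F 0) (k2 * b0 + s2 * p) *
      R (k1 * (s2 * b0 - k2 * p) + s1 * q) (s1 * (s2 * b0 - k2 * p) - k1 * q)" for p q b0 :: real
  have step: "(\<integral>\<^sup>+b. (\<Prod>i<Suc N. indicator (F i) (?out p q b i)) \<partial>gauss) = (\<integral>\<^sup>+b0. S p q b0 \<partial>gauss1)" for p q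
  proof -
    have "(\<integral>\<^sup>+b. (\<Prod>i<Suc N. indicator (F i) (?out p q b i)) \<partial>gauss) =
       (\<integral>\<^sup>+b0. \<integral>\<^sup>+b. (\<Prod>i<Suc N. indicator (F i) (?out p q (case_nat b0 b) i)) \<partial>gauss \<partial>gauss1)"
      by (rule nn_integral_gauss_case_nat) (auto intro!: borel_measurable_prod measurable_compose[OF measurable_compose[OF measurable_lattice_out measurable_component_singleton]])
    also have "\<dots> = (\<integral>\<^sup>+b0. S p q b0 \<partial>gauss1)"
    proof (rule nn_integral_cong)
      fix b0
      have "(\<integral>\<^sup>+b. (\<Prod>i<Suc N. indicator (F i) (?out p q (case_nat b0 b) i)) \<partial>gauss) =
        (\<integral>\<^sup>+b. indicator (F 0) (k2 * b0 + s2 * p) *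
          (\<Prod>i<N. indicator (F (Suc i)) (?out (k1 * (s2 * b0 - k2 * p) + s1 * q) (s1 * (s2 * b0 - k2 * p) - k1 * q) b i)) \<partial>gauss)"
        by (simp only: prod.lessThan_Suc_shift lattice_out_0 lattice_out_Suc nat.case)
      also have "\<dots> = S p q b0"
        unfolding S_def R_def
        by (rule nn_integral_cmult) (auto intro!: borel_measurable_prod measurable_compose[OF measurable_compose[OF measurable_lattice_out measurable_component_singleton]])
      finally show "(\<integral>\<^sup>+b. (\<Prod>i<Suc N. indicator (F i) (?out p q (case_nat b0 b) i)) \<partial>gauss) = S p q b0" .
    qed
    finally show ?thesis .
  qed
  have "(\<integral>\<^sup>+p. \<integral>\<^sup>+q. \<integral>\<^sup>+b. (\<Prod>i<Suc N. indicator (F i) (?out p q b i)) \<partial>gauss \<partial>gauss1 \<partial>gauss1) =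
     (\<integral>\<^sup>+p. \<integral>\<^sup>+q. \<integral>\<^sup>+b0. S p q b0 \<partial>gauss1 \<partial>gauss1 \<partial>gauss1)"
    by (simp only: step)
  \<comment> \<open>The order of integration is rearranged so that \<open>b0\<close> and
    \<open>p\<close> become the two innermost variables, ready for the first reflection with
    \<open>q\<close> frozen.\<close>
  also have "\<dots> = (\<integral>\<^sup>+q. \<integral>\<^sup>+p. \<integral>\<^sup>+b0. S p q b0 \<partial>gauss1 \<partial>gauss1 \<partial>gauss1)"
    by (rule gg.Fubini'[symmetric]) (unfold S_def, measurable)
  also have "\<dots> = (\<integral>\<^sup>+q. \<integral>\<^sup>+b0. \<integral>\<^sup>+p. S p q b0 \<partial>gauss1 \<partial>gauss1 \<partial>gauss1)"
    by (intro nn_integral_cong gg.Fubini'[symmetric]) (unfold S_def, measurable)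
  also have "\<dots> = (\<integral>\<^sup>+q. \<integral>\<^sup>+y. \<integral>\<^sup>+w. indicator (F 0) y * R (k1 * w + s1 * q) (s1 * w - k1 * q) \<partial>gauss1 \<partial>gauss1 \<partial>gauss1)"
  proof (rule nn_integral_cong)
    fix q
    show "(\<integral>\<^sup>+b0. \<integral>\<^sup>+p. S p q b0 \<partial>gauss1 \<partial>gauss1) =
      (\<integral>\<^sup>+y. \<integral>\<^sup>+w. indicator (F 0) y * R (k1 * w + s1 * q) (s1 * w - k1 * q) \<partial>gauss1 \<partial>gauss1)"
      unfolding S_def
      by (rule nn_integral_gauss1_rotate[where H="\<lambda>y w. indicator (F 0) y * R (k1 * w + s1 * q) (s1 * w - k1 * q)"])
        (use ks in measurable)
  qed
  also have "\<dots> = (\<integral>\<^sup>+y. \<integral>\<^sup>+q. \<integral>\<^sup>+w. indicator (F 0) y * R (k1 * w + s1 * q) (s1 * w - k1 * q) \<partial>gauss1 \<partial>gauss1 \<partial>gauss1)"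
    by (rule gg.Fubini'[symmetric]) measurable
  also have "\<dots> = (\<integral>\<^sup>+y. indicator (F 0) y * (\<integral>\<^sup>+q. \<integral>\<^sup>+w. R (k1 * w + s1 * q) (s1 * w - k1 * q) \<partial>gauss1 \<partial>gauss1) \<partial>gauss1)"
    by (simp add: nn_integral_cmult)
  also have "(\<integral>\<^sup>+q. \<integral>\<^sup>+w. R (k1 * w + s1 * q) (s1 * w - k1 * q) \<partial>gauss1 \<partial>gauss1) =
     (\<integral>\<^sup>+w. \<integral>\<^sup>+q. R (k1 * w + s1 * q) (s1 * w - k1 * q) \<partial>gauss1 \<partial>gauss1)"
    by (rule gg.Fubini'[symmetric]) measurable
  also have "\<dots> = (\<integral>\<^sup>+w. \<integral>\<^sup>+q. R w q \<partial>gauss1 \<partial>gauss1)"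
    by (rule nn_integral_gauss1_rotate[where H=R]) (use ks Rm in auto)
  also have "\<dots> = (\<Prod>i<N. emeasure gauss1 (F (Suc i)))" by (rule IH)
  also have "(\<integral>\<^sup>+y. indicator (F 0) y * (\<Prod>i<N. emeasure gauss1 (F (Suc i))) \<partial>gauss1) = (\<Prod>i<Suc N. emeasure gauss1 (F i))"
    by (simp add: nn_integral_multc prod.lessThan_Suc_shift del: prod.lessThan_Suc)
  finally show ?case .
qed

text \<open>The initial state has to be random too: with a zero state the output is the Blaschke
  product times the input series, which is not a standard Gaussian sequence. Freezing the state at
  zero will correspond to conditioning on a zero at \<open>z\<close>.\<close>

lemma lattice_out_measure_preserving:
  assumes ks: "k1\<^sup>2 + s1\<^sup>2 = 1" "k2\<^sup>2 + s2\<^sup>2 = 1"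
    and \<Theta> [measurable]: "\<Theta> \<in> borel_measurable (PiM UNIV (\<lambda>_. borel))"
  shows "(\<integral>\<^sup>+p. \<integral>\<^sup>+q. \<integral>\<^sup>+b. \<Theta> (lattice_out k1 s1 k2 s2 p q b) \<partial>gauss \<partial>gauss1 \<partial>gauss1) = (\<integral>\<^sup>+a. \<Theta> a \<partial>gauss)"
proof -
  let ?out = "lattice_out k1 s1 k2 s2"
  interpret G: prob_space gauss by (rule prob_space_gauss)
  interpret g: prob_space gauss1 by (rule prob_space_gauss1)
  interpret S: sequence_space gauss1 by (rule gauss_seq)
  interpret g2: pair_prob_space gauss1 gauss ..
  interpret g3: pair_prob_space gauss1 "gauss1 \<Otimes>\<^sub>M gauss" ..
  define M3 where "M3 = gauss1 \<Otimes>\<^sub>M (gauss1 \<Otimes>\<^sub>M gauss)"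
  define Y where "Y = (\<lambda>x. ?out (fst x) (fst (snd x)) (snd (snd x)))"
  have Ym: "Y \<in> measurable M3 gauss"
    unfolding Y_def M3_def by measurable
  have int: "(\<integral>\<^sup>+x. H (Y x) \<partial>M3) = (\<integral>\<^sup>+p. \<integral>\<^sup>+q. \<integral>\<^sup>+b. H (?out p q b) \<partial>gauss \<partial>gauss1 \<partial>gauss1)"
    if [measurable]: "H \<in> borel_measurable (PiM UNIV (\<lambda>_. borel))" for H :: "_ \<Rightarrow> ennreal"
  proof -
    have "(\<lambda>x. H (Y x)) \<in> borel_measurable M3"
      by (rule measurable_compose[OF Ym]) measurable
    then have "(\<integral>\<^sup>+x. H (Y x) \<partial>M3) = (\<integral>\<^sup>+p. \<integral>\<^sup>+y. H (Y (p, y)) \<partial>(gauss1 \<Otimes>\<^sub>M gauss) \<partial>gauss1)"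
      unfolding M3_def
      by (rule g2.nn_integral_fst[symmetric])
    also have "\<dots> = (\<integral>\<^sup>+p. \<integral>\<^sup>+q. \<integral>\<^sup>+b. H (Y (p, (q, b))) \<partial>gauss \<partial>gauss1 \<partial>gauss1)"
      by (intro nn_integral_cong G.nn_integral_fst[symmetric]) (simp add: Y_def)
    finally show ?thesis by (simp add: Y_def)
  qed
  have eq: "distr M3 gauss Y = gauss"
    unfolding gauss_def
  proof (rule S.PiM_eq)
    show "sets (distr M3 (Pi\<^sub>M UNIV (\<lambda>_. gauss1)) Y) = sets (Pi\<^sub>M UNIV (\<lambda>_. gauss1))" by simp
  next
    fix J F assume J: "finite J" "J \<subseteq> (UNIV :: nat set)" "\<And>j. j \<in> J \<Longrightarrow> F j \<in> sets gauss1"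
    \<comment> \<open>Unconstrained coordinates get the whole line, which embeds the finite index
      set into an initial segment of the naturals.\<close>
    define F' where "F' i = (if i \<in> J then F i else UNIV)" for i
    have F': "F' i \<in> sets borel" for i using J(3)[of i] by (auto simp: F'_def)
    obtain N where N: "J \<subseteq> {..<N}" using finite_nat_iff_bounded J(1) by blast
    define X where "X = prod_emb UNIV (\<lambda>_. gauss1) J (Pi\<^sub>E J F)"
    have X: "X \<in> sets gauss" unfolding X_def gauss_def using J by (intro sets_PiM_I) auto
    have Xi: "indicator X a = (\<Prod>i<N. indicator (F' i) (a i) :: ennreal)" for a
    proof -
      have "a \<in> X \<longleftrightarrow> (\<forall>i<N. a i \<in> F' i)"
        using N by (auto simp: X_def prod_emb_def F'_def PiE_iff extensional_def split: if_splits)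
      then show ?thesis by (auto simp: indicator_def prod_zero_iff split: if_splits)
    qed
    have "emeasure (distr M3 gauss Y) X = (\<integral>\<^sup>+x. indicator X (Y x) \<partial>M3)"
      using X by (simp add: nn_integral_distr[OF Ym] flip: nn_integral_indicator)
    also have "\<dots> = (\<integral>\<^sup>+p. \<integral>\<^sup>+q. \<integral>\<^sup>+b. indicator X (?out p q b) \<partial>gauss \<partial>gauss1 \<partial>gauss1)"
      using X by (intro int) (simp add: sets_gauss)
    also have "\<dots> = (\<Prod>i<N. emeasure gauss1 (F' i))"
      unfolding Xi by (rule lattice_out_cylinder[OF ks F'])
    also have "\<dots> = (\<Prod>i\<in>J. emeasure gauss1 (F' i))"
      using N g.emeasure_space_1 by (intro prod.mono_neutral_right) (auto simp: F'_def)
    also have "\<dots> = (\<Prod>i\<in>J. emeasure gauss1 (F i))" by (intro prod.cong) (auto simp: F'_def)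
    finally show "emeasure (distr M3 (Pi\<^sub>M UNIV (\<lambda>_. gauss1)) Y) (prod_emb UNIV (\<lambda>_. gauss1) J (Pi\<^sub>E J F)) = (\<Prod>j\<in>J. emeasure gauss1 (F j))"
      by (simp add: X_def gauss_def)
  qed
  have "(\<integral>\<^sup>+a. \<Theta> a \<partial>gauss) = (\<integral>\<^sup>+a. \<Theta> a \<partial>distr M3 gauss Y)" by (simp add: eq)
  also have "\<dots> = (\<integral>\<^sup>+x. \<Theta> (Y x) \<partial>M3)"
    by (rule nn_integral_distr[OF Ym]) measurable
  also have "\<dots> = (\<integral>\<^sup>+p. \<integral>\<^sup>+q. \<integral>\<^sup>+b. \<Theta> (?out p q b) \<partial>gauss \<partial>gauss1 \<partial>gauss1)"
    by (rule int) measurable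
  finally show ?thesis ..
qed

section \<open>Generating function of the filter output\<close>

lemma pser_lincomb:
  assumes "a \<in> conv_seqs" "b \<in> conv_seqs"
  shows "(\<lambda>k. c * a k + d * b k) \<in> conv_seqs"
    and "cmod u < 1 \<Longrightarrow> pser (\<lambda>k. c * a k + d * b k) u = of_real c * pser a u + of_real d * pser b u"
proof -
  show "(\<lambda>k. c * a k + d * b k) \<in> conv_seqs"
    by (intro conv_seqs_add conv_seqs_cmult assms)
  show "pser (\<lambda>k. c * a k + d * b k) u = of_real c * pser a u + of_real d * pser b u" if "cmod u < 1"
    by (simp only: pser_add[OF conv_seqs_cmult[OF assms(1)] conv_seqs_cmult[OF assms(2)] that]
        pser_cmult[OF assms(1) that] pser_cmult[OF assms(2) that])
qed

text \<open>Weighted by \<open>r ^ k\<close>, partial sums form the Cauchy product with a geometric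
  series.\<close>

lemma conv_seqs_partial_sums:
  assumes "b \<in> conv_seqs" shows "(\<lambda>n. \<Sum>i\<le>n. \<bar>b i\<bar>) \<in> conv_seqs"
proof (rule conv_seqsI)
  fix r :: real assume r: "0 < r" "r < 1"
  have "summable (\<lambda>k. \<Sum>i\<le>k. (\<bar>b i\<bar> * r ^ i) * r ^ (k - i))"
    by (rule summable_Cauchy_product) (use r summable_conv_seqs[OF assms, of r] in \<open>auto simp: abs_mult intro: summable_geometric\<close>)
  moreover have "(\<Sum>i\<le>k. (\<bar>b i\<bar> * r ^ i) * r ^ (k - i)) = \<bar>\<Sum>i\<le>k. \<bar>b i\<bar>\<bar> * r ^ k" for k
  proof -
    have "(\<Sum>i\<le>k. (\<bar>b i\<bar> * r ^ i) * r ^ (k - i)) = (\<Sum>i\<le>k. \<bar>b i\<bar> * r ^ k)"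
      by (intro sum.cong refl) (simp add: mult.assoc power_add[symmetric])
    also have "\<dots> = \<bar>\<Sum>i\<le>k. \<bar>b i\<bar>\<bar> * r ^ k"
      by (simp add: sum_distrib_right abs_of_nonneg sum_nonneg)
    finally show ?thesis .
  qed
  ultimately show "summable (\<lambda>k. \<bar>\<Sum>i\<le>k. \<bar>b i\<bar>\<bar> * r ^ k)" by simp
qed

text \<open>Each step conserves energy: the squares of the output and of the new state add up to
  those of the input and of the old state. So the norm of the state grows by at most the modulus of
  the input.\<close>

lemma lattice_state_bound:
  assumes ks: "k1\<^sup>2 + s1\<^sup>2 = 1" "k2\<^sup>2 + s2\<^sup>2 = 1"
  shows "norm (lattice_state k1 s1 k2 s2 x b n) \<le> norm x + (\<Sum>i<n. \<bar>b i\<bar>)"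
proof (induction n)
  case (Suc n)
  obtain p q where pq: "lattice_state k1 s1 k2 s2 x b n = (p, q)" by (meson surj_pair)
  define w where "w = s2 * b n - k2 * p"
  define y where "y = k2 * b n + s2 * p"
  have k1: "s1 * s1 = 1 - k1 * k1" and k2: "s2 * s2 = 1 - k2 * k2" using ks by (simp_all add: power2_eq_square)
  have "(k1 * w + s1 * q)\<^sup>2 + (s1 * w - k1 * q)\<^sup>2 = (k1\<^sup>2 + s1\<^sup>2) * (w\<^sup>2 + q\<^sup>2)"
    by (simp add: power2_eq_square algebra_simps)
  also have "\<dots> = w\<^sup>2 + q\<^sup>2" using ks by simp
  also have "\<dots> \<le> w\<^sup>2 + y\<^sup>2 + q\<^sup>2" by simp
  also have "w\<^sup>2 + y\<^sup>2 = (k2\<^sup>2 + s2\<^sup>2) * ((b n)\<^sup>2 + p\<^sup>2)"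
    by (simp add: w_def y_def power2_eq_square algebra_simps)
  also have "\<dots> + q\<^sup>2 = (b n)\<^sup>2 + (p\<^sup>2 + q\<^sup>2)" using ks by simp
  also have "\<dots> \<le> (\<bar>b n\<bar> + sqrt (p\<^sup>2 + q\<^sup>2))\<^sup>2"
    by (simp add: power2_sum)
  finally have "sqrt ((k1 * w + s1 * q)\<^sup>2 + (s1 * w - k1 * q)\<^sup>2) \<le> \<bar>b n\<bar> + sqrt (p\<^sup>2 + q\<^sup>2)"
    by (intro real_le_lsqrt) auto
  moreover have "norm (p, q) \<le> norm x + (\<Sum>i<n. \<bar>b i\<bar>)" using Suc.IH pq by simp
  ultimately show ?case by (simp add: pq Let_def norm_Pair w_def)
qed simp

lemma lattice_state_conv:
  assumes ks: "k1\<^sup>2 + s1\<^sup>2 = 1" "k2\<^sup>2 + s2\<^sup>2 = 1" and b: "b \<in> conv_seqs"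
  shows "(\<lambda>n. fst (lattice_state k1 s1 k2 s2 x b n)) \<in> conv_seqs"
    "(\<lambda>n. snd (lattice_state k1 s1 k2 s2 x b n)) \<in> conv_seqs"
proof -
  define c where "c n = norm x * 1 + (\<Sum>i\<le>n. \<bar>b i\<bar>)" for n
  have one: "(\<lambda>_. 1) \<in> conv_seqs" by (rule conv_seqsI) (simp add: summable_geometric)
  have c: "c \<in> conv_seqs" unfolding c_def[abs_def]
    by (intro conv_seqs_add conv_seqs_cmult[OF one] conv_seqs_partial_sums b)
  have bd: "norm (lattice_state k1 s1 k2 s2 x b n) \<le> \<bar>c n\<bar>" for n
  proof -
    have "(\<Sum>i<n. \<bar>b i\<bar>) \<le> (\<Sum>i\<le>n. \<bar>b i\<bar>)" by (intro sum_mono2) auto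
    with lattice_state_bound[OF ks, of x b n] show ?thesis by (simp add: c_def)
  qed
  have fs: "\<bar>fst X\<bar> \<le> norm X" "\<bar>snd X\<bar> \<le> norm X" for X :: "real \<times> real"
    using norm_fst_le[of "fst X" "snd X"] norm_snd_le[of "snd X" "fst X"] by simp_all
  show "(\<lambda>n. fst (lattice_state k1 s1 k2 s2 x b n)) \<in> conv_seqs"
    by (rule conv_seqs_le[OF c]) (rule order_trans[OF fs(1) bd])
  show "(\<lambda>n. snd (lattice_state k1 s1 k2 s2 x b n)) \<in> conv_seqs"
    by (rule conv_seqs_le[OF c]) (rule order_trans[OF fs(2) bd])
qed

text \<open>The recursion becomes a linear system for the generating functions of the two state
  components, which is solved by elimination. The polynomial multiplying the input is the reversal
  of the one multiplying the output, as in a Blaschke product.\<close>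

lemma pser_lattice_out:
  assumes ks: "k1\<^sup>2 + s1\<^sup>2 = 1" "k2\<^sup>2 + s2\<^sup>2 = 1" and b: "b \<in> conv_seqs" and u: "cmod u < 1"
  shows "lattice_out k1 s1 k2 s2 p q b \<in> conv_seqs"
   and "(1 + of_real (k1 * (1 + k2)) * u + of_real k2 * u\<^sup>2) * pser (lattice_out k1 s1 k2 s2 p q b) u =
      (u\<^sup>2 + of_real (k1 * (1 + k2)) * u + of_real k2) * pser b u +
      of_real s2 * (of_real p * (1 + of_real k1 * u) + of_real (s1 * q) * u)"
proof -
  define P where "P n = fst (lattice_state k1 s1 k2 s2 (p, q) b n)" for n
  define Q where "Q n = snd (lattice_state k1 s1 k2 s2 (p, q) b n)" for n
  have Pc: "P \<in> conv_seqs" and Qc: "Q \<in> conv_seqs"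
    unfolding P_def[abs_def] Q_def[abs_def] by (rule lattice_state_conv[OF ks b])+
  have o: "lattice_out k1 s1 k2 s2 p q b = (\<lambda>n. k2 * b n + s2 * P n)"
    by (rule ext) (simp add: lattice_out_def P_def)
  show "lattice_out k1 s1 k2 s2 p q b \<in> conv_seqs"
    unfolding o by (intro conv_seqs_add conv_seqs_cmult b Pc)
  have oy: "pser (lattice_out k1 s1 k2 s2 p q b) u = of_real k2 * pser b u + of_real s2 * pser P u"
    unfolding o by (rule pser_lincomb(2)[OF b Pc u])
  define W where "W n = s2 * b n + (- k2) * P n" for n
  have Wc: "W \<in> conv_seqs" unfolding W_def[abs_def] by (intro conv_seqs_add conv_seqs_cmult b Pc)
  have W: "pser W u = of_real s2 * pser b u - of_real k2 * pser P u"
    unfolding W_def[abs_def] using pser_lincomb(2)[OF b Pc u, of s2 "- k2"] by simp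
  have PS: "(\<lambda>n. P (Suc n)) = (\<lambda>n. k1 * W n + s1 * Q n)"
    by (rule ext) (simp add: P_def Q_def W_def Let_def case_prod_beta)
  have QS: "(\<lambda>n. Q (Suc n)) = (\<lambda>n. s1 * W n + (- k1) * Q n)"
    by (rule ext) (simp add: P_def Q_def W_def Let_def case_prod_beta)
  have P1: "pser P u = of_real p + u * (of_real k1 * pser W u + of_real s1 * pser Q u)"
    using pser_split_head[OF Pc u, unfolded PS pser_lincomb(2)[OF Wc Qc u]] by (simp add: P_def)
  have Q1: "pser Q u = of_real q + u * (of_real s1 * pser W u - of_real k1 * pser Q u)"
    using pser_split_head[OF Qc u, unfolded QS pser_lincomb(2)[OF Wc Qc u]] by (simp add: Q_def)
  define B PP QQ WW where "B = pser b u" and "PP = pser P u" and "QQ = pser Q u" and "WW = pser W u"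
  define a1 a2 t1 t2 cp cq where "a1 = complex_of_real k1" and "a2 = complex_of_real k2"
    and "t1 = complex_of_real s1" and "t2 = complex_of_real s2" and "cp = complex_of_real p" and "cq = complex_of_real q"
  have c1: "t1 * t1 = 1 - a1 * a1" and c2: "t2 * t2 = 1 - a2 * a2"
  proof -
    have "s1 * s1 = 1 - k1 * k1" "s2 * s2 = 1 - k2 * k2" using ks by (simp_all add: power2_eq_square)
    then have "complex_of_real (s1 * s1) = of_real (1 - k1 * k1)" "complex_of_real (s2 * s2) = of_real (1 - k2 * k2)" by simp_all
    then show "t1 * t1 = 1 - a1 * a1" "t2 * t2 = 1 - a2 * a2"
      by (simp_all add: a1_def a2_def t1_def t2_def)
  qed
  have e1: "PP = cp + u * (a1 * WW + t1 * QQ)" and e2: "QQ = cq + u * (t1 * WW - a1 * QQ)" and e3: "WW = t2 * B - a2 * PP"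
    using P1 Q1 W by (simp_all add: PP_def QQ_def WW_def B_def cp_def cq_def a1_def a2_def t1_def t2_def)
  \<comment> \<open>The second component is eliminated after multiplication by
    \<open>1 + a1 * u\<close>, which avoids any division.\<close>
  have e4: "QQ * (1 + a1 * u) = cq + u * t1 * WW" using e2 by (simp add: algebra_simps)
  have "PP * (1 + a1 * u) = cp * (1 + a1 * u) + u * a1 * WW * (1 + a1 * u) + u * t1 * (QQ * (1 + a1 * u))"
    by (subst e1) (simp add: algebra_simps)
  also have "\<dots> = cp * (1 + a1 * u) + u * t1 * cq + u * WW * (a1 + u * (a1 * a1 + t1 * t1))"
    unfolding e4 by (simp add: algebra_simps)
  also have "\<dots> = cp * (1 + a1 * u) + u * t1 * cq + u * WW * (a1 + u)" unfolding c1 by simp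
  finally have "PP * (1 + a1 * u) = cp * (1 + a1 * u) + u * t1 * cq + u * (t2 * B - a2 * PP) * (a1 + u)" unfolding e3 .
  then have e5: "PP * (1 + a1 * (1 + a2) * u + a2 * u\<^sup>2) = cp * (1 + a1 * u) + u * t1 * cq + u * (a1 + u) * t2 * B"
    by (simp add: algebra_simps power2_eq_square)
  have "(1 + a1 * (1 + a2) * u + a2 * u\<^sup>2) * (a2 * B + t2 * PP) =
    (1 + a1 * (1 + a2) * u + a2 * u\<^sup>2) * a2 * B + t2 * (PP * (1 + a1 * (1 + a2) * u + a2 * u\<^sup>2))"
    by (simp add: algebra_simps)
  also have "\<dots> = (1 + a1 * (1 + a2) * u + a2 * u\<^sup>2) * a2 * B + u * (a1 + u) * (t2 * t2) * B + t2 * (cp * (1 + a1 * u) + t1 * cq * u)"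
    unfolding e5 by (simp add: algebra_simps)
  also have "\<dots> = (u\<^sup>2 + a1 * (1 + a2) * u + a2) * B + t2 * (cp * (1 + a1 * u) + t1 * cq * u)"
    unfolding c2 by (simp add: algebra_simps power2_eq_square)
  finally show "(1 + of_real (k1 * (1 + k2)) * u + of_real k2 * u\<^sup>2) * pser (lattice_out k1 s1 k2 s2 p q b) u =
      (u\<^sup>2 + of_real (k1 * (1 + k2)) * u + of_real k2) * pser b u +
      of_real s2 * (of_real p * (1 + of_real k1 * u) + of_real (s1 * q) * u)"
    unfolding oy by (simp add: a1_def a2_def t1_def t2_def B_def PP_def cp_def cq_def)
qed

text \<open>Reflection coefficients of the Blaschke product with zeros \<open>z\<close> and \<open>cnj z\<close>, and their complements.\<close>

definition kk2 :: "complex \<Rightarrow> real" where "kk2 z = (cmod z)\<^sup>2"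
definition kk1 :: "complex \<Rightarrow> real" where "kk1 z = - 2 * Re z / (1 + (cmod z)\<^sup>2)"
definition ss2 :: "complex \<Rightarrow> real" where "ss2 z = sqrt (1 - (kk2 z)\<^sup>2)"
definition ss1 :: "complex \<Rightarrow> real" where "ss1 z = sqrt (1 - (kk1 z)\<^sup>2)"

definition blaschke_lift :: "complex \<Rightarrow> real \<Rightarrow> real \<Rightarrow> (nat \<Rightarrow> real) \<Rightarrow> nat \<Rightarrow> real" where
  "blaschke_lift z = lattice_out (kk1 z) (ss1 z) (kk2 z) (ss2 z)"

definition blaschke2 :: "complex \<Rightarrow> complex \<Rightarrow> complex" where
  "blaschke2 z u = (u - z) * (u - cnj z) / ((1 - u * cnj z) * (1 - u * z))"

lemma upper_half_discD: "z \<in> upper_half_disc \<Longrightarrow> cmod z < 1" "z \<in> upper_half_disc \<Longrightarrow> Im z > 0"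
  by (auto simp: upper_half_disc_def)

lemma one_minus_mult_neq_0: "cmod u < 1 \<Longrightarrow> cmod z < 1 \<Longrightarrow> 1 - u * z \<noteq> 0"
proof
  assume "cmod u < 1" "cmod z < 1" "1 - u * z = 0"
  then have "cmod (u * z) = 1" by (metis eq_iff_diff_eq_0 norm_one)
  moreover have "cmod (u * z) < 1 * 1" unfolding norm_mult
    by (rule mult_strict_mono') (use \<open>cmod u < 1\<close> \<open>cmod z < 1\<close> in auto)
  ultimately show False by simp
qed

lemma lattice_params:
  assumes "z \<in> upper_half_disc"
  shows "(kk1 z)\<^sup>2 + (ss1 z)\<^sup>2 = 1" "(kk2 z)\<^sup>2 + (ss2 z)\<^sup>2 = 1" "ss1 z > 0" "ss2 z > 0"
proof -
  note z = upper_half_discD[OF assms]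
  have r: "(cmod z)\<^sup>2 < 1" using z by (simp add: power_less_one_iff abs_square_less_1)
  then have k2: "(kk2 z)\<^sup>2 < 1" unfolding kk2_def
    using abs_square_less_1[of "(cmod z)\<^sup>2"] by (simp only: abs_of_nonneg zero_le_power2)
  have "(2 * Re z)\<^sup>2 < (1 + (cmod z)\<^sup>2)\<^sup>2"
  proof -
    have "\<bar>2 * Re z\<bar> < 1 + (cmod z)\<^sup>2"
    proof -
      \<comment> \<open>Strict positivity comes from \<open>Im z \<noteq> 0\<close> and keeps the
        first reflection coefficient strictly inside the unit interval.\<close>
      have "0 < (1 - \<bar>Re z\<bar>)\<^sup>2 + (Im z)\<^sup>2" using z by (intro add_nonneg_pos) auto
      also have "\<dots> = 1 + (cmod z)\<^sup>2 - 2 * \<bar>Re z\<bar>" by (simp add: cmod_power2 power2_diff)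
      finally show ?thesis by (simp add: abs_mult)
    qed
    then show ?thesis by (metis abs_le_square_iff abs_of_nonneg linorder_not_less norm_ge_zero real_norm_def abs_ge_zero add_nonneg_nonneg zero_le_one zero_le_power2)
  qed
  then have k1: "(kk1 z)\<^sup>2 < 1" unfolding kk1_def power_divide
    by (simp add: divide_less_eq power2_eq_square add_pos_nonneg)
  show "ss1 z > 0" "ss2 z > 0" using k1 k2 by (simp_all add: ss1_def ss2_def)
  show "(kk1 z)\<^sup>2 + (ss1 z)\<^sup>2 = 1" "(kk2 z)\<^sup>2 + (ss2 z)\<^sup>2 = 1"
    using k1 k2 by (simp_all add: ss1_def ss2_def)
qed

text \<open>Comparison of coefficients: \<open>kk2 z\<close> must be the product of \<open>z\<close>
  and \<open>cnj z\<close>, and \<open>kk1 z * (1 + kk2 z)\<close> minus their sum. This is where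
  the formula for \<open>kk1\<close> comes from.\<close>

lemma kk_blaschke:
  shows "1 + of_real (kk1 z * (1 + kk2 z)) * u + of_real (kk2 z) * u\<^sup>2 = (1 - u * cnj z) * (1 - u * z)"
   and "u\<^sup>2 + of_real (kk1 z * (1 + kk2 z)) * u + of_real (kk2 z) = (u - z) * (u - cnj z)"
proof -
  have "1 + (cmod z)\<^sup>2 \<noteq> 0" by (metis add_pos_nonneg less_irrefl zero_le_power2 zero_less_one)
  then have a: "kk1 z * (1 + kk2 z) = - 2 * Re z" by (simp add: kk1_def kk2_def)
  have b: "complex_of_real (- 2 * Re z) = - (z + cnj z)" by (simp add: complex_eq_iff)
  have c: "complex_of_real (kk2 z) = z * cnj z" unfolding kk2_def by (rule complex_norm_square)
  show "1 + of_real (kk1 z * (1 + kk2 z)) * u + of_real (kk2 z) * u\<^sup>2 = (1 - u * cnj z) * (1 - u * z)"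
    "u\<^sup>2 + of_real (kk1 z * (1 + kk2 z)) * u + of_real (kk2 z) = (u - z) * (u - cnj z)"
    unfolding a b c by (simp_all add: algebra_simps power2_eq_square)
qed

lemma pser_blaschke_lift:
  assumes z: "z \<in> upper_half_disc" and b: "b \<in> conv_seqs" and u: "cmod u < 1"
  shows "blaschke_lift z p q b \<in> conv_seqs"
   and "pser (blaschke_lift z p q b) u = blaschke2 z u * pser b u +
      of_real (ss2 z) * (of_real p * (1 + of_real (kk1 z) * u) + of_real (ss1 z * q) * u) / ((1 - u * cnj z) * (1 - u * z))"
proof -
  note pp = pser_lattice_out[OF lattice_params(1,2)[OF z] b u, of p q, folded blaschke_lift_def]
  show "blaschke_lift z p q b \<in> conv_seqs" by (rule pp(1))
  have nz: "(1 - u * cnj z) * (1 - u * z) \<noteq> 0"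
    using one_minus_mult_neq_0[OF u, of z] one_minus_mult_neq_0[OF u, of "cnj z"] upper_half_discD[OF z] by simp
  show "pser (blaschke_lift z p q b) u = blaschke2 z u * pser b u +
      of_real (ss2 z) * (of_real p * (1 + of_real (kk1 z) * u) + of_real (ss1 z * q) * u) / ((1 - u * cnj z) * (1 - u * z))"
  proof -
    have "Y = N / D * B + E / D" if "D * Y = N * B + E" "D \<noteq> 0" for D Y N B E :: complex
      using that by (simp add: field_simps)
    from this[OF pp(2)[unfolded kk_blaschke] nz] show ?thesis unfolding blaschke2_def .
  qed
qed

section \<open>The law of the series conditioned on a zero\<close>

text \<open>The tail is integrated outermost because the area formula is applied for a fixed tail,
  with the two leading coefficients as Lebesgue variables.\<close>

lemma nn_integral_gauss_cons2:
  assumes [measurable]: "F \<in> borel_measurable (PiM UNIV (\<lambda>_. borel))"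
  shows "(\<integral>\<^sup>+a. F a \<partial>gauss) =
    (\<integral>\<^sup>+t. \<integral>\<^sup>+x. \<integral>\<^sup>+y. ennreal (std_normal_density x * std_normal_density y) * F (cons2 x y t) \<partial>lborel \<partial>lborel \<partial>gauss)"
proof -
  interpret G: prob_space gauss by (rule prob_space_gauss)
  interpret g: prob_space gauss1 by (rule prob_space_gauss1)
  interpret gG: pair_sigma_finite gauss1 gauss ..
  have "(\<integral>\<^sup>+a. F a \<partial>gauss) = (\<integral>\<^sup>+x. \<integral>\<^sup>+y. \<integral>\<^sup>+t. F (cons2 x y t) \<partial>gauss \<partial>gauss1 \<partial>gauss1)"
    by (subst nn_integral_gauss_case_nat, measurable)
       (intro nn_integral_cong nn_integral_gauss_case_nat, measurable)
  also have "\<dots> = (\<integral>\<^sup>+x. \<integral>\<^sup>+t. \<integral>\<^sup>+y. F (cons2 x y t) \<partial>gauss1 \<partial>gauss \<partial>gauss1)"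
    by (intro nn_integral_cong gG.Fubini'[symmetric]) measurable
  also have "\<dots> = (\<integral>\<^sup>+t. \<integral>\<^sup>+x. \<integral>\<^sup>+y. F (cons2 x y t) \<partial>gauss1 \<partial>gauss1 \<partial>gauss)"
    by (rule gG.Fubini'[symmetric]) measurable
  also have "\<dots> = (\<integral>\<^sup>+t. \<integral>\<^sup>+x. \<integral>\<^sup>+y. ennreal (std_normal_density x * std_normal_density y) * F (cons2 x y t) \<partial>lborel \<partial>lborel \<partial>gauss)"
    by (intro nn_integral_cong nn_integral_gauss1_gauss1) measurable
  finally show ?thesis .
qed

lemma std_normal_density_le_1: "std_normal_density x \<le> 1"
proof -
  have "1 / sqrt (2 * pi) \<le> 1" using pi_gt3 by (simp add: real_le_rsqrt)
  then show ?thesis unfolding std_normal_density_def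
    by (intro mult_le_one) auto
qed

lemma nn_integral_affine2:
  fixes F :: "real \<Rightarrow> real \<Rightarrow> ennreal"
  assumes F: "(\<lambda>p. F (fst p) (snd p)) \<in> borel_measurable (borel \<Otimes>\<^sub>M borel)" and e: "e > 0"
  shows "(\<integral>\<^sup>+x. \<integral>\<^sup>+y. F x y \<partial>lborel \<partial>lborel) =
    ennreal (e\<^sup>2) * (\<integral>\<^sup>+x. \<integral>\<^sup>+y. F (c + e * x) (d + e * y) \<partial>lborel \<partial>lborel)"
proof -
  have [measurable]: "case_prod F \<in> borel_measurable (borel \<Otimes>\<^sub>M borel)" using F by (simp add: case_prod_beta')
  have "(\<integral>\<^sup>+x. \<integral>\<^sup>+y. F x y \<partial>lborel \<partial>lborel) = (\<integral>\<^sup>+x. ennreal e * (\<integral>\<^sup>+y. F x (d + e * y) \<partial>lborel) \<partial>lborel)"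
  proof (rule nn_integral_cong)
    fix x
    have "(\<integral>\<^sup>+y. F x y \<partial>lborel) = ennreal \<bar>e\<bar> * (\<integral>\<^sup>+y. F x (d + e * y) \<partial>lborel)"
      by (rule nn_integral_real_affine) (use e in auto)
    then show "(\<integral>\<^sup>+y. F x y \<partial>lborel) = ennreal e * (\<integral>\<^sup>+y. F x (d + e * y) \<partial>lborel)" using e by simp
  qed
  also have "\<dots> = ennreal \<bar>e\<bar> * (\<integral>\<^sup>+x. ennreal e * (\<integral>\<^sup>+y. F (c + e * x) (d + e * y) \<partial>lborel) \<partial>lborel)"
    by (rule nn_integral_real_affine) (use e in auto)
  also have "\<dots> = ennreal \<bar>e\<bar> * (ennreal e * (\<integral>\<^sup>+x. \<integral>\<^sup>+y. F (c + e * x) (d + e * y) \<partial>lborel \<partial>lborel))"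
    by (subst nn_integral_cmult) auto
  also have "\<dots> = ennreal (e\<^sup>2) * (\<integral>\<^sup>+x. \<integral>\<^sup>+y. F (c + e * x) (d + e * y) \<partial>lborel \<partial>lborel)"
    using e by (simp add: power2_eq_square ennreal_mult mult.assoc)
  finally show ?thesis .
qed

text \<open>Since the Blaschke product vanishes at \<open>z\<close>, the lifted series takes the
  value \<open>p * dir_p z + q * dir_q z\<close> there: these are the two initial-state terms of the
  output evaluated at \<open>z\<close>.\<close>

definition dir_p :: "complex \<Rightarrow> complex" where "dir_p z = of_real (ss2 z) * (1 + of_real (kk1 z) * z) / ((1 - z * cnj z) * (1 - z * z))"
definition dir_q :: "complex \<Rightarrow> complex" where "dir_q z = of_real (ss2 z) * (of_real (ss1 z) * z) / ((1 - z * cnj z) * (1 - z * z))"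

text \<open>A square window of area 4 around 0; dilated by a small factor it localises the series
  near a zero at \<open>z\<close>.\<close>

definition win :: "complex \<Rightarrow> ennreal" where
  "win w = indicator {-1<..<1} (Re w) * indicator {-1<..<1} (Im w)"

lemma win_measurable [measurable]: "win \<in> borel_measurable borel"
  unfolding win_def by measurable

lemma win_linear:
  assumes "Re \<alpha> * Im \<beta> - Re \<beta> * Im \<alpha> \<noteq> 0"
  shows "(\<integral>\<^sup>+x. \<integral>\<^sup>+y. win (of_real x * \<alpha> + of_real y * \<beta>) \<partial>lborel \<partial>lborel) = ennreal (4 / \<bar>Re \<alpha> * Im \<beta> - Re \<beta> * Im \<alpha>\<bar>)"
proof -
  have "(\<integral>\<^sup>+x. \<integral>\<^sup>+y. win (of_real x * \<alpha> + of_real y * \<beta>) \<partial>lborel \<partial>lborel) =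
     (\<integral>\<^sup>+x. \<integral>\<^sup>+y. indicator {-1<..<1} (Re \<alpha> * x + Re \<beta> * y) * indicator {-1<..<1} (Im \<alpha> * x + Im \<beta> * y) \<partial>lborel \<partial>lborel)"
    by (simp add: win_def mult.commute)
  also have "\<dots> = ennreal (1 / \<bar>Re \<alpha> * Im \<beta> - Re \<beta> * Im \<alpha>\<bar>) * (\<integral>\<^sup>+x. \<integral>\<^sup>+y. indicator {-1<..<1::real} x * indicator {-1<..<1::real} y \<partial>lborel \<partial>lborel)"
    by (rule nn_integral_lborel_linear2[where H="\<lambda>x y. indicator {-1<..<1} x * indicator {-1<..<1} y"]) (use assms in measurable)
  also have "(\<integral>\<^sup>+x. \<integral>\<^sup>+y. indicator {-1<..<1::real} x * indicator {-1<..<1::real} y \<partial>lborel \<partial>lborel) = 2 * 2"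
    by (simp add: nn_integral_cmult nn_integral_multc)
  also have "ennreal (1 / \<bar>Re \<alpha> * Im \<beta> - Re \<beta> * Im \<alpha>\<bar>) * (2 * 2) = ennreal (1 / \<bar>Re \<alpha> * Im \<beta> - Re \<beta> * Im \<alpha>\<bar>) * ennreal 4"
    by simp
  also have "\<dots> = ennreal (4 / \<bar>Re \<alpha> * Im \<beta> - Re \<beta> * Im \<alpha>\<bar>)"
    by (subst ennreal_mult[symmetric]) auto
  finally show ?thesis .
qed

context
  fixes z :: complex
  assumes z: "z \<in> upper_half_disc"
begin

lemma z_facts: "cmod z < 1" "Im z > 0"
  using z by (auto simp: upper_half_disc_def)

lemma pser_lift_at: "b \<in> conv_seqs \<Longrightarrow> pser (blaschke_lift z p q b) z = of_real p * dir_p z + of_real q * dir_q z"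
  using pser_blaschke_lift(2)[OF z _ z_facts(1), of b p q]
  by (simp add: blaschke2_def dir_p_def dir_q_def add_divide_distrib algebra_simps)

lemma pser_cons2_shift:
  assumes "t \<in> conv_seqs"
  shows "pser (cons2 (coef0 t z + x) (coef1 t z + y) t) z = of_real x + of_real y * z"
proof -
  have "pser (cons2 (coef0 t z) (coef1 t z) t) z = 0"
    using pser_cons2_eq_0_iff[OF assms z] by blast
  then show ?thesis unfolding pser_cons2[OF assms z_facts(1)] by (simp add: algebra_simps)
qed

text \<open>Both sides, multiplied by \<open>e\<close> squared, are the expectation of
  \<open>\<Psi>\<close> over the event that \<open>f z / e\<close> lies in the window. On the left
  the leading coefficients are centred at the pair that makes \<open>f z\<close> vanish and rescaled
  by \<open>e\<close>; on the right the initial state of the filter is rescaled.\<close>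

lemma window_identity:
  assumes \<Psi> [measurable]: "\<Psi> \<in> borel_measurable (PiM UNIV (\<lambda>_. borel))" and e: "e > 0"
  shows "(\<integral>\<^sup>+t. \<integral>\<^sup>+x. \<integral>\<^sup>+y. ennreal (std_normal_density (coef0 t z + e * x) * std_normal_density (coef1 t z + e * y)) *
       (win (of_real x + of_real y * z) * \<Psi> (cons2 (coef0 t z + e * x) (coef1 t z + e * y) t)) \<partial>lborel \<partial>lborel \<partial>gauss) =
    (\<integral>\<^sup>+p. \<integral>\<^sup>+q. ennreal (std_normal_density (e * p) * std_normal_density (e * q)) *
      (win (of_real p * dir_p z + of_real q * dir_q z) * (\<integral>\<^sup>+b. \<Psi> (blaschke_lift z (e * p) (e * q) b) \<partial>gauss)) \<partial>lborel \<partial>lborel)"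
    (is "?L = ?R")
proof -
  interpret G: prob_space gauss by (rule prob_space_gauss)
  define \<Theta> where "\<Theta> a = win (pser a z / of_real e) * \<Psi> a" for a
  have [measurable]: "\<Theta> \<in> borel_measurable (PiM UNIV (\<lambda>_. borel))"
    unfolding \<Theta>_def by measurable
  have "(\<integral>\<^sup>+a. \<Theta> a \<partial>gauss) =
     (\<integral>\<^sup>+t. \<integral>\<^sup>+x. \<integral>\<^sup>+y. ennreal (std_normal_density x * std_normal_density y) * \<Theta> (cons2 x y t) \<partial>lborel \<partial>lborel \<partial>gauss)"
    by (rule nn_integral_gauss_cons2) measurable
  also have "\<dots> = (\<integral>\<^sup>+t. ennreal (e\<^sup>2) * (\<integral>\<^sup>+x. \<integral>\<^sup>+y. ennreal (std_normal_density (coef0 t z + e * x) * std_normal_density (coef1 t z + e * y)) *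
       \<Theta> (cons2 (coef0 t z + e * x) (coef1 t z + e * y) t) \<partial>lborel \<partial>lborel) \<partial>gauss)"
    by (intro nn_integral_cong nn_integral_affine2) (use e in measurable)
  also have "\<dots> = (\<integral>\<^sup>+t. ennreal (e\<^sup>2) * (\<integral>\<^sup>+x. \<integral>\<^sup>+y. ennreal (std_normal_density (coef0 t z + e * x) * std_normal_density (coef1 t z + e * y)) *
       (win (of_real x + of_real y * z) * \<Psi> (cons2 (coef0 t z + e * x) (coef1 t z + e * y) t)) \<partial>lborel \<partial>lborel) \<partial>gauss)"
  proof (rule nn_integral_cong_AE)
    show "AE t in gauss. ennreal (e\<^sup>2) * (\<integral>\<^sup>+x. \<integral>\<^sup>+y. ennreal (std_normal_density (coef0 t z + e * x) * std_normal_density (coef1 t z + e * y)) *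
       \<Theta> (cons2 (coef0 t z + e * x) (coef1 t z + e * y) t) \<partial>lborel \<partial>lborel) =
       ennreal (e\<^sup>2) * (\<integral>\<^sup>+x. \<integral>\<^sup>+y. ennreal (std_normal_density (coef0 t z + e * x) * std_normal_density (coef1 t z + e * y)) *
       (win (of_real x + of_real y * z) * \<Psi> (cons2 (coef0 t z + e * x) (coef1 t z + e * y) t)) \<partial>lborel \<partial>lborel)"
      using AE_gauss_conv
    proof eventually_elim
      case (elim t)
      have "pser (cons2 (coef0 t z + e * x) (coef1 t z + e * y) t) z / of_real e = of_real x + of_real y * z" for x y
        unfolding pser_cons2_shift[OF elim] using e by (simp add: field_simps)
      then show ?case by (simp add: \<Theta>_def)
    qed
  qed
  also have "\<dots> = ennreal (e\<^sup>2) * ?L"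
    by (rule nn_integral_cmult) measurable
  finally have 1: "(\<integral>\<^sup>+a. \<Theta> a \<partial>gauss) = ennreal (e\<^sup>2) * ?L" .
  have lm [measurable]: "(\<lambda>x. blaschke_lift z (f x) (g x) (h x)) \<in> measurable M (PiM UNIV (\<lambda>_. borel))"
    if [measurable]: "f \<in> borel_measurable M" "g \<in> borel_measurable M" "h \<in> measurable M (PiM UNIV (\<lambda>_. borel))" for f g h and M :: "'z measure"
    unfolding blaschke_lift_def by measurable
  have lm1 [measurable]: "(\<lambda>x. blaschke_lift z (f x) (g x) (h x)) \<in> measurable M (PiM UNIV (\<lambda>_. borel))"
    if [measurable]: "f \<in> borel_measurable M" "g \<in> borel_measurable M" "h \<in> measurable M (PiM UNIV (\<lambda>_. borel))" for f g h and M :: "((real \<times> real) \<times> (nat \<Rightarrow> real)) measure"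
    unfolding blaschke_lift_def by measurable
  define R where "R p q = (\<integral>\<^sup>+b. \<Theta> (blaschke_lift z p q b) \<partial>gauss)" for p q
  have Rm: "(\<lambda>p. R (fst p) (snd p)) \<in> borel_measurable (borel \<Otimes>\<^sub>M borel)"
    unfolding R_def by (rule G.borel_measurable_nn_integral) (unfold case_prod_beta, measurable)
  have Rm' [measurable]: "(\<lambda>x. R (f x) (g x)) \<in> borel_measurable M" if [measurable]: "f \<in> borel_measurable M" "g \<in> borel_measurable M" for f g and M :: "(real \<times> real) measure"
    using measurable_compose[OF _ Rm, of "\<lambda>x. (f x, g x)" M] by simp
  have "(\<integral>\<^sup>+a. \<Theta> a \<partial>gauss) = (\<integral>\<^sup>+p. \<integral>\<^sup>+q. R p q \<partial>gauss1 \<partial>gauss1)"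
    unfolding R_def blaschke_lift_def
    by (rule lattice_out_measure_preserving[symmetric, OF lattice_params(1,2)[OF z]]) measurable
  also have "\<dots> = (\<integral>\<^sup>+p. \<integral>\<^sup>+q. ennreal (std_normal_density p * std_normal_density q) * R p q \<partial>lborel \<partial>lborel)"
    by (rule nn_integral_gauss1_gauss1[OF Rm])
  also have "\<dots> = ennreal (e\<^sup>2) * (\<integral>\<^sup>+p. \<integral>\<^sup>+q. ennreal (std_normal_density (0 + e * p) * std_normal_density (0 + e * q)) * R (0 + e * p) (0 + e * q) \<partial>lborel \<partial>lborel)"
    by (rule nn_integral_affine2) (use e in measurable)
  also have "(\<integral>\<^sup>+p. \<integral>\<^sup>+q. ennreal (std_normal_density (0 + e * p) * std_normal_density (0 + e * q)) * R (0 + e * p) (0 + e * q) \<partial>lborel \<partial>lborel) = ?R"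
  proof -
    have "R (e * p) (e * q) = win (of_real p * dir_p z + of_real q * dir_q z) * (\<integral>\<^sup>+b. \<Psi> (blaschke_lift z (e * p) (e * q) b) \<partial>gauss)" for p q
    proof -
      have "R (e * p) (e * q) = (\<integral>\<^sup>+b. win (of_real p * dir_p z + of_real q * dir_q z) * \<Psi> (blaschke_lift z (e * p) (e * q) b) \<partial>gauss)"
        unfolding R_def
      proof (rule nn_integral_cong_AE)
        show "AE b in gauss. \<Theta> (blaschke_lift z (e * p) (e * q) b) = win (of_real p * dir_p z + of_real q * dir_q z) * \<Psi> (blaschke_lift z (e * p) (e * q) b)"
          using AE_gauss_conv
        proof eventually_elim
          case (elim b)
          have "pser (blaschke_lift z (e * p) (e * q) b) z / of_real e = of_real p * dir_p z + of_real q * dir_q z"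
            unfolding pser_lift_at[OF elim] using e by (simp add: field_simps)
          then show ?case by (simp add: \<Theta>_def)
        qed
      qed
      also have "\<dots> = win (of_real p * dir_p z + of_real q * dir_q z) * (\<integral>\<^sup>+b. \<Psi> (blaschke_lift z (e * p) (e * q) b) \<partial>gauss)"
        by (rule nn_integral_cmult) measurable
      finally show ?thesis .
    qed
    then show ?thesis by simp
  qed
  finally have "(\<integral>\<^sup>+a. \<Theta> a \<partial>gauss) = ennreal (e\<^sup>2) * ?R" .
  with 1 have "ennreal (e\<^sup>2) * ?L = ennreal (e\<^sup>2) * ?R" by simp
  moreover have "ennreal (e\<^sup>2) \<noteq> 0" "ennreal (e\<^sup>2) \<noteq> top" using e by (auto simp: ennreal_eq_0_iff)
  ultimately show ?thesis by (simp add: ennreal_mult_cancel_left)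
qed

end

lemma continuous_on_cons2:
  assumes "continuous_on S f" "continuous_on S g"
  shows "continuous_on S (\<lambda>x. cons2 (f x) (g x) t :: nat \<Rightarrow> real)"
proof (rule continuous_on_coordinatewise_then_product)
  fix i
  show "continuous_on S (\<lambda>x. cons2 (f x) (g x) t i)"
    using assms by (cases i; cases "i - 1") auto
qed

lemma continuous_on_lattice_out:
  assumes "continuous_on S f" "continuous_on S g"
  shows "continuous_on S (\<lambda>x. lattice_out k1 s1 k2 s2 (f x) (g x) b)"
proof (rule continuous_on_coordinatewise_then_product)
  fix i
  have "continuous_on S (\<lambda>x. lattice_state k1 s1 k2 s2 (f x, g x) b i)"
  proof (induction i)
    case 0
    then show ?case using assms by (simp add: continuous_on_Pair)
  next
    case (Suc i)
    then show ?case by (auto simp: Let_def case_prod_beta intro!: continuous_intros)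
  qed
  then show "continuous_on S (\<lambda>x. lattice_out k1 s1 k2 s2 (f x) (g x) b i)"
    unfolding lattice_out_def by (auto intro!: continuous_intros)
qed

text \<open>The density at 0 of the planar Gaussian vector \<open>f z\<close>, times
  \<open>Im z\<close>. The factor \<open>Im z\<close> is the determinant of the map from
  \<open>(x, y)\<close> to \<open>x + y * z\<close>.\<close>

definition law_const :: "complex \<Rightarrow> real" where
  "law_const z = (1 - (cmod z)\<^sup>2) * cmod (1 - z\<^sup>2) / (2 * pi)"

lemma ss1_eq:
  assumes "z \<in> upper_half_disc"
  shows "ss1 z = cmod (1 - z\<^sup>2) / (1 + (cmod z)\<^sup>2)"
proof -
  have pos: "1 + (cmod z)\<^sup>2 > 0" by (simp add: add_pos_nonneg)
  have "(cmod (1 - z\<^sup>2))\<^sup>2 = (1 + (cmod z)\<^sup>2)\<^sup>2 - (2 * Re z)\<^sup>2"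
    unfolding cmod_power2 by (simp add: power2_eq_square algebra_simps)
  then have "1 - (kk1 z)\<^sup>2 = (cmod (1 - z\<^sup>2) / (1 + (cmod z)\<^sup>2))\<^sup>2"
    using pos by (simp add: kk1_def power_divide field_simps)
  then show ?thesis unfolding ss1_def using pos by simp
qed

lemma ss2_sq:
  assumes "z \<in> upper_half_disc"
  shows "(ss2 z)\<^sup>2 = (1 - (cmod z)\<^sup>2) * (1 + (cmod z)\<^sup>2)"
  using lattice_params(2)[OF assms] by (simp add: kk2_def algebra_simps power2_eq_square)

text \<open>As \<open>f z\<close> is the image of two independent standard normals under the
  directions \<open>dir_p z\<close> and \<open>dir_q z\<close>, this is the square root of the
  covariance determinant of its real and imaginary parts.\<close>

lemma dir_det:
  assumes "z \<in> upper_half_disc"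
  shows "Re (dir_p z) * Im (dir_q z) - Re (dir_q z) * Im (dir_p z) =
     Im z / ((1 - (cmod z)\<^sup>2) * cmod (1 - z\<^sup>2))"
proof -
  note zf = upper_half_discD[OF assms]
  define D where "D = (1 - z * cnj z) * (1 - z * z)"
  have r1: "(cmod z)\<^sup>2 < 1" using zf by (simp add: abs_square_less_1)
  have D0: "1 - z * z \<noteq> 0" using one_minus_mult_neq_0[OF zf(1) zf(1)] by simp
  have cD: "cmod D = (1 - (cmod z)\<^sup>2) * cmod (1 - z\<^sup>2)"
  proof -
    have "1 - z * cnj z = complex_of_real (1 - (cmod z)\<^sup>2)" by (simp only: complex_norm_square of_real_diff of_real_1)
    then have "cmod (1 - z * cnj z) = 1 - (cmod z)\<^sup>2" using r1 by (simp only: norm_of_real)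
    then show ?thesis by (simp add: D_def norm_mult power2_eq_square)
  qed
  have cDpos: "cmod D > 0" unfolding cD using r1 D0 by (simp add: power2_eq_square)
  have "Re (dir_p z) * Im (dir_q z) - Re (dir_q z) * Im (dir_p z) = Im (cnj (dir_p z) * dir_q z)"
    by (simp add: algebra_simps)
  also have "cnj (dir_p z) * dir_q z = of_real ((ss2 z)\<^sup>2 * ss1 z / (cmod D)\<^sup>2) * ((1 + of_real (kk1 z) * cnj z) * z)"
    unfolding dir_p_def dir_q_def D_def[symmetric]
  proof -
    have "cnj D * D = of_real ((cmod D)\<^sup>2)" using complex_norm_square[of D] by (simp add: mult.commute)
    then have "complex_of_real (1 / (cmod D)\<^sup>2) = 1 / (cnj D * D)" by simp
    then show "cnj (of_real (ss2 z) * (1 + of_real (kk1 z) * z) / D) * (of_real (ss2 z) * (of_real (ss1 z) * z) / D) =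
      of_real ((ss2 z)\<^sup>2 * ss1 z / (cmod D)\<^sup>2) * ((1 + of_real (kk1 z) * cnj z) * z)"
      by (simp add: power2_eq_square)
  qed
  also have "Im \<dots> = (ss2 z)\<^sup>2 * ss1 z / (cmod D)\<^sup>2 * Im z"
    by (simp add: Im_complex_of_real) (simp add: algebra_simps)
  also have "(ss2 z)\<^sup>2 * ss1 z = (1 - (cmod z)\<^sup>2) * cmod (1 - z\<^sup>2)"
    unfolding ss2_sq[OF assms] ss1_eq[OF assms] by (simp add: add_pos_nonneg add_nonneg_eq_0_iff)
  also have "(1 - (cmod z)\<^sup>2) * cmod (1 - z\<^sup>2) = cmod D" by (simp add: cD)
  also have "cmod D / (cmod D)\<^sup>2 * Im z = Im z / cmod D" using cDpos by (simp add: power2_eq_square)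
  finally show ?thesis by (simp add: cD)
qed

lemma continuous_std_normal_density [continuous_intros]:
  "continuous_on S f \<Longrightarrow> continuous_on S (\<lambda>x. std_normal_density (f x))"
  unfolding std_normal_density_def by (intro continuous_intros) auto

lemma ennreal_tendsto_weight:
  assumes "h \<longlonglongrightarrow> l" "w \<noteq> top" shows "(\<lambda>n. w * ennreal (h n)) \<longlonglongrightarrow> w * ennreal l"
  by (rule ennreal_tendsto_cmult[OF _ tendsto_ennrealI[OF assms(1)]]) (use assms(2) in \<open>simp add: less_top\<close>)

lemma tendsto_eps_continuous:
  fixes h :: "real \<Rightarrow> real"
  assumes "continuous_on UNIV h" shows "(\<lambda>n. h (inverse (real (Suc n)))) \<longlonglongrightarrow> h 0"
  using continuous_on_tendsto_compose[OF assms LIMSEQ_inverse_real_of_nat] by simp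

lemma win_neq_top: "win w \<noteq> top"
  unfolding win_def by (auto simp: indicator_def)

text \<open>The scale in \<open>window_identity\<close> tends to 0. Densities and
  \<open>\<psi>\<close> are bounded by 1, so the window itself dominates, and it is integrable
  because in both coordinate systems it is a parallelogram of finite area. Continuity of
  \<open>\<psi>\<close> in the product topology gives the pointwise limits.\<close>

lemma conditional_law_continuous:
  assumes z: "z \<in> upper_half_disc" and cont: "continuous_on UNIV \<psi>" and bd: "\<And>a. 0 \<le> \<psi> a" "\<And>a. \<psi> a \<le> 1"
  shows "(\<integral>\<^sup>+t. ennreal (std_normal_density (coef0 t z) * std_normal_density (coef1 t z)) * ennreal (\<psi> (cons2 (coef0 t z) (coef1 t z) t)) \<partial>gauss) =
    ennreal (law_const z) * (\<integral>\<^sup>+b. ennreal (\<psi> (blaschke_lift z 0 0 b)) \<partial>gauss)"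
proof -
  let ?\<phi> = std_normal_density
  interpret G: prob_space gauss by (rule prob_space_gauss)
  note zf = upper_half_discD[OF z]
  define e where "e n = inverse (real (Suc n))" for n
  have e: "e n > 0" for n by (simp add: e_def)
  have \<psi>m [measurable]: "\<psi> \<in> borel_measurable (PiM UNIV (\<lambda>_. borel))"
    using borel_measurable_continuous_onI[OF cont]
    by (simp cong: measurable_cong_sets add: sets_PiM_equal_borel)
  have lm [measurable]: "(\<lambda>x. blaschke_lift z (f x) (g x) (h x)) \<in> measurable M (PiM UNIV (\<lambda>_. borel))"
    if [measurable]: "f \<in> borel_measurable M" "g \<in> borel_measurable M" "h \<in> measurable M (PiM UNIV (\<lambda>_. borel))" for f g h and M :: "((real \<times> real) \<times> (nat \<Rightarrow> real)) measure"
    unfolding blaschke_lift_def by measurable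
  have lm2 [measurable]: "(\<lambda>x. blaschke_lift z p q x) \<in> measurable (PiM UNIV (\<lambda>_. borel)) (PiM UNIV (\<lambda>_. borel))" for p q
    unfolding blaschke_lift_def by measurable
  have phi01: "0 \<le> ?\<phi> x * ?\<phi> y" "?\<phi> x * ?\<phi> y \<le> 1" for x y
    using std_normal_density_le_1 normal_density_nonneg by (auto intro!: mult_le_one)
  define N1 where "N1 = gauss \<Otimes>\<^sub>M ((lborel :: real measure) \<Otimes>\<^sub>M (lborel :: real measure))"
  have int1: "(\<integral>\<^sup>+t. \<integral>\<^sup>+x. \<integral>\<^sup>+y. F (t, x, y) \<partial>lborel \<partial>lborel \<partial>gauss) = (\<integral>\<^sup>+w. F w \<partial>N1)"
    if [measurable]: "F \<in> borel_measurable N1" for F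
  proof -
    have [measurable]: "F \<in> borel_measurable (gauss \<Otimes>\<^sub>M (borel \<Otimes>\<^sub>M borel))"
      using that by (simp add: N1_def cong: measurable_cong_sets)
    have "(\<integral>\<^sup>+w. F w \<partial>N1) = (\<integral>\<^sup>+t. \<integral>\<^sup>+p. F (t, p) \<partial>(lborel \<Otimes>\<^sub>M lborel) \<partial>gauss)"
      unfolding N1_def by (rule sigma_finite_measure.nn_integral_fst[OF lborel_pair.sigma_finite_measure_axioms, symmetric]) (use that in \<open>simp add: N1_def\<close>)
    also have "\<dots> = (\<integral>\<^sup>+t. \<integral>\<^sup>+x. \<integral>\<^sup>+y. F (t, x, y) \<partial>lborel \<partial>lborel \<partial>gauss)"
      by (intro nn_integral_cong lborel.nn_integral_fst[symmetric]) measurable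
    finally show ?thesis ..
  qed
  define N2 where "N2 = ((lborel :: real measure) \<Otimes>\<^sub>M (lborel :: real measure)) \<Otimes>\<^sub>M gauss"
  have int2: "(\<integral>\<^sup>+x. \<integral>\<^sup>+y. \<integral>\<^sup>+b. F ((x, y), b) \<partial>gauss \<partial>lborel \<partial>lborel) = (\<integral>\<^sup>+w. F w \<partial>N2)"
    if [measurable]: "F \<in> borel_measurable N2" for F
  proof -
    have [measurable]: "F \<in> borel_measurable ((borel \<Otimes>\<^sub>M borel) \<Otimes>\<^sub>M gauss)"
      using that by (simp add: N2_def cong: measurable_cong_sets)
    have "(\<integral>\<^sup>+w. F w \<partial>N2) = (\<integral>\<^sup>+p. \<integral>\<^sup>+b. F (p, b) \<partial>gauss \<partial>(lborel \<Otimes>\<^sub>M lborel))"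
      unfolding N2_def by (rule G.nn_integral_fst[symmetric]) (use that in \<open>simp add: N2_def\<close>)
    also have "\<dots> = (\<integral>\<^sup>+x. \<integral>\<^sup>+y. \<integral>\<^sup>+b. F ((x, y), b) \<partial>gauss \<partial>lborel \<partial>lborel)"
      by (rule lborel.nn_integral_fst[symmetric]) measurable
    finally show ?thesis ..
  qed
  define u1 where "u1 \<epsilon> w = win (of_real (fst (snd w)) + of_real (snd (snd w)) * z) *
    ennreal (?\<phi> (coef0 (fst w) z + \<epsilon> * fst (snd w)) * ?\<phi> (coef1 (fst w) z + \<epsilon> * snd (snd w)) *
      \<psi> (cons2 (coef0 (fst w) z + \<epsilon> * fst (snd w)) (coef1 (fst w) z + \<epsilon> * snd (snd w)) (fst w)))" for \<epsilon> and w :: "(nat \<Rightarrow> real) \<times> real \<times> real"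
  define u2 where "u2 \<epsilon> w = win (of_real (fst (fst w)) * dir_p z + of_real (snd (fst w)) * dir_q z) *
    ennreal (?\<phi> (\<epsilon> * fst (fst w)) * ?\<phi> (\<epsilon> * snd (fst w)) * \<psi> (blaschke_lift z (\<epsilon> * fst (fst w)) (\<epsilon> * snd (fst w)) (snd w)))" for \<epsilon> and w :: "(real \<times> real) \<times> (nat \<Rightarrow> real)"
  have u1m [measurable]: "u1 \<epsilon> \<in> borel_measurable N1" for \<epsilon>
    unfolding u1_def N1_def by measurable
  have u2m [measurable]: "u2 \<epsilon> \<in> borel_measurable N2" for \<epsilon>
    unfolding u2_def N2_def by measurable
  have w_ennreal: "ennreal a * (w * ennreal b) = w * ennreal (a * b)" if "0 \<le> a" "0 \<le> b" for a b w
    using that by (simp add: ennreal_mult mult.left_commute)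
  have eq: "(\<integral>\<^sup>+w. u1 (e n) w \<partial>N1) = (\<integral>\<^sup>+w. u2 (e n) w \<partial>N2)" for n
  proof -
    have "(\<integral>\<^sup>+w. u1 (e n) w \<partial>N1) = (\<integral>\<^sup>+t. \<integral>\<^sup>+x. \<integral>\<^sup>+y. ennreal (?\<phi> (coef0 t z + e n * x) * ?\<phi> (coef1 t z + e n * y)) *
       (win (of_real x + of_real y * z) * ennreal (\<psi> (cons2 (coef0 t z + e n * x) (coef1 t z + e n * y) t))) \<partial>lborel \<partial>lborel \<partial>gauss)"
      by (subst int1[symmetric, OF u1m]) (simp add: u1_def w_ennreal[OF phi01(1) bd(1)])
    also have "\<dots> = (\<integral>\<^sup>+p. \<integral>\<^sup>+q. ennreal (?\<phi> (e n * p) * ?\<phi> (e n * q)) *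
      (win (of_real p * dir_p z + of_real q * dir_q z) * (\<integral>\<^sup>+b. ennreal (\<psi> (blaschke_lift z (e n * p) (e n * q) b)) \<partial>gauss)) \<partial>lborel \<partial>lborel)"
      by (rule window_identity[OF z _ e]) measurable
    also have "\<dots> = (\<integral>\<^sup>+p. \<integral>\<^sup>+q. \<integral>\<^sup>+b. ennreal (?\<phi> (e n * p) * ?\<phi> (e n * q)) *
      (win (of_real p * dir_p z + of_real q * dir_q z) * ennreal (\<psi> (blaschke_lift z (e n * p) (e n * q) b))) \<partial>gauss \<partial>lborel \<partial>lborel)"
      by (intro nn_integral_cong) (subst nn_integral_cmult, measurable, subst nn_integral_cmult, measurable)
    also have "\<dots> = (\<integral>\<^sup>+w. u2 (e n) w \<partial>N2)"
      by (subst int2[symmetric, OF u2m]) (simp add: u2_def w_ennreal[OF phi01(1) bd(1)])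
    finally show ?thesis .
  qed
  define X where "X = (\<integral>\<^sup>+x. \<integral>\<^sup>+y. win (of_real x + of_real y * z) \<partial>lborel \<partial>lborel)"
  have X: "X = ennreal (4 / Im z)"
    using win_linear[of 1 z] zf by (simp add: X_def)
  define Y where "Y = (\<integral>\<^sup>+x. \<integral>\<^sup>+y. win (of_real x * dir_p z + of_real y * dir_q z) \<partial>lborel \<partial>lborel)"
  define d where "d = Im z / ((1 - (cmod z)\<^sup>2) * cmod (1 - z\<^sup>2))"
  have r1: "(cmod z)\<^sup>2 < 1" using zf by (simp add: abs_square_less_1)
  have D0: "cmod (1 - z\<^sup>2) > 0" using one_minus_mult_neq_0[OF zf(1) zf(1)] by (simp add: power2_eq_square)
  have d: "d > 0" using zf r1 D0 by (simp add: d_def)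
  have Y: "Y = ennreal (4 / d)"
    unfolding Y_def using d by (subst win_linear) (auto simp: dir_det[OF z] d_def[symmetric])
  have "(\<lambda>n. \<integral>\<^sup>+w. u1 (e n) w \<partial>N1) \<longlonglongrightarrow> (\<integral>\<^sup>+w. u1 0 w \<partial>N1)"
  proof (rule nn_integral_dominated_convergence[where w="\<lambda>w. win (of_real (fst (snd w)) + of_real (snd (snd w)) * z)"])
    show wm: "(\<lambda>w. win (of_real (fst (snd w)) + of_real (snd (snd w)) * z)) \<in> borel_measurable N1"
      unfolding N1_def by measurable
    have "u1 (e j) w \<le> win (of_real (fst (snd w)) + of_real (snd (snd w)) * z) * 1" for j w
      unfolding u1_def by (intro mult_left_mono) (simp_all add: ennreal_le_1 mult_le_one[OF phi01(2) bd(1) bd(2)])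
    then show "AE w in N1. u1 (e j) w \<le> win (of_real (fst (snd w)) + of_real (snd (snd w)) * z)" for j by simp
    have "(\<integral>\<^sup>+w. win (of_real (fst (snd w)) + of_real (snd (snd w)) * z) \<partial>N1) = X"
      by (subst int1[symmetric, OF wm]) (simp add: X_def G.emeasure_space_1[simplified])
    then show "(\<integral>\<^sup>+w. win (of_real (fst (snd w)) + of_real (snd (snd w)) * z) \<partial>N1) < \<infinity>" by (simp add: X)
    have "(\<lambda>i. u1 (e i) w) \<longlonglongrightarrow> u1 0 w" for w
      unfolding u1_def e_def
    proof (intro ennreal_tendsto_weight win_neq_top)
      obtain t x y where w: "w = (t, x, y)" by (cases w) auto
      have "continuous_on UNIV (\<lambda>\<epsilon>. ?\<phi> (coef0 t z + \<epsilon> * x) * ?\<phi> (coef1 t z + \<epsilon> * y) * \<psi> (cons2 (coef0 t z + \<epsilon> * x) (coef1 t z + \<epsilon> * y) t))"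
        by (intro continuous_intros continuous_on_compose2[OF cont] continuous_on_cons2) auto
      from tendsto_eps_continuous[OF this]
      show "(\<lambda>i. ?\<phi> (coef0 (fst w) z + inverse (real (Suc i)) * fst (snd w)) * ?\<phi> (coef1 (fst w) z + inverse (real (Suc i)) * snd (snd w)) *
         \<psi> (cons2 (coef0 (fst w) z + inverse (real (Suc i)) * fst (snd w)) (coef1 (fst w) z + inverse (real (Suc i)) * snd (snd w)) (fst w))) \<longlonglongrightarrow>
         ?\<phi> (coef0 (fst w) z + 0 * fst (snd w)) * ?\<phi> (coef1 (fst w) z + 0 * snd (snd w)) *
         \<psi> (cons2 (coef0 (fst w) z + 0 * fst (snd w)) (coef1 (fst w) z + 0 * snd (snd w)) (fst w))"
        by (simp add: w)
    qed
    then show "AE w in N1. (\<lambda>i. u1 (e i) w) \<longlonglongrightarrow> u1 0 w" by simp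
  qed measurable
  moreover have "(\<lambda>n. \<integral>\<^sup>+w. u2 (e n) w \<partial>N2) \<longlonglongrightarrow> (\<integral>\<^sup>+w. u2 0 w \<partial>N2)"
  proof (rule nn_integral_dominated_convergence[where w="\<lambda>w. win (of_real (fst (fst w)) * dir_p z + of_real (snd (fst w)) * dir_q z)"])
    show wm: "(\<lambda>w. win (of_real (fst (fst w)) * dir_p z + of_real (snd (fst w)) * dir_q z)) \<in> borel_measurable N2"
      unfolding N2_def by measurable
    have "u2 (e j) w \<le> win (of_real (fst (fst w)) * dir_p z + of_real (snd (fst w)) * dir_q z) * 1" for j w
      unfolding u2_def by (intro mult_left_mono) (simp_all add: ennreal_le_1 mult_le_one[OF phi01(2) bd(1) bd(2)])
    then show "AE w in N2. u2 (e j) w \<le> win (of_real (fst (fst w)) * dir_p z + of_real (snd (fst w)) * dir_q z)" for j by simp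
    have "(\<integral>\<^sup>+w. win (of_real (fst (fst w)) * dir_p z + of_real (snd (fst w)) * dir_q z) \<partial>N2) = Y"
      by (subst int2[symmetric, OF wm]) (simp add: Y_def G.emeasure_space_1[simplified])
    then show "(\<integral>\<^sup>+w. win (of_real (fst (fst w)) * dir_p z + of_real (snd (fst w)) * dir_q z) \<partial>N2) < \<infinity>" by (simp add: Y)
    have "(\<lambda>i. u2 (e i) w) \<longlonglongrightarrow> u2 0 w" for w
      unfolding u2_def e_def
    proof (intro ennreal_tendsto_weight win_neq_top)
      obtain p q b where w: "w = ((p, q), b)" by (cases w) auto
      have "continuous_on UNIV (\<lambda>\<epsilon>. ?\<phi> (\<epsilon> * p) * ?\<phi> (\<epsilon> * q) * \<psi> (blaschke_lift z (\<epsilon> * p) (\<epsilon> * q) b))"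
        unfolding blaschke_lift_def
        by (intro continuous_intros continuous_on_compose2[OF cont] continuous_on_lattice_out) auto
      from tendsto_eps_continuous[OF this]
      show "(\<lambda>i. ?\<phi> (inverse (real (Suc i)) * fst (fst w)) * ?\<phi> (inverse (real (Suc i)) * snd (fst w)) *
         \<psi> (blaschke_lift z (inverse (real (Suc i)) * fst (fst w)) (inverse (real (Suc i)) * snd (fst w)) (snd w))) \<longlonglongrightarrow>
         ?\<phi> (0 * fst (fst w)) * ?\<phi> (0 * snd (fst w)) * \<psi> (blaschke_lift z (0 * fst (fst w)) (0 * snd (fst w)) (snd w))"
        by (simp add: w)
    qed
    then show "AE w in N2. (\<lambda>i. u2 (e i) w) \<longlonglongrightarrow> u2 0 w" by simp
  qed measurable
  ultimately have lim: "(\<integral>\<^sup>+w. u1 0 w \<partial>N1) = (\<integral>\<^sup>+w. u2 0 w \<partial>N2)"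
    unfolding eq by (rule LIMSEQ_unique)
  define \<Lambda>1 where "\<Lambda>1 = (\<integral>\<^sup>+t. ennreal (?\<phi> (coef0 t z) * ?\<phi> (coef1 t z)) * ennreal (\<psi> (cons2 (coef0 t z) (coef1 t z) t)) \<partial>gauss)"
  define \<Lambda>2 where "\<Lambda>2 = (\<integral>\<^sup>+b. ennreal (\<psi> (blaschke_lift z 0 0 b)) \<partial>gauss)"
  have "(\<integral>\<^sup>+w. u1 0 w \<partial>N1) = (\<integral>\<^sup>+t. X * (ennreal (?\<phi> (coef0 t z) * ?\<phi> (coef1 t z)) * ennreal (\<psi> (cons2 (coef0 t z) (coef1 t z) t))) \<partial>gauss)"
    unfolding X_def
    by (subst int1[symmetric, OF u1m]) (simp add: u1_def nn_integral_multc ennreal_mult[OF phi01(1) bd(1)])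
  also have "\<dots> = X * \<Lambda>1" unfolding \<Lambda>1_def by (rule nn_integral_cmult) measurable
  finally have L: "(\<integral>\<^sup>+w. u1 0 w \<partial>N1) = ennreal (4 / Im z) * \<Lambda>1" by (simp add: X)
  have "(\<integral>\<^sup>+w. u2 0 w \<partial>N2) = (\<integral>\<^sup>+x. \<integral>\<^sup>+y. win (of_real x * dir_p z + of_real y * dir_q z) * (ennreal (?\<phi> 0 * ?\<phi> 0) * \<Lambda>2) \<partial>lborel \<partial>lborel)"
    unfolding \<Lambda>2_def
    by (subst int2[symmetric, OF u2m]) (simp add: u2_def nn_integral_cmult ennreal_mult[OF phi01(1) bd(1)])
  also have "\<dots> = Y * (ennreal (?\<phi> 0 * ?\<phi> 0) * \<Lambda>2)"
    unfolding Y_def by (simp add: nn_integral_multc)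
  finally have R: "(\<integral>\<^sup>+w. u2 0 w \<partial>N2) = ennreal (4 / d) * (ennreal (?\<phi> 0 * ?\<phi> 0) * \<Lambda>2)" by (simp add: Y)
  have "?\<phi> 0 * ?\<phi> 0 = 1 / (2 * pi)" by (simp add: std_normal_density_def)
  \<comment> \<open>The two window areas are \<open>4 / Im z\<close> and \<open>4 / d\<close>, and
    \<open>1 / (2 * pi)\<close> is the planar normal density at the origin; solving for the left
    integral leaves \<open>law_const z\<close>.\<close>
  with L R lim have main: "ennreal (4 / Im z) * \<Lambda>1 = ennreal (4 / d) * (ennreal (1 / (2 * pi)) * \<Lambda>2)" by simp
  have "\<Lambda>1 = ennreal (Im z / 4) * (ennreal (4 / Im z) * \<Lambda>1)"
    using zf by (simp add: mult.assoc[symmetric] ennreal_mult[symmetric])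
  also have "\<dots> = ennreal (Im z / 4 * (4 / d) * (1 / (2 * pi))) * \<Lambda>2"
    unfolding main using zf d by (simp only: mult.assoc[symmetric] ennreal_mult[symmetric] divide_nonneg_nonneg mult_nonneg_nonneg less_imp_le zero_le_numeral zero_le_one pi_ge_zero)
  also have "Im z / 4 * (4 / d) * (1 / (2 * pi)) = law_const z"
    using zf by (simp add: d_def law_const_def)
  finally show ?thesis by (simp add: \<Lambda>1_def \<Lambda>2_def)
qed

text \<open>Both sides are integrals of \<open>\<Psi>\<close> against finite measures. Indicators of
  open sets are increasing limits of truncated multiples of the distance to the complement, so
  agreement on continuous functions gives agreement on the open sets, which generate the product
  sigma-algebra.\<close>

lemma conditional_law:
  assumes z: "z \<in> upper_half_disc" and \<Psi>: "\<Psi> \<in> borel_measurable (PiM UNIV (\<lambda>_. borel))"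
  shows "(\<integral>\<^sup>+t. ennreal (std_normal_density (coef0 t z) * std_normal_density (coef1 t z)) * \<Psi> (cons2 (coef0 t z) (coef1 t z) t) \<partial>gauss) =
    ennreal (law_const z) * (\<integral>\<^sup>+b. \<Psi> (blaschke_lift z 0 0 b) \<partial>gauss)"
proof -
  let ?\<phi> = std_normal_density
  interpret G: prob_space gauss by (rule prob_space_gauss)
  define W where "W t = ennreal (?\<phi> (coef0 t z) * ?\<phi> (coef1 t z))" for t
  have Wm [measurable]: "W \<in> borel_measurable gauss" unfolding W_def by measurable
  have cm [measurable]: "(\<lambda>t. cons2 (coef0 t z) (coef1 t z) t) \<in> measurable gauss gauss" by measurable
  have lm [measurable]: "(\<lambda>b. blaschke_lift z 0 0 b) \<in> measurable gauss gauss"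
    unfolding blaschke_lift_def by measurable
  define \<mu>1 where "\<mu>1 = distr (density gauss W) gauss (\<lambda>t. cons2 (coef0 t z) (coef1 t z) t)"
  define \<mu>2 where "\<mu>2 = distr (density gauss (\<lambda>_. ennreal (law_const z))) gauss (\<lambda>b. blaschke_lift z 0 0 b)"
  have i1: "(\<integral>\<^sup>+a. F a \<partial>\<mu>1) = (\<integral>\<^sup>+t. W t * F (cons2 (coef0 t z) (coef1 t z) t) \<partial>gauss)"
    if [measurable]: "F \<in> borel_measurable gauss" for F
    unfolding \<mu>1_def by (subst nn_integral_distr) (auto simp: nn_integral_density)
  have i2: "(\<integral>\<^sup>+a. F a \<partial>\<mu>2) = ennreal (law_const z) * (\<integral>\<^sup>+b. F (blaschke_lift z 0 0 b) \<partial>gauss)"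
    if [measurable]: "F \<in> borel_measurable gauss" for F
    unfolding \<mu>2_def by (subst nn_integral_distr) (auto simp: nn_integral_density nn_integral_cmult)
  have sb: "sets gauss = sigma_sets UNIV {S. open S}"
    unfolding sets_gauss_borel by (simp add: borel_def)
  have c: "(\<integral>\<^sup>+a. ennreal (\<psi> a) \<partial>\<mu>1) = (\<integral>\<^sup>+a. ennreal (\<psi> a) \<partial>\<mu>2)"
    if "continuous_on UNIV \<psi>" "\<And>a. 0 \<le> \<psi> a" "\<And>a. \<psi> a \<le> 1" for \<psi>
  proof -
    have [measurable]: "\<psi> \<in> borel_measurable gauss"
      using borel_measurable_continuous_onI[OF that(1)]
      by (simp cong: measurable_cong_sets add: sets_gauss_borel)
    show ?thesis
      by (simp add: i1 i2 W_def conditional_law_continuous[OF z that])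
  qed
  have "\<mu>1 = \<mu>2"
  proof (rule measure_eqI_generator_eq[where \<Omega>=UNIV and E="{S. open S}" and A="\<lambda>_. UNIV"])
    fix U :: "(nat \<Rightarrow> real) set" assume "U \<in> {S. open S}"
    then have U: "open U" by simp
    then have Um: "U \<in> sets gauss" by (simp add: sets_gauss_borel)
    show "emeasure \<mu>1 U = emeasure \<mu>2 U"
    proof (cases "U = UNIV")
      case True
      have "emeasure \<mu>1 UNIV = (\<integral>\<^sup>+a. ennreal 1 \<partial>\<mu>1)" "emeasure \<mu>2 UNIV = (\<integral>\<^sup>+a. ennreal 1 \<partial>\<mu>2)"
        by (simp_all add: \<mu>1_def \<mu>2_def)
      then show ?thesis unfolding True using c[of "\<lambda>_. 1"] by simp
    next
      case False
      \<comment> \<open>The distance to the empty set is 0 by convention, so the approximating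
        functions below need a nonempty complement; the whole space was treated separately.\<close>
      then have ne: "- U \<noteq> {}" by auto
      have cl: "closed (- U)" using U by (simp add: closed_def)
      define \<psi> where "\<psi> m a = min 1 (real m * infdist a (- U))" for m a
      have \<psi>c: "continuous_on UNIV (\<psi> m)" for m unfolding \<psi>_def by (intro continuous_intros continuous_on_infdist)
      have \<psi>01: "0 \<le> \<psi> m a" "\<psi> m a \<le> 1" for m a by (auto simp: \<psi>_def infdist_nonneg)
      have \<psi>m: "(\<lambda>a. ennreal (\<psi> m a)) \<in> borel_measurable gauss" for m
        using borel_measurable_continuous_onI[OF \<psi>c[of m]]
        by (simp cong: measurable_cong_sets add: sets_gauss_borel)
      have inc: "incseq (\<lambda>m a. ennreal (\<psi> m a))"
        unfolding incseq_def le_fun_def \<psi>_def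
        by (auto intro!: ennreal_leI min.mono mult_right_mono infdist_nonneg)
      have sup: "indicator U a = (SUP m. ennreal (\<psi> m a))" for a
      proof (cases "a \<in> U")
        case True
        then have "infdist a (- U) > 0"
          using in_closed_iff_infdist_zero[OF cl ne, of a] infdist_nonneg[of a "- U"] by auto
        then obtain m :: nat where "1 < real m * infdist a (- U)"
          using reals_Archimedean3 by blast
        then have "\<psi> m a = 1" by (simp add: \<psi>_def)
        then have "1 \<le> (SUP m. ennreal (\<psi> m a))" by (metis SUP_upper UNIV_I ennreal_1)
        moreover have "(SUP m. ennreal (\<psi> m a)) \<le> 1" by (rule SUP_least) (simp add: \<psi>01 ennreal_le_1)
        ultimately show ?thesis using True by simp
      next
        case False
        then have "infdist a (- U) = 0" by simp
        then show ?thesis using False by (simp add: \<psi>_def)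
      qed
      have em: "emeasure \<mu> U = (SUP m. \<integral>\<^sup>+a. ennreal (\<psi> m a) \<partial>\<mu>)" if "sets \<mu> = sets gauss" for \<mu>
      proof -
        have "emeasure \<mu> U = (\<integral>\<^sup>+a. indicator U a \<partial>\<mu>)" using Um that by simp
        also have "\<dots> = (\<integral>\<^sup>+a. (SUP m. ennreal (\<psi> m a)) \<partial>\<mu>)" by (simp only: sup)
        also have "\<dots> = (SUP m. \<integral>\<^sup>+a. ennreal (\<psi> m a) \<partial>\<mu>)"
          by (rule nn_integral_monotone_convergence_SUP[OF inc]) (use \<psi>m measurable_cong_sets[OF that refl] in blast)
        finally show ?thesis .
      qed
      have "sets \<mu>1 = sets gauss" "sets \<mu>2 = sets gauss" by (simp_all add: \<mu>1_def \<mu>2_def)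
      then show ?thesis unfolding em[OF \<open>sets \<mu>1 = sets gauss\<close>] em[OF \<open>sets \<mu>2 = sets gauss\<close>]
        by (simp only: c[OF \<psi>c \<psi>01])
    qed
  next
    have "emeasure \<mu>1 UNIV = (\<integral>\<^sup>+t. W t \<partial>gauss)" using i1[of "\<lambda>_. 1"] by (simp add: \<mu>1_def)
    also have "\<dots> \<le> (\<integral>\<^sup>+t. 1 \<partial>gauss)" unfolding W_def
      by (intro nn_integral_mono) (auto intro!: mult_le_one simp: std_normal_density_le_1 normal_density_nonneg ennreal_le_1)
    finally show "emeasure \<mu>1 UNIV \<noteq> \<infinity>" by (auto simp: G.emeasure_space_1[simplified] top_unique)
  qed (auto simp: \<mu>1_def \<mu>2_def sb Int_stable_def)
  then have "(\<integral>\<^sup>+a. \<Psi> a \<partial>\<mu>1) = (\<integral>\<^sup>+a. \<Psi> a \<partial>\<mu>2)" by simp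
  moreover have "\<Psi> \<in> borel_measurable gauss" using \<Psi> by measurable
  ultimately show ?thesis by (simp add: i1 i2 W_def)
qed

section \<open>The Palm formula\<close>

definition double_zero :: "(nat \<Rightarrow> real) \<Rightarrow> bool" where
  "double_zero a \<longleftrightarrow> (\<exists>z\<in>upper_half_disc. a \<in> conv_seqs \<and> pser a z = 0 \<and> pderiv_ser a z = 0)"

lemma double_zero_pred [measurable]: "Measurable.pred (PiM UNIV (\<lambda>_. borel)) double_zero"
proof -
  obtain K where K: "\<And>n. compact (K n)" "\<And>n. K n \<subseteq> upper_half_disc" "(\<Union>n::nat. K n) = upper_half_disc"
    using open_Union_compact_subsets[OF open_upper_half_disc] by metis
  have m: "{a\<in>space (PiM UNIV (\<lambda>_. borel)). \<exists>q\<in>K n. (if a \<in> conv_seqs then cmod (pser a q) + cmod (pderiv_ser a q) else 1) = 0} \<in> sets (PiM UNIV (\<lambda>_. borel))" for n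
  proof (rule measurable_ex_zero_compact[OF K(1)])
    fix a :: "nat \<Rightarrow> real"
    have sub: "K n \<subseteq> ball 0 1" using K(2)[of n] by (auto simp: upper_half_disc_def)
    show "continuous_on (K n) (\<lambda>q. if a \<in> conv_seqs then cmod (pser a q) + cmod (pderiv_ser a q) else 1)"
    proof (cases "a \<in> conv_seqs")
      case True
      have "continuous_on (K n) (pser a)" "continuous_on (K n) (pderiv_ser a)"
        using pser_holomorphic[OF True] pderiv_ser_holomorphic[OF True] sub
        by (meson continuous_on_subset holomorphic_on_imp_continuous_on)+
      then show ?thesis using True by (auto intro!: continuous_intros)
    qed simp
  next
    fix q show "(\<lambda>x. if x \<in> conv_seqs then cmod (pser x q) + cmod (pderiv_ser x q) else 1) \<in> borel_measurable (PiM UNIV (\<lambda>_. borel))"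
      by measurable
  qed
  have "{a\<in>space (PiM UNIV (\<lambda>_. borel)). double_zero a} = (\<Union>n. {a\<in>space (PiM UNIV (\<lambda>_. borel)). \<exists>q\<in>K n. (if a \<in> conv_seqs then cmod (pser a q) + cmod (pderiv_ser a q) else 1) = 0})"
    unfolding double_zero_def K(3)[symmetric] by (auto simp: add_nonneg_eq_0_iff split: if_splits)
  also have "\<dots> \<in> sets (PiM UNIV (\<lambda>_. borel))"
    using m by blast
  finally show ?thesis by (simp add: pred_def)
qed

text \<open>At a double zero the Jacobian of \<open>root_map t\<close> vanishes, being a multiple of
  the squared modulus of the derivative. The offending coefficient pairs are therefore critical
  values, a null set by Sard.\<close>

lemma double_zero_null:
  assumes t: "t \<in> conv_seqs"
  shows "(\<integral>\<^sup>+x. \<integral>\<^sup>+y. indicator {a. double_zero a} (cons2 x y t) \<partial>lborel \<partial>lborel) = 0"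
proof -
  define S where "S = {v \<in> cplx -` upper_half_disc. det (root_mat t v) = 0}"
  have neg: "negligible (root_map t ` S)"
    by (rule negligible_critical_values[where f'="\<lambda>v h. root_mat t v *v h"])
       (auto simp: S_def intro: root_map_has_derivative[OF t])
  have sub: "double_zero (cons2 (v $ 1) (v $ 2) t) \<Longrightarrow> v \<in> root_map t ` S" for v :: "real^2"
  proof -
    assume "double_zero (cons2 (v $ 1) (v $ 2) t)"
    then obtain z where z: "z \<in> upper_half_disc" "pser (cons2 (v $ 1) (v $ 2) t) z = 0" "pderiv_ser (cons2 (v $ 1) (v $ 2) t) z = 0"
      by (auto simp: double_zero_def)
    then have v: "v $ 1 = coef0 t z" "v $ 2 = coef1 t z" using pser_cons2_eq_0_iff[OF t z(1)] by auto
    obtain u where u: "cplx u = z"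
      by (rule that[of "vector [Re z, Im z]"]) (simp add: complex_eq_iff)
    have "det (root_mat t u) = 0"
      using z v by (simp add: det_root_mat[OF t] u root_jac_def)
    moreover have "root_map t u = v" using v u by (simp add: root_map_def vec_eq_iff forall_2 axis_def)
    ultimately show "v \<in> root_map t ` S" using z u by (auto simp: S_def)
  qed
  have "(\<integral>\<^sup>+x. \<integral>\<^sup>+y. indicator {a. double_zero a} (cons2 x y t) \<partial>lborel \<partial>lborel) =
     (\<integral>\<^sup>+v. indicator {a. double_zero a} (cons2 ((v::real^2) $ 1) (v $ 2) t) \<partial>lborel)"
    by (rule nn_integral_lborel_vec2[where G="\<lambda>p. indicator {a. double_zero a} (cons2 (fst p) (snd p) t)", simplified, symmetric]) measurable
  also have "\<dots> = (\<integral>\<^sup>+v. indicator {a. double_zero a} (cons2 ((v::real^2) $ 1) (v $ 2) t) \<partial>lebesgue)"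
    by (simp add: nn_integral_completion)
  also have "\<dots> = (\<integral>\<^sup>+(v::real^2). 0 \<partial>lebesgue)"
    by (rule nn_integral_cong_AE, rule AE_I'[of "root_map t ` S"])
      (use neg sub in \<open>auto simp: negligible_iff_null_sets indicator_def\<close>)
  finally show ?thesis by simp
qed

lemma AE_gauss_no_double_zero: "AE a in gauss. \<not> double_zero a"
proof -
  have "(\<integral>\<^sup>+a. indicator {a. double_zero a} a \<partial>gauss) =
    (\<integral>\<^sup>+t. \<integral>\<^sup>+x. \<integral>\<^sup>+y. ennreal (std_normal_density x * std_normal_density y) * indicator {a. double_zero a} (cons2 x y t) \<partial>lborel \<partial>lborel \<partial>gauss)"
    by (rule nn_integral_gauss_cons2) measurable
  also have "\<dots> \<le> (\<integral>\<^sup>+t. \<integral>\<^sup>+x. \<integral>\<^sup>+y. 1 * indicator {a. double_zero a} (cons2 x y t) \<partial>lborel \<partial>lborel \<partial>gauss)"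
    by (intro nn_integral_mono mult_right_mono)
      (auto intro!: mult_le_one simp: std_normal_density_le_1 normal_density_nonneg ennreal_le_1)
  also have "\<dots> = (\<integral>\<^sup>+t. 0 \<partial>gauss)"
    using AE_gauss_conv by (intro nn_integral_cong_AE) (auto elim!: eventually_mono simp: double_zero_null)
  finally have "(\<integral>\<^sup>+a. indicator {a. double_zero a} a \<partial>gauss) = 0" by simp
  then have "AE a in gauss. indicator {a. double_zero a} a = (0::ennreal)"
    by (subst (asm) nn_integral_0_iff_AE) measurable
  then show ?thesis by eventually_elim (auto simp: indicator_def split: if_splits)
qed

lemma AE_gauss_nondeg: "AE a in gauss. nondeg a"
proof -
  have "AE x in gauss1. x \<noteq> 0"
  proof -
    have "AE x in lborel. x \<noteq> (0::real)" by (rule AE_lborel_singleton)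
    then show ?thesis by (subst AE_density) auto
  qed
  then have "AE a in gauss. a 0 \<noteq> 0"
    unfolding gauss_def by (intro AE_PiM_component prob_space_gauss1) auto
  then show ?thesis using AE_gauss_conv
    by eventually_elim (auto simp: nondeg_def)
qed

lemma num_zeros_eq_zcount:
  assumes nd: "nondeg a" and simple: "\<not> double_zero a" and B: "B \<subseteq> upper_half_disc"
  shows "num_zeros (pser a) B = zcount a B"
proof -
  have a: "a \<in> conv_seqs" using nd by (simp add: nondeg_def)
  have z1: "zorder (pser a) z = 1" if z: "z \<in> B" "pser a z = 0" for z
  proof (rule zorder_zero_eqI[OF pser_holomorphic[OF a] open_ball])
    have zz: "z \<in> upper_half_disc" "cmod z < 1" using z B by (auto simp: upper_half_disc_def)
    show "z \<in> ball 0 1" using zz by simp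
    have "pderiv_ser a z \<noteq> 0" using simple a zz z by (auto simp: double_zero_def)
    then show "(deriv ^^ nat 1) (pser a) z \<noteq> 0"
      using DERIV_imp_deriv[OF has_field_derivative_pser[OF a zz(2)]] by simp
    show "(deriv ^^ i) (pser a) z = 0" if "i < nat 1" for i using that z by simp
  qed simp
  have "num_zeros (pser a) B = (\<integral>\<^sup>+z. 1 \<partial>count_space {z\<in>B. pser a z = 0})"
    unfolding num_zeros_def by (rule nn_integral_cong) (simp add: z1)
  also have "\<dots> = emeasure (count_space {z\<in>B. pser a z = 0}) {z\<in>B. pser a z = 0}"
    by simp
  also have "\<dots> = emeasure (count_space UNIV) {z\<in>B. pser a z = 0}"
    by (cases "finite {z\<in>B. pser a z = 0}") simp_all
  also have "{z\<in>B. pser a z = 0} = zeros a \<inter> B"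
    using nd B by (auto simp: zeros_def upper_half_disc_def)
  finally show ?thesis by (simp add: zcount_def)
qed

lemma AE_gauss_num_zeros:
  "AE a in gauss. \<forall>B. B \<subseteq> upper_half_disc \<longrightarrow> num_zeros (pser a) B = zcount a B"
  using AE_gauss_no_double_zero AE_gauss_nondeg
  by eventually_elim (simp add: num_zeros_eq_zcount)

text \<open>\<open>law_const z\<close> times the squared modulus of the derivative of the Blaschke
  product at its zero \<open>z\<close>, divided by \<open>Im z\<close>: everything in the intensity
  at \<open>z\<close> that does not depend on the random series.\<close>

definition palm_weight :: "complex \<Rightarrow> real" where
  "palm_weight z = 2 * Im z / (pi * (1 - (cmod z)\<^sup>2) * cmod (1 - z\<^sup>2))"

lemma blaschke2_has_derivative:
  assumes z: "z \<in> upper_half_disc"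
  shows "(blaschke2 z has_field_derivative (z - cnj z) / ((1 - z * cnj z) * (1 - z * z))) (at z)"
proof -
  note zf = upper_half_discD[OF z]
  have nz: "1 - z * cnj z \<noteq> 0" "1 - z * z \<noteq> 0"
    using one_minus_mult_neq_0[OF zf(1), of "cnj z"] one_minus_mult_neq_0[OF zf(1), of z] zf by auto
  define g where "g u = (u - cnj z) / ((1 - u * cnj z) * (1 - u * z))" for u
  have "g field_differentiable (at z)"
    unfolding g_def by (intro derivative_intros) (use nz in auto)
  then obtain g' where "(g has_field_derivative g') (at z)" by (auto simp: field_differentiable_def)
  then have "((\<lambda>u. (u - z) * g u) has_field_derivative g z) (at z)"
    by (auto intro!: derivative_eq_intros)
  then show ?thesis by (simp add: g_def blaschke2_def[abs_def])
qed

lemma pderiv_ser_lift: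
  assumes z: "z \<in> upper_half_disc" and b: "b \<in> conv_seqs"
  shows "pderiv_ser (blaschke_lift z 0 0 b) z = (z - cnj z) / ((1 - z * cnj z) * (1 - z * z)) * pser b z"
proof (rule pderiv_ser_unique)
  note zf = upper_half_discD[OF z]
  show "blaschke_lift z 0 0 b \<in> conv_seqs" by (rule pser_blaschke_lift(1)[OF z b zf(1)])
  have "((\<lambda>u. blaschke2 z u * pser b u) has_field_derivative (z - cnj z) / ((1 - z * cnj z) * (1 - z * z)) * pser b z) (at z)"
  proof -
    have b0: "blaschke2 z z = 0" by (simp add: blaschke2_def)
    show ?thesis
      using DERIV_mult[OF blaschke2_has_derivative[OF z] has_field_derivative_pser[OF b zf(1)]] by (simp add: b0)
  qed
  then show "(pser (blaschke_lift z 0 0 b) has_field_derivative (z - cnj z) / ((1 - z * cnj z) * (1 - z * z)) * pser b z) (at z)"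
    by (rule has_field_derivative_transform_within_open[of _ _ _ "ball 0 1"])
       (use zf pser_blaschke_lift(2)[OF z b] in auto)
qed (use upper_half_discD[OF z] in auto)

lemma palm_weight_eq:
  assumes z: "z \<in> upper_half_disc"
  shows "law_const z * (cmod ((z - cnj z) / ((1 - z * cnj z) * (1 - z * z))))\<^sup>2 / Im z = palm_weight z"
proof -
  note zf = upper_half_discD[OF z]
  have r1: "(cmod z)\<^sup>2 < 1" using zf by (simp add: abs_square_less_1)
  have "cmod (1 - z\<^sup>2) \<noteq> 0" using one_minus_mult_neq_0[OF zf(1) zf(1)] by (simp add: power2_eq_square)
  moreover have "1 - z * cnj z = complex_of_real (1 - (cmod z)\<^sup>2)" by (simp only: complex_norm_square of_real_diff of_real_1)
  then have "cmod (1 - z * cnj z) = 1 - (cmod z)\<^sup>2" using r1 by (simp only: norm_of_real)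
  moreover have "z - cnj z = of_real (2 * Im z) * \<i>" by (simp add: complex_eq_iff)
  then have "cmod (z - cnj z) = 2 * Im z" using zf by (simp only: norm_mult norm_of_real) simp
  ultimately have e: "cmod ((z - cnj z) / ((1 - z * cnj z) * (1 - z * z))) = 2 * Im z / ((1 - (cmod z)\<^sup>2) * cmod (1 - z\<^sup>2))"
    by (simp add: norm_mult norm_divide power2_eq_square)
  moreover have "1 - (cmod z)\<^sup>2 \<noteq> 0" using r1 by simp
  ultimately show ?thesis using \<open>cmod (1 - z\<^sup>2) \<noteq> 0\<close> zf
    unfolding law_const_def palm_weight_def e
    by (simp add: power2_eq_square divide_simps)
qed

text \<open>The area formula replaces the count by an integral over the position \<open>z\<close>
  with Jacobian \<open>root_jac\<close>, and \<open>conditional_law\<close> replaces the series by a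
  Blaschke lift with zero initial state. The derivative of the lift at \<open>z\<close> is the
  derivative of the Blaschke product times \<open>pser b z\<close>, which explains the extra squared
  modulus.\<close>

lemma palm_formula:
  assumes B: "B \<in> sets borel" "B \<subseteq> upper_half_disc"
    and H [measurable]: "H \<in> borel_measurable (PiM UNIV (\<lambda>_. borel))"
  shows "(\<integral>\<^sup>+a. zcount a B * H a \<partial>gauss) =
    (\<integral>\<^sup>+z. indicator B z * (ennreal (palm_weight z) * (\<integral>\<^sup>+b. ennreal ((cmod (pser b z))\<^sup>2) * H (blaschke_lift z 0 0 b) \<partial>gauss)) \<partial>lborel)"
proof -
  let ?\<phi> = std_normal_density
  interpret G: prob_space gauss by (rule prob_space_gauss)
  interpret LG: pair_sigma_finite "lborel :: complex measure" gauss ..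
  have Bball: "B \<subseteq> ball 0 1" using B(2) by (auto simp: upper_half_disc_def)
  note [measurable] = B(1)
  note zm = zcount_measurable[OF B(1) Bball]
  have [measurable]: "(\<lambda>a. zcount a B) \<in> borel_measurable (PiM UNIV (\<lambda>_. borel))" by (rule zm)
  have "(\<integral>\<^sup>+a. zcount a B * H a \<partial>gauss) =
    (\<integral>\<^sup>+t. \<integral>\<^sup>+x. \<integral>\<^sup>+y. ennreal (?\<phi> x * ?\<phi> y) * (zcount (cons2 x y t) B * H (cons2 x y t)) \<partial>lborel \<partial>lborel \<partial>gauss)"
    by (rule nn_integral_gauss_cons2) measurable
  also have "\<dots> = (\<integral>\<^sup>+t. \<integral>\<^sup>+z. (ennreal (?\<phi> (coef0 t z) * ?\<phi> (coef1 t z)) * H (cons2 (coef0 t z) (coef1 t z) t)) * ennreal (root_jac t z) * indicator B z \<partial>lborel \<partial>gauss)"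
  proof (rule nn_integral_cong_AE)
    show "AE t in gauss. (\<integral>\<^sup>+x. \<integral>\<^sup>+y. ennreal (?\<phi> x * ?\<phi> y) * (zcount (cons2 x y t) B * H (cons2 x y t)) \<partial>lborel \<partial>lborel) =
      (\<integral>\<^sup>+z. (ennreal (?\<phi> (coef0 t z) * ?\<phi> (coef1 t z)) * H (cons2 (coef0 t z) (coef1 t z) t)) * ennreal (root_jac t z) * indicator B z \<partial>lborel)"
      using AE_gauss_conv
    proof eventually_elim
      case (elim t)
      have "(\<integral>\<^sup>+x. \<integral>\<^sup>+y. ennreal (?\<phi> x * ?\<phi> y) * (zcount (cons2 x y t) B * H (cons2 x y t)) \<partial>lborel \<partial>lborel) =
        (\<integral>\<^sup>+x. \<integral>\<^sup>+y. (ennreal (?\<phi> x * ?\<phi> y) * H (cons2 x y t)) * zcount (cons2 x y t) B \<partial>lborel \<partial>lborel)"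
        by (simp add: ac_simps)
      also have "\<dots> = (\<integral>\<^sup>+z. (ennreal (?\<phi> (coef0 t z) * ?\<phi> (coef1 t z)) * H (cons2 (coef0 t z) (coef1 t z) t)) * ennreal (root_jac t z) * indicator B z \<partial>lborel)"
        by (rule root_area_formula[OF elim B, where K="\<lambda>p. ennreal (?\<phi> (fst p) * ?\<phi> (snd p)) * H (cons2 (fst p) (snd p) t)", simplified]) measurable
      finally show ?case .
    qed
  qed
  also have "\<dots> = (\<integral>\<^sup>+z. \<integral>\<^sup>+t. (ennreal (?\<phi> (coef0 t z) * ?\<phi> (coef1 t z)) * H (cons2 (coef0 t z) (coef1 t z) t)) * ennreal (root_jac t z) * indicator B z \<partial>gauss \<partial>lborel)"
    by (rule LG.Fubini') measurable
  also have "\<dots> = (\<integral>\<^sup>+z. indicator B z * (ennreal (palm_weight z) * (\<integral>\<^sup>+b. ennreal ((cmod (pser b z))\<^sup>2) * H (blaschke_lift z 0 0 b) \<partial>gauss)) \<partial>lborel)"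
  proof (rule nn_integral_cong)
    fix z
    show "(\<integral>\<^sup>+t. (ennreal (?\<phi> (coef0 t z) * ?\<phi> (coef1 t z)) * H (cons2 (coef0 t z) (coef1 t z) t)) * ennreal (root_jac t z) * indicator B z \<partial>gauss) =
      indicator B z * (ennreal (palm_weight z) * (\<integral>\<^sup>+b. ennreal ((cmod (pser b z))\<^sup>2) * H (blaschke_lift z 0 0 b) \<partial>gauss))"
    proof (cases "z \<in> B")
      case True
      then have z: "z \<in> upper_half_disc" using B by auto
      note zf = upper_half_discD[OF z]
      define \<Psi> where "\<Psi> a = H a * ennreal ((cmod (pderiv_ser a z))\<^sup>2 / Im z)" for a
      have [measurable]: "\<Psi> \<in> borel_measurable (PiM UNIV (\<lambda>_. borel))" unfolding \<Psi>_def by measurable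
      have [measurable]: "(\<lambda>b. blaschke_lift z 0 0 b) \<in> measurable (PiM UNIV (\<lambda>_. borel)) (PiM UNIV (\<lambda>_. borel))"
        unfolding blaschke_lift_def by measurable
      define \<beta> where "\<beta> = (z - cnj z) / ((1 - z * cnj z) * (1 - z * z))"
      have "(\<integral>\<^sup>+t. (ennreal (?\<phi> (coef0 t z) * ?\<phi> (coef1 t z)) * H (cons2 (coef0 t z) (coef1 t z) t)) * ennreal (root_jac t z) * indicator B z \<partial>gauss) =
        (\<integral>\<^sup>+t. ennreal (?\<phi> (coef0 t z) * ?\<phi> (coef1 t z)) * \<Psi> (cons2 (coef0 t z) (coef1 t z) t) \<partial>gauss)"
        using True by (simp add: \<Psi>_def root_jac_def mult.assoc)
      also have "\<dots> = ennreal (law_const z) * (\<integral>\<^sup>+b. \<Psi> (blaschke_lift z 0 0 b) \<partial>gauss)"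
        by (rule conditional_law[OF z]) measurable
      also have "(\<integral>\<^sup>+b. \<Psi> (blaschke_lift z 0 0 b) \<partial>gauss) =
         (\<integral>\<^sup>+b. ennreal ((cmod \<beta>)\<^sup>2 / Im z) * (ennreal ((cmod (pser b z))\<^sup>2) * H (blaschke_lift z 0 0 b)) \<partial>gauss)"
      proof (rule nn_integral_cong_AE)
        show "AE b in gauss. \<Psi> (blaschke_lift z 0 0 b) = ennreal ((cmod \<beta>)\<^sup>2 / Im z) * (ennreal ((cmod (pser b z))\<^sup>2) * H (blaschke_lift z 0 0 b))"
          using AE_gauss_conv
        proof eventually_elim
          case (elim b)
          have "(cmod (pderiv_ser (blaschke_lift z 0 0 b) z))\<^sup>2 / Im z = (cmod \<beta>)\<^sup>2 / Im z * (cmod (pser b z))\<^sup>2"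
            unfolding pderiv_ser_lift[OF z elim] \<beta>_def[symmetric] by (simp add: norm_mult power_mult_distrib)
          then have "ennreal ((cmod (pderiv_ser (blaschke_lift z 0 0 b) z))\<^sup>2 / Im z) = ennreal ((cmod \<beta>)\<^sup>2 / Im z) * ennreal ((cmod (pser b z))\<^sup>2)"
            using zf by (simp only: ennreal_mult zero_le_power2 divide_nonneg_pos)
          then show ?case unfolding \<Psi>_def by (simp only: ac_simps)
        qed
      qed
      also have "\<dots> = ennreal ((cmod \<beta>)\<^sup>2 / Im z) * (\<integral>\<^sup>+b. ennreal ((cmod (pser b z))\<^sup>2) * H (blaschke_lift z 0 0 b) \<partial>gauss)"
        by (rule nn_integral_cmult) measurable
      also have "ennreal (law_const z) * (ennreal ((cmod \<beta>)\<^sup>2 / Im z) * (\<integral>\<^sup>+b. ennreal ((cmod (pser b z))\<^sup>2) * H (blaschke_lift z 0 0 b) \<partial>gauss)) =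
         ennreal (law_const z * (cmod \<beta>)\<^sup>2 / Im z) * (\<integral>\<^sup>+b. ennreal ((cmod (pser b z))\<^sup>2) * H (blaschke_lift z 0 0 b) \<partial>gauss)"
      proof -
        have "law_const z \<ge> 0" unfolding law_const_def using zf by (simp add: abs_square_le_1)
        then have "ennreal (law_const z * ((cmod \<beta>)\<^sup>2 / Im z)) = ennreal (law_const z) * ennreal ((cmod \<beta>)\<^sup>2 / Im z)"
          using zf by (intro ennreal_mult) auto
        then show ?thesis by (simp add: mult.assoc)
      qed
      also have "law_const z * (cmod \<beta>)\<^sup>2 / Im z = palm_weight z"
        unfolding \<beta>_def by (rule palm_weight_eq[OF z])
      finally show ?thesis using True by simp
    qed simp
  qed
  finally show ?thesis .
qed

section \<open>Factorial moment measures\<close>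

text \<open>The lift adds only the zeros \<open>z\<close> and \<open>cnj z\<close>; the first is
  excluded from \<open>B\<close> by assumption and the second lies in the lower half plane.\<close>

lemma zcount_blaschke_lift:
  assumes z: "z \<in> upper_half_disc" and b: "nondeg b" and B: "B \<subseteq> upper_half_disc" "z \<notin> B"
  shows "zcount (blaschke_lift z 0 0 b) B = zcount b B"
proof -
  note zf = upper_half_discD[OF z]
  have bc: "b \<in> conv_seqs" using b by (simp add: nondeg_def)
  let ?c = "blaschke_lift z 0 0 b"
  have c: "?c \<in> conv_seqs" by (rule pser_blaschke_lift(1)[OF z bc zf(1)])
  have ps: "pser ?c u = blaschke2 z u * pser b u" if "cmod u < 1" for u
    using pser_blaschke_lift(2)[OF z bc that, of 0 0] by simp
  have bl0: "blaschke2 z u = 0 \<longleftrightarrow> u = z \<or> u = cnj z" if "cmod u < 1" for u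
    using one_minus_mult_neq_0[OF that, of z] one_minus_mult_neq_0[OF that, of "cnj z"] zf
    by (simp add: blaschke2_def)
  have "\<exists>k. ?c k \<noteq> 0"
  proof (rule ccontr)
    assume "\<not> ?thesis"
    then have 0: "pser ?c u = 0" for u by (simp add: pser_def)
    \<comment> \<open>If the lift were the zero sequence, \<open>pser b\<close> would vanish off the
      two zeros of the Blaschke product and hence identically.\<close>
    have "b k = 0" for k
    proof (rule pser_zero_imp_zero_open[OF bc, of "ball 0 1 - {z, cnj z}"])
      show "open (ball 0 1 - {z, cnj z})" by (intro open_Diff) auto
      have "infinite (ball (0::complex) 1)"
        using uncountable_ball[of 1 "0::complex"] countable_finite by auto
      then have "infinite (ball (0::complex) 1 - {z, cnj z})" by simp
      then show "ball 0 1 - {z, cnj z} \<noteq> {}" by (metis finite.emptyI)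
      fix u assume "u \<in> ball 0 1 - {z, cnj z}"
      then show "pser b u = 0" using ps[of u] bl0[of u] 0[of u] by auto
    qed auto
    then show False using b by (auto simp: nondeg_def)
  qed
  then have "nondeg ?c" using c by (simp add: nondeg_def)
  have "zeros ?c \<inter> B = zeros b \<inter> B"
  proof -
    have "pser ?c u = 0 \<longleftrightarrow> pser b u = 0" if "u \<in> B" for u
    proof -
      have u: "cmod u < 1" "Im u > 0" using that B by (auto simp: upper_half_disc_def)
      have "u \<noteq> z" using that B by auto
      moreover have "u \<noteq> cnj z" using u zf by auto
      ultimately show ?thesis using ps[OF u(1)] bl0[OF u(1)] by simp
    qed
    then show ?thesis using \<open>nondeg ?c\<close> b by (auto simp: zeros_def)
  qed
  then show ?thesis by (simp add: zcount_def)
qed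

text \<open>The list holds the points already produced by earlier Palm steps, the indexed family
  those still to be integrated. The induction moves points from one to the other.\<close>

definition sqprod :: "complex list \<Rightarrow> nat \<Rightarrow> (nat \<Rightarrow> complex) \<Rightarrow> (nat \<Rightarrow> real) \<Rightarrow> ennreal" where
  "sqprod xs n z a = (\<Prod>x\<leftarrow>xs. ennreal ((cmod (pser a x))\<^sup>2)) * (\<Prod>i\<in>{1..n}. ennreal ((cmod (pser a (z i)))\<^sup>2))"

definition sqmoment :: "complex list \<Rightarrow> nat \<Rightarrow> (nat \<Rightarrow> complex) \<Rightarrow> ennreal" where
  "sqmoment xs n z = (\<integral>\<^sup>+a. sqprod xs n z a \<partial>gauss)"

text \<open>The inner range \<open>j < i\<close> reflects that zeros are extracted from the last
  index downwards: the factor left at \<open>z i\<close> picks up a Blaschke value for each zero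
  extracted after it.\<close>

definition weight :: "nat \<Rightarrow> (nat \<Rightarrow> complex) \<Rightarrow> ennreal" where
  "weight n z = (\<Prod>i\<in>{1..n}. ennreal (palm_weight (z i)) * (\<Prod>j\<in>{1..<i}. ennreal ((cmod (blaschke2 (z j) (z i)))\<^sup>2)))"

text \<open>The Blaschke values that the listed points collect from all the zeros extracted
  later.\<close>

definition cross :: "complex list \<Rightarrow> nat \<Rightarrow> (nat \<Rightarrow> complex) \<Rightarrow> ennreal" where
  "cross xs n z = (\<Prod>x\<leftarrow>xs. \<Prod>i\<in>{1..n}. ennreal ((cmod (blaschke2 (z i) x))\<^sup>2))"

lemma prod_list_map_measurable [measurable (raw)]:
  fixes f :: "'a \<Rightarrow> 'b \<Rightarrow> ennreal"
  assumes "\<And>x. f x \<in> borel_measurable M" shows "(\<lambda>a. \<Prod>x\<leftarrow>xs. f x a) \<in> borel_measurable M"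
  by (induction xs) (auto intro!: borel_measurable_times_ennreal assms)

lemma sqprod_measurable [measurable (raw)]:
  assumes [measurable]: "f \<in> measurable M (PiM UNIV (\<lambda>_. borel))" "\<And>i. i \<in> {1..n} \<Longrightarrow> (\<lambda>x. g x i) \<in> borel_measurable M"
  shows "(\<lambda>x. sqprod xs n (g x) (f x)) \<in> borel_measurable M"
  unfolding sqprod_def by measurable

lemma sqmoment_measurable [measurable (raw)]:
  assumes g: "\<And>i. i \<in> {1..n} \<Longrightarrow> (\<lambda>x. g x i) \<in> borel_measurable M"
  shows "(\<lambda>x. sqmoment xs n (g x)) \<in> borel_measurable M"
proof -
  interpret G: prob_space gauss by (rule prob_space_gauss)
  have [measurable]: "(\<lambda>p. g (fst p) i) \<in> borel_measurable (M \<Otimes>\<^sub>M gauss)" if "i \<in> {1..n}" for i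
    by (rule measurable_compose[OF measurable_fst g[OF that]])
  show ?thesis unfolding sqmoment_def
    by (rule G.borel_measurable_nn_integral) (unfold case_prod_beta, measurable)
qed

lemma cnj_measurable [measurable]: "cnj \<in> borel_measurable borel"
  by (intro borel_measurable_continuous_onI continuous_intros)

lemma blaschke2_measurable [measurable (raw)]:
  assumes [measurable]: "f \<in> borel_measurable M" "g \<in> borel_measurable M"
  shows "(\<lambda>x. blaschke2 (f x) (g x)) \<in> borel_measurable M"
  unfolding blaschke2_def by measurable

lemma palm_weight_measurable [measurable (raw)]:
  assumes [measurable]: "f \<in> borel_measurable M"
  shows "(\<lambda>x. palm_weight (f x)) \<in> borel_measurable M"
  unfolding palm_weight_def by measurable

lemma weight_measurable [measurable (raw)]:
  assumes [measurable]: "\<And>i. i \<in> {1..n} \<Longrightarrow> (\<lambda>x. g x i) \<in> borel_measurable M"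
  shows "(\<lambda>x. weight n (g x)) \<in> borel_measurable M"
  unfolding weight_def
proof (rule borel_measurable_prod_ennreal)
  fix i assume i: "i \<in> {1..n}"
  show "(\<lambda>x. ennreal (palm_weight (g x i)) * (\<Prod>j\<in>{1..<i}. ennreal ((cmod (blaschke2 (g x j) (g x i)))\<^sup>2))) \<in> borel_measurable M"
  proof (rule borel_measurable_times_ennreal, goal_cases)
    case 1
    note [measurable] = assms[OF i]
    show ?case by measurable
  next
    case 2
    show ?case
    proof (rule borel_measurable_prod_ennreal)
      fix j assume "j \<in> {1..<i}"
      then have "j \<in> {1..n}" using i by auto
      note [measurable] = assms[OF this] assms[OF i]
      show "(\<lambda>x. ennreal ((cmod (blaschke2 (g x j) (g x i)))\<^sup>2)) \<in> borel_measurable M" by measurable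
    qed
  qed
qed

lemma cross_measurable [measurable (raw)]:
  assumes [measurable]: "\<And>i. i \<in> {1..n} \<Longrightarrow> (\<lambda>x. g x i) \<in> borel_measurable M"
  shows "(\<lambda>x. cross xs n (g x)) \<in> borel_measurable M"
  unfolding cross_def by measurable

lemma sqprod_lift:
  assumes z: "z \<in> upper_half_disc" and b: "b \<in> conv_seqs" and xs: "set xs \<subseteq> upper_half_disc"
  shows "(\<Prod>x\<leftarrow>xs. ennreal ((cmod (pser (blaschke_lift z 0 0 b) x))\<^sup>2)) =
    (\<Prod>x\<leftarrow>xs. ennreal ((cmod (blaschke2 z x))\<^sup>2)) * (\<Prod>x\<leftarrow>xs. ennreal ((cmod (pser b x))\<^sup>2))"
  using xs
proof (induction xs)
  case (Cons x xs)
  have "cmod x < 1" using Cons.prems by (auto simp: upper_half_disc_def)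
  then have "pser (blaschke_lift z 0 0 b) x = blaschke2 z x * pser b x"
    using pser_blaschke_lift(2)[OF z b, of x 0 0] by simp
  then have "ennreal ((cmod (pser (blaschke_lift z 0 0 b) x))\<^sup>2) = ennreal ((cmod (blaschke2 z x))\<^sup>2) * ennreal ((cmod (pser b x))\<^sup>2)"
    by (simp add: norm_mult power_mult_distrib ennreal_mult)
  then show ?case using Cons by (simp add: ac_simps)
qed simp

text \<open>Induction with the list generalised. The Palm formula at the last set contributes the
  squared modulus of the new series at \<open>z\<close>, so \<open>z\<close> joins the list, while
  the points already listed are multiplied by Blaschke values. The remaining counts do not change
  because the sets are disjoint.\<close>

lemma correlation_formula:
  assumes xs: "set xs \<subseteq> upper_half_disc"
    and B: "\<And>i. i \<in> {1..n} \<Longrightarrow> B i \<in> sets borel" "\<And>i. i \<in> {1..n} \<Longrightarrow> B i \<subseteq> upper_half_disc" "disjoint_family_on B {1..n}"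
  shows "(\<integral>\<^sup>+a. sqprod xs 0 undefined a * (\<Prod>i\<in>{1..n}. zcount a (B i)) \<partial>gauss) =
    (\<integral>\<^sup>+z. indicator (PiE {1..n} B) z * (weight n z * cross xs n z * sqmoment xs n z) \<partial>(PiM {1..n} (\<lambda>_. lborel)))"
  using xs B
proof (induction n arbitrary: xs)
  case 0
  have "(\<integral>\<^sup>+z. indicator (PiE {} B) z * (weight 0 z * cross xs 0 z * sqmoment xs 0 z) \<partial>(PiM {} (\<lambda>_. lborel))) = sqmoment xs 0 undefined"
  proof -
    have "(\<Prod>x\<leftarrow>xs. (1::ennreal)) = 1" by (induction xs) simp_all
    then show ?thesis
      by (simp add: PiM_empty nn_integral_count_space_finite weight_def cross_def sqmoment_def sqprod_def)
  qed
  then show ?case by (simp add: sqmoment_def sqprod_def)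
next
  case (Suc n)
  interpret P: product_sigma_finite "\<lambda>_::nat. lborel :: complex measure" ..
  interpret G: prob_space gauss by (rule prob_space_gauss)
  have Bn: "B (Suc n) \<in> sets borel" "B (Suc n) \<subseteq> upper_half_disc" using Suc.prems(2,3)[of "Suc n"] by auto
  note [measurable] = Bn(1)
  have Bm [measurable]: "i \<in> {1..n} \<Longrightarrow> B i \<in> sets borel" for i using Suc.prems(2)[of i] by simp
  have Bsub: "i \<in> {1..n} \<Longrightarrow> B i \<subseteq> upper_half_disc" for i using Suc.prems(3)[of i] by simp
  have dis: "disjoint_family_on B {1..n}" using Suc.prems(4) by (rule disjoint_family_on_mono[rotated]) auto
  have notin: "z \<notin> B i" if "z \<in> B (Suc n)" "i \<in> {1..n}" for z i
  proof -
    have "B (Suc n) \<inter> B i = {}"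
      by (rule disjoint_family_onD[OF Suc.prems(4)]) (use that in auto)
    then show ?thesis using that(1) by blast
  qed
  have [measurable]: "(\<lambda>a. zcount a (B i)) \<in> borel_measurable (PiM UNIV (\<lambda>_. borel))" if "i \<in> {1..n}" for i
    by (rule zcount_measurable[OF Bm[OF that]]) (use Bsub[OF that] in \<open>auto simp: upper_half_disc_def\<close>)
  define H where "H a = sqprod xs 0 undefined a * (\<Prod>i\<in>{1..n}. zcount a (B i))" for a
  have [measurable]: "H \<in> borel_measurable (PiM UNIV (\<lambda>_. borel))" unfolding H_def by measurable
  define f where "f w = indicator (PiE {1..Suc n} B) w * (weight (Suc n) w * cross xs (Suc n) w * sqmoment xs (Suc n) w)" for w
  have ins: "{1..Suc n} = insert (Suc n) {1..n}" by auto
  have "(\<integral>\<^sup>+a. sqprod xs 0 undefined a * (\<Prod>i\<in>{1..Suc n}. zcount a (B i)) \<partial>gauss) = (\<integral>\<^sup>+a. zcount a (B (Suc n)) * H a \<partial>gauss)"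
    by (simp add: H_def ins ac_simps)
  also have "\<dots> = (\<integral>\<^sup>+z. indicator (B (Suc n)) z * (ennreal (palm_weight z) * (\<integral>\<^sup>+b. ennreal ((cmod (pser b z))\<^sup>2) * H (blaschke_lift z 0 0 b) \<partial>gauss)) \<partial>lborel)"
    by (rule palm_formula[OF Bn]) measurable
  also have "\<dots> = (\<integral>\<^sup>+z. (\<integral>\<^sup>+w. f (w(Suc n := z)) \<partial>(PiM {1..n} (\<lambda>_. lborel))) \<partial>lborel)"
  proof (rule nn_integral_cong)
    fix z :: complex
    show "indicator (B (Suc n)) z * (ennreal (palm_weight z) * (\<integral>\<^sup>+b. ennreal ((cmod (pser b z))\<^sup>2) * H (blaschke_lift z 0 0 b) \<partial>gauss)) =
      (\<integral>\<^sup>+w. f (w(Suc n := z)) \<partial>(PiM {1..n} (\<lambda>_. lborel)))"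
    proof (cases "z \<in> B (Suc n)")
      case False
      then have "f (w(Suc n := z)) = 0" for w
        by (auto simp: f_def indicator_def PiE_iff)
      then show ?thesis using False by simp
    next
      case True
      then have z: "z \<in> upper_half_disc" using Bn by auto
      define k where "k = (\<Prod>x\<leftarrow>xs. ennreal ((cmod (blaschke2 z x))\<^sup>2))"
      have "(\<integral>\<^sup>+b. ennreal ((cmod (pser b z))\<^sup>2) * H (blaschke_lift z 0 0 b) \<partial>gauss) =
        (\<integral>\<^sup>+b. k * (sqprod (z # xs) 0 undefined b * (\<Prod>i\<in>{1..n}. zcount b (B i))) \<partial>gauss)"
      proof (rule nn_integral_cong_AE)
        show "AE b in gauss. ennreal ((cmod (pser b z))\<^sup>2) * H (blaschke_lift z 0 0 b) =
           k * (sqprod (z # xs) 0 undefined b * (\<Prod>i\<in>{1..n}. zcount b (B i)))"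
          using AE_gauss_nondeg
        proof eventually_elim
          case (elim b)
          then have b: "b \<in> conv_seqs" by (simp add: nondeg_def)
          have "(\<Prod>i\<in>{1..n}. zcount (blaschke_lift z 0 0 b) (B i)) = (\<Prod>i\<in>{1..n}. zcount b (B i))"
            by (rule prod.cong[OF refl]) (rule zcount_blaschke_lift[OF z elim Bsub notin[OF True]])
          then show ?case unfolding H_def sqprod_def k_def
            using sqprod_lift[OF z b Suc.prems(1)] by (simp add: ac_simps)
        qed
      qed
      also have "\<dots> = k * (\<integral>\<^sup>+b. sqprod (z # xs) 0 undefined b * (\<Prod>i\<in>{1..n}. zcount b (B i)) \<partial>gauss)"
        by (rule nn_integral_cmult) measurable
      also have "(\<integral>\<^sup>+b. sqprod (z # xs) 0 undefined b * (\<Prod>i\<in>{1..n}. zcount b (B i)) \<partial>gauss) =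
        (\<integral>\<^sup>+w. indicator (PiE {1..n} B) w * (weight n w * cross (z # xs) n w * sqmoment (z # xs) n w) \<partial>(PiM {1..n} (\<lambda>_. lborel)))"
        by (rule Suc.IH) (use Suc.prems z dis in auto)
      finally have "indicator (B (Suc n)) z * (ennreal (palm_weight z) * (\<integral>\<^sup>+b. ennreal ((cmod (pser b z))\<^sup>2) * H (blaschke_lift z 0 0 b) \<partial>gauss)) =
         (ennreal (palm_weight z) * k) * (\<integral>\<^sup>+w. indicator (PiE {1..n} B) w * (weight n w * cross (z # xs) n w * sqmoment (z # xs) n w) \<partial>(PiM {1..n} (\<lambda>_. lborel)))"
        using True by (simp add: mult.assoc)
      also have "\<dots> = (\<integral>\<^sup>+w. (ennreal (palm_weight z) * k) * (indicator (PiE {1..n} B) w * (weight n w * cross (z # xs) n w * sqmoment (z # xs) n w)) \<partial>(PiM {1..n} (\<lambda>_. lborel)))"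
        by (rule nn_integral_cmult[symmetric]) measurable
      also have "\<dots> = (\<integral>\<^sup>+w. f (w(Suc n := z)) \<partial>(PiM {1..n} (\<lambda>_. lborel)))"
      proof (rule nn_integral_cong)
        fix w :: "nat \<Rightarrow> complex" assume "w \<in> space (PiM {1..n} (\<lambda>_. lborel))"
        then have we: "w \<in> extensional {1..n}" by (simp add: space_PiM PiE_def)
        define w' where "w' = w(Suc n := z)"
        have w': "i \<in> {1..n} \<Longrightarrow> w' i = w i" "w' (Suc n) = z" for i by (auto simp: w'_def)
        have ind: "indicator (PiE {1..Suc n} B) w' = (indicator (PiE {1..n} B) w :: ennreal)"
        proof -
          have "w' \<in> PiE {1..Suc n} B \<longleftrightarrow> w \<in> PiE {1..n} B"
            using True we by (auto simp: w'_def PiE_iff extensional_def)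
          then show ?thesis by (simp add: indicator_def)
        qed
        have wt: "weight (Suc n) w' = weight n w * (ennreal (palm_weight z) * (\<Prod>j\<in>{1..n}. ennreal ((cmod (blaschke2 (w j) z))\<^sup>2)))"
        proof -
          have "weight (Suc n) w' = ennreal (palm_weight (w' (Suc n))) * (\<Prod>j\<in>{1..<Suc n}. ennreal ((cmod (blaschke2 (w' j) (w' (Suc n))))\<^sup>2)) * weight n w'"
            unfolding weight_def ins by (subst prod.insert) auto
          moreover have "weight n w' = weight n w"
            unfolding weight_def by (intro prod.cong refl arg_cong2[where f="(*)"]) (auto simp: w')
          moreover have "(\<Prod>j\<in>{1..<Suc n}. ennreal ((cmod (blaschke2 (w' j) z))\<^sup>2)) = (\<Prod>j\<in>{1..n}. ennreal ((cmod (blaschke2 (w j) z))\<^sup>2))"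
            by (rule prod.cong) (auto simp: w')
          ultimately show ?thesis by (simp add: w' ac_simps)
        qed
        have cr: "cross xs (Suc n) w' = k * cross xs n w"
        proof -
          have "cross xs (Suc n) w' = (\<Prod>x\<leftarrow>xs. ennreal ((cmod (blaschke2 z x))\<^sup>2) * (\<Prod>i\<in>{1..n}. ennreal ((cmod (blaschke2 (w i) x))\<^sup>2)))"
          proof -
            have "(\<Prod>i\<in>{1..Suc n}. ennreal ((cmod (blaschke2 (w' i) x))\<^sup>2)) = ennreal ((cmod (blaschke2 z x))\<^sup>2) * (\<Prod>i\<in>{1..n}. ennreal ((cmod (blaschke2 (w i) x))\<^sup>2))" for x
              unfolding ins by (subst prod.insert) (auto simp: w' intro!: prod.cong arg_cong2[where f="(*)"])
            then show ?thesis unfolding cross_def by simp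
          qed
          also have "\<dots> = k * cross xs n w" unfolding k_def cross_def
            by (induction xs) (simp_all add: ac_simps)
          finally show ?thesis .
        qed
        have cr2: "cross (z # xs) n w = (\<Prod>j\<in>{1..n}. ennreal ((cmod (blaschke2 (w j) z))\<^sup>2)) * cross xs n w"
          by (simp add: cross_def)
        have sq: "sqmoment xs (Suc n) w' = sqmoment (z # xs) n w"
        proof -
          have "sqprod xs (Suc n) w' a = sqprod (z # xs) n w a" for a
            unfolding sqprod_def ins by (subst prod.insert) (auto simp: w' ac_simps intro!: prod.cong arg_cong2[where f="(*)"])
          then show ?thesis by (simp add: sqmoment_def)
        qed
        show "(ennreal (palm_weight z) * k) * (indicator (PiE {1..n} B) w * (weight n w * cross (z # xs) n w * sqmoment (z # xs) n w)) = f (w(Suc n := z))"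
          unfolding f_def w'_def[symmetric] ind wt cr cr2 sq by (simp add: ac_simps)
      qed
      finally show ?thesis .
    qed
  qed
  also have "\<dots> = (\<integral>\<^sup>+w. f w \<partial>(PiM (insert (Suc n) {1..n}) (\<lambda>_. lborel)))"
  proof (rule P.product_nn_integral_insert_rev[symmetric])
    have Bi: "B i \<in> sets lborel" if "i \<in> {1..Suc n}" for i using Suc.prems(2)[OF that] by simp
    have [measurable]: "(\<lambda>w. w i :: complex) \<in> borel_measurable (PiM {1..Suc n} (\<lambda>_. lborel))" if "i \<in> {1..Suc n}" for i
      using measurable_component_singleton[OF that, of "\<lambda>_. lborel :: complex measure"] by simp
    have [measurable]: "PiE {1..Suc n} B \<in> sets (PiM {1..Suc n} (\<lambda>_. lborel))"
      using Bi by (intro sets_PiM_I_finite) auto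
    have "f \<in> borel_measurable (PiM {1..Suc n} (\<lambda>_. lborel))"
      unfolding f_def by measurable
    then show "f \<in> borel_measurable (PiM (insert (Suc n) {1..n}) (\<lambda>_. lborel))"
      by (simp only: ins)
  qed auto
  finally show ?case unfolding f_def ins[symmetric] .
qed

section \<open>Gaussian moments\<close>

definition abs_ser :: "real \<Rightarrow> (nat \<Rightarrow> real) \<Rightarrow> real" where
  "abs_ser r a = (\<Sum>k. \<bar>a k\<bar> * r ^ k)"

text \<open>Split \<open>r\<close> as a square. One factor \<open>sqrt r\<close> damps the
  coefficients, whose supremum is at most the \<open>m\<close>-th root of the sum of
  \<open>m\<close>-th powers; the other makes the series geometric. The right side has a finite
  expectation, computed coordinate by coordinate.\<close>

lemma abs_ser_power_bound:
  assumes "0 \<le> r" "r < 1" "m \<ge> 1" and a: "a \<in> conv_seqs"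
  shows "ennreal (abs_ser r a ^ m) \<le> ennreal (1 / (1 - sqrt r) ^ m) * (\<Sum>k. ennreal (\<bar>a k\<bar> ^ m) * ennreal ((sqrt r ^ m) ^ k))"
proof (cases "(\<Sum>k. ennreal (\<bar>a k\<bar> ^ m) * ennreal ((sqrt r ^ m) ^ k)) = top")
  case True
  define c where "c = 1 / (1 - sqrt r) ^ m"
  have "0 < 1 - sqrt r" using assms by simp
  then have "c > 0" unfolding c_def by (intro divide_pos_pos zero_less_power) simp_all
  then have "ennreal (1 / (1 - sqrt r) ^ m) * top = top" unfolding c_def[symmetric] by (simp add: ennreal_mult_top)
  then show ?thesis unfolding True by simp
next
  case False
  define \<rho> where "\<rho> = sqrt r"
  have \<rho>: "0 \<le> \<rho>" "\<rho> < 1" "\<rho> * \<rho> = r" using assms by (auto simp: \<rho>_def)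
  define \<tau> where "\<tau> = enn2real (\<Sum>k. ennreal (\<bar>a k\<bar> ^ m) * ennreal ((\<rho> ^ m) ^ k))"
  have \<tau>: "ennreal \<tau> = (\<Sum>k. ennreal (\<bar>a k\<bar> ^ m) * ennreal ((\<rho> ^ m) ^ k))" "\<tau> \<ge> 0"
    using False by (simp_all add: \<tau>_def \<rho>_def less_top)
  have "(\<bar>a k\<bar> * \<rho> ^ k) ^ m \<le> \<tau>" for k
  proof -
    have "ennreal ((\<bar>a k\<bar> * \<rho> ^ k) ^ m) = ennreal (\<bar>a k\<bar> ^ m) * ennreal ((\<rho> ^ m) ^ k)"
      using \<rho> by (subst ennreal_mult[symmetric]) (auto simp: power_mult_distrib power_mult[symmetric] mult.commute)
    also have "\<dots> \<le> (\<Sum>k. ennreal (\<bar>a k\<bar> ^ m) * ennreal ((\<rho> ^ m) ^ k))"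
      using sum_le_suminf[of "\<lambda>k. ennreal (\<bar>a k\<bar> ^ m) * ennreal ((\<rho> ^ m) ^ k)" "{k}"] by simp
    finally show ?thesis using \<tau> by (metis ennreal_le_iff)
  qed
  then have b: "\<bar>a k\<bar> * \<rho> ^ k \<le> root m \<tau>" for k
    using \<rho> assms(3) by (metis abs_ge_zero mult_nonneg_nonneg real_root_le_iff real_root_power_cancel zero_le_power not_one_le_zero bot_nat_0.not_eq_extremum)
  have "abs_ser r a \<le> (\<Sum>k. root m \<tau> * \<rho> ^ k)"
    unfolding abs_ser_def
  proof (rule suminf_le)
    fix k
    have "\<bar>a k\<bar> * r ^ k = (\<bar>a k\<bar> * \<rho> ^ k) * \<rho> ^ k" using \<rho>(3) by (metis mult.assoc power_mult_distrib)
    also have "\<dots> \<le> root m \<tau> * \<rho> ^ k" using b \<rho> by (intro mult_right_mono) auto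
    finally show "\<bar>a k\<bar> * r ^ k \<le> root m \<tau> * \<rho> ^ k" .
  next
    show "summable (\<lambda>k. \<bar>a k\<bar> * r ^ k)" using summable_conv_seqs[OF a] assms by simp
    show "summable (\<lambda>k. root m \<tau> * \<rho> ^ k)" using \<rho> by (intro summable_mult summable_geometric) auto
  qed
  also have "\<dots> = root m \<tau> * (1 / (1 - \<rho>))"
    using \<rho> by (subst suminf_mult) (auto intro!: summable_geometric simp: suminf_geometric)
  finally have "abs_ser r a \<le> root m \<tau> * (1 / (1 - \<rho>))" .
  moreover have "0 \<le> abs_ser r a" unfolding abs_ser_def
    using summable_conv_seqs[OF a, of r] assms by (intro suminf_nonneg) auto
  ultimately have "abs_ser r a ^ m \<le> (root m \<tau> * (1 / (1 - \<rho>))) ^ m" by (intro power_mono)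
  also have "\<dots> = (1 / (1 - \<rho>) ^ m) * \<tau>"
    using \<tau>(2) assms(3) by (simp add: power_mult_distrib power_divide)
  finally have "ennreal (abs_ser r a ^ m) \<le> ennreal ((1 / (1 - \<rho>) ^ m) * \<tau>)" by (rule ennreal_leI)
  also have "\<dots> = ennreal (1 / (1 - \<rho>) ^ m) * ennreal \<tau>"
    using \<rho> \<tau> by (intro ennreal_mult) auto
  finally show ?thesis unfolding \<tau>(1) unfolding \<rho>_def .
qed

lemma abs_ser_measurable [measurable]: "abs_ser r \<in> borel_measurable (PiM UNIV (\<lambda>_. borel))"
  unfolding abs_ser_def[abs_def] by measurable

lemma integrable_abs_ser_power:
  assumes "0 \<le> r" "r < 1"
  shows "integrable gauss (\<lambda>a. abs_ser r a ^ m)"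
proof (cases "m = 0")
  case True
  interpret prob_space gauss by (rule prob_space_gauss)
  show ?thesis using True by simp
next
  case False
  then have m: "m \<ge> 1" by simp
  define c where "c = (\<integral>\<^sup>+x. ennreal (\<bar>x\<bar> ^ m) \<partial>gauss1)"
  have c: "c < \<infinity>" unfolding c_def by (rule gauss1_abs_moment_finite)
  have q: "0 \<le> sqrt r ^ m" "sqrt r ^ m < 1" using assms m by (auto simp: power_less_one_iff)
  show ?thesis
  proof (rule integrableI_nonneg)
    show "AE a in gauss. 0 \<le> abs_ser r a ^ m"
      using AE_gauss_conv
    proof eventually_elim
      case (elim a)
      have "0 \<le> abs_ser r a" unfolding abs_ser_def
        using summable_conv_seqs[OF elim, of r] assms by (intro suminf_nonneg) auto
      then show ?case by simp
    qed
    have "(\<integral>\<^sup>+a. ennreal (abs_ser r a ^ m) \<partial>gauss) \<le> (\<integral>\<^sup>+a. ennreal (1 / (1 - sqrt r) ^ m) * (\<Sum>k. ennreal (\<bar>a k\<bar> ^ m) * ennreal ((sqrt r ^ m) ^ k)) \<partial>gauss)"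
      using AE_gauss_conv by (intro nn_integral_mono_AE) (auto elim!: eventually_mono intro: abs_ser_power_bound[OF assms m])
    also have "\<dots> = ennreal (1 / (1 - sqrt r) ^ m) * (\<Sum>k. \<integral>\<^sup>+a. ennreal (\<bar>a k\<bar> ^ m) * ennreal ((sqrt r ^ m) ^ k) \<partial>gauss)"
      by (subst nn_integral_cmult, measurable, subst nn_integral_suminf, measurable)
    also have "(\<Sum>k. \<integral>\<^sup>+a. ennreal (\<bar>a k\<bar> ^ m) * ennreal ((sqrt r ^ m) ^ k) \<partial>gauss) = (\<Sum>k. c * ennreal ((sqrt r ^ m) ^ k))"
    proof (rule arg_cong[where f=suminf], rule ext)
      fix k
      show "(\<integral>\<^sup>+a. ennreal (\<bar>a k\<bar> ^ m) * ennreal ((sqrt r ^ m) ^ k) \<partial>gauss) = c * ennreal ((sqrt r ^ m) ^ k)"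
        unfolding c_def by (subst nn_integral_multc) (auto simp: nn_integral_gauss_component[of "\<lambda>x. ennreal (\<bar>x\<bar> ^ m)"])
    qed
    also have "\<dots> = c * (\<Sum>k. ennreal ((sqrt r ^ m) ^ k))" by (rule ennreal_suminf_cmult)
    also have "(\<Sum>k. ennreal ((sqrt r ^ m) ^ k)) = ennreal (\<Sum>k. (sqrt r ^ m) ^ k)"
      using q by (intro suminf_ennreal2) (auto intro: summable_geometric)
    also have "ennreal (1 / (1 - sqrt r) ^ m) * (c * \<dots>) < \<infinity>" using c by (simp add: ennreal_mult_less_top)
    finally show "(\<integral>\<^sup>+a. ennreal (abs_ser r a ^ m) \<partial>gauss) < \<infinity>" .
  qed measurable
qed

section \<open>Gaussian integration by parts\<close>

lemma gauss1_moment_rec: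
  "(\<integral>x. x ^ Suc m \<partial>gauss1) = real m * (\<integral>x. x ^ (m - 1) \<partial>gauss1)"
proof (cases "even m")
  case True
  then have "(\<integral>x. x ^ Suc m \<partial>gauss1) = 0" by (intro integral_std_normal_distribution_moment_odd) simp
  \<comment> \<open>For \<open>m = 0\<close> the truncated difference \<open>m - 1\<close> is
    harmless, since the factor \<open>real m\<close> vanishes.\<close>
  moreover have "real m * (\<integral>x. x ^ (m - 1) \<partial>gauss1) = 0"
  proof (cases "m = 0")
    case False
    then have "odd (m - 1)" using True by presburger
    then show ?thesis by (simp add: integral_std_normal_distribution_moment_odd)
  qed simp
  ultimately show ?thesis by simp
next
  case False
  then obtain j where j: "m = 2 * j + 1" by (auto elim: oddE)
  have "(\<integral>x. x ^ Suc m \<partial>gauss1) = fact (2 * Suc j) / (2 ^ Suc j * fact (Suc j))"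
    using std_normal_distribution_even_moments(1)[of "Suc j"] by (simp add: j)
  moreover have "(\<integral>x. x ^ (m - 1) \<partial>gauss1) = fact (2 * j) / (2 ^ j * fact j)"
    using std_normal_distribution_even_moments(1)[of j] by (simp add: j)
  moreover have "fact (2 * Suc j) / (2 ^ Suc j * fact (Suc j)) = (2 * real j + 1) * (fact (2 * j) / (2 ^ j * fact j))"
  proof -
    have f1: "(fact (2 * Suc j) :: real) = (2 * real j + 2) * ((2 * real j + 1) * fact (2 * j))"
      by (simp add: algebra_simps)
    have f2: "(2::real) ^ Suc j * fact (Suc j) = (2 * real j + 2) * (2 ^ j * fact j)"
      by (simp add: algebra_simps)
    have f3: "2 * real j + 2 \<noteq> 0" by (metis add_pos_nonneg less_irrefl mult_nonneg_nonneg of_nat_0_le_iff zero_le_numeral zero_less_numeral add.commute)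
    show ?thesis unfolding f1 f2 by (simp only: mult_divide_mult_cancel_left[OF f3] times_divide_eq_right)
  qed
  ultimately show ?thesis by (simp add: j)
qed

lemma integrable_gauss1_poly:
  "integrable gauss1 (\<lambda>x. poly p (complex_of_real x))"
  "integrable gauss1 (\<lambda>x. complex_of_real x * poly p (complex_of_real x))"
proof -
  have i: "integrable gauss1 (\<lambda>x. poly p (complex_of_real x))" for p
    unfolding poly_altdef of_real_power[symmetric]
    by (intro Bochner_Integration.integrable_sum integrable_mult_right integrable_of_real integrable_std_normal_distribution_moment)
  show "integrable gauss1 (\<lambda>x. poly p (complex_of_real x))" by (rule i)
  show "integrable gauss1 (\<lambda>x. complex_of_real x * poly p (complex_of_real x))"
    using i[of "pCons 0 p"] by simp
qed

text \<open>Stein's identity, reduced by linearity to monomials and thus to the moment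
  recursion.\<close>

lemma stein_poly:
  "(\<integral>x. complex_of_real x * poly p (complex_of_real x) \<partial>gauss1) = (\<integral>x. poly (pderiv p) (complex_of_real x) \<partial>gauss1)"
proof -
  let ?P = "\<lambda>p. (\<integral>x. complex_of_real x * poly p (complex_of_real x) \<partial>gauss1) = (\<integral>x. poly (pderiv p) (complex_of_real x) \<partial>gauss1)"
  have mon: "?P (monom c m)" for c m
  proof -
    have "(\<integral>x. complex_of_real x * poly (monom c m) (complex_of_real x) \<partial>gauss1) = (\<integral>x. c * complex_of_real (x ^ Suc m) \<partial>gauss1)"
      by (simp add: poly_monom mult.left_commute)
    also have "\<dots> = c * complex_of_real (\<integral>x. x ^ Suc m \<partial>gauss1)"
      by (simp only: integral_mult_right_zero integral_complex_of_real)
    also have "\<dots> = c * of_nat m * complex_of_real (\<integral>x. x ^ (m - 1) \<partial>gauss1)"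
      unfolding gauss1_moment_rec by simp
    also have "\<dots> = (\<integral>x. c * of_nat m * complex_of_real (x ^ (m - 1)) \<partial>gauss1)"
      by (simp only: integral_mult_right_zero integral_complex_of_real)
    also have "\<dots> = (\<integral>x. poly (pderiv (monom c m)) (complex_of_real x) \<partial>gauss1)"
      by (simp add: pderiv_monom poly_monom mult.commute)
    finally show ?thesis .
  qed
  have "?P (\<Sum>i\<in>A. monom (coeff p i) i)" if "finite A" for A
    using that
  proof (induction A rule: finite_induct)
    case (insert i A)
    then show ?case using mon[of "coeff p i" i]
      by (simp add: pderiv_add distrib_left Bochner_Integration.integral_add[OF integrable_gauss1_poly(2) integrable_gauss1_poly(2)]
        Bochner_Integration.integral_add[OF integrable_gauss1_poly(1) integrable_gauss1_poly(1)])
  qed simp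
  from this[of "{..degree p}"] show ?thesis by (simp add: poly_as_sum_of_monoms)
qed

text \<open>Replacing one coordinate by a fresh independent copy preserves the law; this isolates
  the coordinate in which to integrate by parts.\<close>

lemma integral_gauss_resample:
  fixes F :: "(nat \<Rightarrow> real) \<Rightarrow> complex"
  assumes F: "integrable gauss F"
  shows "(\<integral>a. F a \<partial>gauss) = (\<integral>a. (\<integral>x. F (a(k := x)) \<partial>gauss1) \<partial>gauss)"
proof -
  interpret G: prob_space gauss by (rule prob_space_gauss)
  interpret g: prob_space gauss1 by (rule prob_space_gauss1)
  interpret gG: pair_sigma_finite gauss1 gauss ..
  have eq: "distr (gauss1 \<Otimes>\<^sub>M gauss) gauss (\<lambda>(x, X). X(k := x)) = gauss"
    using distr_pair_PiM_eq_PiM[of UNIV "\<lambda>_. gauss1" k] prob_space_gauss1 by (simp add: gauss_def)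
  have m: "(\<lambda>(x, X). X(k := x)) \<in> measurable (gauss1 \<Otimes>\<^sub>M gauss) gauss"
    unfolding gauss_def using measurable_fun_upd[of "UNIV :: nat set" UNIV k snd "gauss1 \<Otimes>\<^sub>M PiM UNIV (\<lambda>_. gauss1)" "\<lambda>_. gauss1" fst]
    by (simp add: case_prod_beta')
  have Fm: "F \<in> borel_measurable gauss" using F by simp
  have int: "integrable (gauss1 \<Otimes>\<^sub>M gauss) (\<lambda>(x, X). F (X(k := x)))"
    using integrable_distr_eq[OF m Fm] F unfolding eq by (simp add: case_prod_beta')
  have "(\<integral>a. F a \<partial>gauss) = (\<integral>a. F a \<partial>distr (gauss1 \<Otimes>\<^sub>M gauss) gauss (\<lambda>(x, X). X(k := x)))" by (simp only: eq)
  also have "\<dots> = (\<integral>p. F ((\<lambda>(x, X). X(k := x)) p) \<partial>(gauss1 \<Otimes>\<^sub>M gauss))" by (rule integral_distr[OF m Fm])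
  also have "\<dots> = (\<integral>a. (\<integral>x. F (a(k := x)) \<partial>gauss1) \<partial>gauss)"
    using gG.integral_snd[OF int] by (simp add: case_prod_beta')
  finally show ?thesis .
qed

text \<open>Truncation keeps the sum over coordinates in Wick's formula finite; the limit is taken
  only after integration.\<close>

definition psum :: "nat \<Rightarrow> (nat \<Rightarrow> real) \<Rightarrow> complex \<Rightarrow> complex" where
  "psum N a w = (\<Sum>k<N. complex_of_real (a k) * w ^ k)"

lemma norm_psum_le:
  assumes "a \<in> conv_seqs" "cmod w \<le> r" "r < 1"
  shows "cmod (psum N a w) \<le> abs_ser r a"
proof -
  have r0: "0 \<le> r" using assms(2) norm_ge_zero order_trans by blast
  have "cmod (psum N a w) \<le> (\<Sum>k<N. \<bar>a k\<bar> * r ^ k)"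
    unfolding psum_def by (rule sum_norm_le) (auto simp: norm_mult norm_power intro!: mult_left_mono power_mono assms)
  also have "\<dots> \<le> abs_ser r a" unfolding abs_ser_def
    by (rule sum_le_suminf) (use summable_conv_seqs[OF assms(1) r0 assms(3)] r0 in auto)
  finally show ?thesis .
qed

lemma psum_tendsto_pser:
  assumes "a \<in> conv_seqs" "cmod w < 1" shows "(\<lambda>N. psum N a w) \<longlonglongrightarrow> pser a w"
  using summable_LIMSEQ[OF summable_pser'[OF assms]] by (simp add: psum_def pser_def)

lemma norm_pser_le:
  assumes "a \<in> conv_seqs" "cmod w \<le> r" "r < 1"
  shows "cmod (pser a w) \<le> abs_ser r a"
  by (rule LIMSEQ_le_const2[OF tendsto_norm[OF psum_tendsto_pser]])
     (use assms norm_psum_le in auto)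

lemma finite_disc_radius:
  assumes "finite S" "S \<subseteq> ball (0::complex) 1"
  obtains r where "0 \<le> r" "r < 1" "\<And>w. w \<in> S \<Longrightarrow> cmod w \<le> r"
proof (cases "S = {}")
  case True then show ?thesis using that[of 0] by auto
next
  case False
  show ?thesis
  proof (rule that)
    show "cmod w \<le> Max (cmod ` S)" if "w \<in> S" for w using assms(1) that by simp
    then show "0 \<le> Max (cmod ` S)" using False by (meson ex_in_conv norm_ge_zero order_trans)
    show "Max (cmod ` S) < 1" using assms False by (subst Max_less_iff) auto
  qed
qed

lemma integrable_prod_bound:
  fixes g :: "complex \<Rightarrow> (nat \<Rightarrow> real) \<Rightarrow> complex"
  assumes "finite S" and r: "0 \<le> r" "r < 1"
    and gm: "\<And>w. w \<in> S \<Longrightarrow> g w \<in> borel_measurable (PiM UNIV (\<lambda>_. borel))"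
    and gb: "\<And>w a. w \<in> S \<Longrightarrow> a \<in> conv_seqs \<Longrightarrow> cmod (g w a) \<le> abs_ser r a"
  shows "integrable gauss (\<lambda>a. \<Prod>w\<in>S. g w a)"
    and "AE a in gauss. norm (\<Prod>w\<in>S. g w a) \<le> abs_ser r a ^ card S"
proof -
  show b: "AE a in gauss. norm (\<Prod>w\<in>S. g w a) \<le> abs_ser r a ^ card S"
    using AE_gauss_conv
  proof eventually_elim
    case (elim a)
    have "norm (\<Prod>w\<in>S. g w a) = (\<Prod>w\<in>S. cmod (g w a))" by (simp add: prod_norm)
    also have "\<dots> \<le> (\<Prod>w\<in>S. abs_ser r a)" by (rule prod_mono) (use gb elim in auto)
    finally show ?case by simp
  qed
  have [measurable]: "(\<lambda>a. \<Prod>w\<in>S. g w a) \<in> borel_measurable gauss"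
    using gm by (intro borel_measurable_prod) measurable
  show "integrable gauss (\<lambda>a. \<Prod>w\<in>S. g w a)"
    by (rule Bochner_Integration.integrable_bound[OF integrable_abs_ser_power[OF r, of "card S"]])
       (use b in \<open>auto elim!: eventually_mono intro: order_trans[OF _ abs_ge_self]\<close>)
qed

text \<open>Indexed by sets, so only distinct points are covered; coincidences are left to the
  continuity argument at the end.\<close>

definition moment :: "complex set \<Rightarrow> complex" where
  "moment S = (\<integral>a. (\<Prod>w\<in>S. pser a w) \<partial>gauss)"

definition psum_moment :: "nat \<Rightarrow> complex set \<Rightarrow> complex" where
  "psum_moment N S = (\<integral>a. (\<Prod>w\<in>S. psum N a w) \<partial>gauss)"

lemma psum_measurable [measurable (raw)]:
  assumes [measurable]: "f \<in> measurable M (PiM UNIV (\<lambda>_. borel))"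
  shows "(\<lambda>x. psum N (f x) w) \<in> borel_measurable M"
  unfolding psum_def by measurable

lemma psum_moment_tendsto:
  assumes S: "finite S" "S \<subseteq> ball 0 1"
  shows "(\<lambda>N. psum_moment N S) \<longlonglongrightarrow> moment S"
proof -
  obtain r where r: "0 \<le> r" "r < 1" "\<And>w. w \<in> S \<Longrightarrow> cmod w \<le> r" using finite_disc_radius[OF S] by metis
  show ?thesis unfolding psum_moment_def moment_def
  proof (rule integral_dominated_convergence[where w="\<lambda>a. abs_ser r a ^ card S"])
    show "integrable gauss (\<lambda>a. abs_ser r a ^ card S)" by (rule integrable_abs_ser_power[OF r(1,2)])
    show "AE a in gauss. (\<lambda>N. \<Prod>w\<in>S. psum N a w) \<longlonglongrightarrow> (\<Prod>w\<in>S. pser a w)"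
      using AE_gauss_conv
      by eventually_elim (use S in \<open>auto intro!: tendsto_prod psum_tendsto_pser\<close>)
    show "AE a in gauss. norm (\<Prod>w\<in>S. psum N a w) \<le> abs_ser r a ^ card S" for N
      by (rule integrable_prod_bound(2)[OF S(1) r(1,2)]) (use r norm_psum_le in auto)
  qed measurable
qed

lemma integrable_psum_prod:
  assumes S: "finite S" "S \<subseteq> ball 0 1"
  shows "integrable gauss (\<lambda>a. \<Prod>w\<in>S. psum N a w)" "integrable gauss (\<lambda>a. complex_of_real (a k) * (\<Prod>w\<in>S. psum N a w))"
proof -
  obtain r0 where r0: "0 \<le> r0" "r0 < 1" "\<And>w. w \<in> S \<Longrightarrow> cmod w \<le> r0" using finite_disc_radius[OF S] by metis
  \<comment> \<open>A positive radius is needed so that \<open>abs_ser r a\<close> also controls the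
    single coefficient \<open>a k\<close>, with factor \<open>1 / r ^ k\<close>.\<close>
  define r where "r = max r0 (1/2)"
  have r: "0 < r" "0 \<le> r" "r < 1" "\<And>w. w \<in> S \<Longrightarrow> cmod w \<le> r" using r0 by (auto simp: r_def intro: order_trans max.cobounded1)
  show i: "integrable gauss (\<lambda>a. \<Prod>w\<in>S. psum N a w)"
    by (rule integrable_prod_bound(1)[OF S(1) r(2,3)]) (use r norm_psum_le in auto)
  have b: "AE a in gauss. norm (\<Prod>w\<in>S. psum N a w) \<le> abs_ser r a ^ card S"
    by (rule integrable_prod_bound(2)[OF S(1) r(2,3)]) (use r norm_psum_le in auto)
  show "integrable gauss (\<lambda>a. complex_of_real (a k) * (\<Prod>w\<in>S. psum N a w))"
  proof (rule Bochner_Integration.integrable_bound)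
    show "integrable gauss (\<lambda>a. (1 / r ^ k) * abs_ser r a ^ Suc (card S))"
      by (intro integrable_mult_right integrable_abs_ser_power r)
    show "AE a in gauss. norm (complex_of_real (a k) * (\<Prod>w\<in>S. psum N a w)) \<le> norm ((1 / r ^ k) * abs_ser r a ^ Suc (card S))"
      using b AE_gauss_conv
    proof eventually_elim
      case (elim a)
      have "\<bar>a k\<bar> * r ^ k \<le> abs_ser r a" unfolding abs_ser_def
        using sum_le_suminf[OF summable_conv_seqs[OF elim(2) r(2,3)], of "{k}"] r by simp
      then have ak: "\<bar>a k\<bar> \<le> (1 / r ^ k) * abs_ser r a" using r by (simp add: field_simps)
      have "norm (complex_of_real (a k) * (\<Prod>w\<in>S. psum N a w)) = \<bar>a k\<bar> * norm (\<Prod>w\<in>S. psum N a w)"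
        by (simp add: norm_mult)
      also have "\<dots> \<le> ((1 / r ^ k) * abs_ser r a) * abs_ser r a ^ card S"
        using ak elim(1) by (intro mult_mono) (auto intro: order_trans[OF abs_ge_zero ak])
      finally show ?case by (simp add: abs_mult) (metis (no_types, opaque_lifting) abs_ge_self order_trans abs_mult power_abs times_divide_eq_left mult_1 abs_divide abs_of_pos r(1) zero_less_power)
    qed
  qed measurable
qed

lemma psum_update: "k < N \<Longrightarrow> psum N (a(k := x)) w = psum N (a(k := 0)) w + complex_of_real x * w ^ k"
proof -
  assume k: "k < N"
  have "psum N (a(k := x)) w = complex_of_real x * w ^ k + (\<Sum>j\<in>{..<N} - {k}. complex_of_real (a j) * w ^ j)" for x
    unfolding psum_def using k by (subst sum.remove[of _ k]) (auto intro!: sum.cong)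
  from this[of x] this[of 0] show ?thesis by simp
qed

text \<open>As a function of the coordinate \<open>k\<close> alone, every truncated series is linear
  with slope \<open>w ^ k\<close>. Stein's identity differentiates the product, and the product rule
  removes one factor at a time.\<close>

lemma stein_coordinate:
  assumes S: "finite S" "S \<subseteq> ball 0 1" and k: "k < N"
  shows "(\<integral>a. complex_of_real (a k) * (\<Prod>w\<in>S. psum N a w) \<partial>gauss) = (\<Sum>y\<in>S. y ^ k * psum_moment N (S - {y}))"
proof -
  define P where "P a T = (\<Prod>w\<in>T. [: psum N (a(k := 0)) w, w ^ k :])" for a T
  have P: "(\<Prod>w\<in>T. psum N (a(k := x)) w) = poly (P a T) (complex_of_real x)" for a T x
    unfolding P_def poly_prod by (intro prod.cong refl) (simp add: psum_update[OF k, of a x])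
  have "(\<integral>a. complex_of_real (a k) * (\<Prod>w\<in>S. psum N a w) \<partial>gauss) =
     (\<integral>a. (\<integral>x. complex_of_real x * poly (P a S) (complex_of_real x) \<partial>gauss1) \<partial>gauss)"
    by (subst integral_gauss_resample[OF integrable_psum_prod(2)[OF S], of _ _ k]) (simp add: P)
  also have "\<dots> = (\<integral>a. (\<integral>x. poly (pderiv (P a S)) (complex_of_real x) \<partial>gauss1) \<partial>gauss)"
    by (simp only: stein_poly)
  also have "\<dots> = (\<integral>a. (\<integral>x. (\<Sum>y\<in>S. y ^ k * (\<Prod>w\<in>S-{y}. psum N (a(k := x)) w)) \<partial>gauss1) \<partial>gauss)"
  proof -
    have "poly (pderiv (P a S)) (complex_of_real x) = (\<Sum>y\<in>S. y ^ k * (\<Prod>w\<in>S-{y}. psum N (a(k := x)) w))" for a x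
    proof -
      have "pderiv (P a S) = (\<Sum>y\<in>S. P a (S - {y}) * pderiv [: psum N (a(k := 0)) y, y ^ k :])"
        unfolding P_def by (rule pderiv_prod)
      then show ?thesis by (simp add: poly_sum P pderiv_pCons mult.commute)
    qed
    then show ?thesis by simp
  qed
  also have "\<dots> = (\<integral>a. (\<Sum>y\<in>S. y ^ k * (\<Prod>w\<in>S-{y}. psum N a w)) \<partial>gauss)"
    by (rule integral_gauss_resample[symmetric])
       (intro Bochner_Integration.integrable_sum integrable_mult_right integrable_psum_prod(1), use S in auto)
  also have "\<dots> = (\<Sum>y\<in>S. y ^ k * psum_moment N (S - {y}))"
    unfolding psum_moment_def
    by (subst Bochner_Integration.integral_sum) (use S in \<open>auto intro!: integrable_mult_right integrable_psum_prod(1)\<close>)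
  finally show ?thesis .
qed

lemma moment_empty: "moment {} = 1"
proof -
  interpret prob_space gauss by (rule prob_space_gauss)
  show ?thesis by (simp add: moment_def prob_space[simplified])
qed

text \<open>Only the factor at \<open>x\<close> is expanded into coordinates. Integration by parts
  pairs \<open>x\<close> with each other point \<open>y\<close>, and the sum over coordinates gives
  a truncated geometric series in \<open>x * y\<close>, which converges to the covariance
  kernel.\<close>

lemma moment_wick:
  assumes S: "finite S" "S \<subseteq> ball 0 1" and x: "x \<in> S"
  shows "moment S = (\<Sum>y\<in>S-{x}. moment (S - {x, y}) / (1 - x * y))"
proof -
  have T: "finite (S - {x})" "S - {x} \<subseteq> ball 0 1" using S by auto
  have rec: "psum_moment N S = (\<Sum>y\<in>S-{x}. (\<Sum>k<N. (x * y) ^ k) * psum_moment N (S - {x} - {y}))" for N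
  proof -
    have "psum_moment N S = (\<integral>a. (\<Sum>k<N. x ^ k * (complex_of_real (a k) * (\<Prod>w\<in>S-{x}. psum N a w))) \<partial>gauss)"
      unfolding psum_moment_def prod.remove[OF S(1) x]
      unfolding psum_def[of N _ x] sum_distrib_right by (simp only: mult_ac)
    also have "\<dots> = (\<Sum>k<N. x ^ k * (\<Sum>y\<in>S-{x}. y ^ k * psum_moment N (S - {x} - {y})))"
      by (subst Bochner_Integration.integral_sum)
         (auto intro!: integrable_mult_right integrable_psum_prod(2)[OF T] simp: stein_coordinate[OF T])
    also have "\<dots> = (\<Sum>y\<in>S-{x}. (\<Sum>k<N. (x * y) ^ k) * psum_moment N (S - {x} - {y}))"
      unfolding sum_distrib_left sum_distrib_right
      by (subst sum.swap) (simp add: power_mult_distrib mult.assoc)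
    finally show ?thesis .
  qed
  have "(\<lambda>N. psum_moment N S) \<longlonglongrightarrow> (\<Sum>y\<in>S-{x}. (1 / (1 - x * y)) * moment (S - {x} - {y}))"
    unfolding rec
  proof (intro tendsto_sum tendsto_mult psum_moment_tendsto)
    fix y assume y: "y \<in> S - {x}"
    have "cmod (x * y) < 1"
    proof -
      have "cmod x < 1" "cmod y < 1" using S x y by auto
      then have "cmod x * cmod y < 1 * 1" by (intro mult_strict_mono') auto
      then show ?thesis by (simp add: norm_mult)
    qed
    from geometric_sums[OF this] show "(\<lambda>N. \<Sum>k<N. (x * y) ^ k) \<longlonglongrightarrow> 1 / (1 - x * y)"
      by (simp add: sums_def)
  qed (use T in auto)
  then have "moment S = (\<Sum>y\<in>S-{x}. (1 / (1 - x * y)) * moment (S - {x} - {y}))"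
    using LIMSEQ_unique[OF psum_moment_tendsto[OF S]] by blast
  also have "\<dots> = (\<Sum>y\<in>S-{x}. moment (S - {x, y}) / (1 - x * y))"
    by (intro sum.cong refl) (simp add: Diff_insert[symmetric] insert_commute)
  finally show ?thesis .
qed

section \<open>Partial fractions for the moments\<close>

lemma holomorphic_extend_finite:
  assumes "finite P" "f holomorphic_on (- P)" "\<And>p. p \<in> P \<Longrightarrow> ((\<lambda>z. (z - p) * f z) \<longlongrightarrow> 0) (at p)"
  shows "\<exists>g. g holomorphic_on UNIV \<and> (\<forall>z\<in>-P. g z = f z)"
  using assms
proof (induction P arbitrary: f rule: finite_induct)
  case (insert p P)
  have op: "open (- P)" using insert.hyps(1) by (simp add: finite_imp_closed open_Compl)
  have "- insert p P = - P - {p}" by auto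
  moreover have "p \<in> interior (- P)" using op insert.hyps by (simp add: interior_open)
  ultimately obtain g where g: "g holomorphic_on - P" "\<forall>z\<in>- P - {p}. g z = f z"
    using holomorphic_on_extend_lim[of f "- P" p] insert.prems by auto
  have "((\<lambda>z. (z - q) * g z) \<longlongrightarrow> 0) (at q)" if q: "q \<in> P" for q
  proof (rule Lim_transform_eventually)
    show "((\<lambda>z. (z - q) * f z) \<longlongrightarrow> 0) (at q)" using insert.prems(2) q by auto
    have "open (- ((P - {q}) \<union> {p}))" using insert.hyps(1) by (intro open_Compl finite_imp_closed) auto
    then have "eventually (\<lambda>z. z \<in> - ((P - {q}) \<union> {p}) - {q}) (at q)"
      by (rule eventually_at_in_open) (use q insert.hyps in auto)
    then show "eventually (\<lambda>z. (z - q) * f z = (z - q) * g z) (at q)"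
      by eventually_elim (use g(2) in auto)
  qed
  from insert.IH[OF g(1) this] obtain h where "h holomorphic_on UNIV" "\<forall>z\<in>-P. h z = g z" by blast
  then show ?case using g(2) by (intro exI[of _ h]) auto
qed auto

lemma sum_antisym_pairs:
  fixes M T :: "'b \<Rightarrow> 'b \<Rightarrow> complex"
  assumes "finite Y" and sym: "\<And>l m. M l m = M m l"
    and anti: "\<And>l m. l \<in> Y \<Longrightarrow> m \<in> Y \<Longrightarrow> l \<noteq> m \<Longrightarrow> T l m + T m l = 0"
  shows "(\<Sum>l\<in>Y. \<Sum>m\<in>Y-{l}. M l m * T l m) = 0"
proof -
  let ?S = "\<Sum>l\<in>Y. \<Sum>m\<in>Y. if m \<noteq> l then M l m * T l m else 0"
  have e: "(\<Sum>l\<in>Y. \<Sum>m\<in>Y-{l}. M l m * T l m) = ?S"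
    using assms(1) by (intro sum.cong refl sum.mono_neutral_cong_left) auto
  have "?S = (\<Sum>m\<in>Y. \<Sum>l\<in>Y. if m \<noteq> l then M l m * T l m else 0)" by (rule sum.swap)
  then have "?S + ?S = (\<Sum>l\<in>Y. \<Sum>m\<in>Y. (if m \<noteq> l then M l m * T l m else 0) + (if l \<noteq> m then M m l * T m l else 0))"
    by (simp add: sum.distrib)
  also have "\<dots> = 0"
  proof (intro sum.neutral ballI)
    fix l m assume lm: "l \<in> Y" "m \<in> Y"
    show "(if m \<noteq> l then M l m * T l m else 0) + (if l \<noteq> m then M m l * T m l else 0) = 0"
      using anti[OF lm] sym[of l m] by (simp add: distrib_left[symmetric])
  qed
  finally show ?thesis unfolding e by simp
qed

lemma pair_identity:
  fixes j l m :: complex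
  assumes "j \<noteq> l" "j \<noteq> m" "1 - j * l \<noteq> 0" "1 - j * m \<noteq> 0" "1 - l * m \<noteq> 0"
  shows "((1 - l\<^sup>2) / ((j - l) * (1 - j * l)) / (1 - l * m) - 1 / ((j - l) * (1 - j * m))) +
    ((1 - m\<^sup>2) / ((j - m) * (1 - j * m)) / (1 - m * l) - 1 / ((j - m) * (1 - j * l))) = 0"
proof -
  define a b c d e where "a = j - l" and "b = j - m" and "c = 1 - j * l" and "d = 1 - j * m" and "e = 1 - l * m"
  have nz: "a \<noteq> 0" "b \<noteq> 0" "c \<noteq> 0" "d \<noteq> 0" "e \<noteq> 0" using assms by (auto simp: a_def b_def c_def d_def e_def)
  have e2: "1 - m * l = e" by (simp add: e_def mult.commute)
  \<comment> \<open>The common numerator after clearing denominators; with the abbreviations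
    expanded it is a polynomial identity in \<open>j\<close>, \<open>l\<close> and
    \<open>m\<close>.\<close>
  have key: "(1 - l\<^sup>2) * b * d - b * c * e + (1 - m\<^sup>2) * a * c - a * d * e = 0"
    unfolding a_def b_def c_def d_def e_def by (simp add: algebra_simps power2_eq_square)
  have "((1 - l\<^sup>2) / (a * c) / e - 1 / (a * d)) + ((1 - m\<^sup>2) / (b * d) / e - 1 / (b * c)) =
    ((1 - l\<^sup>2) * b * d - b * c * e + (1 - m\<^sup>2) * a * c - a * d * e) / (a * b * c * d * e)"
    using nz by (simp add: field_simps)
  then show ?thesis unfolding key unfolding a_def[symmetric] b_def[symmetric] c_def[symmetric] d_def[symmetric] e_def[symmetric] e2 by simp
qed

lemma disc_neq: "x \<in> ball 0 1 \<Longrightarrow> y \<in> ball 0 1 \<Longrightarrow> 1 - x * y \<noteq> (0::complex)"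
  using one_minus_mult_neq_0[of x y] by simp

text \<open>Vanishing of the simple-pole part in the partial fraction expansion below: both sides are sums over
  ordered pairs after one Wick expansion, and the difference of the coefficients is antisymmetric.\<close>

lemma moment_residue_identity:
  assumes Y: "finite Y" "Y \<subseteq> ball 0 1" and j: "j \<in> ball 0 1" "j \<notin> Y"
  shows "moment Y * (\<Sum>l\<in>Y. (1 - l\<^sup>2) / ((j - l) * (1 - j * l))) = (\<Sum>l\<in>Y. moment (insert j (Y - {l})) / (j - l))"
proof -
  define T where "T l m = (1 - l\<^sup>2) / ((j - l) * (1 - j * l)) / (1 - l * m) - 1 / ((j - l) * (1 - j * m))" for l m
  define M where "M l m = moment (Y - {l, m})" for l m
  have 1: "moment Y * ((1 - l\<^sup>2) / ((j - l) * (1 - j * l))) = (\<Sum>m\<in>Y-{l}. M l m * ((1 - l\<^sup>2) / ((j - l) * (1 - j * l)) / (1 - l * m)))"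
    if "l \<in> Y" for l
    unfolding moment_wick[OF Y that] M_def sum_distrib_right by (intro sum.cong refl) simp
  have 2: "moment (insert j (Y - {l})) / (j - l) = (\<Sum>m\<in>Y-{l}. M l m * (1 / ((j - l) * (1 - j * m))))" if "l \<in> Y" for l
  proof -
    have "moment (insert j (Y - {l})) = (\<Sum>m\<in>insert j (Y - {l}) - {j}. moment (insert j (Y - {l}) - {j, m}) / (1 - j * m))"
      by (rule moment_wick) (use Y j in auto)
    also have "insert j (Y - {l}) - {j} = Y - {l}" using j by auto
    also have "(\<Sum>m\<in>Y - {l}. moment (insert j (Y - {l}) - {j, m}) / (1 - j * m)) = (\<Sum>m\<in>Y-{l}. M l m / (1 - j * m))"
    proof (intro sum.cong refl)
      fix m assume "m \<in> Y - {l}"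
      have "insert j (Y - {l}) - {j, m} = Y - {l, m}" using j by auto
      then show "moment (insert j (Y - {l}) - {j, m}) / (1 - j * m) = M l m / (1 - j * m)" by (simp add: M_def)
    qed
    finally show ?thesis by (simp add: sum_divide_distrib mult.commute)
  qed
  have "moment Y * (\<Sum>l\<in>Y. (1 - l\<^sup>2) / ((j - l) * (1 - j * l))) - (\<Sum>l\<in>Y. moment (insert j (Y - {l})) / (j - l)) =
    (\<Sum>l\<in>Y. \<Sum>m\<in>Y-{l}. M l m * T l m)"
    unfolding sum_distrib_left sum_subtractf[symmetric]
  proof (rule sum.cong[OF refl])
    fix l assume l: "l \<in> Y"
    show "moment Y * ((1 - l\<^sup>2) / ((j - l) * (1 - j * l))) - moment (insert j (Y - {l})) / (j - l) = (\<Sum>m\<in>Y-{l}. M l m * T l m)"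
      unfolding 1[OF l] 2[OF l] sum_subtractf[symmetric] T_def by (intro sum.cong refl) (simp add: right_diff_distrib)
  qed
  also have "\<dots> = 0"
  proof (rule sum_antisym_pairs[OF Y(1)])
    show "M l m = M m l" for l m by (simp add: M_def insert_commute)
    fix l m assume lm: "l \<in> Y" "m \<in> Y" "l \<noteq> m"
    have d: "l \<in> ball 0 1" "m \<in> ball 0 1" using lm Y by auto
    show "T l m + T m l = 0" unfolding T_def
      by (rule pair_identity[OF _ _ disc_neq[OF j(1) d(1)] disc_neq[OF j(1) d(2)] disc_neq[OF d]]) (use lm j in auto)
  qed
  finally show ?thesis by simp
qed

lemma tendsto_inverse_linear_at_infinity:
  assumes "j \<noteq> (0::complex)" shows "((\<lambda>u. 1 / (1 - u * j)) \<longlongrightarrow> 0) at_infinity"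
proof -
  have "filterlim (\<lambda>u. 1 - u * j) at_infinity at_infinity"
  proof -
    have "filterlim (\<lambda>u. (- j) * u) at_infinity at_infinity"
      by (rule tendsto_mult_filterlim_at_infinity[OF tendsto_const _ filterlim_ident]) (use assms in simp)
    from tendsto_add_filterlim_at_infinity[OF tendsto_const this, of 1]
    show ?thesis by (simp add: mult.commute)
  qed
  then show ?thesis by (rule tendsto_divide_0[OF tendsto_const])
qed

lemma tendsto_moebius_at_infinity:
  assumes "j \<noteq> (0::complex)" shows "((\<lambda>u. (u - j) / (1 - u * j)) \<longlongrightarrow> - 1 / j) at_infinity"
proof -
  have "((\<lambda>u. - 1 / j + (1 / j - j) * (1 / (1 - u * j))) \<longlongrightarrow> - 1 / j + (1 / j - j) * 0) at_infinity"
    by (intro tendsto_intros tendsto_inverse_linear_at_infinity assms)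
  moreover have "eventually (\<lambda>u. - 1 / j + (1 / j - j) * (1 / (1 - u * j)) = (u - j) / (1 - u * j)) at_infinity"
  proof -
    have "eventually (\<lambda>u. u \<noteq> 1 / j) at_infinity"
      unfolding eventually_at_infinity by (intro exI[of _ "cmod (1 / j) + 1"]) auto
    then show ?thesis
    proof eventually_elim
      case (elim u)
      then have "1 - u * j \<noteq> 0" using assms by (auto simp: field_simps)
      then show ?case using assms by (simp add: field_simps)
    qed
  qed
  ultimately show ?thesis by (simp add: Lim_transform_eventually)
qed

text \<open>Each summand is the logarithmic derivative of one Moebius factor.\<close>

lemma has_derivative_prod_moebius:
  assumes "finite Y" and nz: "\<And>l. l \<in> Y \<Longrightarrow> 1 - p * l \<noteq> 0" "\<And>l. l \<in> Y \<Longrightarrow> p \<noteq> (l::complex)"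
  shows "((\<lambda>u. \<Prod>l\<in>Y. (u - l) / (1 - u * l)) has_field_derivative
     (\<Prod>l\<in>Y. (p - l) / (1 - p * l)) * (\<Sum>l\<in>Y. (1 - l\<^sup>2) / ((1 - p * l) * (p - l)))) (at p)"
  using assms
proof (induction Y rule: finite_induct)
  case (insert l Y)
  have l: "1 - p * l \<noteq> 0" "p - l \<noteq> 0" using insert.prems by auto
  have d: "((\<lambda>u. (u - l) / (1 - u * l)) has_field_derivative (p - l) / (1 - p * l) * ((1 - l\<^sup>2) / ((1 - p * l) * (p - l)))) (at p)"
    using l by (auto intro!: derivative_eq_intros simp: divide_simps) (simp add: algebra_simps power2_eq_square)
  have "((\<lambda>u. (u - l) / (1 - u * l) * (\<Prod>l\<in>Y. (u - l) / (1 - u * l))) has_field_derivative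
    (p - l) / (1 - p * l) * ((1 - l\<^sup>2) / ((1 - p * l) * (p - l))) * (\<Prod>l\<in>Y. (p - l) / (1 - p * l)) +
    (\<Prod>l\<in>Y. (p - l) / (1 - p * l)) * (\<Sum>l\<in>Y. (1 - l\<^sup>2) / ((1 - p * l) * (p - l))) * ((p - l) / (1 - p * l))) (at p)"
    by (rule DERIV_mult[OF d insert.IH]) (use insert.prems in auto)
  moreover have "A * a * D + D * S * A = A * D * (a + S)" for A a D S :: complex
    by (simp add: algebra_simps)
  ultimately show ?case by (simp only: prod.insert[OF insert.hyps] sum.insert[OF insert.hyps])
qed simp

text \<open>The difference \<open>G\<close> of the two sides, after Wick expansion at
  \<open>u\<close>, is a rational function of \<open>u\<close> with possible poles only at the
  reciprocals of points of \<open>L\<close>. The double poles cancel by the choice of the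
  coefficients on the right, the simple ones by \<open>moment_residue_identity\<close>. So
  \<open>G\<close> extends to an entire function vanishing at infinity and is zero by
  Liouville.\<close>

lemma moment_partial_fractions:
  assumes L: "finite L" "L \<subseteq> ball 0 1" "0 \<notin> L" and u: "u \<in> ball 0 1" "u \<notin> L"
  shows "(\<Prod>l\<in>L. (u - l) / (1 - u * l)) * moment (insert u L) =
    (\<Sum>j\<in>L. (u - j) / (1 - u * j)\<^sup>2 * (\<Prod>l\<in>L-{j}. (1 - j * l) / (j - l)) * moment (L - {j}))"
proof -
  define h where "h j = moment (L - {j})" for j
  define C where "C j = (\<Prod>l\<in>L-{j}. (1 - j * l) / (j - l))" for j
  define P where "P = (\<lambda>l. 1 / l) ` L"
  have P: "finite P" using L by (simp add: P_def)
  have L0: "l \<in> L \<Longrightarrow> l \<noteq> 0" for l using L by auto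
  have notP: "1 - w * l \<noteq> 0" if "w \<notin> P" "l \<in> L" for w l
  proof
    assume "1 - w * l = 0"
    then have "w = 1 / l" using L0[OF that(2)] by (simp add: field_simps)
    then show False using that by (auto simp: P_def)
  qed
  define A where "A S w = (\<Sum>l\<in>S. h l / (1 - w * l))" for S w
  define R where "R S w = (\<Prod>l\<in>S. (w - l) / (1 - w * l))" for S :: "complex set" and w
  define Q where "Q S w = (\<Sum>l\<in>S. (w - l) / (1 - w * l)\<^sup>2 * C l * h l)" for S w
  define G where "G w = R L w * A L w - Q L w" for w
  have holR: "R S holomorphic_on - P" and holA: "A S holomorphic_on - P" and holQ: "Q S holomorphic_on - P" if "S \<subseteq> L" for S
    unfolding R_def A_def Q_def using that notP by (auto intro!: holomorphic_intros)
  have holG: "G holomorphic_on - P"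
    unfolding G_def by (intro holomorphic_intros holR holA holQ) auto
  have lim: "((\<lambda>w. (w - p) * G w) \<longlongrightarrow> 0) (at p)" if "p \<in> P" for p
  proof -
    from that obtain j where j: "j \<in> L" "p = 1 / j" by (auto simp: P_def)
    have j0: "j \<noteq> 0" using L0 j by simp
    have jd: "j \<in> ball 0 1" using L j by auto
    define Y where "Y = L - {j}"
    have Y: "finite Y" "Y \<subseteq> ball 0 1" "j \<notin> Y" "L = insert j Y" using L j by (auto simp: Y_def)
    have pl: "1 - p * l \<noteq> 0" "p \<noteq> l" if "l \<in> Y" for l
    proof -
      have "l \<noteq> j" using that Y by auto
      then show "1 - p * l \<noteq> 0" using j0 by (simp add: j field_simps)
      show "p \<noteq> l" using disc_neq[OF jd, of l] Y that j0 by (auto simp: j field_simps)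
    qed
    \<comment> \<open>The product over the other points, evaluated at the pole, is exactly the
      coefficient of the double pole on the right; this is the reason for its form.\<close>
    have Rp: "R Y p = C j" unfolding R_def C_def Y_def[symmetric]
    proof (rule prod.cong[OF refl])
      fix l assume l: "l \<in> Y"
      show "(p - l) / (1 - p * l) = (1 - j * l) / (j - l)"
      proof -
        have "p - l = (1 - j * l) / j" "1 - p * l = (j - l) / j" using j0 by (simp_all add: j field_simps)
        then show ?thesis using j0 by simp
      qed
    qed
    define R' where "R' = R Y p * (\<Sum>l\<in>Y. (1 - l\<^sup>2) / ((1 - p * l) * (p - l)))"
    have dR: "(R Y has_field_derivative R') (at p)"
      unfolding R_def[abs_def] R'_def by (rule has_derivative_prod_moebius[OF Y(1)]) (use pl in auto)
    have contA: "(A Y \<longlongrightarrow> A Y p) (at p)" unfolding A_def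
      by (intro tendsto_intros) (use pl in auto)
    have contQ: "(Q Y \<longlongrightarrow> Q Y p) (at p)" unfolding Q_def
      by (intro tendsto_intros) (use pl in auto)
    have contR: "(R Y \<longlongrightarrow> R Y p) (at p)"
      using DERIV_isCont[OF dR] by (simp add: isCont_def)
    have quot: "((\<lambda>w. (R Y w - R Y p) / (w - p)) \<longlongrightarrow> R') (at p)"
      using dR by (simp add: has_field_derivative_iff)
    \<comment> \<open>The residue condition at \<open>p\<close>: rewriting everything from
      \<open>p = 1 / j\<close> back to \<open>j\<close> turns it into
      \<open>moment_residue_identity\<close>.\<close>
    have bracket: "- 1 / j * (h j * R') + R Y p * A Y p = 0"
    proof -
      have "h j * (\<Sum>l\<in>Y. (1 - l\<^sup>2) / ((j - l) * (1 - j * l))) = (\<Sum>l\<in>Y. h l / (j - l))"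
      proof -
        have hj: "h j = moment Y" by (simp add: h_def Y_def)
        have hl: "h l = moment (insert j (Y - {l}))" if "l \<in> Y" for l
        proof -
          have "L - {l} = insert j (Y - {l})" using that Y by auto
          then show ?thesis by (simp add: h_def)
        qed
        show ?thesis unfolding hj using moment_residue_identity[OF Y(1,2) jd Y(3)] hl by simp
      qed
      moreover have "(\<Sum>l\<in>Y. (1 - l\<^sup>2) / ((1 - p * l) * (p - l))) = j\<^sup>2 * (\<Sum>l\<in>Y. (1 - l\<^sup>2) / ((j - l) * (1 - j * l)))"
        unfolding sum_distrib_left
      proof (rule sum.cong[OF refl])
        fix l assume "l \<in> Y"
        have "1 - p * l = (j - l) / j" "p - l = (1 - j * l) / j" using j0 by (simp_all add: j field_simps)
        then show "(1 - l\<^sup>2) / ((1 - p * l) * (p - l)) = j\<^sup>2 * ((1 - l\<^sup>2) / ((j - l) * (1 - j * l)))"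
          using j0 by (simp add: power2_eq_square)
      qed
      moreover have "A Y p = j * (\<Sum>l\<in>Y. h l / (j - l))"
        unfolding A_def sum_distrib_left
      proof (rule sum.cong[OF refl])
        fix l assume "l \<in> Y"
        have "1 - p * l = (j - l) / j" using j0 by (simp add: j field_simps)
        then show "h l / (1 - p * l) = j * (h l / (j - l))" by simp
      qed
      ultimately show ?thesis using j0 unfolding R'_def by (simp add: power2_eq_square mult.left_commute)
    qed
    \<comment> \<open>Writing \<open>1 - w * j\<close> as \<open>- j * (w - p)\<close>, the two
      double-pole terms combine into a difference quotient of \<open>R Y\<close>, which stays
      bounded at \<open>p\<close>.\<close>
    have ev: "eventually (\<lambda>w. (w - p) * G w = - 1 / j * (w - j) * (- 1 / j * (h j * ((R Y w - R Y p) / (w - p))) + R Y w * A Y w) - (w - p) * Q Y w) (at p)"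
    proof -
      have "eventually (\<lambda>w. w \<noteq> p) (at p)" by (rule eventually_neq_at_within)
      then show ?thesis
      proof eventually_elim
        case (elim w)
        have t: "1 - w * j = - j * (w - p)" using j0 by (simp add: j field_simps)
        have wp: "w - p \<noteq> 0" using elim by simp
        have G: "G w = (w - j) / (1 - w * j) * R Y w * (h j / (1 - w * j) + A Y w) - ((w - j) / (1 - w * j)\<^sup>2 * C j * h j + Q Y w)"
          unfolding G_def R_def A_def Q_def Y(4) using Y(1,3) by simp
        show ?case unfolding G t Rp[symmetric] using wp j0
          by (simp add: divide_simps power2_eq_square) (simp add: algebra_simps)
      qed
    qed
    have "((\<lambda>w. - 1 / j * (w - j) * (- 1 / j * (h j * ((R Y w - R Y p) / (w - p))) + R Y w * A Y w) - (w - p) * Q Y w) \<longlongrightarrow>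
       - 1 / j * (p - j) * (- 1 / j * (h j * R') + R Y p * A Y p) - (p - p) * Q Y p) (at p)"
      by (intro tendsto_intros quot contA contQ contR)
    then have "((\<lambda>w. - 1 / j * (w - j) * (- 1 / j * (h j * ((R Y w - R Y p) / (w - p))) + R Y w * A Y w) - (w - p) * Q Y w) \<longlongrightarrow> 0) (at p)"
      unfolding bracket by simp
    then show ?thesis
      by (rule Lim_transform_eventually) (use ev in \<open>auto elim!: eventually_mono\<close>)
  qed
  from holomorphic_extend_finite[OF P holG lim]
  obtain g where g: "g holomorphic_on UNIV" "\<forall>z\<in>-P. g z = G z" by blast
  \<comment> \<open>Moebius factors have finite limits at infinity, whereas \<open>A L\<close> and
    \<open>Q L\<close> contain a further factor that tends to 0.\<close>
  have Ginf: "(G \<longlongrightarrow> 0) at_infinity"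
  proof -
    have q: "((\<lambda>w. (w - l) / (1 - w * l)\<^sup>2 * C l * h l) \<longlongrightarrow> (- 1 / l) * 0 * C l * h l) at_infinity" if "l \<in> L" for l
    proof -
      have "((\<lambda>w. (w - l) / (1 - w * l) * (1 / (1 - w * l)) * C l * h l) \<longlongrightarrow> (- 1 / l) * 0 * C l * h l) at_infinity"
        by (intro tendsto_intros tendsto_moebius_at_infinity tendsto_inverse_linear_at_infinity L0 that)
      then show ?thesis by (simp add: power2_eq_square)
    qed
    have a: "((\<lambda>w. h l / (1 - w * l)) \<longlongrightarrow> h l * 0) at_infinity" if "l \<in> L" for l
      using tendsto_mult[OF tendsto_const[of "h l"] tendsto_inverse_linear_at_infinity[OF L0[OF that]]] by simp
    have "(G \<longlongrightarrow> (\<Prod>l\<in>L. - 1 / l) * (\<Sum>l\<in>L. h l * 0) - (\<Sum>l\<in>L. (- 1 / l) * 0 * C l * h l)) at_infinity"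
      unfolding G_def R_def A_def Q_def
      by (intro tendsto_diff tendsto_mult tendsto_prod tendsto_sum tendsto_moebius_at_infinity L0 q a)
    then show ?thesis by simp
  qed
  have "(g \<longlongrightarrow> 0) at_infinity"
  proof (rule Lim_transform_eventually[OF Ginf])
    have "bounded P" using P by (rule finite_imp_bounded)
    then obtain b where b: "\<And>x. x \<in> P \<Longrightarrow> cmod x \<le> b" by (auto simp: bounded_iff)
    show "eventually (\<lambda>x. G x = g x) at_infinity"
      unfolding eventually_at_infinity
    proof (intro exI[of _ "b + 1"] allI impI)
      fix x assume "b + 1 \<le> cmod x"
      then have "x \<notin> P" using b[of x] by auto
      then show "G x = g x" using g(2) by simp
    qed
  qed
  then have "g u = 0" using Liouville_weak_0[OF g(1)] by blast
  moreover have uP: "u \<notin> P"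
  proof
    assume "u \<in> P"
    then obtain l where l: "l \<in> L" "u = 1 / l" by (auto simp: P_def)
    then have "1 - u * l = 0" using L0 by simp
    then show False using disc_neq[OF u(1), of l] l L by auto
  qed
  ultimately have "G u = 0" using g(2) by simp
  moreover have "moment (insert u L) = A L u"
  proof -
    have "moment (insert u L) = (\<Sum>y\<in>insert u L - {u}. moment (insert u L - {u, y}) / (1 - u * y))"
      by (rule moment_wick) (use L u in auto)
    also have "insert u L - {u} = L" using u by auto
    also have "(\<Sum>y\<in>L. moment (insert u L - {u, y}) / (1 - u * y)) = A L u"
      unfolding A_def h_def
    proof (intro sum.cong refl)
      fix y assume "y \<in> L"
      have "insert u L - {u, y} = L - {y}" using u by auto
      then show "moment (insert u L - {u, y}) / (1 - u * y) = moment (L - {y}) / (1 - u * y)" by simp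
    qed
    finally show ?thesis .
  qed
  ultimately show ?thesis unfolding G_def R_def Q_def C_def h_def by simp
qed

section \<open>Expansion of the Pfaffian along the first row\<close>

text \<open>The cycle that puts \<open>d + 2\<close> in second place and shifts \<open>2\<close>,
  ..., \<open>d + 1\<close> up by one place. As a product of \<open>d\<close> adjacent
  transpositions it has sign \<open>(-1) ^ d\<close>.\<close>

fun cyc :: "nat \<Rightarrow> nat \<Rightarrow> nat" where
  "cyc 0 = id"
| "cyc (Suc d) = Transposition.transpose (Suc (Suc d)) (Suc (Suc (Suc d))) \<circ> cyc d"

text \<open>The increasing enumeration, by \<open>1, 2, ...\<close>, of the indices that remain
  after deleting \<open>1\<close> and \<open>d + 2\<close>.\<close>

definition skip :: "nat \<Rightarrow> nat \<Rightarrow> nat" where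
  "skip d p = (if p < d + 1 then p + 1 else p + 2)"

lemma cyc_simps: "cyc d 1 = 1" "cyc d 2 = d + 2" "i \<ge> 1 \<Longrightarrow> cyc d (i + 2) = skip d i"
proof -
  show "cyc d 1 = 1" by (induction d) (auto simp: transpose_def)
  show "cyc d 2 = d + 2" by (induction d) (auto simp: transpose_def)
  show "i \<ge> 1 \<Longrightarrow> cyc d (i + 2) = skip d i"
  proof (induction d)
    case (Suc d)
    consider "i < Suc d" | "i = Suc d" | "i > Suc d" by linarith
    then show ?case by cases (use Suc in \<open>auto simp: transpose_def skip_def\<close>)
  qed (simp add: skip_def)
qed

lemma cyc_permutes: "d < 2 * n + 1 \<Longrightarrow> cyc d permutes {1..2 * Suc n}"
proof (induction d)
  case (Suc d)
  have "Transposition.transpose (Suc (Suc d)) (Suc (Suc (Suc d))) permutes {1..2 * Suc n}"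
    by (rule permutes_swap_id) (use Suc.prems in auto)
  then show ?case unfolding cyc.simps by (rule permutes_compose[rotated]) (use Suc in auto)
qed (simp add: permutes_id)

lemma sign_cyc: "sign (cyc d) = (-1) ^ d"
proof (induction d)
  case (Suc d)
  have "permutation (cyc d)"
    by (rule permutation_permutes[THEN iffD2]) (use cyc_permutes[of d d] in \<open>auto intro!: exI[of _ "{1..2 * Suc d}"]\<close>)
  then have "sign (cyc (Suc d)) = sign (Transposition.transpose (Suc (Suc d)) (Suc (Suc (Suc d)))) * sign (cyc d)"
    by (simp add: sign_compose permutation_swap_id)
  then show ?case using Suc by (simp only: sign_swap_id) simp
qed (simp add: sign_id)

lemma skip_strict_mono: "p < q \<Longrightarrow> skip d p < skip d q"
  by (auto simp: skip_def)

lemma skip_less_iff: "skip d p < skip d q \<longleftrightarrow> p < q"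
  by (auto simp: skip_def)

text \<open>Canonical representatives of perfect matchings: pairs are ordered internally and then by
  their smaller elements.\<close>

definition pf_perms :: "nat \<Rightarrow> (nat \<Rightarrow> nat) set" where
  "pf_perms n = {\<eta>. \<eta> permutes {1..2*n} \<and> (\<forall>i\<in>{1..n}. \<eta> (2*i - 1) < \<eta> (2*i)) \<and> (\<forall>i\<in>{1..<n}. \<eta> (2*i - 1) < \<eta> (2*i + 1))}"

lemma pfaffian_alt: "pfaffian n b = (\<Sum>\<eta>\<in>pf_perms n. of_int (sign \<eta>) * (\<Prod>i\<in>{1..n}. b (\<eta> (2*i - 1)) (\<eta> (2*i))))"
  unfolding pfaffian_def pf_perms_def ..

definition lift2 :: "nat \<Rightarrow> (nat \<Rightarrow> nat) \<Rightarrow> nat \<Rightarrow> nat" where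
  "lift2 n \<eta> = map_permutation {1..2*n} (\<lambda>i. i + 2) \<eta>"

text \<open>The matching of the remaining indices, preceded by the pair of \<open>1\<close> and
  \<open>d + 2\<close>.\<close>

definition ext :: "nat \<Rightarrow> nat \<Rightarrow> (nat \<Rightarrow> nat) \<Rightarrow> nat \<Rightarrow> nat" where
  "ext n d \<eta> = cyc d \<circ> lift2 n \<eta>"

lemma inj_add2: "inj_on (\<lambda>i. i + 2) (S :: nat set)" by (auto simp: inj_on_def)

lemma image_add2: "(\<lambda>i. i + 2) ` {1..2*n} = {3..2*n+2::nat}"
  using image_add_atLeastAtMost'[of 2 1 "2*n"] by (simp add: add.commute)

lemma lift2_permutes: "\<eta> permutes {1..2*n} \<Longrightarrow> lift2 n \<eta> permutes {3..2*n+2}"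
  unfolding lift2_def image_add2[symmetric]
  by (rule map_permutation_permutes) (auto simp: bij_betw_def inj_on_def)

lemma lift2_apply: "\<eta> permutes {1..2*n} \<Longrightarrow> i \<in> {1..2*n} \<Longrightarrow> lift2 n \<eta> (i + 2) = \<eta> i + 2"
  unfolding lift2_def by (rule map_permutation_apply[OF inj_add2])

lemma lift2_12: "\<eta> permutes {1..2*n} \<Longrightarrow> lift2 n \<eta> 1 = 1" "\<eta> permutes {1..2*n} \<Longrightarrow> lift2 n \<eta> 2 = 2"
  using lift2_permutes[of \<eta> n] by (auto simp: permutes_def)

lemma ext_apply:
  assumes "\<eta> permutes {1..2*n}"
  shows "ext n d \<eta> 1 = 1" "ext n d \<eta> 2 = d + 2" "i \<in> {1..2*n} \<Longrightarrow> ext n d \<eta> (i + 2) = skip d (\<eta> i)"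
proof -
  show "ext n d \<eta> 1 = 1" "ext n d \<eta> 2 = d + 2"
    using lift2_12[OF assms] cyc_simps(1,2) by (simp_all add: ext_def)
  assume i: "i \<in> {1..2*n}"
  then have "\<eta> i \<in> {1..2*n}" using permutes_in_image[OF assms] by blast
  then show "ext n d \<eta> (i + 2) = skip d (\<eta> i)"
    using lift2_apply[OF assms i] cyc_simps(3)[of "\<eta> i" d] by (simp add: ext_def)
qed

lemma ext_permutes:
  assumes "\<eta> permutes {1..2*n}" "d < 2 * n + 1"
  shows "ext n d \<eta> permutes {1..2 * Suc n}"
  unfolding ext_def
  by (rule permutes_compose[OF permutes_subset[OF lift2_permutes[OF assms(1)]] cyc_permutes[OF assms(2)]]) auto

lemma sign_ext:
  assumes "\<eta> permutes {1..2*n}" "d < 2 * n + 1"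
  shows "sign (ext n d \<eta>) = (-1) ^ d * sign \<eta>"
proof -
  have "permutation (lift2 n \<eta>)" "permutation (cyc d)"
    using lift2_permutes[OF assms(1)] cyc_permutes[OF assms(2)] permutation_permutes by blast+
  moreover have "sign (lift2 n \<eta>) = sign \<eta>"
    unfolding lift2_def by (rule sign_map_permutation) (use assms inj_add2 in auto)
  ultimately show ?thesis by (simp add: ext_def sign_compose sign_cyc)
qed

lemma ext_in_pf_perms:
  assumes "\<eta> \<in> pf_perms n" "d < 2 * n + 1"
  shows "ext n d \<eta> \<in> pf_perms (Suc n)"
proof -
  have \<eta>: "\<eta> permutes {1..2*n}" "\<And>i. i \<in> {1..n} \<Longrightarrow> \<eta> (2*i - 1) < \<eta> (2*i)" "\<And>i. i \<in> {1..<n} \<Longrightarrow> \<eta> (2*i - 1) < \<eta> (2*i + 1)"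
    using assms(1) by (auto simp: pf_perms_def)
  note ea = ext_apply[OF \<eta>(1), where d=d]
  have odd: "ext n d \<eta> (2 * Suc k - 1) = skip d (\<eta> (2 * k - 1))" and even: "ext n d \<eta> (2 * Suc k) = skip d (\<eta> (2 * k))"
    if k: "k \<in> {1..n}" for k
  proof -
    have "2 * Suc k - 1 = (2 * k - 1) + 2" "2 * k - 1 \<in> {1..2*n}" using k by auto
    then show "ext n d \<eta> (2 * Suc k - 1) = skip d (\<eta> (2 * k - 1))" using ea(3)[of "2 * k - 1"] by (simp only:)
    have "2 * Suc k = 2 * k + 2" "2 * k \<in> {1..2*n}" using k by auto
    then show "ext n d \<eta> (2 * Suc k) = skip d (\<eta> (2 * k))" using ea(3)[of "2 * k"] by (simp only:)
  qed
  have "ext n d \<eta> (2 * i - 1) < ext n d \<eta> (2 * i)" if i: "i \<in> {1..Suc n}" for i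
  proof (cases "i = 1")
    case True
    then show ?thesis using ea(1,2) by simp
  next
    case False
    then obtain k where k: "i = Suc k" "k \<in> {1..n}" using i by (cases i) auto
    show ?thesis unfolding k(1) odd[OF k(2)] even[OF k(2)] by (intro skip_strict_mono \<eta>(2) k)
  qed
  moreover have "ext n d \<eta> (2 * i - 1) < ext n d \<eta> (2 * i + 1)" if i: "i \<in> {1..<Suc n}" for i
  proof (cases "i = 1")
    case True
    have "1 \<in> {1..2*n}" using i by auto
    then have "ext n d \<eta> (1 + 2) = skip d (\<eta> 1)" "\<eta> 1 \<ge> 1" using ea(3)[of 1] permutes_in_image[OF \<eta>(1), of 1] by (simp, simp add: permutes_in_image[OF \<eta>(1), of 1])
    then have "1 < ext n d \<eta> (1 + 2)" by (simp add: skip_def)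
    moreover have "2 * i + 1 = 1 + 2" "2 * i - 1 = 1" using True by simp_all
    ultimately show ?thesis using ea(1) by (simp only:)
  next
    case False
    then obtain k where k: "i = Suc k" "k \<in> {1..n}" "Suc k \<in> {1..n}" "k \<in> {1..<n}" using i by (cases i) auto
    have "2 * i + 1 = 2 * Suc (Suc k) - 1" "2 * Suc k - 1 = 2 * k + 1" using k by auto
    then have "ext n d \<eta> (2 * i + 1) = skip d (\<eta> (2 * k + 1))" using odd[OF k(3)] by (simp only:)
    then show ?thesis unfolding k(1) odd[OF k(2)] using skip_strict_mono[OF \<eta>(3)[OF k(4)]] by simp
  qed
  ultimately show ?thesis using ext_permutes[OF \<eta>(1) assms(2)] by (auto simp: pf_perms_def)
qed

text \<open>An element in an even position exceeds its partner, and one in a later odd position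
  exceeds the previous first entry; so the minimum can only stand at position 1.\<close>

lemma pf_perms_first:
  assumes "\<eta> \<in> pf_perms (Suc n)"
  shows "\<eta> 1 = 1"
proof -
  have \<eta>: "\<eta> permutes {1..2*Suc n}" "\<And>i. i \<in> {1..Suc n} \<Longrightarrow> \<eta> (2*i - 1) < \<eta> (2*i)" "\<And>i. i \<in> {1..<Suc n} \<Longrightarrow> \<eta> (2*i - 1) < \<eta> (2*i + 1)"
    using assms by (auto simp: pf_perms_def)
  have "1 \<in> \<eta> ` {1..2*Suc n}" using permutes_image[OF \<eta>(1)] by simp
  then obtain k where k: "k \<in> {1..2*Suc n}" "\<eta> k = 1" by auto
  have pos: "\<eta> i \<ge> 1" if "i \<in> {1..2*Suc n}" for i using permutes_in_image[OF \<eta>(1), of i] that by auto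
  show ?thesis
  proof (cases "even k")
    case True
    then obtain i where i: "k = 2 * i" by blast
    then have "i \<in> {1..Suc n}" "2 * i - 1 \<in> {1..2*Suc n}" using k by auto
    then show ?thesis using \<eta>(2)[of i] pos[of "2 * i - 1"] k i by auto
  next
    case False
    then obtain i where i: "k = 2 * i + 1" by (auto elim: oddE)
    show ?thesis
    proof (cases "i = 0")
      case False
      then have "i \<in> {1..<Suc n}" "2 * i - 1 \<in> {1..2*Suc n}" using k i by auto
      then show ?thesis using \<eta>(3)[of i] pos[of "2 * i - 1"] k i by auto
    qed (use k i in simp)
  qed
qed

lemma pf_perms_Suc_surj:
  assumes "\<eta> \<in> pf_perms (Suc n)"
  shows "\<exists>d \<eta>'. d < 2 * n + 1 \<and> \<eta>' \<in> pf_perms n \<and> \<eta> = ext n d \<eta>'"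
proof -
  have \<eta>: "\<eta> permutes {1..2*Suc n}" "\<And>i. i \<in> {1..Suc n} \<Longrightarrow> \<eta> (2*i - 1) < \<eta> (2*i)" "\<And>i. i \<in> {1..<Suc n} \<Longrightarrow> \<eta> (2*i - 1) < \<eta> (2*i + 1)"
    using assms by (auto simp: pf_perms_def)
  have e1: "\<eta> 1 = 1" by (rule pf_perms_first[OF assms])
  have "\<eta> 2 \<in> {1..2*Suc n}" using permutes_in_image[OF \<eta>(1), of 2] by auto
  moreover have "\<eta> 1 < \<eta> 2" using \<eta>(2)[of 1] by simp
  ultimately have "2 \<le> \<eta> 2" "\<eta> 2 \<le> 2 * n + 2" using e1 by auto
  then obtain d where d: "\<eta> 2 = d + 2" "d < 2 * n + 1"
    by (intro that[of "\<eta> 2 - 2"]) auto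
  define \<psi> where "\<psi> = inv (cyc d) \<circ> \<eta>"
  have cp: "cyc d permutes {1..2*Suc n}" by (rule cyc_permutes[OF d(2)])
  have \<psi>p: "\<psi> permutes {1..2*Suc n}" unfolding \<psi>_def by (intro permutes_compose \<eta>(1) permutes_inv cp)
  have \<psi>1: "\<psi> 1 = 1" using e1 cyc_simps(1)[of d] permutes_inverses(2)[OF cp, of 1] by (simp add: \<psi>_def)
  have \<psi>2: "\<psi> 2 = 2" using d cyc_simps(2)[of d] permutes_inverses(2)[OF cp, of 2] by (simp add: \<psi>_def)
  have \<psi>q: "\<psi> permutes {3..2*n+2}"
  proof (rule permutes_superset[OF \<psi>p])
    fix x assume "x \<in> {1..2*Suc n} - {3..2*n+2}"
    then have "x = 1 \<or> x = 2" by auto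
    then show "\<psi> x = x" using \<psi>1 \<psi>2 by auto
  qed
  define \<eta>' where "\<eta>' = map_permutation {3..2*n+2} (\<lambda>i. i - 2) \<psi>"
  have inj: "inj_on (\<lambda>i. i - 2) {3..2*n+2::nat}" by (auto simp: inj_on_def)
  have im: "(\<lambda>i. i - 2) ` {3..2*n+2::nat} = {1..2*n}"
    unfolding image_add2[symmetric] image_image by simp
  have \<eta>'p: "\<eta>' permutes {1..2*n}"
    unfolding \<eta>'_def im[symmetric] by (rule map_permutation_permutes) (use inj \<psi>q in \<open>auto simp: bij_betw_def\<close>)
  have \<eta>'a: "\<eta>' i + 2 = \<psi> (i + 2)" if "i \<in> {1..2*n}" for i
  proof -
    have "i + 2 \<in> {3..2*n+2}" using that by auto
    moreover from this have "\<psi> (i + 2) \<in> {3..2*n+2}" using permutes_in_image[OF \<psi>q] by blast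
    ultimately show ?thesis
      using map_permutation_apply[OF inj, of "i + 2" \<psi>] by (auto simp: \<eta>'_def)
  qed
  have eq: "\<eta> = ext n d \<eta>'"
  proof
    fix k
    have "lift2 n \<eta>' k = \<psi> k"
    proof (cases "k \<in> {3..2*n+2}")
      case True
      then obtain i where i: "k = i + 2" "i \<in> {1..2*n}" unfolding image_add2[symmetric] by auto
      then show ?thesis using lift2_apply[OF \<eta>'p i(2)] \<eta>'a[OF i(2)] by simp
    next
      case False
      then show ?thesis using lift2_permutes[OF \<eta>'p] \<psi>q by (auto simp: permutes_def)
    qed
    then show "\<eta> k = ext n d \<eta>' k" using permutes_inverses(1)[OF cp] by (simp add: ext_def \<psi>_def)
  qed
  note ea = ext_apply(3)[OF \<eta>'p, where d=d, folded eq]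
  have "\<eta>' \<in> pf_perms n"
    unfolding pf_perms_def
  proof (intro CollectI conjI \<eta>'p ballI)
    fix i assume i: "i \<in> {1..n}"
    have "\<eta> (2 * Suc i - 1) < \<eta> (2 * Suc i)" by (rule \<eta>(2)) (use i in auto)
    moreover have "2 * Suc i - 1 = (2 * i - 1) + 2" "2 * Suc i = 2 * i + 2" using i by auto
    moreover have "2 * i - 1 \<in> {1..2*n}" "2 * i \<in> {1..2*n}" using i by auto
    ultimately have "skip d (\<eta>' (2 * i - 1)) < skip d (\<eta>' (2 * i))"
      using ea[of "2 * i - 1"] ea[of "2 * i"] by (simp only:)
    then show "\<eta>' (2 * i - 1) < \<eta>' (2 * i)" by (simp add: skip_less_iff)
  next
    fix i assume i: "i \<in> {1..<n}"
    have "\<eta> (2 * Suc i - 1) < \<eta> (2 * Suc i + 1)" by (rule \<eta>(3)) (use i in auto)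
    moreover have "2 * Suc i - 1 = (2 * i - 1) + 2" "2 * Suc i + 1 = (2 * i + 1) + 2" using i by auto
    moreover have "2 * i - 1 \<in> {1..2*n}" "2 * i + 1 \<in> {1..2*n}" using i by auto
    ultimately have "skip d (\<eta>' (2 * i - 1)) < skip d (\<eta>' (2 * i + 1))"
      using ea[of "2 * i - 1"] ea[of "2 * i + 1"] by (simp only:)
    then show "\<eta>' (2 * i - 1) < \<eta>' (2 * i + 1)" by (simp add: skip_less_iff)
  qed
  then show ?thesis using d(2) eq by blast
qed

lemma ext_inj:
  assumes "\<eta> permutes {1..2*n}" "\<eta>' permutes {1..2*n}" "ext n d \<eta> = ext n d' \<eta>'"
  shows "d = d' \<and> \<eta> = \<eta>'"
proof -
  have d: "d = d'" using ext_apply(2)[OF assms(1), of d] ext_apply(2)[OF assms(2), of d'] assms(3) by simp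
  have "\<eta> i = \<eta>' i" for i
  proof (cases "i \<in> {1..2*n}")
    case True
    then have "skip d (\<eta> i) = skip d (\<eta>' i)"
      using ext_apply(3)[OF assms(1) True, of d] ext_apply(3)[OF assms(2) True, of d'] assms(3) d by simp
    then show ?thesis by (auto simp: skip_def split: if_splits)
  next
    case False
    then show ?thesis using assms(1,2) by (auto simp: permutes_def)
  qed
  with d show ?thesis by auto
qed

text \<open>A canonical matching is determined by the partner \<open>d + 2\<close> of the index
  \<open>1\<close> and by the matching induced on the rest, so \<open>ext\<close> is a bijection.
  The cycle accounts for the alternating sign.\<close>

lemma pfaffian_Suc:
  "pfaffian (Suc n) b = (\<Sum>d<2*n+1. (-1) ^ d * b 1 (d + 2) * pfaffian n (\<lambda>p q. b (skip d p) (skip d q)))"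
proof -
  let ?t = "\<lambda>n b \<eta>. of_int (sign \<eta>) * (\<Prod>i\<in>{1..n}. b (\<eta> (2*i - 1)) (\<eta> (2*i)))"
  have fin: "finite (pf_perms n)" for n
    by (rule finite_subset[OF _ finite_permutations[of "{1..2*n}"]]) (auto simp: pf_perms_def)
  have img: "pf_perms (Suc n) = (\<lambda>(d, \<eta>). ext n d \<eta>) ` ({..<2*n+1} \<times> pf_perms n)"
  proof (rule set_eqI, rule iffI)
    fix \<eta> assume "\<eta> \<in> pf_perms (Suc n)"
    then obtain d \<eta>' where "d < 2 * n + 1" "\<eta>' \<in> pf_perms n" "\<eta> = ext n d \<eta>'" using pf_perms_Suc_surj by blast
    then show "\<eta> \<in> (\<lambda>(d, \<eta>). ext n d \<eta>) ` ({..<2*n+1} \<times> pf_perms n)" by (intro image_eqI[of _ _ "(d, \<eta>')"]) auto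
  qed (auto intro: ext_in_pf_perms)
  have inj: "inj_on (\<lambda>(d, \<eta>). ext n d \<eta>) ({..<2*n+1} \<times> pf_perms n)"
  proof (rule inj_onI)
    fix x y assume xy: "x \<in> {..<2*n+1} \<times> pf_perms n" "y \<in> {..<2*n+1} \<times> pf_perms n"
      "(\<lambda>(d, \<eta>). ext n d \<eta>) x = (\<lambda>(d, \<eta>). ext n d \<eta>) y"
    obtain d \<eta> d' \<eta>' where e: "x = (d, \<eta>)" "y = (d', \<eta>')" by (cases x, cases y)
    show "x = y" using ext_inj[of \<eta> n \<eta>' d d'] xy by (simp add: e pf_perms_def)
  qed
  have "pfaffian (Suc n) b = (\<Sum>(d, \<eta>)\<in>{..<2*n+1} \<times> pf_perms n. ?t (Suc n) b (ext n d \<eta>))"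
    unfolding pfaffian_alt img by (subst sum.reindex[OF inj]) (simp add: case_prod_beta')
  also have "\<dots> = (\<Sum>d<2*n+1. \<Sum>\<eta>\<in>pf_perms n. ?t (Suc n) b (ext n d \<eta>))"
    by (rule sum.cartesian_product[symmetric])
  also have "\<dots> = (\<Sum>d<2*n+1. (-1) ^ d * b 1 (d + 2) * pfaffian n (\<lambda>p q. b (skip d p) (skip d q)))"
  proof (rule sum.cong[OF refl])
    fix d assume "d \<in> {..<2*n+1}"
    then have d: "d < 2 * n + 1" by simp
    have "?t (Suc n) b (ext n d \<eta>) = (-1) ^ d * b 1 (d + 2) * ?t n (\<lambda>p q. b (skip d p) (skip d q)) \<eta>" if "\<eta> \<in> pf_perms n" for \<eta>
    proof -
      have \<eta>: "\<eta> permutes {1..2*n}" using that by (simp add: pf_perms_def)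
      have "(\<Prod>i\<in>{1..Suc n}. b (ext n d \<eta> (2*i - 1)) (ext n d \<eta> (2*i))) =
        b 1 (d + 2) * (\<Prod>i\<in>{1..n}. b (ext n d \<eta> (2*Suc i - 1)) (ext n d \<eta> (2*Suc i)))"
      proof -
        have "(\<Prod>i\<in>{1..Suc n}. g i) = g 1 * (\<Prod>i\<in>{1..n}. g (Suc i))" for g :: "nat \<Rightarrow> 'a"
          using prod.atLeast_Suc_atMost[of 1 "Suc n" g] prod.shift_bounds_cl_Suc_ivl[of g 1 n] by simp
        from this[of "\<lambda>i. b (ext n d \<eta> (2*i - 1)) (ext n d \<eta> (2*i))"]
        show ?thesis using ext_apply(1,2)[OF \<eta>, where d=d] by simp
      qed
      also have "(\<Prod>i\<in>{1..n}. b (ext n d \<eta> (2*Suc i - 1)) (ext n d \<eta> (2*Suc i))) = (\<Prod>i\<in>{1..n}. b (skip d (\<eta> (2*i - 1))) (skip d (\<eta> (2*i))))"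
      proof (rule prod.cong[OF refl])
        fix i assume i: "i \<in> {1..n}"
        have "2 * Suc i - 1 = (2 * i - 1) + 2" "2 * Suc i = 2 * i + 2" using i by auto
        moreover have "2 * i - 1 \<in> {1..2*n}" "2 * i \<in> {1..2*n}" using i by auto
        ultimately show "b (ext n d \<eta> (2*Suc i - 1)) (ext n d \<eta> (2*Suc i)) = b (skip d (\<eta> (2*i - 1))) (skip d (\<eta> (2*i)))"
          using ext_apply(3)[OF \<eta>, where d=d] by (simp only:)
      qed
      finally show ?thesis unfolding sign_ext[OF \<eta> d] by (simp add: ac_simps)
    qed
    then show "(\<Sum>\<eta>\<in>pf_perms n. ?t (Suc n) b (ext n d \<eta>)) = (-1) ^ d * b 1 (d + 2) * pfaffian n (\<lambda>p q. b (skip d p) (skip d q))"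
      unfolding pfaffian_alt by (simp add: sum_distrib_left)
  qed
  finally show ?thesis .
qed

lemma pfaffian_0: "pfaffian 0 b = 1"
proof -
  have "pf_perms 0 = {id}" by (auto simp: pf_perms_def)
  then show ?thesis unfolding pfaffian_alt by (simp add: sign_id)
qed

section \<open>The Pfaffian as a moment\<close>

abbreviation moeb :: "complex \<Rightarrow> complex \<Rightarrow> complex" where "moeb x y \<equiv> (x - y) / (1 - x * y)"

text \<open>The product of Moebius differences over all pairs in list order, the hyperbolic analogue
  of a Vandermonde product.\<close>

primrec schur :: "complex list \<Rightarrow> complex" where
  "schur [] = 1"
| "schur (x # xs) = (\<Prod>y\<leftarrow>xs. moeb x y) * schur xs"

lemma moeb_antisym: "moeb x y = - moeb y x"
  by (simp add: mult.commute minus_divide_left)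

lemma schur_append: "schur (xs @ [a]) = schur xs * (\<Prod>x\<leftarrow>xs. moeb x a)"
  by (induction xs) (simp_all add: ac_simps)

text \<open>Bringing the entry at position \<open>j\<close> to the front reverses the order of
  \<open>j\<close> pairs, and each Moebius difference is antisymmetric.\<close>

lemma schur_remove:
  assumes "distinct xs" "j < length xs"
  shows "schur xs = (-1) ^ j * (\<Prod>l\<in>set xs - {xs ! j}. moeb (xs ! j) l) * schur (take j xs @ drop (Suc j) xs)"
  using assms
proof (induction xs arbitrary: j)
  case (Cons x ys)
  show ?case
  proof (cases j)
    case 0
    then show ?thesis using Cons.prems by (simp add: prod.distinct_set_conv_list)
  next
    case (Suc i)
    define y where "y = ys ! i"
    define rem where "rem = take i ys @ drop (Suc i) ys"
    have i: "i < length ys" "distinct ys" "x \<notin> set ys" using Cons.prems Suc by auto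
    have y: "y \<in> set ys" "x \<noteq> y" using i by (auto simp: y_def)
    have ys: "ys = take i ys @ y # drop (Suc i) ys" unfolding y_def using i by (simp add: id_take_nth_drop)
    have rem: "distinct rem" "set rem = set ys - {y}"
    proof -
      have "distinct (take i ys @ y # drop (Suc i) ys)" using ys i by simp
      moreover have "set ys = set (take i ys @ y # drop (Suc i) ys)" using ys by simp
      ultimately show "distinct rem" "set rem = set ys - {y}" by (auto simp: rem_def)
    qed
    have IH: "schur ys = (-1) ^ i * (\<Prod>l\<in>set ys - {y}. moeb y l) * schur rem"
      using Cons.IH[OF i(2,1)] by (simp add: y_def rem_def)
    have p1: "(\<Prod>l\<leftarrow>ys. moeb x l) = moeb x y * (\<Prod>l\<in>set ys - {y}. moeb x l)"
      using y i by (simp add: prod.distinct_set_conv_list[symmetric] prod.remove[of _ y])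
    have p2: "(\<Prod>l\<leftarrow>rem. moeb x l) = (\<Prod>l\<in>set ys - {y}. moeb x l)"
      using rem by (simp add: prod.distinct_set_conv_list[symmetric])
    have p3: "(\<Prod>l\<in>set (x # ys) - {y}. moeb y l) = moeb y x * (\<Prod>l\<in>set ys - {y}. moeb y l)"
    proof -
      have "set (x # ys) - {y} = insert x (set ys - {y})" using y by auto
      then show ?thesis using i by simp
    qed
    have "schur (x # ys) = moeb x y * (\<Prod>l\<in>set ys - {y}. moeb x l) * ((-1) ^ i * (\<Prod>l\<in>set ys - {y}. moeb y l) * schur rem)"
      by (simp only: schur.simps p1 IH)
    also have "\<dots> = (-1) ^ Suc i * (moeb y x * (\<Prod>l\<in>set ys - {y}. moeb y l)) * ((\<Prod>l\<in>set ys - {y}. moeb x l) * schur rem)"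
      unfolding moeb_antisym[of x y] by (simp only: power_Suc mult_minus_left mult_minus_right mult_1_left mult_ac)
    finally show ?thesis unfolding Suc by (simp only: nth_Cons_Suc y_def[symmetric] p3 take_Suc_Cons drop_Suc_Cons append_Cons schur.simps rem_def[symmetric] p2)
  qed
qed simp

lemma map_skip_eq:
  assumes "d < 2 * n + 1"
  shows "map (\<lambda>p. f (skip d p)) [1..<2*n+1] = take d (map f [2..<2*n+3]) @ drop (Suc d) (map f [2..<2*n+3])"
proof (rule nth_equalityI)
  show "length (map (\<lambda>p. f (skip d p)) [1..<2*n+1]) = length (take d (map f [2..<2*n+3]) @ drop (Suc d) (map f [2..<2*n+3]))"
    using assms by simp
  fix i assume "i < length (map (\<lambda>p. f (skip d p)) [1..<2*n+1])"
  then have i: "i < 2 * n" by (simp del: upt_Suc)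
  have "map (\<lambda>p. f (skip d p)) [1..<2*n+1] ! i = f (skip d (1 + i))"
    by (subst nth_map_upt) (use i in auto)
  also have "\<dots> = (take d (map f [2..<2*n+3]) @ drop (Suc d) (map f [2..<2*n+3])) ! i"
  proof (cases "i < d")
    case True
    have "map f [2..<2*n+3] ! i = f (2 + i)" by (subst nth_map_upt) (use i in auto)
    moreover have "skip d (1 + i) = 2 + i" using True by (simp add: skip_def)
    ultimately show ?thesis using True assms by (simp add: nth_append)
  next
    case False
    have "map f [2..<2*n+3] ! (Suc i) = f (2 + Suc i)" by (subst nth_map_upt) (use i in auto)
    moreover have "skip d (1 + i) = 2 + Suc i" using False by (simp add: skip_def)
    moreover have "length (map f [2..<2*n+3]) \<ge> Suc d" using assms by simp
    ultimately show ?thesis using False assms by (simp add: nth_append min_def del: upt_Suc)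
  qed
  finally show "map (\<lambda>p. f (skip d p)) [1..<2*n+1] ! i = (take d (map f [2..<2*n+3]) @ drop (Suc d) (map f [2..<2*n+3])) ! i" .
qed

text \<open>Induction by expansion along the first row. In the term for \<open>j\<close> the smaller
  Schur product is the full one divided by the factors involving \<open>j\<close>; the alternating
  signs cancel against those of the expansion. What is left is the partial fraction formula with
  \<open>u = f 1\<close>.\<close>

lemma pfaffian_moment:
  assumes "inj_on f {1..2*n}" "f ` {1..2*n} \<subseteq> ball 0 1" "0 \<notin> f ` {1..2*n}"
  shows "pfaffian n (\<lambda>p q. (f p - f q) / (1 - f p * f q)\<^sup>2) = schur (map f [1..<2*n+1]) * moment (f ` {1..2*n})"
  using assms
proof (induction n arbitrary: f)
  case 0
  show ?case by (simp add: pfaffian_0 moment_empty)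
next
  case (Suc n)
  define xs where "xs = map f [2..<2*n+3]"
  define u where "u = f 1"
  define L where "L = set xs"
  have idx: "{1..2 * Suc n} = insert 1 {2..<2*n+3}" by auto
  have L: "L = f ` {2..<2*n+3}" by (simp add: L_def xs_def)
  have fS: "f ` {1..2 * Suc n} = insert u L" unfolding idx L u_def by simp
  have dxs: "distinct xs" unfolding xs_def distinct_map using Suc.prems(1) by (auto intro: inj_on_subset)
  have uL: "u \<notin> L"
  proof
    assume "u \<in> L"
    then obtain i where "i \<in> {2..<2*n+3}" "f 1 = f i" by (auto simp: L u_def)
    then have "1 = i" by (intro inj_onD[OF Suc.prems(1)]) auto
    with \<open>i \<in> {2..<2*n+3}\<close> show False by simp
  qed
  have Lb: "finite L" "L \<subseteq> ball 0 1" "0 \<notin> L" "u \<in> ball 0 1"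
    using Suc.prems(2,3) unfolding fS by (auto simp: L_def)
  have len: "length xs = 2 * n + 1" by (simp add: xs_def)
  have nth: "xs ! d = f (d + 2)" if "d < 2 * n + 1" for d using that by (simp add: xs_def add.commute)
  have map1: "map f [1..<2 * Suc n + 1] = u # xs"
  proof -
    have "[1..<2 * Suc n + 1] = 1 # [Suc 1..<2 * Suc n + 1]" by (rule upt_conv_Cons) simp
    moreover have "Suc 1 = 2" "2 * Suc n + 1 = 2 * n + 3" by simp_all
    ultimately show ?thesis by (simp only: xs_def u_def list.map)
  qed
  have nz: "moeb j l \<noteq> 0" if "j \<in> L" "l \<in> L - {j}" for j l
  proof -
    have "j \<in> ball 0 1" "l \<in> ball 0 1" "j \<noteq> l" using that Lb(2) by auto
    then show ?thesis using disc_neq[of j l] by simp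
  qed
  define t where "t j = (u - j) / (1 - u * j)\<^sup>2 * (\<Prod>l\<in>L-{j}. (1 - j * l) / (j - l)) * moment (L - {j})" for j
  have trm: "(-1) ^ d * ((u - f (d + 2)) / (1 - u * f (d + 2))\<^sup>2) *
      pfaffian n (\<lambda>p q. (f (skip d p) - f (skip d q)) / (1 - f (skip d p) * f (skip d q))\<^sup>2) = schur xs * t (xs ! d)"
    if d: "d < 2 * n + 1" for d
  proof -
    define rem where "rem = take d xs @ drop (Suc d) xs"
    define j where "j = xs ! d"
    have jL: "j \<in> L" using d len by (simp add: j_def L_def)
    have xsd: "xs = take d xs @ j # drop (Suc d) xs" unfolding j_def using d len by (simp add: id_take_nth_drop)
    have rem: "distinct rem" "set rem = L - {j}"
    proof -
      have "distinct (take d xs @ j # drop (Suc d) xs)" using xsd dxs by simp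
      moreover have "set xs = set (take d xs @ j # drop (Suc d) xs)" using xsd by simp
      ultimately show "distinct rem" "set rem = L - {j}" by (auto simp: rem_def L_def)
    qed
    have m: "map (\<lambda>p. f (skip d p)) [1..<2*n+1] = rem"
      unfolding rem_def xs_def by (rule map_skip_eq[OF d])
    have im: "(\<lambda>p. f (skip d p)) ` {1..2*n} = L - {j}"
    proof -
      have "{1..2*n} = set [1..<2*n+1]" by auto
      then have "(\<lambda>p. f (skip d p)) ` {1..2*n} = set (map (\<lambda>p. f (skip d p)) [1..<2*n+1])" by (simp only: set_map)
      then show ?thesis unfolding m rem(2) .
    qed
    have inj: "inj_on (\<lambda>p. f (skip d p)) {1..2*n}"
    proof -
      have "distinct (map (\<lambda>p. f (skip d p)) [1..<2*n+1])" unfolding m by (rule rem(1))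
      moreover have "set [1..<2*n+1] = {1..2*n}" by auto
      ultimately show ?thesis by (simp only: distinct_map)
    qed
    have IH: "pfaffian n (\<lambda>p q. (f (skip d p) - f (skip d q)) / (1 - f (skip d p) * f (skip d q))\<^sup>2) = schur rem * moment (L - {j})"
      using Suc.IH[OF inj] Lb unfolding im m by auto
    define Q where "Q = (\<Prod>l\<in>L - {j}. moeb j l)"
    have Q0: "Q \<noteq> 0" unfolding Q_def using nz[OF jL] Lb(1) by (simp add: prod_zero_iff)
    have "schur xs = (-1) ^ d * Q * schur rem"
      using schur_remove[OF dxs, of d] d len by (simp add: Q_def rem_def j_def L_def)
    \<comment> \<open>The sign is its own inverse, so it moves across when the nonzero factor
      \<open>Q\<close> is divided out.\<close>
    then have "(-1) ^ d * schur rem = schur xs * (1 / Q)"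
      using Q0 by (simp add: field_simps flip: power_mult_distrib)
    moreover have "1 / Q = (\<Prod>l\<in>L-{j}. (1 - j * l) / (j - l))"
      unfolding Q_def by (simp add: prod_dividef[symmetric] prod_inversef[symmetric] divide_inverse mult.commute)
    ultimately have "(-1) ^ d * schur rem = schur xs * (\<Prod>l\<in>L-{j}. (1 - j * l) / (j - l))" by simp
    define P where "P = (\<Prod>l\<in>L-{j}. (1 - j * l) / (j - l))"
    have e: "(-1) ^ d * schur rem = schur xs * P"
      using \<open>(-1) ^ d * schur rem = schur xs * (\<Prod>l\<in>L-{j}. (1 - j * l) / (j - l))\<close> by (simp only: P_def)
    have gen: "(-1) ^ d * X * (schur rem * Y) = schur xs * (X * P * Y)" for X Y
    proof -
      have "(-1) ^ d * X * (schur rem * Y) = ((-1) ^ d * schur rem) * (X * Y)" by (simp only: mult_ac)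
      also have "\<dots> = schur xs * (X * P * Y)" unfolding e by (simp only: mult_ac)
      finally show ?thesis .
    qed
    show ?thesis unfolding IH t_def j_def[symmetric] nth[OF d, symmetric] P_def[symmetric] by (rule gen)
  qed
  have "pfaffian (Suc n) (\<lambda>p q. (f p - f q) / (1 - f p * f q)\<^sup>2) = (\<Sum>d<2*n+1. schur xs * t (xs ! d))"
    unfolding pfaffian_Suc
    by (rule sum.cong[OF refl]) (use trm in \<open>simp add: u_def\<close>)
  also have "\<dots> = schur xs * (\<Sum>j\<in>L. t j)"
  proof -
    have "bij_betw (\<lambda>d. xs ! d) {..<2*n+1} L"
      unfolding L_def using bij_betw_nth[OF dxs, of "{..<2*n+1}" "set xs"] len by (auto simp: lessThan_atLeast0)
    then show ?thesis unfolding sum_distrib_left by (rule sum.reindex_bij_betw)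
  qed
  also have "(\<Sum>j\<in>L. t j) = (\<Prod>l\<in>L. moeb u l) * moment (insert u L)"
    unfolding t_def by (rule moment_partial_fractions[symmetric, OF Lb(1-3,4) uL])
  also have "schur xs * ((\<Prod>l\<in>L. moeb u l) * moment (insert u L)) = schur (u # xs) * moment (insert u L)"
    using dxs by (simp add: L_def prod.distinct_set_conv_list)
  finally show ?case unfolding map1 fS .
qed

text \<open>Each \<open>z i\<close> followed by its conjugate. The block matrix thereby becomes a
  scalar kernel evaluated at \<open>2 * n\<close> points, for which the Pfaffian is already
  known.\<close>

definition conj_pts :: "(nat \<Rightarrow> complex) \<Rightarrow> nat \<Rightarrow> complex" where
  "conj_pts z p = (if odd p then z ((p + 1) div 2) else cnj (z ((p + 1) div 2)))"

lemma block_matrix_kernel_c: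
  "block_matrix kernel_c z = (\<lambda>p q. (conj_pts z p - conj_pts z q) / (1 - conj_pts z p * conj_pts z q)\<^sup>2)"
  by (intro ext) (simp add: block_matrix_def kernel_c_def conj_pts_def)

lemma conj_pts_simps: "i \<ge> 1 \<Longrightarrow> conj_pts z (2 * i - 1) = z i" "conj_pts z (2 * i) = cnj (z i)"
proof -
  show "conj_pts z (2 * i) = cnj (z i)" by (simp add: conj_pts_def)
  assume "i \<ge> 1"
  then have "odd (2 * i - 1)" "(2 * i - 1 + 1) div 2 = i" by auto
  then show "conj_pts z (2 * i - 1) = z i" by (simp add: conj_pts_def)
qed

text \<open>The four factors are the Moebius differences between the conjugate pair of
  \<open>x\<close> and that of \<open>a\<close>. This is what matches the Schur product with the
  weights from the Palm formula.\<close>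

lemma norm_blaschke2_sq:
  "of_real ((cmod (blaschke2 x a))\<^sup>2) = moeb x a * moeb x (cnj a) * moeb (cnj x) a * moeb (cnj x) (cnj a)"
proof -
  have b: "blaschke2 x a = moeb x a * moeb (cnj x) a"
  proof -
    have "(a - x) * (a - cnj x) = (x - a) * (cnj x - a)" by (simp add: algebra_simps)
    moreover have "(1 - a * cnj x) * (1 - a * x) = (1 - x * a) * (1 - cnj x * a)" by (simp only: mult.commute)
    ultimately show ?thesis unfolding blaschke2_def times_divide_times_eq by simp
  qed
  have c: "cnj (blaschke2 x a) = moeb (cnj x) (cnj a) * moeb x (cnj a)" unfolding b by simp
  have "(A * B) * (C * D) = A * D * B * C" for A B C D :: complex by (simp only: mult_ac)
  then show ?thesis unfolding complex_norm_square c unfolding b .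
qed

lemma prod_list_conj_pts:
  fixes g :: "complex \<Rightarrow> complex"
  shows "(\<Prod>x\<leftarrow>map (conj_pts z) [1..<2*n+1]. g x) = (\<Prod>j\<in>{1..n}. g (z j) * g (cnj (z j)))"
proof (induction n)
  case (Suc n)
  have e: "[1..<2*Suc n+1] = [1..<2*n+1] @ [2*n+1] @ [2*n+2]" by simp
  have w: "conj_pts z (2*n+1) = z (Suc n)" "conj_pts z (2*n+2) = cnj (z (Suc n))"
    using conj_pts_simps[where i="Suc n" and z=z] by simp_all
  have "(\<Prod>x\<leftarrow>map (conj_pts z) [1..<2*Suc n+1]. g x) = (\<Prod>j\<in>{1..n}. g (z j) * g (cnj (z j))) * (g (z (Suc n)) * g (cnj (z (Suc n))))"
    unfolding e map_append prod_list.append Suc.IH by (simp only: list.map prod_list.Cons prod_list.Nil w mult_1_right)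
  then show ?case by (simp add: mult.commute)
qed simp

text \<open>Factors are grouped by the indices involved: within one conjugate pair a single Moebius
  difference remains, and between two pairs four of them form a squared Blaschke modulus. The range
  \<open>j < i\<close> agrees with that in \<open>weight\<close>.\<close>

lemma schur_conj_pts:
  "schur (map (conj_pts z) [1..<2*n+1]) =
    (\<Prod>i\<in>{1..n}. moeb (z i) (cnj (z i)) * of_real (\<Prod>j\<in>{1..<i}. (cmod (blaschke2 (z j) (z i)))\<^sup>2))"
proof (induction n)
  case (Suc n)
  let ?w = "conj_pts z" and ?a = "z (Suc n)"
  have "[1..<2*Suc n+1] = [1..<2*n+1] @ [2*n+1] @ [2*n+2]" by simp
  moreover have "?w (2*n+1) = ?a" "?w (2*n+2) = cnj ?a"
    using conj_pts_simps[where i="Suc n" and z=z] by simp_all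
  ultimately have "schur (map ?w [1..<2*Suc n+1]) = schur ((map ?w [1..<2*n+1] @ [?a]) @ [cnj ?a])"
    by (simp only: map_append list.map append_assoc)
  also have "\<dots> = schur (map ?w [1..<2*n+1]) * (\<Prod>x\<leftarrow>map ?w [1..<2*n+1]. moeb x ?a) * ((\<Prod>x\<leftarrow>map ?w [1..<2*n+1]. moeb x (cnj ?a)) * moeb ?a (cnj ?a))"
    by (simp only: schur_append map_append prod_list.append list.map prod_list.Cons prod_list.Nil mult_1_right)
  finally have "schur (map ?w [1..<2*Suc n+1]) = schur (map ?w [1..<2*n+1]) *
     (moeb ?a (cnj ?a) * (\<Prod>j\<in>{1..n}. moeb (z j) ?a * moeb (cnj (z j)) ?a * (moeb (z j) (cnj ?a) * moeb (cnj (z j)) (cnj ?a))))"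
    unfolding prod_list_conj_pts prod.distrib by (simp only: mult_ac)
  also have "(\<Prod>j\<in>{1..n}. moeb (z j) ?a * moeb (cnj (z j)) ?a * (moeb (z j) (cnj ?a) * moeb (cnj (z j)) (cnj ?a))) =
     of_real (\<Prod>j\<in>{1..<Suc n}. (cmod (blaschke2 (z j) ?a))\<^sup>2)"
    unfolding of_real_prod
  proof (rule prod.cong)
    fix j assume "j \<in> {1..<Suc n}"
    show "moeb (z j) ?a * moeb (cnj (z j)) ?a * (moeb (z j) (cnj ?a) * moeb (cnj (z j)) (cnj ?a)) = of_real ((cmod (blaschke2 (z j) ?a))\<^sup>2)"
      unfolding norm_blaschke2_sq by (simp only: mult_ac)
  qed auto
  finally have "schur (map ?w [1..<2*Suc n+1]) = schur (map ?w [1..<2*n+1]) *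
     (moeb ?a (cnj ?a) * of_real (\<Prod>j\<in>{1..<Suc n}. (cmod (blaschke2 (z j) ?a))\<^sup>2))" .
  then show ?case unfolding Suc.IH by (simp only: prod.nat_ivl_Suc' le_add1 plus_1_eq_Suc One_nat_def Suc_le_mono le0 mult.commute)
qed simp

definition abs_moment :: "nat \<Rightarrow> (nat \<Rightarrow> complex) \<Rightarrow> real" where
  "abs_moment n z = (\<integral>a. (\<Prod>i\<in>{1..n}. (cmod (pser a (z i)))\<^sup>2) \<partial>gauss)"

text \<open>Parity of the position is visible in the sign of the imaginary part, so a point never
  coincides with the conjugate of another; this also excludes 0.\<close>

lemma conj_pts_range:
  assumes z: "z \<in> PiE {1..n} (\<lambda>_. upper_half_disc)" and inj: "inj_on z {1..n}"
  shows "inj_on (conj_pts z) {1..2*n}" "conj_pts z ` {1..2*n} \<subseteq> ball 0 1" "0 \<notin> conj_pts z ` {1..2*n}"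
proof -
  have k: "(p + 1) div 2 \<in> {1..n}" if "p \<in> {1..2*n}" for p
  proof -
    have "1 \<le> p" "p \<le> 2 * n" using that by auto
    then show ?thesis unfolding atLeastAtMost_iff by presburger
  qed
  have zz: "cmod (z i) < 1" "Im (z i) > 0" if "i \<in> {1..n}" for i
    using z that by (auto simp: PiE_iff upper_half_disc_def)
  show "conj_pts z ` {1..2*n} \<subseteq> ball 0 1" "0 \<notin> conj_pts z ` {1..2*n}"
  proof -
    have "cmod (conj_pts z p) < 1 \<and> conj_pts z p \<noteq> 0" if "p \<in> {1..2*n}" for p
      using zz[OF k[OF that]] by (auto simp: conj_pts_def)
    then show "conj_pts z ` {1..2*n} \<subseteq> ball 0 1" "0 \<notin> conj_pts z ` {1..2*n}" by force+
  qed
  show "inj_on (conj_pts z) {1..2*n}"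
  proof (rule inj_onI)
    fix p q assume p: "p \<in> {1..2*n}" and q: "q \<in> {1..2*n}" and eq: "conj_pts z p = conj_pts z q"
    have ip: "Im (conj_pts z p) > 0 \<longleftrightarrow> odd p" and iq: "Im (conj_pts z q) > 0 \<longleftrightarrow> odd q"
      using zz(2)[OF k[OF p]] zz(2)[OF k[OF q]] by (auto simp: conj_pts_def)
    then have par: "odd p \<longleftrightarrow> odd q" using eq by simp
    then have "z ((p + 1) div 2) = z ((q + 1) div 2)" using eq by (cases "odd p") (simp_all add: conj_pts_def)
    then have "(p + 1) div 2 = (q + 1) div 2" by (rule inj_onD[OF inj _ k[OF p] k[OF q]])
    moreover have "p \<ge> 1" "q \<ge> 1" using p q by auto
    ultimately show "p = q" using par by presburger
  qed
qed

lemma prod_conj_pts: "(\<Prod>p\<in>{1..2*n}. g (conj_pts z p)) = (\<Prod>i\<in>{1..n}. g (z i) * g (cnj (z i)) :: complex)"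
proof (induction n)
  case (Suc n)
  have e: "{1..2 * Suc n} = insert (2*n+2) (insert (2*n+1) {1..2*n})" by auto
  have "(\<Prod>p\<in>{1..2*Suc n}. g (conj_pts z p)) = g (conj_pts z (2*n+2)) * (g (conj_pts z (2*n+1)) * (\<Prod>p\<in>{1..2*n}. g (conj_pts z p)))"
    unfolding e by (subst prod.insert, simp, simp, subst prod.insert) auto
  moreover have "conj_pts z (2*n+1) = z (Suc n)" "conj_pts z (2*n+2) = cnj (z (Suc n))"
    using conj_pts_simps[where i="Suc n" and z=z] by simp_all
  ultimately show ?case using Suc by (simp add: ac_simps)
qed simp

text \<open>Real coefficients make \<open>pser a (cnj w)\<close> the conjugate of
  \<open>pser a w\<close>, so the product over a conjugate pair is a squared modulus.\<close>

lemma moment_conj_pts: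
  assumes z: "z \<in> PiE {1..n} (\<lambda>_. upper_half_disc)" and inj: "inj_on z {1..n}"
  shows "moment (conj_pts z ` {1..2*n}) = of_real (abs_moment n z)"
    and "sqmoment [] n z = ennreal (abs_moment n z)"
proof -
  note r = conj_pts_range[OF z inj]
  have eq: "AE a in gauss. (\<Prod>w\<in>conj_pts z ` {1..2*n}. pser a w) = of_real (\<Prod>i\<in>{1..n}. (cmod (pser a (z i)))\<^sup>2)"
    using AE_gauss_conv
  proof eventually_elim
    case (elim a)
    have "(\<Prod>w\<in>conj_pts z ` {1..2*n}. pser a w) = (\<Prod>p\<in>{1..2*n}. pser a (conj_pts z p))"
      by (rule prod.reindex[OF r(1), unfolded o_def])
    also have "\<dots> = (\<Prod>i\<in>{1..n}. pser a (z i) * pser a (cnj (z i)))" by (rule prod_conj_pts)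
    also have "\<dots> = (\<Prod>i\<in>{1..n}. of_real ((cmod (pser a (z i)))\<^sup>2))"
    proof (rule prod.cong[OF refl])
      fix i assume "i \<in> {1..n}"
      then have "cmod (z i) < 1" using z by (auto simp: PiE_iff upper_half_disc_def)
      then show "pser a (z i) * pser a (cnj (z i)) = of_real ((cmod (pser a (z i)))\<^sup>2)"
        by (simp only: complex_norm_square pser_cnj[OF elim])
    qed
    finally show ?case by simp
  qed
  obtain \<rho> where \<rho>: "0 \<le> \<rho>" "\<rho> < 1" "\<And>w. w \<in> conj_pts z ` {1..2*n} \<Longrightarrow> cmod w \<le> \<rho>"
    using finite_disc_radius[OF _ r(2)] by (metis finite_atLeastAtMost finite_imageI)
  have int: "integrable gauss (\<lambda>a. \<Prod>w\<in>conj_pts z ` {1..2*n}. pser a w)"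
    by (rule integrable_prod_bound(1)[OF _ \<rho>(1,2)]) (use \<rho> norm_pser_le in auto)
  have int2: "integrable gauss (\<lambda>a. complex_of_real (\<Prod>i\<in>{1..n}. (cmod (pser a (z i)))\<^sup>2))"
    by (rule integrable_cong_AE_imp[OF int]) (measurable, use eq in \<open>auto elim!: eventually_mono\<close>)
  then have int3: "integrable gauss (\<lambda>a. (\<Prod>i\<in>{1..n}. (cmod (pser a (z i)))\<^sup>2))"
    by (simp only: complex_of_real_integrable_eq)
  have "moment (conj_pts z ` {1..2*n}) = (\<integral>a. complex_of_real (\<Prod>i\<in>{1..n}. (cmod (pser a (z i)))\<^sup>2) \<partial>gauss)"
    unfolding moment_def by (rule integral_cong_AE) (measurable, rule eq)
  also have "\<dots> = of_real (abs_moment n z)" unfolding abs_moment_def by (rule integral_complex_of_real)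
  finally show "moment (conj_pts z ` {1..2*n}) = of_real (abs_moment n z)" .
  have "sqmoment [] n z = (\<integral>\<^sup>+a. ennreal (\<Prod>i\<in>{1..n}. (cmod (pser a (z i)))\<^sup>2) \<partial>gauss)"
    unfolding sqmoment_def sqprod_def by (simp add: prod_ennreal)
  also have "\<dots> = ennreal (abs_moment n z)" unfolding abs_moment_def
    by (rule nn_integral_eq_integral[OF int3]) (auto intro!: prod_nonneg)
  finally show "sqmoment [] n z = ennreal (abs_moment n z)" .
qed

definition rho_formula :: "nat \<Rightarrow> (nat \<Rightarrow> complex) \<Rightarrow> complex" where
  "rho_formula n z = 1 / (complex_of_real pi * \<i>) ^ n *
          (\<Prod>j\<in>{1..n}. 1 / complex_of_real (cmod (1 - (z j)^2))) *
          pfaffian n (block_matrix kernel_c z)"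

definition rho_real :: "nat \<Rightarrow> (nat \<Rightarrow> complex) \<Rightarrow> real" where
  "rho_real n z = (\<Prod>i\<in>{1..n}. palm_weight (z i) * (\<Prod>j\<in>{1..<i}. (cmod (blaschke2 (z j) (z i)))\<^sup>2)) * abs_moment n z"

lemma palm_weight_nonneg: "z \<in> upper_half_disc \<Longrightarrow> palm_weight z \<ge> 0"
  unfolding palm_weight_def using upper_half_discD[of z] by (auto intro!: divide_nonneg_nonneg mult_nonneg_nonneg simp: abs_square_le_1)

lemma abs_moment_nonneg: "abs_moment n z \<ge> 0"
  unfolding abs_moment_def by (intro integral_nonneg_AE) (auto intro!: prod_nonneg)

lemma rho_real_nonneg: "z \<in> PiE {1..n} (\<lambda>_. upper_half_disc) \<Longrightarrow> rho_real n z \<ge> 0"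
  unfolding rho_real_def
  by (intro mult_nonneg_nonneg prod_nonneg ballI abs_moment_nonneg palm_weight_nonneg) (auto simp: PiE_iff)

lemma ennreal_rho_real:
  assumes z: "z \<in> PiE {1..n} (\<lambda>_. upper_half_disc)" and inj: "inj_on z {1..n}"
  shows "weight n z * cross [] n z * sqmoment [] n z = ennreal (rho_real n z)"
proof -
  have pw: "palm_weight (z i) \<ge> 0" if "i \<in> {1..n}" for i
    using z that by (intro palm_weight_nonneg) (auto simp: PiE_iff)
  have "weight n z = (\<Prod>i\<in>{1..n}. ennreal (palm_weight (z i) * (\<Prod>j\<in>{1..<i}. (cmod (blaschke2 (z j) (z i)))\<^sup>2)))"
    unfolding weight_def
  proof (rule prod.cong[OF refl])
    fix i assume "i \<in> {1..n}"
    have "(\<Prod>j\<in>{1..<i}. ennreal ((cmod (blaschke2 (z j) (z i)))\<^sup>2)) = ennreal (\<Prod>j\<in>{1..<i}. (cmod (blaschke2 (z j) (z i)))\<^sup>2)"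
      by (rule prod_ennreal) simp
    then show "ennreal (palm_weight (z i)) * (\<Prod>j\<in>{1..<i}. ennreal ((cmod (blaschke2 (z j) (z i)))\<^sup>2)) =
        ennreal (palm_weight (z i) * (\<Prod>j\<in>{1..<i}. (cmod (blaschke2 (z j) (z i)))\<^sup>2))"
      using ennreal_mult[OF pw[OF \<open>i \<in> {1..n}\<close>], of "\<Prod>j\<in>{1..<i}. (cmod (blaschke2 (z j) (z i)))\<^sup>2"] by (simp add: prod_nonneg)
  qed
  also have "\<dots> = ennreal (\<Prod>i\<in>{1..n}. palm_weight (z i) * (\<Prod>j\<in>{1..<i}. (cmod (blaschke2 (z j) (z i)))\<^sup>2))"
    using pw by (intro prod_ennreal mult_nonneg_nonneg prod_nonneg) auto
  finally have w: "weight n z = ennreal (\<Prod>i\<in>{1..n}. palm_weight (z i) * (\<Prod>j\<in>{1..<i}. (cmod (blaschke2 (z j) (z i)))\<^sup>2))" .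
  have "cross [] n z = 1" by (simp add: cross_def)
  moreover have "0 \<le> (\<Prod>i\<in>{1..n}. palm_weight (z i) * (\<Prod>j\<in>{1..<i}. (cmod (blaschke2 (z j) (z i)))\<^sup>2))"
    using pw by (intro prod_nonneg mult_nonneg_nonneg) auto
  ultimately show ?thesis unfolding moment_conj_pts(2)[OF z inj] rho_real_def w
    using ennreal_mult abs_moment_nonneg by simp
qed

text \<open>Point by point, the Moebius difference of \<open>z i\<close> and its conjugate is
  \<open>2 * i * Im\<close> over \<open>1 - \<bar>z\<bar>\<close> squared, with \<open>i\<close> the
  imaginary unit; dividing by \<open>pi * i\<close> and by the modulus of \<open>1 - z^2\<close>
  gives exactly \<open>palm_weight\<close>.\<close>

lemma rho_formula_eq:
  assumes z: "z \<in> PiE {1..n} (\<lambda>_. upper_half_disc)" and inj: "inj_on z {1..n}"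
  shows "rho_formula n z = of_real (rho_real n z)"
proof -
  define b where "b i = (\<Prod>j\<in>{1..<i}. (cmod (blaschke2 (z j) (z i)))\<^sup>2)" for i
  have "pfaffian n (block_matrix kernel_c z) = (\<Prod>i\<in>{1..n}. moeb (z i) (cnj (z i)) * of_real (b i)) * of_real (abs_moment n z)"
    unfolding block_matrix_kernel_c
    using pfaffian_moment[OF conj_pts_range[OF z inj]] by (simp only: schur_conj_pts moment_conj_pts(1)[OF z inj] b_def)
  moreover have "1 / (complex_of_real pi * \<i>) ^ n = (\<Prod>j\<in>{1..n}. 1 / (complex_of_real pi * \<i>))"
    by (simp add: power_one_over)
  ultimately have "rho_formula n z = (\<Prod>i\<in>{1..n}. 1 / (complex_of_real pi * \<i>) * (1 / complex_of_real (cmod (1 - (z i)^2))) * (moeb (z i) (cnj (z i)) * of_real (b i))) * of_real (abs_moment n z)"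
    unfolding rho_formula_def by (simp only: prod.distrib mult.assoc)
  also have "(\<Prod>i\<in>{1..n}. 1 / (complex_of_real pi * \<i>) * (1 / complex_of_real (cmod (1 - (z i)^2))) * (moeb (z i) (cnj (z i)) * of_real (b i))) =
     (\<Prod>i\<in>{1..n}. of_real (palm_weight (z i) * b i))"
  proof (rule prod.cong[OF refl])
    fix i assume i: "i \<in> {1..n}"
    then have zi: "z i \<in> upper_half_disc" using z by (auto simp: PiE_iff)
    have 1: "z i - cnj (z i) = of_real (2 * Im (z i)) * \<i>" by (simp add: complex_eq_iff)
    have 2: "1 - z i * cnj (z i) = of_real (1 - (cmod (z i))\<^sup>2)" by (simp only: complex_norm_square of_real_diff of_real_1)
    show "1 / (complex_of_real pi * \<i>) * (1 / complex_of_real (cmod (1 - (z i)^2))) * (moeb (z i) (cnj (z i)) * of_real (b i)) = of_real (palm_weight (z i) * b i)"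
      unfolding 1 2 palm_weight_def by (simp only: of_real_mult of_real_divide) (simp add: mult_ac)
  qed
  finally show ?thesis by (simp add: rho_real_def b_def)
qed

section \<open>The correlation function\<close>

lemma tendsto_componentwise:
  fixes y :: "'c \<Rightarrow> 'i \<Rightarrow> 'b::topological_space"
  assumes "\<And>i. ((\<lambda>k. y k i) \<longlongrightarrow> z i) F"
  shows "(y \<longlongrightarrow> z) F"
proof -
  have "limitin (product_topology (\<lambda>i::'i. euclidean :: 'b topology) UNIV) y z F"
    unfolding limitin_componentwise using assms by simp
  then show ?thesis by (simp add: euclidean_product_topology)
qed

lemma continuous_on_coordinate: "continuous_on S (\<lambda>z. z i :: 'b::topological_space)"
  by (rule continuous_on_subset[OF continuous_on_product_coordinates]) simp

lemma continuous_on_conj_pts: "continuous_on S (\<lambda>z. conj_pts z p)"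
  unfolding conj_pts_def by (cases "odd p") (auto intro!: continuous_intros continuous_on_coordinate)

lemma conj_pts_ball:
  assumes z: "z \<in> PiE {1..n} (\<lambda>_. upper_half_disc)" and "p \<in> {1..2*n}"
  shows "conj_pts z p \<in> ball 0 1"
proof -
  have "1 \<le> p" "p \<le> 2 * n" using assms by auto
  then have "(p + 1) div 2 \<in> {1..n}" unfolding atLeastAtMost_iff by presburger
  then have "z ((p + 1) div 2) \<in> upper_half_disc" using z by (auto simp: PiE_iff)
  then show ?thesis by (auto simp: conj_pts_def upper_half_disc_def)
qed

lemma continuous_on_rho_formula: "continuous_on (PiE {1..n} (\<lambda>_. upper_half_disc)) (rho_formula n)"
  (is "continuous_on ?S _")
proof -
  have k: "continuous_on ?S (\<lambda>z. (conj_pts z p - conj_pts z q) / (1 - conj_pts z p * conj_pts z q)\<^sup>2)"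
    if "p \<in> {1..2*n}" "q \<in> {1..2*n}" for p q
  proof (intro continuous_intros continuous_on_conj_pts ballI)
    fix z assume "z \<in> ?S"
    then have "1 - conj_pts z p * conj_pts z q \<noteq> 0" using that by (intro disc_neq conj_pts_ball)
    then show "(1 - conj_pts z p * conj_pts z q)\<^sup>2 \<noteq> 0" by simp
  qed
  have p: "continuous_on ?S (\<lambda>z. pfaffian n (block_matrix kernel_c z))"
    unfolding block_matrix_kernel_c pfaffian_def
  proof (intro continuous_on_sum continuous_on_mult continuous_on_const continuous_on_prod k)
    fix \<eta> i assume e: "\<eta> \<in> {\<eta>. \<eta> permutes {1..2 * n} \<and> (\<forall>i\<in>{1..n}. \<eta> (2 * i - 1) < \<eta> (2 * i)) \<and> (\<forall>i\<in>{1..<n}. \<eta> (2 * i - 1) < \<eta> (2 * i + 1))}"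
      and i: "i \<in> {1..n}"
    have "2 * i - 1 \<in> {1..2*n}" "2 * i \<in> {1..2*n}" using i by auto
    moreover have "\<eta> permutes {1..2*n}" using e by simp
    ultimately show "\<eta> (2 * i - 1) \<in> {1..2*n}" "\<eta> (2 * i) \<in> {1..2*n}"
      by (simp_all only: permutes_in_image)
  qed
  have q: "continuous_on ?S (\<lambda>z. \<Prod>j\<in>{1..n}. 1 / complex_of_real (cmod (1 - (z j)^2)))"
  proof (rule continuous_on_prod)
    fix j assume j: "j \<in> {1..n}"
    have "complex_of_real (cmod (1 - (z j)^2)) \<noteq> 0" if "z \<in> ?S" for z
    proof -
      have "cmod (z j) < 1" using j that by (auto simp: PiE_iff upper_half_disc_def)
      then have "1 - z j * z j \<noteq> 0" by (intro one_minus_mult_neq_0)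
      then show ?thesis by (simp add: power2_eq_square)
    qed
    then show "continuous_on ?S (\<lambda>z. 1 / complex_of_real (cmod (1 - (z j)^2)))"
      by (intro continuous_on_divide continuous_on_const continuous_on_of_real continuous_on_norm
          continuous_on_diff continuous_on_power continuous_on_coordinate) auto
  qed
  show ?thesis unfolding rho_formula_def[abs_def]
    by (intro continuous_on_mult continuous_on_const p q)
qed

lemma injective_approximation:
  fixes z :: "nat \<Rightarrow> complex"
  assumes z: "z \<in> PiE {1..n} (\<lambda>_. upper_half_disc)"
  obtains y where "y \<longlonglongrightarrow> z"
    "eventually (\<lambda>k. y k \<in> PiE {1..n} (\<lambda>_. upper_half_disc) \<and> inj_on (y k) {1..n}) sequentially"
proof -
  \<comment> \<open>Shifts proportional to the index separate equal coordinates for every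
    \<open>k\<close>, while distinct coordinates stay distinct for large \<open>k\<close>.
    Coordinates outside the index range keep their default value.\<close>
  define y where "y k i = (if i \<in> {1..n} then z i + of_real (inverse (real (Suc k))) * of_nat i else z i)" for k i
  have lim: "(\<lambda>k. y k i) \<longlonglongrightarrow> z i" for i
  proof (cases "i \<in> {1..n}")
    case True
    have "(\<lambda>k. z i + of_real (inverse (real (Suc k))) * of_nat i) \<longlonglongrightarrow> z i + of_real 0 * of_nat i"
      by (intro tendsto_intros LIMSEQ_inverse_real_of_nat)
    then show ?thesis using True by (simp add: y_def)
  next
    case False
    then show ?thesis by (simp only: y_def if_False tendsto_const)
  qed
  have "eventually (\<lambda>k. \<forall>i\<in>{1..n}. y k i \<in> upper_half_disc) sequentially"
  proof (rule eventually_ball_finite[OF finite_atLeastAtMost], rule ballI)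
    fix i assume "i \<in> {1..n}"
    then have "z i \<in> upper_half_disc" using z by (auto simp: PiE_iff)
    then show "eventually (\<lambda>k. y k i \<in> upper_half_disc) sequentially"
      by (rule topological_tendstoD[OF lim open_upper_half_disc])
  qed
  moreover have "eventually (\<lambda>k. \<forall>i\<in>{1..n}. \<forall>j\<in>{1..n} - {i}. y k i \<noteq> y k j) sequentially"
  proof (intro eventually_ball_finite ballI finite_atLeastAtMost finite_Diff)
    fix i j assume ij: "i \<in> {1..n}" "j \<in> {1..n} - {i}"
    show "eventually (\<lambda>k. y k i \<noteq> y k j) sequentially"
    proof (cases "z i = z j")
      case True
      then show ?thesis using ij by (simp add: y_def del: of_nat_Suc)
    next
      case False
      have "(\<lambda>k. y k i - y k j) \<longlonglongrightarrow> z i - z j" by (intro tendsto_diff lim)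
      then have "eventually (\<lambda>k. y k i - y k j \<noteq> 0) sequentially"
        by (rule tendsto_imp_eventually_ne) (use False in simp)
      then show ?thesis by eventually_elim simp
    qed
  qed
  ultimately have "eventually (\<lambda>k. y k \<in> PiE {1..n} (\<lambda>_. upper_half_disc) \<and> inj_on (y k) {1..n}) sequentially"
  proof eventually_elim
    case (elim k)
    have "y k i = undefined" if "i \<notin> {1..n}" for i using z that by (auto simp: y_def PiE_def extensional_def)
    then show ?case using elim by (auto simp: PiE_iff extensional_def inj_on_def)
  qed
  then show thesis by (rule that[OF tendsto_componentwise[OF lim]])
qed

lemma eq_on_injective_imp_eq:
  fixes f g :: "(nat \<Rightarrow> complex) \<Rightarrow> 'b::t2_space"
  assumes f: "continuous_on (PiE {1..n} (\<lambda>_. upper_half_disc)) f"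
    and g: "continuous_on (PiE {1..n} (\<lambda>_. upper_half_disc)) g"
    and eq: "\<And>z. z \<in> PiE {1..n} (\<lambda>_. upper_half_disc) \<Longrightarrow> inj_on z {1..n} \<Longrightarrow> f z = g z"
    and z: "z \<in> PiE {1..n} (\<lambda>_. upper_half_disc)"
  shows "f z = g z"
proof -
  obtain y where y: "y \<longlonglongrightarrow> z"
    and ev: "eventually (\<lambda>k. y k \<in> PiE {1..n} (\<lambda>_. upper_half_disc) \<and> inj_on (y k) {1..n}) sequentially"
    using injective_approximation[OF z] .
  have ev': "eventually (\<lambda>k. y k \<in> PiE {1..n} (\<lambda>_. upper_half_disc)) sequentially"
    using ev by eventually_elim simp
  have "(\<lambda>k. f (y k)) \<longlonglongrightarrow> f z" by (rule continuous_on_tendsto_compose[OF f y z ev'])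
  moreover have "eventually (\<lambda>k. f (y k) = g (y k)) sequentially"
    using ev by eventually_elim (simp add: eq)
  ultimately have "(\<lambda>k. g (y k)) \<longlonglongrightarrow> f z" by (rule Lim_transform_eventually)
  then show ?thesis using continuous_on_tendsto_compose[OF g y z ev'] by (rule LIMSEQ_unique)
qed

text \<open>Equality with its own modulus says that the value is real and nonnegative, and it is a
  closed condition; so it passes from distinct points to all points.\<close>

lemma rho_formula_cmod:
  assumes "z \<in> PiE {1..n} (\<lambda>_. upper_half_disc)"
  shows "rho_formula n z = complex_of_real (cmod (rho_formula n z))"
proof (rule eq_on_injective_imp_eq[OF continuous_on_rho_formula _ _ assms])
  show "continuous_on (PiE {1..n} (\<lambda>_. upper_half_disc)) (\<lambda>z. complex_of_real (cmod (rho_formula n z)))"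
    by (intro continuous_intros continuous_on_rho_formula)
  fix z assume "z \<in> PiE {1..n} (\<lambda>_. upper_half_disc)" "inj_on z {1..n}"
  then show "rho_formula n z = complex_of_real (cmod (rho_formula n z))"
    using rho_formula_eq rho_real_nonneg by simp
qed

section \<open>Uniqueness of the continuous version\<close>

lemma continuous_on_box_bound:
  fixes \<rho> :: "(nat \<Rightarrow> complex) \<Rightarrow> real"
  assumes \<rho>: "continuous_on (PiE {1..n} (\<lambda>_. D)) \<rho>" and z: "z \<in> PiE {1..n} (\<lambda>_. D)" and U: "open U" "\<rho> z \<in> U"
  shows "\<exists>r>0. \<forall>y\<in>PiE {1..n} (\<lambda>i. D \<inter> ball (z i) r). \<rho> y \<in> U"
proof (rule ccontr)
  assume "\<not> ?thesis"
  then have ex: "\<exists>y. y \<in> PiE {1..n} (\<lambda>i. D \<inter> ball (z i) r) \<and> \<rho> y \<notin> U" if "r > 0" for r using that by blast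
  have "\<exists>y. \<forall>k. y k \<in> PiE {1..n} (\<lambda>i. D \<inter> ball (z i) (inverse (real (Suc k)))) \<and> \<rho> (y k) \<notin> U"
    by (intro choice allI ex) simp
  then obtain y where y: "\<And>k. y k \<in> PiE {1..n} (\<lambda>i. D \<inter> ball (z i) (inverse (real (Suc k))))" "\<And>k. \<rho> (y k) \<notin> U" by blast
  have S: "y k \<in> PiE {1..n} (\<lambda>_. D)" for k
    by (rule subsetD[OF PiE_mono y(1)]) simp
  have "(\<lambda>k. y k i) \<longlonglongrightarrow> z i" for i
  proof (cases "i \<in> {1..n}")
    case True
    have "dist (y k i) (z i) \<le> inverse (real (Suc k))" for k
      using PiE_mem[OF y(1) True, of k] by (simp add: dist_commute less_imp_le del: of_nat_Suc)
    then have "eventually (\<lambda>k. dist (y k i) (z i) \<le> inverse (real (Suc k))) sequentially"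
      by (intro always_eventually allI)
    then have "(\<lambda>k. dist (y k i) (z i)) \<longlonglongrightarrow> 0"
      by (rule real_tendsto_sandwich[OF _ _ tendsto_const LIMSEQ_inverse_real_of_nat, rotated]) simp
    then show ?thesis by (rule tendsto_dist_iff[THEN iffD2])
  next
    case False
    \<comment> \<open>Extensionality fixes both functions outside the index range, so convergence in
      the full product topology concerns finitely many coordinates only.\<close>
    then have "y k i = z i" for k using PiE_arb[OF y(1) False] PiE_arb[OF z False] by simp
    then show ?thesis by simp
  qed
  then have "(\<lambda>k. \<rho> (y k)) \<longlonglongrightarrow> \<rho> z"
    by (intro continuous_on_tendsto_compose[OF \<rho> tendsto_componentwise z]) (use S in auto)
  then have "eventually (\<lambda>k. \<rho> (y k) \<in> U) sequentially" using U by (rule topological_tendstoD)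
  then show False using y(2) by simp
qed

text \<open>Around distinct points there are small disjoint balls in \<open>D\<close>, so both
  functions integrate to the same expected product of counts over the box. A strict inequality at
  \<open>z\<close> would persist on a small box and contradict this.\<close>

lemma continuous_correlation_function_le:
  assumes \<rho>: "continuous_correlation_function M F D n \<rho>" and \<sigma>: "continuous_correlation_function M F D n \<sigma>"
    and D: "open D" and z: "z \<in> PiE {1..n} (\<lambda>_. D)" and inj: "inj_on z {1..n}"
  shows "\<sigma> z \<le> \<rho> z"
proof (rule ccontr)
  assume "\<not> \<sigma> z \<le> \<rho> z"
  \<comment> \<open>The two points trisect the gap between the values, which leaves a positive
    margin between the bounds on the box.\<close>
  define c d where "c = (2 * \<rho> z + \<sigma> z) / 3" and "d = (\<rho> z + 2 * \<sigma> z) / 3"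
  have cd: "\<rho> z < c" "c < d" "d < \<sigma> z" using \<open>\<not> \<sigma> z \<le> \<rho> z\<close> by (simp_all add: c_def d_def)
  have c\<rho>: "continuous_on (PiE {1..n} (\<lambda>_. D)) \<rho>" "continuous_on (PiE {1..n} (\<lambda>_. D)) \<sigma>"
    using \<rho> \<sigma> by (auto simp: continuous_correlation_function_def)
  have "\<rho> z \<ge> 0" using \<rho> z by (simp add: continuous_correlation_function_def)
  then have c0: "0 \<le> c" using cd by simp
  obtain r1 where r1: "r1 > 0" "\<And>y. y \<in> PiE {1..n} (\<lambda>i. D \<inter> ball (z i) r1) \<Longrightarrow> \<rho> y < c"
    using continuous_on_box_bound[OF c\<rho>(1) z, of "{..<c}"] cd by auto
  obtain r2 where r2: "r2 > 0" "\<And>y. y \<in> PiE {1..n} (\<lambda>i. D \<inter> ball (z i) r2) \<Longrightarrow> d < \<sigma> y"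
    using continuous_on_box_bound[OF c\<rho>(2) z, of "{d<..}"] cd by auto
  have "eventually (\<lambda>r. \<forall>i\<in>{1..n}. ball (z i) r \<subseteq> D) (at_right 0)"
  proof (intro eventually_ball_finite ballI finite_atLeastAtMost)
    fix i assume "i \<in> {1..n}"
    then have "z i \<in> D" using z by (auto simp: PiE_iff)
    then obtain e where "e > 0" "ball (z i) e \<subseteq> D" using D by (meson open_contains_ball)
    then show "eventually (\<lambda>r. ball (z i) r \<subseteq> D) (at_right 0)"
      unfolding eventually_at_right_field by (intro exI[of _ e]) (auto simp: subset_eq)
  qed
  moreover have "eventually (\<lambda>r. \<forall>i\<in>{1..n}. \<forall>j\<in>{1..n} - {i}. 2 * r < dist (z i) (z j)) (at_right 0)"
  proof (intro eventually_ball_finite ballI finite_atLeastAtMost finite_Diff)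
    fix i j assume "i \<in> {1..n}" "j \<in> {1..n} - {i}"
    then have "z i \<noteq> z j" using inj_onD[OF inj, of i j] by auto
    then show "eventually (\<lambda>r. 2 * r < dist (z i) (z j)) (at_right 0)"
      unfolding eventually_at_right_field by (intro exI[of _ "dist (z i) (z j) / 2"]) auto
  qed
  moreover have "eventually (\<lambda>r. r \<in> {0<..<min r1 r2}) (at_right 0)"
    using r1(1) r2(1) by (intro eventually_at_right_real) simp
  ultimately have "eventually (\<lambda>r. (\<forall>i\<in>{1..n}. ball (z i) r \<subseteq> D) \<and>
      (\<forall>i\<in>{1..n}. \<forall>j\<in>{1..n} - {i}. 2 * r < dist (z i) (z j)) \<and> r \<in> {0<..<min r1 r2}) (at_right 0)"
    by eventually_elim blast
  then obtain r where r': "(\<forall>i\<in>{1..n}. ball (z i) r \<subseteq> D) \<and>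
      (\<forall>i\<in>{1..n}. \<forall>j\<in>{1..n} - {i}. 2 * r < dist (z i) (z j)) \<and> r \<in> {0<..<min r1 r2}"
    by (rule eventually_happens[THEN disjE]) (use trivial_limit_at_right_real[of "0::real"] in auto)
  then have r: "\<And>i. i \<in> {1..n} \<Longrightarrow> ball (z i) r \<subseteq> D"
      "\<And>i j. i \<in> {1..n} \<Longrightarrow> j \<in> {1..n} \<Longrightarrow> i \<noteq> j \<Longrightarrow> 2 * r < dist (z i) (z j)" "0 < r" "r < r1" "r < r2"
    by auto
  define B where "B i = ball (z i) r" for i
  have B: "\<forall>i\<in>{1..n}. B i \<in> sets borel \<and> B i \<subseteq> D" using r by (auto simp: B_def)
  have disj: "disjoint_family_on B {1..n}"
    unfolding disjoint_family_on_def B_def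
  proof (intro ballI impI)
    fix i j assume "i \<in> {1..n}" "j \<in> {1..n}" "i \<noteq> j"
    then have "2 * r < dist (z i) (z j)" by (rule r(2))
    then show "ball (z i) r \<inter> ball (z j) r = {}"
      by (intro disjoint_ballI) simp
  qed
  have box: "y \<in> PiE {1..n} (\<lambda>i. D \<inter> ball (z i) s)" if y: "y \<in> PiE {1..n} B" and s: "r < s" for y s
  proof (rule PiE_I)
    fix i assume i: "i \<in> {1..n}"
    then have "y i \<in> ball (z i) r" using y unfolding B_def by (rule PiE_mem[rotated])
    then show "y i \<in> D \<inter> ball (z i) s" using r(1)[OF i] s by auto
  qed (use y in \<open>auto simp: PiE_def extensional_def\<close>)
  interpret product_sigma_finite "\<lambda>_::nat. lborel :: complex measure" ..
  let ?P = "PiM {1..n} (\<lambda>_. lborel :: complex measure)"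
  have Bs: "PiE {1..n} B \<in> sets ?P" using B by (intro sets_PiM_I_finite) auto
  have vol: "emeasure ?P (PiE {1..n} B) = (\<Prod>i\<in>{1..n}. emeasure lborel (B i))"
    using B by (intro emeasure_PiM) auto
  have "emeasure lborel (B i) = ennreal (pi * r\<^sup>2)" for i
    unfolding B_def using r(3) by (simp add: emeasure_ball unit_ball_vol_2)
  then have vol': "emeasure ?P (PiE {1..n} B) = ennreal ((pi * r\<^sup>2) ^ n)"
    unfolding vol using r(3) by (simp add: ennreal_power)
  have "ennreal d * emeasure ?P (PiE {1..n} B) = (\<integral>\<^sup>+y. ennreal d * indicator (PiE {1..n} B) y \<partial>?P)"
    using Bs by (simp add: nn_integral_cmult_indicator)
  also have "\<dots> \<le> (\<integral>\<^sup>+y. ennreal (\<sigma> y) * indicator (PiE {1..n} B) y \<partial>?P)"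
  proof (intro nn_integral_mono)
    fix y
    have "d \<le> \<sigma> y" if "y \<in> PiE {1..n} B"
      using that r by (intro less_imp_le r2(2) box) simp_all
    then show "ennreal d * indicator (PiE {1..n} B) y \<le> ennreal (\<sigma> y) * indicator (PiE {1..n} B) y"
      by (auto simp: indicator_def intro!: ennreal_leI)
  qed
  also have "\<dots> = (\<integral>\<^sup>+y. ennreal (\<rho> y) * indicator (PiE {1..n} B) y \<partial>?P)"
  proof -
    have "(\<integral>\<^sup>+ \<omega>. (\<Prod>i\<in>{1..n}. num_zeros (F \<omega>) (B i)) \<partial>M) = (\<integral>\<^sup>+y. ennreal (\<tau> y) * indicator (PiE {1..n} B) y \<partial>?P)"
      if "continuous_correlation_function M F D n \<tau>" for \<tau>
      using that B disj by (simp only: continuous_correlation_function_def)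
    from this[OF \<rho>] this[OF \<sigma>] show ?thesis by simp
  qed
  also have "\<dots> \<le> (\<integral>\<^sup>+y. ennreal c * indicator (PiE {1..n} B) y \<partial>?P)"
  proof (intro nn_integral_mono)
    fix y
    have "\<rho> y \<le> c" if "y \<in> PiE {1..n} B"
      using that r by (intro less_imp_le r1(2) box) simp_all
    then show "ennreal (\<rho> y) * indicator (PiE {1..n} B) y \<le> ennreal c * indicator (PiE {1..n} B) y"
      by (auto simp: indicator_def intro!: ennreal_leI)
  qed
  also have "\<dots> = ennreal c * emeasure ?P (PiE {1..n} B)"
    using Bs by (simp add: nn_integral_cmult_indicator)
  finally have "ennreal (d * (pi * r\<^sup>2) ^ n) \<le> ennreal (c * (pi * r\<^sup>2) ^ n)"
    unfolding vol' using c0 cd by (simp add: ennreal_mult'')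
  then have "d * (pi * r\<^sup>2) ^ n \<le> c * (pi * r\<^sup>2) ^ n" using c0 r(3) by (simp add: ennreal_le_iff)
  moreover have "(pi * r\<^sup>2) ^ n > 0" using r(3) by simp
  ultimately show False using cd by simp
qed

lemma distr_gaussian_coefficients:
  fixes a :: "nat \<Rightarrow> 'w \<Rightarrow> real"
  assumes "prob_space M" "prob_space.indep_vars M (\<lambda>_. borel) a UNIV"
    "\<And>k. distributed M lborel (a k) std_normal_density"
  shows "distr M (PiM UNIV (\<lambda>_. borel)) (\<lambda>\<omega> k. a k \<omega>) = gauss"
proof -
  interpret prob_space M by fact
  have m [measurable]: "a k \<in> borel_measurable M" for k
    using distributed_measurable[OF assms(3)[of k]] by simp
  have "distr M borel (a k) = gauss1" for k
    using distributed_distr_eq_density[OF assms(3)[of k]] by (simp cong: distr_cong)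
  then show ?thesis using indep_vars_iff_distr_eq_PiM[where I=UNIV and M'="\<lambda>_. borel" and X=a] assms(2)
    by (simp add: gauss_def restrict_UNIV)
qed

lemma rho_formula_correlation_function:
  fixes a :: "nat \<Rightarrow> 'w \<Rightarrow> real"
  assumes "prob_space M" "prob_space.indep_vars M (\<lambda>_. borel) a UNIV"
    "\<And>k. distributed M lborel (a k) std_normal_density"
  shows "continuous_correlation_function M (gaussian_series a) upper_half_disc n (\<lambda>z. cmod (rho_formula n z))"
  unfolding continuous_correlation_function_def
proof (intro conjI allI impI ballI)
  show "continuous_on (PiE {1..n} (\<lambda>_. upper_half_disc)) (\<lambda>z. cmod (rho_formula n z))"
    by (intro continuous_intros continuous_on_rho_formula)
  fix B assume "(\<forall>i\<in>{1..n}. B i \<in> sets borel \<and> B i \<subseteq> upper_half_disc) \<and> disjoint_family_on B {1..n}"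
  then have B: "\<And>i. i \<in> {1..n} \<Longrightarrow> B i \<in> sets borel" "\<And>i. i \<in> {1..n} \<Longrightarrow> B i \<subseteq> upper_half_disc"
    and disj: "disjoint_family_on B {1..n}" by auto
  note d = distr_gaussian_coefficients[OF assms]
  have m [measurable]: "a k \<in> borel_measurable M" for k
    using distributed_measurable[OF assms(3)[of k]] by simp
  have mm: "(\<lambda>\<omega> k. a k \<omega>) \<in> measurable M (PiM UNIV (\<lambda>_. borel))"
    by (rule measurable_PiM_single') auto
  have zm: "(\<lambda>b. \<Prod>i\<in>{1..n}. zcount b (B i)) \<in> borel_measurable (PiM UNIV (\<lambda>_. borel))"
  proof (rule borel_measurable_prod_ennreal)
    fix i assume i: "i \<in> {1..n}"
    have "B i \<subseteq> ball 0 1" using B(2)[OF i] by (auto simp: upper_half_disc_def)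
    then show "(\<lambda>b. zcount b (B i)) \<in> borel_measurable (PiM UNIV (\<lambda>_. borel))" by (rule zcount_measurable[OF B(1)[OF i]])
  qed
  have "AE b in distr M (PiM UNIV (\<lambda>_. borel)) (\<lambda>\<omega> k. a k \<omega>). \<forall>B. B \<subseteq> upper_half_disc \<longrightarrow> num_zeros (pser b) B = zcount b B"
    unfolding d by (rule AE_gauss_num_zeros)
  then have "AE \<omega> in M. \<forall>B. B \<subseteq> upper_half_disc \<longrightarrow> num_zeros (pser (\<lambda>k. a k \<omega>)) B = zcount (\<lambda>k. a k \<omega>) B"
    by (rule AE_distrD[OF mm])
  moreover have "gaussian_series a \<omega> = pser (\<lambda>k. a k \<omega>)" for \<omega>
    by (simp add: fun_eq_iff gaussian_series_def pser_def)
  ultimately have "(\<integral>\<^sup>+ \<omega>. (\<Prod>i\<in>{1..n}. num_zeros (gaussian_series a \<omega>) (B i)) \<partial>M) =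
      (\<integral>\<^sup>+ \<omega>. (\<Prod>i\<in>{1..n}. zcount (\<lambda>k. a k \<omega>) (B i)) \<partial>M)"
    using B(2) by (intro nn_integral_cong_AE) (auto elim!: eventually_mono intro!: prod.cong)
  also have "\<dots> = (\<integral>\<^sup>+ b. (\<Prod>i\<in>{1..n}. zcount b (B i)) \<partial>gauss)"
    unfolding d[symmetric] using nn_integral_distr[OF mm, of "\<lambda>b. \<Prod>i\<in>{1..n}. zcount b (B i)"] zm by simp
  also have "\<dots> = (\<integral>\<^sup>+z. indicator (PiE {1..n} B) z * (weight n z * cross [] n z * sqmoment [] n z) \<partial>(PiM {1..n} (\<lambda>_. lborel)))"
    using correlation_formula[of "[]" n B] B disj by (simp add: sqprod_def)
  also have "\<dots> = (\<integral>\<^sup>+ z. ennreal (cmod (rho_formula n z)) * indicator (PiE {1..n} B) z \<partial>(Pi\<^sub>M {1..n} (\<lambda>_. lborel)))"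
  proof (intro nn_integral_cong)
    fix z
    show "indicator (PiE {1..n} B) z * (weight n z * cross [] n z * sqmoment [] n z) = ennreal (cmod (rho_formula n z)) * indicator (PiE {1..n} B) z"
    proof (cases "z \<in> PiE {1..n} B")
      case True
      have zB: "z i \<in> B i" if "i \<in> {1..n}" for i using True that by (rule PiE_mem)
      have z: "z \<in> PiE {1..n} (\<lambda>_. upper_half_disc)"
        using True B(2) by (meson PiE_mono subsetD)
      \<comment> \<open>Points taken from disjoint sets are distinct, so the moment formula for
        distinct points suffices under the integral.\<close>
      have inj: "inj_on z {1..n}"
      proof (rule inj_onI, rule ccontr)
        fix i j assume ij: "i \<in> {1..n}" "j \<in> {1..n}" "z i = z j" "i \<noteq> j"
        then have "z i \<in> B i" "z i \<in> B j" using zB[of i] zB[of j] by auto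
        moreover have "B i \<inter> B j = {}" using disj ij(1,2,4) by (rule disjoint_family_onD)
        ultimately show False by blast
      qed
      show ?thesis using True rho_formula_eq[OF z inj] rho_real_nonneg[OF z] by (simp add: ennreal_rho_real[OF z inj])
    qed simp
  qed
  finally show "(\<integral>\<^sup>+ \<omega>. (\<Prod>i\<in>{1..n}. num_zeros (gaussian_series a \<omega>) (B i)) \<partial>M) =
    (\<integral>\<^sup>+ z. ennreal (cmod (rho_formula n z)) * indicator (PiE {1..n} B) z \<partial>(Pi\<^sub>M {1..n} (\<lambda>_. lborel)))" .
qed simp

theorem theorem2p7:
  fixes M :: "'w measure" and a :: "nat \<Rightarrow> 'w \<Rightarrow> real" and n :: nat
  assumes "prob_space M"
    and "prob_space.indep_vars M (\<lambda>_. borel) a UNIV"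
    and "\<And>k. distributed M lborel (a k) std_normal_density"
    and "n \<ge> 1"
  shows "(\<exists>\<rho>. continuous_correlation_function M (gaussian_series a) upper_half_disc n \<rho>) \<and>
    (\<forall>\<rho>. continuous_correlation_function M (gaussian_series a) upper_half_disc n \<rho> \<longrightarrow>
      (\<forall>z \<in> PiE {1..n} (\<lambda>_. upper_half_disc).
        complex_of_real (\<rho> z) =
          1 / (complex_of_real pi * \<i>) ^ n *
          (\<Prod>j\<in>{1..n}. 1 / complex_of_real (cmod (1 - (z j)^2))) *
          pfaffian n (block_matrix kernel_c z)))"
proof (intro conjI allI impI ballI)
  note ex = rho_formula_correlation_function[OF assms(1-3), of n]
  show "\<exists>\<rho>. continuous_correlation_function M (gaussian_series a) upper_half_disc n \<rho>" by (rule exI, rule ex)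
  fix \<rho> z assume \<rho>: "continuous_correlation_function M (gaussian_series a) upper_half_disc n \<rho>"
    and z: "z \<in> PiE {1..n} (\<lambda>_. upper_half_disc)"
  \<comment> \<open>The test sets determine a continuous version only at distinct points; continuity
    of both functions gives the remaining ones.\<close>
  have "\<rho> z = cmod (rho_formula n z)"
  proof (rule eq_on_injective_imp_eq[OF _ _ _ z])
    show "continuous_on (PiE {1..n} (\<lambda>_. upper_half_disc)) \<rho>"
      "continuous_on (PiE {1..n} (\<lambda>_. upper_half_disc)) (\<lambda>z. cmod (rho_formula n z))"
      using \<rho> ex by (auto simp: continuous_correlation_function_def)
    fix z assume "z \<in> PiE {1..n} (\<lambda>_. upper_half_disc)" "inj_on z {1..n}"
    then show "\<rho> z = cmod (rho_formula n z)"
      using continuous_correlation_function_le[OF \<rho> ex open_upper_half_disc]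
        continuous_correlation_function_le[OF ex \<rho> open_upper_half_disc] by (intro antisym)
  qed
  then show "complex_of_real (\<rho> z) = 1 / (complex_of_real pi * \<i>) ^ n *
          (\<Prod>j\<in>{1..n}. 1 / complex_of_real (cmod (1 - (z j)^2))) *
          pfaffian n (block_matrix kernel_c z)"
    using rho_formula_cmod[OF z] by (simp only: rho_formula_def)
qed

end
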